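(* Let $\pi_*$ be the probability measure on $\mathbb{R}^d$ with density proportional to $\exp(-F)$, where $F=\frac1N\sum_{i=1}^N g_i$. Assume that, for some constants $\mu,L>0$: $F$ is continuously differentiable, $L$-smooth and $\mu$-strongly convex; and for every $\boldsymbol{\omega}\subset\{1,\dots,N\}$ with $|\boldsymbol{\omega}|=n<N$, the function $f_{\boldsymbol{\omega}}$ is continuously differentiable, $L$-smooth and $\mu$-strongly convex. Assume also that $$0<\sigma_*^2:=\mathbb{E}_{X\sim\pi_*,\boldsymbol{\omega}}\left\|\nabla f_{\boldsymbol{\omega}}(X)-\nabla F(X)\right\|^2<\infty .$$ Let $(x_k)_{k\in\mathbb{N}}$ be the iterates of SGLD-RR with objective $F$, step size $0<h<1/L$ and $x_0\sim\widetilde{\pi}_0$, and let $\widetilde{\pi}_k$ denote the law of $x_k$. Then for every $K\in\mathbb{N}$, $$\mathcal{W}_{2}(\widetilde{\pi}_{K},\pi_* )\leq (1-h\mu)^{K}\mathcal{W}_{2}(\widetilde{\pi}_{0},\pi_* ) + 240\frac{L}{\mu}\left(h\sqrt{R}\,\sigma_{*} + h\left(LR\sqrt{hd} + \sqrt{LRd}\right)+ \sqrt{hd}\right).$$ If in addition $F$ is twice continuously differentiable and has an $L_1$-smooth Hessian, then for every $K\in\mathbb{N}$, $$\mathcal{W}_{2}(\widetilde{\pi}_{K},\pi_* ) \leq (1-h\mu)^{K}\mathcal{W}_{2}(\widetilde{\pi}_{0},\pi_* ) + 240h\frac{L}{\mu}\left(\sqrt{R}\,\sigma_{*} + \left(LR\sqrt{hd}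 + \sqrt{LRd}\right)+\left(\sqrt{Ld} +\frac{L_{1}}{L}d\right)\right).$$
   Context: Setting: $g_1,\dots,g_N:\mathbb{R}^d\to\mathbb{R}$ are given functions, $F=\frac1N\sum_{i=1}^N g_i$ (so $\nabla F=\frac1N\sum_i\nabla g_i$). The batch size $n$ divides $N$ exactly, and $R=N/n$. For a batch $\boldsymbol{\omega}=(\omega_1,\dots,\omega_n)$ of $n$ distinct indices from $\{1,\dots,N\}$ (equivalently, a subset of size $n$), $f_{\boldsymbol{\omega}}=\frac1n\sum_{j=1}^n g_{\omega_j}$, so $\nabla f_{\boldsymbol{\omega}}=\frac1n\sum_{j=1}^n\nabla g_{\omega_j}$. In the definition of $\sigma_*^2$, $X\sim\pi_*$ and $\boldsymbol{\omega}$ is independent of $X$ and drawn uniformly without replacement from $\{1,\dots,N\}$ (a random vector of length $n$). Definitions: a continuously differentiable $f:\mathbb{R}^d\to\mathbb{R}$ is $L$-smooth ($L>0$) if $\|\nabla f(x)-\nabla f(y)\|\le L\|x-y\|$ for all $x,y$; it is $\mu$-strongly convex ($\mu>0$) if $f(x)\ge f(y)+\langle\nabla f(y),x-y\rangle+\frac{\mu}{2}\|x-y\|^2$ for all $x,y$. A twice continuously differentiable $f$ has an $L_1$-smooth Hessian ($L_1>0$) if $\|\nabla^2 f(x)-\nabla^2 f(y)\|\le L_1\|x-y\|$ for all $x,y$. SGLD-RR (Stochastic Gradient Langevin Dynamics with Random Reshuffling): the iterates are $$x_{k+1}=x_k-h\nabla f_{\boldsymbol{\omega}_k}(x_k)+\sqrt{2h}\,\xi_k,\qquad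 k=0,1,2,\dots,$$ with $\xi_k\sim\mathcal{N}(0_d,I_d)$ i.i.d., where the batches are generated epoch by epoch: for each $l=0,1,2,\dots$, the batches $(\boldsymbol{\omega}_{lR},\boldsymbol{\omega}_{lR+1},\dots,\boldsymbol{\omega}_{lR+R-1})$ are the $R$ successive blocks of length $n$ of a uniformly random permutation of $\{1,\dots,N\}$ (so they partition $\{1,\dots,N\}$), independent across epochs $l$. The initial point $x_0$, the noises $(\xi_k)$ and the permutations are mutually independent. $\mathcal{W}_2$ is the Wasserstein-2 distance on $\mathbb{R}^d$ with the Euclidean metric. *)

theory Defs
  imports "HOL-Probability.Probability" "HOL-Combinatorics.Permutations"
begin

section \<open>Smooth and strongly convex functions\<close>

definition grad :: "('a::euclidean_space \<Rightarrow> real) \<Rightarrow> 'a \<Rightarrow> 'a" where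
  "grad f x = (THE D. GDERIV f x :> D)"

definition cont_diff :: "('a::euclidean_space \<Rightarrow> real) \<Rightarrow> bool" where
  "cont_diff f \<longleftrightarrow> (\<forall>x. f differentiable (at x)) \<and> continuous_on UNIV (grad f)"

definition smooth :: "real \<Rightarrow> ('a::euclidean_space \<Rightarrow> real) \<Rightarrow> bool" where
  "smooth L f \<longleftrightarrow> (\<forall>x y. norm (grad f x - grad f y) \<le> L * norm (x - y))"

definition strongly_convex :: "real \<Rightarrow> ('a::euclidean_space \<Rightarrow> real) \<Rightarrow> bool" where
  "strongly_convex \<mu> f \<longleftrightarrow>
     (\<forall>x y. f x \<ge> f y + grad f y \<bullet> (x - y) + \<mu> / 2 * (norm (x - y))\<^sup>2)"

text \<open>The Hessian is the derivative of the gradient, as a bounded linear map; the norm on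
  \<open>'a \<Rightarrow>\<^sub>L 'a\<close> is the operator norm.  \<open>Blinfun\<close> and \<open>frechet_derivative\<close> are meaningful only where
  \<open>grad f\<close> is differentiable, which \<open>twice_cont_diff\<close> demands.\<close>

definition hessian :: "('a::euclidean_space \<Rightarrow> real) \<Rightarrow> 'a \<Rightarrow> 'a \<Rightarrow>\<^sub>L 'a" where
  "hessian f x = Blinfun (frechet_derivative (grad f) (at x))"

definition twice_cont_diff :: "('a::euclidean_space \<Rightarrow> real) \<Rightarrow> bool" where
  "twice_cont_diff f \<longleftrightarrow>
     cont_diff f \<and> (\<forall>x. grad f differentiable (at x)) \<and> continuous_on UNIV (hessian f)"

definition smooth_hessian :: "real \<Rightarrow> ('a::euclidean_space \<Rightarrow> real) \<Rightarrow> bool" where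
  "smooth_hessian L\<^sub>1 f \<longleftrightarrow> (\<forall>x y. norm (hessian f x - hessian f y) \<le> L\<^sub>1 * norm (x - y))"


section \<open>Measures on Euclidean space\<close>

definition gibbs :: "('a::euclidean_space \<Rightarrow> real) \<Rightarrow> 'a measure" where
  "gibbs F = density lborel
     (\<lambda>x. ennreal (exp (- F x)) / (\<integral>\<^sup>+ y. ennreal (exp (- F y)) \<partial>lborel))"

text \<open>The normal distribution with mean zero and identity covariance.\<close>

definition std_gaussian :: "'a::euclidean_space measure" where
  "std_gaussian = density lborel (\<lambda>x. ennreal (\<Prod>b\<in>Basis. std_normal_density (x \<bullet> b)))"

definition couplings ::
    "'a::euclidean_space measure \<Rightarrow> 'a measure \<Rightarrow> ('a \<times> 'a) measure set" where
  "couplings \<alpha> \<beta> = {\<gamma>. sets \<gamma> = sets (borel \<Otimes>\<^sub>M borel) \<and>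
     distr \<gamma> borel fst = \<alpha> \<and> distr \<gamma> borel snd = \<beta>}"

definition ennreal_sqrt :: "ennreal \<Rightarrow> ennreal" where
  "ennreal_sqrt c = (if c = \<infinity> then \<infinity> else ennreal (sqrt (enn2real c)))"

text \<open>Wasserstein-2 distance of probability measures; it is infinite when no coupling has finite
  quadratic cost.\<close>

definition W2 :: "'a::euclidean_space measure \<Rightarrow> 'a measure \<Rightarrow> ennreal" where
  "W2 \<alpha> \<beta> = ennreal_sqrt
     (INF \<gamma>\<in>couplings \<alpha> \<beta>. \<integral>\<^sup>+ (x, y). ennreal ((dist x y)\<^sup>2) \<partial>\<gamma>)"


section \<open>Finite sums and batches\<close>

definition objective :: "(nat \<Rightarrow> 'a \<Rightarrow> real) \<Rightarrow> nat \<Rightarrow> 'a \<Rightarrow> real" where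
  "objective g N x = (\<Sum>i = 1..N. g i x) / real N"

definition batches :: "nat \<Rightarrow> nat \<Rightarrow> nat list set" where
  "batches N n = {\<omega>. length \<omega> = n \<and> distinct \<omega> \<and> set \<omega> \<subseteq> {1..N}}"

definition batch_fun :: "(nat \<Rightarrow> 'a \<Rightarrow> real) \<Rightarrow> nat list \<Rightarrow> 'a \<Rightarrow> real" where
  "batch_fun g \<omega> x = (\<Sum>j<length \<omega>. g (\<omega> ! j) x) / real (length \<omega>)"

text \<open>The variance \<open>\<sigma>\<^sub>*\<^sup>2\<close> of the batch gradient, for a point \<open>x\<close> drawn from \<open>\<pi>\<close> and an independent
  batch \<open>\<omega>\<close> drawn uniformly without replacement.\<close>

definition batch_grad_variance ::
    "(nat \<Rightarrow> 'a::euclidean_space \<Rightarrow> real) \<Rightarrow> nat \<Rightarrow> nat \<Rightarrow> 'a measure \<Rightarrow> ennreal" where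
  "batch_grad_variance g N n \<pi> =
     (\<integral>\<^sup>+ (x, \<omega>). ennreal ((norm (grad (batch_fun g \<omega>) x - grad (objective g N) x))\<^sup>2)
        \<partial>(\<pi> \<Otimes>\<^sub>M uniform_count_measure (batches N n)))"


section \<open>SGLD with random reshuffling\<close>

text \<open>The \<open>r\<close>-th block of length \<open>n\<close> (counting from \<open>0\<close>) of the word \<open>p 1, p 2, p 3, \<dots>\<close>\<close>

definition block :: "nat \<Rightarrow> (nat \<Rightarrow> nat) \<Rightarrow> nat \<Rightarrow> nat list" where
  "block n p r = map p [r * n + 1 ..< r * n + n + 1]"

datatype source = Initial | Noise nat | Shuffle nat

text \<open>The independent inputs take values in different spaces, so mutual independence is stated for
  the generated families of events, exactly as \<open>indep_vars\<close> does for a common value type.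
  \<open>P l\<close> is the permutation used in epoch \<open>l\<close>.\<close>

locale sgld_rr = prob_space M for M :: "'s measure" +
  fixes g :: "nat \<Rightarrow> 'a::euclidean_space \<Rightarrow> real" and N n R :: nat and h :: real
    and x \<xi> :: "nat \<Rightarrow> 's \<Rightarrow> 'a" and P :: "nat \<Rightarrow> 's \<Rightarrow> nat \<Rightarrow> nat"
  assumes x0_measurable: "x 0 \<in> borel_measurable M"
    and noise_measurable: "\<xi> k \<in> borel_measurable M"
    and noise_law: "distr M borel (\<xi> k) = std_gaussian"
    and perm_measurable: "P l \<in> measurable M (count_space {p. p permutes {1..N}})"
    and perm_law: "distr M (count_space {p. p permutes {1..N}}) (P l) =
          uniform_count_measure {p. p permutes {1..N}}"
    and independent: "indep_sets (\<lambda>s. case s of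
          Initial \<Rightarrow> {x 0 -` A \<inter> space M | A. A \<in> sets borel}
        | Noise k \<Rightarrow> {\<xi> k -` A \<inter> space M | A. A \<in> sets borel}
        | Shuffle l \<Rightarrow> {P l -` A \<inter> space M | A. A \<in> sets (count_space {p. p permutes {1..N}})})
        UNIV"
    and step: "s \<in> space M \<Longrightarrow> x (Suc k) s =
          x k s - h *\<^sub>R grad (batch_fun g (block n (P (k div R) s) (k mod R))) (x k s)
            + sqrt (2 * h) *\<^sub>R \<xi> k s"

end

theory Submission
  imports Defs
begin

text \<open>The Langevin diffusion is replaced by chains that preserve \<open>\<pi>\<close> exactly.  Random-walk Metropolis
  with Gaussian proposals \<open>y + c \<zeta>\<close> is \<open>\<pi>\<close>-reversible; its rejections produce the drift
  \<open>- c\<^sup>2/2 \<nabla>F\<close> up to \<open>O(c\<^sup>3)\<close> and otherwise only noise of variance \<open>O(c\<^sup>3)\<close>.  Hence \<open>2h/c\<^sup>2\<close> steps with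
  small \<open>c\<close> form a \<open>\<pi>\<close>-stationary step \<open>y \<mapsto> y - h \<nabla>F y + \<surd>(2h) \<xi> + E\<close>, driven by a standard normal
  \<open>\<xi>\<close> independent of \<open>y\<close>, with \<open>E\<close> of order \<open>L h\<^bsup>3/2\<^esup> \<surd>d\<close> and, if the Hessian is Lipschitz, conditional
  mean of order \<open>h\<^sup>2\<close>.

  SGLD is coupled with the stationary chain \<open>Y\<close> through \<open>\<xi>\<close>.  The difference is studied after adding
  the accumulated gradient noise \<open>h \<Sum> (\<nabla>f\<^sub>\<omega> - \<nabla>F)(Y)\<close>, so that one step becomes a contraction up to an
  error \<open>h L\<close> times that sum.  Because the batches of an epoch partition the data, the sum over an
  epoch has mean zero given \<open>Y\<close>, vanishes if \<open>Y\<close> stands still, and has second moment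
  \<open>\<le> 2 R \<sigma>\<^sub>*\<^sup>2\<close> at any time.\<close>

section \<open>Gradients\<close>

text \<open>Exact stationarity of the comparison chain makes the moments of \<open>grad F\<close>
  and the variance bound \<open>\<sigma>\<close> under \<open>\<pi>\<close> available at every time,
  with no error in law to be tracked. The price is an arbitrarily small but positive error
  \<open>e\<close> of the Metropolis construction. Another \<open>e\<close> comes from couplings
  that nearly attain the infimum in \<open>W2\<close>; both vanish in a single limit at the very
  end.

  The obstacle is that the gradient noise of a single step is too large to be treated as an error:
  summed against the contraction \<open>1 - h * \<mu>\<close> it would cost
  \<open>\<sigma> / \<mu>\<close>, without any factor \<open>h\<close>. This is why accumulated sums
  are carried along in the comparison instead of being estimated step by step.

  SGLD is given on its own probability space, while the coupling is built on a product space. Both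
  are instances of \<open>sgld_rr\<close>, and a recursion for the joint law of the iterate and the
  current permutation shows that the initial law determines the law of the iterates.

  The constant 240 leaves room: the estimates give at most 24 in front of each term.\<close>

lemma grad_eqI: "grad f x = D" if "GDERIV f x :> D"
  unfolding grad_def
proof (rule the_equality)
  fix D' assume "GDERIV f x :> D'"
  then have "(\<lambda>h. h \<bullet> D') = (\<lambda>h. h \<bullet> D)"
    using that unfolding gderiv_def by (rule has_derivative_unique)
  then have "(D' - D) \<bullet> (D' - D) = 0"
    by (metis inner_diff_right right_minus_eq)
  then show "D' = D" by simp
qed (fact that)

lemma GDERIV_grad:
  fixes f :: "'a::euclidean_space \<Rightarrow> real"
  assumes "f differentiable (at x)"
  shows "GDERIV f x :> grad f x"
proof -
  obtain f' where f': "(f has_derivative f') (at x)"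
    using assms by (auto simp: differentiable_def)
  interpret linear f' by (rule has_derivative_linear[OF f'])
  have "f' v = v \<bullet> (\<Sum>b\<in>Basis. f' b *\<^sub>R b)" for v
  proof -
    have "f' v = f' (\<Sum>b\<in>Basis. (v \<bullet> b) *\<^sub>R b)" by (simp add: euclidean_representation)
    then show ?thesis by (simp add: sum scale inner_sum_right mult.commute)
  qed
  then have "f' = (\<lambda>v. v \<bullet> (\<Sum>b\<in>Basis. f' b *\<^sub>R b))" by blast
  then have "GDERIV f x :> (\<Sum>b\<in>Basis. f' b *\<^sub>R b)"
    using f' unfolding gderiv_def by simp
  then show ?thesis using grad_eqI by metis
qed

lemma cont_diff_GDERIV: "cont_diff f \<Longrightarrow> GDERIV f x :> grad f x"
  unfolding cont_diff_def by (blast intro: GDERIV_grad)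

lemma cont_diff_continuous: "cont_diff f \<Longrightarrow> continuous_on UNIV f"
  unfolding cont_diff_def
  by (auto intro!: continuous_at_imp_continuous_on differentiable_imp_continuous_within)

lemma cont_diff_borel:
  assumes "cont_diff f"
  shows "f \<in> borel_measurable borel" "grad f \<in> borel_measurable borel"
  using assms cont_diff_continuous[OF assms]
  by (auto simp: cont_diff_def intro: borel_measurable_continuous_onI)

lemma GDERIV_along:
  assumes "\<And>x. GDERIV f x :> grad f x"
  shows "((\<lambda>t. f (x + t *\<^sub>R v)) has_real_derivative (v \<bullet> grad f (x + t *\<^sub>R v))) (at t)"
proof -
  have "((\<lambda>t. x + t *\<^sub>R v) has_derivative (\<lambda>s. s *\<^sub>R v)) (at t)"
    by (auto intro!: derivative_eq_intros)
  from diff_chain_at[OF this assms[unfolded gderiv_def]] show ?thesis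
    by (simp add: has_field_derivative_def o_def mult_commute_abs)
qed

text \<open>The descent lemma. Along the segment, the gap \<open>?p\<close> between \<open>f\<close>
  and its quadratic majorant has nonpositive derivative, because the gradient changes by at most
  \<open>L * t * norm v\<close>.\<close>

lemma smooth_upper:
  assumes "cont_diff f" "smooth L f"
  shows "f (x + v) \<le> f x + grad f x \<bullet> v + L / 2 * (norm v)\<^sup>2"
proof -
  let ?p = "\<lambda>t. f (x + t *\<^sub>R v) - t * (grad f x \<bullet> v) - L / 2 * t\<^sup>2 * (norm v)\<^sup>2"
  have "?p 1 \<le> ?p 0"
  proof (rule DERIV_nonpos_imp_nonincreasing[of 0 1 ?p])
    fix t :: real assume t: "0 \<le> t" "t \<le> 1"
    have "(?p has_real_derivative
       v \<bullet> grad f (x + t *\<^sub>R v) - grad f x \<bullet> v - L * t * (norm v)\<^sup>2) (at t)"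
      by (rule derivative_eq_intros GDERIV_along cont_diff_GDERIV assms refl | simp)+
    moreover have "v \<bullet> grad f (x + t *\<^sub>R v) - grad f x \<bullet> v \<le> L * t * (norm v)\<^sup>2"
    proof -
      have "v \<bullet> grad f (x + t *\<^sub>R v) - grad f x \<bullet> v = v \<bullet> (grad f (x + t *\<^sub>R v) - grad f x)"
        by (simp add: inner_diff_right inner_commute)
      also have "\<dots> \<le> norm v * norm (grad f (x + t *\<^sub>R v) - grad f x)"
        by (rule norm_cauchy_schwarz)
      also have "\<dots> \<le> norm v * (L * norm ((x + t *\<^sub>R v) - x))"
        using assms(2) unfolding smooth_def by (intro mult_left_mono) (erule allE, erule allE, assumption, rule norm_ge_zero)
      finally show ?thesis using t by (simp add: power2_eq_square mult_ac)
    qed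
    ultimately show "\<exists>y. DERIV ?p t :> y \<and> y \<le> 0" by (intro exI conjI) (assumption, linarith)
  qed simp
  then show ?thesis by (simp add: algebra_simps)
qed

lemma smooth_lower:
  assumes "cont_diff f" "strongly_convex \<mu> f"
  shows "f (x + v) \<ge> f x + grad f x \<bullet> v + \<mu> / 2 * (norm v)\<^sup>2"
  using assms(2) unfolding strongly_convex_def by (metis add_diff_cancel_left')

text \<open>The quadratic bounds from below and from above are compared in the direction of one unit
  vector.\<close>

lemma strong_convexity_le_smoothness:
  fixes f :: "'a::euclidean_space \<Rightarrow> real"
  assumes "cont_diff f" "smooth L f" "strongly_convex \<mu> f"
  shows "\<mu> \<le> L"
proof -
  obtain b :: 'a where "b \<in> Basis" using nonempty_Basis by blast
  then show ?thesis
    using smooth_upper[OF assms(1,2), of 0 b] smooth_lower[OF assms(1,3), of 0 b] by simp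
qed

text \<open>Strong convexity from below at one point and smoothness from above at the other, compared at
  \<open>y + t q\<close> with \<open>q = \<nabla>f x - \<nabla>f y - \<mu> (x - y)\<close>, give the co-coercivity of \<open>f - \<mu>/2 |\<cdot>|\<^sup>2\<close>.\<close>

lemma gradient_step_contraction:
  fixes f :: "'a::euclidean_space \<Rightarrow> real"
  assumes f: "cont_diff f" "smooth L f" "strongly_convex \<mu> f"
    and h: "0 < h" "h * L < 1"
  shows "norm ((x - h *\<^sub>R grad f x) - (y - h *\<^sub>R grad f y)) \<le> (1 - h * \<mu>) * norm (x - y)"
proof -
  define e where "e = x - y"
  define q where "q = grad f x - grad f y - \<mu> *\<^sub>R e"
  have half: "f x - f y - grad f x \<bullet> e + \<mu> / 2 * (e \<bullet> e)
      + s * ((grad f x - grad f y - \<mu> *\<^sub>R e) \<bullet> q) - (L - \<mu>) / 2 * s\<^sup>2 * (q \<bullet> q) \<le> 0"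
    if "e = x - y" for x y e and s :: real
  proof -
    have "f (y + s *\<^sub>R q) \<le> f y + grad f y \<bullet> (s *\<^sub>R q) + L / 2 * (norm (s *\<^sub>R q))\<^sup>2"
      by (rule smooth_upper[OF f(1,2)])
    moreover have "f (x + (s *\<^sub>R q - e)) \<ge> f x + grad f x \<bullet> (s *\<^sub>R q - e) + \<mu> / 2 * (norm (s *\<^sub>R q - e))\<^sup>2"
      by (rule smooth_lower[OF f(1,3)])
    moreover have "x + (s *\<^sub>R q - e) = y + s *\<^sub>R q" using that by simp
    ultimately have "f x + grad f x \<bullet> (s *\<^sub>R q - e) + \<mu> / 2 * (norm (s *\<^sub>R q - e))\<^sup>2
        \<le> f y + grad f y \<bullet> (s *\<^sub>R q) + L / 2 * (norm (s *\<^sub>R q))\<^sup>2" by simp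
    then show ?thesis
      unfolding power2_norm_eq_inner
      by (simp add: inner_diff_left inner_diff_right inner_commute algebra_simps power2_eq_square
        add_divide_distrib diff_divide_distrib)
  qed
  \<comment> \<open>The best parameter \<open>1 / (L - \<mu>)\<close> is undefined for
    \<open>L = \<mu>\<close>. This one never exceeds it, since
    \<open>(L - \<mu>) * t \<le> 1\<close> is just \<open>h * L \<le> 1\<close>, and multiplying by
    \<open>1 - h * \<mu>\<close> turns it into \<open>h\<close>.\<close>
  define t where "t = h / (1 - h * \<mu>)"
  have muL: "h * \<mu> \<le> h * L" using strong_convexity_le_smoothness[OF f] h by simp
  then have pos: "1 - h * \<mu> > 0" using h by linarith
  have th: "h = t * (1 - h * \<mu>)" "t > 0" using pos h by (auto simp: t_def)
  have tl: "(L - \<mu>) * t \<le> 1"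
  proof -
    have "(L - \<mu>) * h \<le> 1 - h * \<mu>" using h by (simp add: algebra_simps)
    then show ?thesis using pos by (simp add: t_def field_simps)
  qed
  have "2 * t * (q \<bullet> q) - (L - \<mu>) * t\<^sup>2 * (q \<bullet> q) \<le> q \<bullet> e"
  proof -
    have 1: "f x - f y - grad f x \<bullet> e + \<mu> / 2 * (e \<bullet> e) + t * (q \<bullet> q) - (L - \<mu>) / 2 * t\<^sup>2 * (q \<bullet> q) \<le> 0"
      using half[OF e_def, of t] by (simp add: q_def)
    \<comment> \<open>Exchanging \<open>x\<close> and \<open>y\<close> changes the sign of both
      \<open>e\<close> and \<open>q\<close>, so the parameter \<open>- t\<close> yields the same
      quadratic terms. Adding the two inequalities eliminates the function values.\<close>
    have yx: "y - x = - e" by (simp add: e_def)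
    have "grad f y - grad f x - \<mu> *\<^sub>R (- e) = - q" by (simp add: q_def)
    then have 2: "f y - f x + grad f y \<bullet> e + \<mu> / 2 * (e \<bullet> e) + t * (q \<bullet> q) - (L - \<mu>) / 2 * t\<^sup>2 * (q \<bullet> q) \<le> 0"
      using half[OF yx[symmetric], of "- t"] by (simp add: yx)
    have "q \<bullet> e = grad f x \<bullet> e - grad f y \<bullet> e - \<mu> * (e \<bullet> e)" by (simp add: q_def inner_diff_left)
    moreover have "(L - \<mu>) / 2 * t\<^sup>2 * (q \<bullet> q) = ((L - \<mu>) * t\<^sup>2 * (q \<bullet> q)) / 2"
      "\<mu> / 2 * (e \<bullet> e) = (\<mu> * (e \<bullet> e)) / 2" by simp_all
    ultimately show ?thesis using 1 2 by linarith
  qed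
  moreover have "t * (q \<bullet> q) \<le> 2 * t * (q \<bullet> q) - (L - \<mu>) * t\<^sup>2 * (q \<bullet> q)"
  proof -
    have "((L - \<mu>) * t) * (t * (q \<bullet> q)) \<le> 1 * (t * (q \<bullet> q))" using tl th by (intro mult_right_mono) auto
    then show ?thesis by (simp add: power2_eq_square algebra_simps)
  qed
  ultimately have "t * (q \<bullet> q) \<le> q \<bullet> e" by linarith
  then have "t * (q \<bullet> q) * (1 - h * \<mu>) \<le> (q \<bullet> e) * (1 - h * \<mu>)" using pos by (intro mult_right_mono) auto
  then have *: "h * (q \<bullet> q) \<le> (1 - h * \<mu>) * (q \<bullet> e)"
    by (metis th(1) mult.commute mult.left_commute)
  have eq: "(x - h *\<^sub>R grad f x) - (y - h *\<^sub>R grad f y) = (1 - h * \<mu>) *\<^sub>R e - h *\<^sub>R q"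
    by (simp add: q_def e_def algebra_simps)
  have "(norm ((1 - h * \<mu>) *\<^sub>R e - h *\<^sub>R q))\<^sup>2
      = (1 - h * \<mu>)\<^sup>2 * (e \<bullet> e) - 2 * h * ((1 - h * \<mu>) * (q \<bullet> e)) + h * (h * (q \<bullet> q))"
    unfolding power2_norm_eq_inner
    by (simp add: inner_diff_left inner_diff_right inner_commute algebra_simps power2_eq_square)
  also have "\<dots> \<le> (1 - h * \<mu>)\<^sup>2 * (e \<bullet> e) - 2 * h * (h * (q \<bullet> q)) + h * (h * (q \<bullet> q))"
    using * h by (intro add_right_mono diff_left_mono mult_left_mono) auto
  also have "\<dots> \<le> (1 - h * \<mu>)\<^sup>2 * (e \<bullet> e)" using h by simp
  also have "\<dots> = ((1 - h * \<mu>) * norm e)\<^sup>2" by (simp add: power_mult_distrib power2_norm_eq_inner)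
  finally have "norm ((1 - h * \<mu>) *\<^sub>R e - h *\<^sub>R q) \<le> (1 - h * \<mu>) * norm e"
    using pos by (auto intro: power2_le_imp_le)
  then show ?thesis unfolding eq e_def .
qed

lemma smooth_increment:
  assumes "cont_diff f" "smooth L f" "strongly_convex \<mu> f" "\<mu> > 0"
  shows "\<bar>f (x + v) - f x - grad f x \<bullet> v\<bar> \<le> L / 2 * (norm v)\<^sup>2"
proof -
  have "0 \<le> \<mu> / 2 * (norm v)\<^sup>2" "0 \<le> L / 2 * (norm v)\<^sup>2"
    using assms(4) strong_convexity_le_smoothness[OF assms(1-3)] by auto
  then show ?thesis
    using smooth_upper[OF assms(1,2), of x v] smooth_lower[OF assms(1,3), of x v] by linarith
qed

section \<open>Taylor expansion of the gradient\<close>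

lemma hessian_derivative:
  assumes "twice_cont_diff f"
  shows "(grad f has_derivative blinfun_apply (hessian f x)) (at x)"
proof -
  have d: "(grad f has_derivative frechet_derivative (grad f) (at x)) (at x)"
    using assms by (auto simp: twice_cont_diff_def frechet_derivative_works)
  then show ?thesis
    unfolding hessian_def by (simp add: bounded_linear_Blinfun_apply has_derivative_bounded_linear)
qed

text \<open>The mean value inequality for \<open>grad f\<close> minus its linearization at
  \<open>x\<close>: on the segment the derivative of this difference is
  \<open>hessian f z - hessian f x\<close>, of norm at most \<open>K * norm v\<close>. The constant
  is \<open>K\<close> rather than the optimal \<open>K / 2\<close>.\<close>

lemma grad_taylor:
  assumes "twice_cont_diff f" "smooth_hessian K f" "K \<ge> 0"
  shows "norm (grad f (x + v) - grad f x - blinfun_apply (hessian f x) v) \<le> K * (norm v)\<^sup>2"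
proof -
  let ?g = "\<lambda>z. grad f z - blinfun_apply (hessian f x) z"
  have "norm (?g (x + v) - ?g x) \<le> (K * norm v) * norm ((x + v) - x)"
  proof (rule differentiable_bound[where S="closed_segment x (x + v)"])
    fix z assume z: "z \<in> closed_segment x (x + v)"
    show "(?g has_derivative (\<lambda>w. blinfun_apply (hessian f z) w - blinfun_apply (hessian f x) w))
      (at z within closed_segment x (x + v))"
      by (rule has_derivative_at_withinI)
         (intro has_derivative_diff hessian_derivative assms(1) bounded_linear_imp_has_derivative
            blinfun.bounded_linear_right)
    have "norm (hessian f z - hessian f x) \<le> K * norm (z - x)"
      using assms(2) by (auto simp: smooth_hessian_def)
    also have "\<dots> \<le> K * norm v"
      using segment_bound1[OF z] assms(3) by (intro mult_left_mono) auto
    finally show "onorm (\<lambda>w. blinfun_apply (hessian f z) w - blinfun_apply (hessian f x) w) \<le> K * norm v"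
      by (simp add: norm_blinfun.rep_eq blinfun.diff_left[symmetric])
  qed auto
  then show ?thesis
    by (simp add: blinfun.add_right power2_eq_square algebra_simps)
qed

text \<open>The Hessian applied to \<open>v\<close> is a limit of difference quotients of the
  gradient, all bounded by \<open>L * norm v\<close>. The Taylor remainder at distance
  \<open>t\<close> is quadratic in \<open>t\<close>; the choice of \<open>t\<close> makes its
  quotient at most \<open>e\<close>, and the summand \<open>1\<close> in the denominator covers
  \<open>v = 0\<close>.\<close>

lemma hessian_bound:
  assumes "twice_cont_diff f" "smooth_hessian K f" "K \<ge> 0" "smooth L f"
  shows "norm (blinfun_apply (hessian f x) v) \<le> L * norm v"
proof (rule field_le_epsilon)
  fix e :: real assume e: "e > 0"
  define t where "t = e / (K * (norm v)\<^sup>2 + 1)"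
  have t: "t > 0" using e assms(3) by (simp add: t_def add_nonneg_pos)
  have "t * norm (blinfun_apply (hessian f x) v) = norm (blinfun_apply (hessian f x) (t *\<^sub>R v))"
    using t by (simp add: blinfun.scaleR_right)
  also have "\<dots> \<le> norm (grad f (x + t *\<^sub>R v) - grad f x)
      + norm (grad f (x + t *\<^sub>R v) - grad f x - blinfun_apply (hessian f x) (t *\<^sub>R v))"
    by (metis add.commute norm_minus_commute norm_triangle_sub)
  also have "\<dots> \<le> L * norm (t *\<^sub>R v) + K * (norm (t *\<^sub>R v))\<^sup>2"
    using assms(4) by (intro add_mono grad_taylor assms) (metis add_diff_cancel_left' smooth_def)
  also have "\<dots> = t * (L * norm v + t * (K * (norm v)\<^sup>2))"
    using t by (simp add: power2_eq_square algebra_simps)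
  finally have "norm (blinfun_apply (hessian f x) v) \<le> L * norm v + t * (K * (norm v)\<^sup>2)"
    using t by simp
  also have "t * (K * (norm v)\<^sup>2) \<le> t * (K * (norm v)\<^sup>2 + 1)" using t by simp
  also have "\<dots> = e" using assms(3) by (simp add: t_def add_nonneg_eq_0_iff)
  finally show "norm (blinfun_apply (hessian f x) v) \<le> L * norm v + e" by simp
qed

section \<open>Square-integrable functions\<close>

text \<open>A bound on the L2 norm as a predicate. Measurability and the sign of the bound are
  included, so that estimates compose by Minkowski, scaling and domination without separate
  integrability goals.\<close>

definition L2le :: "'s measure \<Rightarrow> ('s \<Rightarrow> 'a::euclidean_space) \<Rightarrow> real \<Rightarrow> bool" where
  "L2le M f a \<longleftrightarrow> f \<in> borel_measurable M \<and> 0 \<le> a \<and>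
     (\<integral>\<^sup>+ x. ennreal ((norm (f x))\<^sup>2) \<partial>M) \<le> ennreal (a\<^sup>2)"

lemma L2le_measurable: "L2le M f a \<Longrightarrow> f \<in> borel_measurable M"
  and L2le_nonneg: "L2le M f a \<Longrightarrow> 0 \<le> a"
  by (auto simp: L2le_def)

lemma L2le_mono:
  assumes "L2le M f a" "a \<le> b"
  shows "L2le M f b"
proof -
  have "ennreal (a\<^sup>2) \<le> ennreal (b\<^sup>2)" using assms by (intro ennreal_leI power_mono) (auto simp: L2le_def)
  then show ?thesis using assms unfolding L2le_def by (auto intro: order_trans)
qed

lemma L2le_integrable:
  assumes "L2le M f a"
  shows "integrable M (\<lambda>x. (norm (f x))\<^sup>2)" "(\<integral>x. (norm (f x))\<^sup>2 \<partial>M) \<le> a\<^sup>2"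
proof -
  have [measurable]: "f \<in> borel_measurable M" using assms by (simp add: L2le_def)
  have fin: "(\<integral>\<^sup>+ x. ennreal ((norm (f x))\<^sup>2) \<partial>M) \<le> ennreal (a\<^sup>2)" using assms by (simp add: L2le_def)
  show *: "integrable M (\<lambda>x. (norm (f x))\<^sup>2)"
    by (rule integrableI_nonneg) (use fin in \<open>auto intro: le_less_trans\<close>)
  show "(\<integral>x. (norm (f x))\<^sup>2 \<partial>M) \<le> a\<^sup>2"
    using fin by (subst (asm) nn_integral_eq_integral[OF *]) auto
qed

lemma L2leI:
  assumes "f \<in> borel_measurable M" "integrable M (\<lambda>x. (norm (f x))\<^sup>2)"
    "(\<integral>x. (norm (f x))\<^sup>2 \<partial>M) \<le> a\<^sup>2" "0 \<le> a"
  shows "L2le M f a"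
  using assms unfolding L2le_def by (subst nn_integral_eq_integral) (auto intro: ennreal_leI)

lemma L2le_dominated:
  assumes "L2le M g a" "f \<in> borel_measurable M" "\<And>x. x \<in> space M \<Longrightarrow> norm (f x) \<le> norm (g x)"
  shows "L2le M f a"
proof -
  have "(\<integral>\<^sup>+ x. ennreal ((norm (f x))\<^sup>2) \<partial>M) \<le> (\<integral>\<^sup>+ x. ennreal ((norm (g x))\<^sup>2) \<partial>M)"
    by (intro nn_integral_mono ennreal_leI power_mono assms) auto
  then show ?thesis using assms(1,2) unfolding L2le_def by (auto intro: order_trans)
qed

lemma L2le_cong:
  assumes "L2le M f a" "\<And>x. x \<in> space M \<Longrightarrow> f x = g x"
  shows "L2le M g a"
proof -
  have "g \<in> borel_measurable M"
    using measurable_cong[THEN iffD1, OF assms(2) L2le_measurable[OF assms(1)]] .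
  then show ?thesis using assms by (intro L2le_dominated[OF assms(1)]) auto
qed

lemma norm_add_power2_weighted:
  assumes "t > 0"
  shows "(norm (u + v))\<^sup>2 \<le> (1 + t) * (norm u)\<^sup>2 + (1 + 1 / t) * (norm v)\<^sup>2"
proof -
  have "(norm (u + v))\<^sup>2 \<le> (norm u + norm v)\<^sup>2"
    by (intro power_mono norm_triangle_ineq) auto
  also have "\<dots> = (norm u)\<^sup>2 + (norm v)\<^sup>2 + 2 * (norm u * norm v)"
    by (simp add: power2_sum)
  also have "2 * (norm u * norm v) \<le> t * (norm u)\<^sup>2 + 1 / t * (norm v)\<^sup>2"
  proof -
    have "0 \<le> (t * norm u - norm v)\<^sup>2 / t" using assms by simp
    also have "\<dots> = t * (norm u)\<^sup>2 + 1 / t * (norm v)\<^sup>2 - 2 * (norm u * norm v)"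
      using assms by (simp add: power2_diff field_simps power2_eq_square)
    finally show ?thesis by simp
  qed
  finally show ?thesis by (simp add: algebra_simps)
qed

text \<open>Minkowski's inequality follows by optimizing the weight \<open>t\<close> in
  \<open>|u + v|\<^sup>2 \<le> (1 + t) |u|\<^sup>2 + (1 + 1/t) |v|\<^sup>2\<close>.\<close>

lemma L2le_add:
  assumes "L2le M f a" "L2le M g b"
  shows "L2le M (\<lambda>x. f x + g x) (a + b)"
proof -
  have [measurable]: "f \<in> borel_measurable M" "g \<in> borel_measurable M"
    and ab: "0 \<le> a" "0 \<le> b" using assms by (auto simp: L2le_def)
  note f = L2le_integrable[OF assms(1)] and g = L2le_integrable[OF assms(2)]
  have int: "integrable M (\<lambda>x. (norm (f x + g x))\<^sup>2)"
  proof (rule Bochner_Integration.integrable_bound)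
    show "integrable M (\<lambda>x. 2 * (norm (f x))\<^sup>2 + 2 * (norm (g x))\<^sup>2)" using f g by simp
    show "AE x in M. norm ((norm (f x + g x))\<^sup>2) \<le> norm (2 * (norm (f x))\<^sup>2 + 2 * (norm (g x))\<^sup>2)"
      using norm_add_power2_weighted[of 1] by (auto simp: norm_add_power2_weighted)
  qed auto
  let ?I = "\<integral>x. (norm (f x + g x))\<^sup>2 \<partial>M"
  \<comment> \<open>The optimal weight is \<open>b / a\<close>; enlarging both bounds by
    \<open>e / 2\<close> keeps it positive and defined when one of them is \<open>0\<close>.\<close>
  have "sqrt ?I \<le> (a + b) + e" if "e > 0" for e
  proof -
    define p q where "p = a + e / 2" and "q = b + e / 2"
    have pq: "p > 0" "q > 0" "a \<le> p" "b \<le> q" using that ab by (auto simp: p_def q_def)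
    have "?I \<le> (\<integral>x. (1 + q / p) * (norm (f x))\<^sup>2 + (1 + 1 / (q / p)) * (norm (g x))\<^sup>2 \<partial>M)"
      using int f g pq by (intro integral_mono norm_add_power2_weighted) auto
    also have "\<dots> = (1 + q / p) * (\<integral>x. (norm (f x))\<^sup>2 \<partial>M) + (1 + p / q) * (\<integral>x. (norm (g x))\<^sup>2 \<partial>M)"
      using f g by simp
    also have "\<dots> \<le> (1 + q / p) * p\<^sup>2 + (1 + p / q) * q\<^sup>2"
      using f(2) g(2) pq ab
      by (intro add_mono mult_left_mono order_trans[OF f(2)] order_trans[OF g(2)] power_mono) auto
    also have "\<dots> = (p + q)\<^sup>2" using pq by (simp add: power2_eq_square field_simps)
    finally have "sqrt ?I \<le> p + q" using pq by (intro real_le_lsqrt) auto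
    then show ?thesis by (simp add: p_def q_def)
  qed
  then have "sqrt ?I \<le> a + b" by (rule field_le_epsilon)
  then have "?I \<le> (a + b)\<^sup>2" using sqrt_le_D by blast
  then show ?thesis using int ab by (intro L2leI) auto
qed

lemma L2le_zero: "L2le M (\<lambda>x. 0) 0"
  by (simp add: L2le_def)

lemma L2le_scaleR:
  assumes "L2le M f a"
  shows "L2le M (\<lambda>x. c *\<^sub>R f x) (\<bar>c\<bar> * a)"
  using assms L2le_integrable[OF assms]
  by (intro L2leI) (auto simp: L2le_def power_mult_distrib intro!: mult_left_mono)

lemma L2le_uminus: "L2le M f a \<Longrightarrow> L2le M (\<lambda>x. - f x) a"
  by (simp add: L2le_def)

lemma L2le_diff: "L2le M f a \<Longrightarrow> L2le M g b \<Longrightarrow> L2le M (\<lambda>x. f x - g x) (a + b)"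
  using L2le_add[OF _ L2le_uminus] by fastforce

lemma L2le_norm: "L2le M f a \<Longrightarrow> L2le M (\<lambda>x. norm (f x)) a"
  by (auto simp: L2le_def)

lemma L2le_norm_bound:
  assumes "L2le M g a" "f \<in> borel_measurable M" "\<And>x. x \<in> space M \<Longrightarrow> norm (f x) \<le> g x"
  shows "L2le M f a"
  using assms(3) by (intro L2le_dominated[OF assms(1,2)]) force

lemma L2le_sum:
  assumes "\<And>i. i \<in> I \<Longrightarrow> L2le M (f i) (a i)"
  shows "L2le M (\<lambda>x. \<Sum>i\<in>I. f i x) (\<Sum>i\<in>I. a i)"
  using assms by (induction I rule: infinite_finite_induct) (auto intro: L2le_zero L2le_add)

lemma L2le_inner_integrable:
  assumes "L2le M f a" "L2le M g b"
  shows "integrable M (\<lambda>x. f x \<bullet> g x)"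
proof (rule Bochner_Integration.integrable_bound)
  show "integrable M (\<lambda>x. (norm (f x))\<^sup>2 + (norm (g x))\<^sup>2)"
    using L2le_integrable(1) assms by (intro Bochner_Integration.integrable_add) auto
  have "\<bar>u \<bullet> v\<bar> \<le> (norm u)\<^sup>2 + (norm v)\<^sup>2" for u v :: 'b
  proof -
    have "0 \<le> (norm u - norm v)\<^sup>2" by simp
    then have "norm u * norm v * 2 \<le> (norm u)\<^sup>2 + (norm v)\<^sup>2" by (simp add: power2_diff)
    moreover have "0 \<le> norm u * norm v" by simp
    ultimately show ?thesis using Cauchy_Schwarz_ineq2[of u v] by linarith
  qed
  then show "AE x in M. norm (f x \<bullet> g x) \<le> norm ((norm (f x))\<^sup>2 + (norm (g x))\<^sup>2)" by simp
  show "(\<lambda>x. f x \<bullet> g x) \<in> borel_measurable M"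
    using assms[THEN L2le_measurable] by measurable
qed

text \<open>Pythagoras; the gain over Minkowski is what keeps martingale sums at the square root of
  the number of their terms.\<close>

lemma L2le_orthogonal:
  assumes "L2le M f a" "L2le M g b" "(\<integral>x. f x \<bullet> g x \<partial>M) = 0"
  shows "L2le M (\<lambda>x. f x + g x) (sqrt (a\<^sup>2 + b\<^sup>2))"
proof (rule L2leI)
  note f = L2le_integrable[OF assms(1)] and g = L2le_integrable[OF assms(2)]
  note fg = L2le_inner_integrable[OF assms(1,2)]
  have eq: "(norm (f x + g x))\<^sup>2 = (norm (f x))\<^sup>2 + (norm (g x))\<^sup>2 + 2 * (f x \<bullet> g x)" for x
    by (simp add: power2_norm_eq_inner inner_add_left inner_add_right inner_commute)
  show "integrable M (\<lambda>x. (norm (f x + g x))\<^sup>2)" unfolding eq using f g fg by simp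
  show "(\<integral>x. (norm (f x + g x))\<^sup>2 \<partial>M) \<le> (sqrt (a\<^sup>2 + b\<^sup>2))\<^sup>2"
    unfolding eq using f g fg assms(3) by simp
qed (use assms(1,2)[THEN L2le_measurable] in \<open>auto\<close>)

lemma (in finite_measure) L2le_imp_integrable:
  assumes "L2le M f a"
  shows "integrable M f"
proof (rule Bochner_Integration.integrable_bound)
  show "integrable M (\<lambda>x. 1 + (norm (f x))\<^sup>2)"
    using L2le_integrable(1)[OF assms] by simp
  have "r \<le> 1 + r\<^sup>2" for r :: real
  proof -
    have "0 \<le> (r - 1/2)\<^sup>2" by simp
    then have "r \<le> r\<^sup>2 + (1 / 2)\<^sup>2" by (simp add: power2_diff)
    also have "\<dots> \<le> 1 + r\<^sup>2" by (simp add: power2_eq_square)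
    finally show ?thesis .
  qed
  then show "AE x in M. norm (f x) \<le> norm (1 + (norm (f x))\<^sup>2)" by simp
qed (rule L2le_measurable[OF assms])

lemma L2le_distr:
  assumes "X \<in> measurable M N"
  shows "L2le (distr M N X) f a \<longleftrightarrow> f \<in> borel_measurable N \<and> L2le M (\<lambda>x. f (X x)) a"
  using assms unfolding L2le_def by (auto simp: nn_integral_distr)

text \<open>Jensen's inequality for the conditional expectation given the first coordinate, from the
  nonnegativity of the variance of \<open>f\<close> at fixed \<open>y\<close>. For the exceptional
  \<open>y\<close> with infinite second moment the bound is infinite.\<close>

lemma L2le_partial_integral:
  fixes f :: "'b \<times> 'c \<Rightarrow> 'a::euclidean_space"
  assumes "prob_space P" "prob_space Q" "L2le (P \<Otimes>\<^sub>M Q) f a"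
  shows "L2le P (\<lambda>y. \<integral>q. f (y, q) \<partial>Q) a"
proof -
  interpret P: prob_space P by fact
  interpret Q: prob_space Q by fact
  interpret PQ: pair_prob_space P Q ..
  have [measurable]: "f \<in> borel_measurable (P \<Otimes>\<^sub>M Q)" using assms(3) by (rule L2le_measurable)
  have jensen: "ennreal ((norm (\<integral>q. f (y, q) \<partial>Q))\<^sup>2) \<le> (\<integral>\<^sup>+q. ennreal ((norm (f (y, q)))\<^sup>2) \<partial>Q)"
    if y: "y \<in> space P" for y
  proof (cases "(\<integral>\<^sup>+q. ennreal ((norm (f (y, q)))\<^sup>2) \<partial>Q) < \<infinity>")
    case True
    have [measurable]: "(\<lambda>q. f (y, q)) \<in> borel_measurable Q" using y by measurable
    define c where "c = (\<integral>q. f (y, q) \<partial>Q)"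
    have i2: "integrable Q (\<lambda>q. (norm (f (y, q)))\<^sup>2)" by (rule integrableI_nonneg) (use True in auto)
    define s where "s = sqrt (\<integral>q. (norm (f (y, q)))\<^sup>2 \<partial>Q)"
    have "L2le Q (\<lambda>q. f (y, q)) s" using i2 by (intro L2leI) (auto simp: s_def)
    then have i1: "integrable Q (\<lambda>q. f (y, q))" by (rule Q.L2le_imp_integrable)
    have "0 \<le> (\<integral>q. (norm (f (y, q) - c))\<^sup>2 \<partial>Q)" by simp
    also have "\<dots> = (\<integral>q. (norm (f (y, q)))\<^sup>2 - 2 * (f (y, q) \<bullet> c) + (norm c)\<^sup>2 \<partial>Q)"
      by (intro Bochner_Integration.integral_cong refl)
         (simp add: power2_norm_eq_inner inner_diff_left inner_diff_right inner_commute)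
    also have "\<dots> = (\<integral>q. (norm (f (y, q)))\<^sup>2 \<partial>Q) - 2 * (c \<bullet> c) + (norm c)\<^sup>2"
      using i1 i2 by (simp add: c_def Q.prob_space)
    finally have "(norm c)\<^sup>2 \<le> (\<integral>q. (norm (f (y, q)))\<^sup>2 \<partial>Q)" by (simp add: power2_norm_eq_inner)
    then show ?thesis unfolding c_def by (subst nn_integral_eq_integral[OF i2]) (auto intro: ennreal_leI)
  qed (simp add: not_less top.extremum_unique)
  have "(\<integral>\<^sup>+ y. ennreal ((norm (\<integral>q. f (y, q) \<partial>Q))\<^sup>2) \<partial>P)
      \<le> (\<integral>\<^sup>+ y. \<integral>\<^sup>+q. ennreal ((norm (f (y, q)))\<^sup>2) \<partial>Q \<partial>P)"
    by (intro nn_integral_mono jensen)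
  also have "\<dots> = (\<integral>\<^sup>+ z. ennreal ((norm (f z))\<^sup>2) \<partial>(P \<Otimes>\<^sub>M Q))"
    by (subst Q.nn_integral_fst[symmetric]) auto
  finally show ?thesis using assms(3) unfolding L2le_def
    by (auto intro: Q.borel_measurable_lebesgue_integral order_trans)
qed

lemma L2le_snd:
  assumes "prob_space P" "prob_space Q" "L2le Q f a"
  shows "L2le (P \<Otimes>\<^sub>M Q) (\<lambda>z. f (snd z)) a"
proof -
  interpret P: prob_space P by fact
  interpret Q: prob_space Q by fact
  have [measurable]: "f \<in> borel_measurable Q" using assms(3) by (rule L2le_measurable)
  have "(\<integral>\<^sup>+ z. ennreal ((norm (f (snd z)))\<^sup>2) \<partial>(P \<Otimes>\<^sub>M Q)) = (\<integral>\<^sup>+ y. ennreal ((norm (f y))\<^sup>2) \<partial>Q)"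
    by (subst Q.nn_integral_fst[symmetric]) (auto simp: P.emeasure_space_1)
  then show ?thesis using assms(3) by (simp add: L2le_def)
qed

section \<open>Resampling one coordinate of a product measure\<close>

text \<open>Splitting off the coordinate \<open>i\<close> makes \<open>w\<close> an independent pair
  of one value and the remaining coordinates. The value is overwritten and integrates out, and the
  fresh sample takes its place.\<close>

lemma distr_PiM_resample:
  fixes S :: "'i \<Rightarrow> 'b measure"
  assumes S: "\<And>i. prob_space (S i)"
  shows "distr (PiM UNIV S \<Otimes>\<^sub>M S i) (PiM UNIV S) (\<lambda>(w, t). w(i := t)) = PiM UNIV S"
proof -
  let ?O = "PiM UNIV S" and ?I = "PiM (UNIV - {i}) S"
  interpret Si: prob_space "S i" by (rule S)
  interpret I: prob_space ?I by (intro prob_space_PiM S)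
  interpret O: prob_space ?O by (intro prob_space_PiM S)
  interpret SI: pair_prob_space "S i" ?I ..
  have ins: "insert i (UNIV - {i}) = (UNIV :: 'i set)" by auto
  have O: "?O = distr (S i \<Otimes>\<^sub>M ?I) ?O (\<lambda>(x, X). X(i := x))"
    using distr_pair_PiM_eq_PiM[of "UNIV - {i}" S i, OF S S, unfolded ins] by simp
  have [measurable]: "(\<lambda>(x, X). X(i := x)) \<in> measurable (S i \<Otimes>\<^sub>M ?I) ?O"
    unfolding split_beta' by (rule measurable_fun_upd[where J="UNIV - {i}"]) (use ins in auto)
  have upd [measurable]: "(\<lambda>(w, t). w(i := t)) \<in> measurable (?O \<Otimes>\<^sub>M S i) ?O"
    unfolding split_beta' by (rule measurable_fun_upd[where J=UNIV]) auto
  show ?thesis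
  proof (rule measure_eqI)
    fix A assume "A \<in> sets (distr (?O \<Otimes>\<^sub>M S i) ?O (\<lambda>(w, t). w(i := t)))"
    then have A [measurable]: "A \<in> sets ?O" by simp
    have "emeasure (distr (?O \<Otimes>\<^sub>M S i) ?O (\<lambda>(w, t). w(i := t))) A
        = (\<integral>\<^sup>+ z. indicator A ((fst z)(i := snd z)) \<partial>(?O \<Otimes>\<^sub>M S i))"
      by (subst nn_integral_indicator[symmetric], simp, subst nn_integral_distr) (auto simp: split_beta')
    also have "\<dots> = (\<integral>\<^sup>+ w. \<integral>\<^sup>+ t. indicator A (w(i := t)) \<partial>S i \<partial>?O)"
      by (subst Si.nn_integral_fst[symmetric]) auto
    also have "\<dots> = (\<integral>\<^sup>+ z. \<integral>\<^sup>+ t. indicator A (((snd z)(i := fst z))(i := t)) \<partial>S i \<partial>(S i \<Otimes>\<^sub>M ?I))"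
      by (subst O, subst nn_integral_distr) (auto simp: split_beta')
    also have "\<dots> = (\<integral>\<^sup>+ x. \<integral>\<^sup>+ X. \<integral>\<^sup>+ t. indicator A (X(i := t)) \<partial>S i \<partial>?I \<partial>S i)"
      by (subst I.nn_integral_fst[symmetric]) auto
    also have "\<dots> = (\<integral>\<^sup>+ X. \<integral>\<^sup>+ t. indicator A (X(i := t)) \<partial>S i \<partial>?I)"
      by (simp add: Si.emeasure_space_1)
    also have "\<dots> = (\<integral>\<^sup>+ z. indicator A ((snd z)(i := fst z)) \<partial>(S i \<Otimes>\<^sub>M ?I))"
      by (subst SI.nn_integral_snd[symmetric]) auto
    also have "\<dots> = emeasure ?O A"
    proof -
      have "emeasure ?O A = emeasure (distr (S i \<Otimes>\<^sub>M ?I) ?O (\<lambda>(x, X). X(i := x))) A" using O by simp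
      also have "\<dots> = (\<integral>\<^sup>+ w. indicator A w \<partial>distr (S i \<Otimes>\<^sub>M ?I) ?O (\<lambda>(x, X). X(i := x)))" by simp
      also have "\<dots> = (\<integral>\<^sup>+ z. indicator A ((snd z)(i := fst z)) \<partial>(S i \<Otimes>\<^sub>M ?I))"
        by (subst nn_integral_distr) (auto simp: split_beta')
      finally show ?thesis by simp
    qed
    finally show "emeasure (distr (?O \<Otimes>\<^sub>M S i) ?O (\<lambda>(w, t). w(i := t))) A = emeasure ?O A" .
  qed simp
qed

text \<open>Overwriting by \<open>u w t\<close> a part of \<open>w\<close> with a fresh sample \<open>t\<close> leaves the law unchanged; this
  expresses that the part is independent of the rest and has law \<open>S\<close>.\<close>

definition resampling :: "'s measure \<Rightarrow> 't measure \<Rightarrow> ('s \<Rightarrow> 't \<Rightarrow> 's) \<Rightarrow> bool" where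
  "resampling \<Omega> S u \<longleftrightarrow> prob_space \<Omega> \<and> prob_space S \<and>
     (\<lambda>(w, t). u w t) \<in> measurable (\<Omega> \<Otimes>\<^sub>M S) \<Omega> \<and> distr (\<Omega> \<Otimes>\<^sub>M S) \<Omega> (\<lambda>(w, t). u w t) = \<Omega>"

lemma resampling_PiM:
  fixes S :: "'i \<Rightarrow> 'b measure"
  assumes S: "\<And>i. prob_space (S i)"
  shows "resampling (PiM UNIV S) (S i) (\<lambda>w t. w(i := t))"
  unfolding resampling_def
proof (intro conjI)
  show "(\<lambda>(w, t). w(i := t)) \<in> measurable (PiM UNIV S \<Otimes>\<^sub>M S i) (PiM UNIV S)"
    unfolding split_beta' by (rule measurable_fun_upd[where J=UNIV]) auto
qed (use S in \<open>auto intro: prob_space_PiM distr_PiM_resample\<close>)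

lemma resampling_nn_integral:
  assumes r: "resampling \<Omega> S u" and [measurable]: "f \<in> borel_measurable \<Omega>"
  shows "(\<integral>\<^sup>+ w. f w \<partial>\<Omega>) = (\<integral>\<^sup>+ w. \<integral>\<^sup>+ t. f (u w t) \<partial>S \<partial>\<Omega>)"
proof -
  interpret S: prob_space S using r by (simp add: resampling_def)
  have [measurable]: "(\<lambda>(w, t). u w t) \<in> measurable (\<Omega> \<Otimes>\<^sub>M S) \<Omega>" using r by (simp add: resampling_def)
  have "(\<integral>\<^sup>+ w. f w \<partial>\<Omega>) = (\<integral>\<^sup>+ w. f w \<partial>distr (\<Omega> \<Otimes>\<^sub>M S) \<Omega> (\<lambda>(w, t). u w t))"
    using r by (simp add: resampling_def)
  also have "\<dots> = (\<integral>\<^sup>+ z. f (u (fst z) (snd z)) \<partial>(\<Omega> \<Otimes>\<^sub>M S))"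
    by (subst nn_integral_distr) (auto simp: split_beta')
  also have "\<dots> = (\<integral>\<^sup>+ w. \<integral>\<^sup>+ t. f (u w t) \<partial>S \<partial>\<Omega>)"
    by (subst S.nn_integral_fst[symmetric]) auto
  finally show ?thesis .
qed

lemma resampling_integral:
  fixes f :: "'s \<Rightarrow> 'a::euclidean_space"
  assumes r: "resampling \<Omega> S u" and f: "integrable \<Omega> f"
  shows "(\<integral> w. f w \<partial>\<Omega>) = (\<integral> w. \<integral> t. f (u w t) \<partial>S \<partial>\<Omega>)"
proof -
  interpret S: prob_space S using r by (simp add: resampling_def)
  interpret \<Omega>: prob_space \<Omega> using r by (simp add: resampling_def)
  interpret OS: pair_prob_space \<Omega> S ..
  have [measurable]: "(\<lambda>(w, t). u w t) \<in> measurable (\<Omega> \<Otimes>\<^sub>M S) \<Omega>" using r by (simp add: resampling_def)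
  have [measurable]: "f \<in> borel_measurable \<Omega>" using f by auto
  have eq: "\<Omega> = distr (\<Omega> \<Otimes>\<^sub>M S) \<Omega> (\<lambda>(w, t). u w t)"
    using r by (simp add: resampling_def)
  have i: "integrable (\<Omega> \<Otimes>\<^sub>M S) (\<lambda>(w, t). f (u w t))"
    using f by (subst (asm) eq, subst (asm) integrable_distr_eq) (auto simp: split_beta')
  have "(\<integral>w. f w \<partial>\<Omega>) = (\<integral>z. f (u (fst z) (snd z)) \<partial>(\<Omega> \<Otimes>\<^sub>M S))"
    by (subst eq, subst integral_distr) (auto simp: split_beta')
  also have "\<dots> = (\<integral>w. \<integral>t. f (u w t) \<partial>S \<partial>\<Omega>)"
    using OS.integral_fst'[of "\<lambda>(w, t). f (u w t)"] i by (simp add: split_beta')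
  finally show ?thesis .
qed

lemma resampling_pair:
  assumes r: "resampling \<Omega> S u" and P: "prob_space P"
  shows "resampling (P \<Otimes>\<^sub>M \<Omega>) S (\<lambda>z t. (fst z, u (snd z) t))"
proof -
  interpret S: prob_space S using r by (simp add: resampling_def)
  interpret \<Omega>: prob_space \<Omega> using r by (simp add: resampling_def)
  interpret P: prob_space P by fact
  interpret PO: pair_prob_space P \<Omega> ..
  have u [measurable]: "(\<lambda>(w, t). u w t) \<in> measurable (\<Omega> \<Otimes>\<^sub>M S) \<Omega>" using r by (simp add: resampling_def)
  have m [measurable]: "(\<lambda>(z, t). (fst z, u (snd z) t)) \<in> measurable ((P \<Otimes>\<^sub>M \<Omega>) \<Otimes>\<^sub>M S) (P \<Otimes>\<^sub>M \<Omega>)"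
    by measurable
  have "distr ((P \<Otimes>\<^sub>M \<Omega>) \<Otimes>\<^sub>M S) (P \<Otimes>\<^sub>M \<Omega>) (\<lambda>(z, t). (fst z, u (snd z) t)) = P \<Otimes>\<^sub>M \<Omega>" (is "?D = _")
  proof (rule measure_eqI)
    fix A assume "A \<in> sets ?D"
    then have A [measurable]: "A \<in> sets (P \<Otimes>\<^sub>M \<Omega>)" by simp
    have "emeasure ?D A = (\<integral>\<^sup>+ z. indicator A (fst (fst z), u (snd (fst z)) (snd z)) \<partial>((P \<Otimes>\<^sub>M \<Omega>) \<Otimes>\<^sub>M S))"
      by (subst nn_integral_indicator[symmetric], simp, subst nn_integral_distr) (auto simp: split_beta')
    also have "\<dots> = (\<integral>\<^sup>+ y. \<integral>\<^sup>+ w. \<integral>\<^sup>+ t. indicator A (y, u w t) \<partial>S \<partial>\<Omega> \<partial>P)"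
      by (subst S.nn_integral_fst[symmetric], simp, subst \<Omega>.nn_integral_fst[symmetric]) auto
    also have "\<dots> = (\<integral>\<^sup>+ y. \<integral>\<^sup>+ w. indicator A (y, w) \<partial>\<Omega> \<partial>P)"
      by (intro nn_integral_cong resampling_nn_integral[OF r, symmetric]) auto
    also have "\<dots> = emeasure (P \<Otimes>\<^sub>M \<Omega>) A"
      by (subst \<Omega>.nn_integral_fst) auto
    finally show "emeasure ?D A = emeasure (P \<Otimes>\<^sub>M \<Omega>) A" .
  qed simp
  then show ?thesis
    unfolding resampling_def using m S.prob_space_axioms PO.prob_space_axioms by auto
qed

text \<open>Independence read off from resampling: \<open>A\<close> ignores the overwritten part and
  \<open>B\<close> returns it, so under the resampled law the two depend on separate factors of a
  product.\<close>

lemma resampling_joint_law: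
  assumes r: "resampling \<Omega> S u" and A: "A \<in> measurable \<Omega> N" and B: "B \<in> measurable \<Omega> S"
    and A_u: "\<And>w t. w \<in> space \<Omega> \<Longrightarrow> t \<in> space S \<Longrightarrow> A (u w t) = A w"
    and B_u: "\<And>w t. w \<in> space \<Omega> \<Longrightarrow> t \<in> space S \<Longrightarrow> B (u w t) = t"
  shows "distr \<Omega> (N \<Otimes>\<^sub>M S) (\<lambda>w. (A w, B w)) = distr \<Omega> N A \<Otimes>\<^sub>M S"
proof -
  interpret S: prob_space S using r by (simp add: resampling_def)
  interpret \<Omega>: prob_space \<Omega> using r by (simp add: resampling_def)
  note A [measurable] B [measurable]
  have u [measurable]: "(\<lambda>(w, t). u w t) \<in> measurable (\<Omega> \<Otimes>\<^sub>M S) \<Omega>" using r by (simp add: resampling_def)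
  have eq: "\<Omega> = distr (\<Omega> \<Otimes>\<^sub>M S) \<Omega> (\<lambda>(w, t). u w t)"
    using r by (simp add: resampling_def)
  have "distr \<Omega> (N \<Otimes>\<^sub>M S) (\<lambda>w. (A w, B w))
      = distr (\<Omega> \<Otimes>\<^sub>M S) (N \<Otimes>\<^sub>M S) (\<lambda>(w, t). (A w, id t))"
    by (subst eq, subst distr_distr, simp, simp)
       (auto simp: space_pair_measure A_u B_u intro!: distr_cong)
  also have "\<dots> = distr \<Omega> N A \<Otimes>\<^sub>M distr S S id"
    by (subst pair_measure_distr)
       (auto simp: id_def distr_id intro: S.sigma_finite_measure_axioms)
  finally show ?thesis by (simp add: id_def distr_id)
qed

text \<open>Orthogonality of martingale increments. Invariance of \<open>f\<close> under resampling
  says that it is determined by the rest, and the inner integral over \<open>t\<close> is the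
  conditional expectation of \<open>g\<close> given the rest.\<close>

lemma resampling_orthogonal:
  assumes r: "resampling \<Omega> S u"
    and f: "L2le \<Omega> f a" and g: "L2le \<Omega> g b"
    and ind: "\<And>w t. w \<in> space \<Omega> \<Longrightarrow> t \<in> space S \<Longrightarrow> f (u w t) = f w"
    and int: "\<And>w. w \<in> space \<Omega> \<Longrightarrow> integrable S (\<lambda>t. g (u w t))"
    and zero: "\<And>w. w \<in> space \<Omega> \<Longrightarrow> (\<integral>t. g (u w t) \<partial>S) = 0"
  shows "(\<integral>w. f w \<bullet> g w \<partial>\<Omega>) = 0"
proof -
  have "(\<integral>w. f w \<bullet> g w \<partial>\<Omega>) = (\<integral>w. \<integral>t. f (u w t) \<bullet> g (u w t) \<partial>S \<partial>\<Omega>)"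
    by (rule resampling_integral[OF r L2le_inner_integrable[OF f g]])
  also have "\<dots> = (\<integral>w. 0 \<partial>\<Omega>)"
  proof (intro Bochner_Integration.integral_cong refl)
    fix w assume w: "w \<in> space \<Omega>"
    have "(\<integral>t. f (u w t) \<bullet> g (u w t) \<partial>S) = (\<integral>t. f w \<bullet> g (u w t) \<partial>S)"
      by (intro Bochner_Integration.integral_cong refl) (simp add: ind w)
    then show "(\<integral>t. f (u w t) \<bullet> g (u w t) \<partial>S) = 0" by (simp add: int zero w)
  qed
  finally show ?thesis by simp
qed

lemma L2le_orthogonal_sum:
  assumes "\<And>i. i < k \<Longrightarrow> L2le M (X i) a"
    and "\<And>i. i < k \<Longrightarrow> (\<integral>w. (\<Sum>j<i. X j w) \<bullet> X i w \<partial>M) = 0"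
  shows "L2le M (\<lambda>w. \<Sum>i<k. X i w) (sqrt (real k) * a)"
  using assms
proof (induction k)
  case (Suc k)
  have a: "a \<ge> 0" using Suc.prems(1)[of 0] by (auto simp: L2le_def)
  have "L2le M (\<lambda>w. (\<Sum>i<k. X i w) + X k w) (sqrt ((sqrt (real k) * a)\<^sup>2 + a\<^sup>2))"
    by (intro L2le_orthogonal Suc) auto
  also have "(sqrt (real k) * a)\<^sup>2 + a\<^sup>2 = (sqrt (real (Suc k)) * a)\<^sup>2"
    by (simp add: power_mult_distrib algebra_simps)
  finally show ?case using a by simp
qed (simp add: L2le_zero)

section \<open>Exponentially bounded functions and Gaussian tails\<close>

text \<open>A growth class closed under sums and products whose members are integrable against every
  density with a Gaussian tail; it settles integrability under the Gaussian and under
  \<open>gibbs F\<close> alike.\<close>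

definition expb :: "('a::euclidean_space \<Rightarrow> 'b::real_normed_vector) \<Rightarrow> bool" where
  "expb f \<longleftrightarrow> (\<exists>C\<ge>0. \<exists>a\<ge>0. \<forall>x. norm (f x) \<le> C * exp (a * norm x))"

lemma expbI: "C \<ge> 0 \<Longrightarrow> a \<ge> 0 \<Longrightarrow> (\<And>x. norm (f x) \<le> C * exp (a * norm x)) \<Longrightarrow> expb f"
  by (auto simp: expb_def)

lemma expb_dominated:
  assumes "expb g" "\<And>x. norm (f x) \<le> norm (g x)"
  shows "expb f"
  using assms unfolding expb_def by (meson order_trans)

lemma expb_const [intro, simp]: "expb (\<lambda>x. c)"
  by (rule expbI[of "norm c" 0]) auto

lemma expb_norm_id [intro, simp]: "expb (\<lambda>x. norm x)"
proof (rule expbI[of 1 1])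
  fix x :: 'a
  show "norm (norm x) \<le> 1 * exp (1 * norm x)"
    using exp_ge_add_one_self[of "norm x"] by (simp, linarith)
qed auto

lemma expb_norm [intro]: "expb f \<Longrightarrow> expb (\<lambda>x. norm (f x))"
  by (erule expb_dominated) simp

lemma expb_add [intro]:
  assumes "expb f" "expb g"
  shows "expb (\<lambda>x. f x + g x)"
proof -
  obtain C a D b where f: "C \<ge> 0" "a \<ge> 0" "\<And>x. norm (f x) \<le> C * exp (a * norm x)"
    and g: "D \<ge> 0" "b \<ge> 0" "\<And>x. norm (g x) \<le> D * exp (b * norm x)"
    using assms unfolding expb_def by metis
  show ?thesis
  proof (rule expbI[of "C + D" "a + b"])
    fix x
    have "norm (f x + g x) \<le> C * exp (a * norm x) + D * exp (b * norm x)"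
      using f(3)[of x] g(3)[of x] norm_triangle_ineq[of "f x" "g x"] by linarith
    also have "\<dots> \<le> C * exp ((a + b) * norm x) + D * exp ((a + b) * norm x)"
      using f g by (intro add_mono mult_left_mono) (auto intro: mult_right_mono)
    finally show "norm (f x + g x) \<le> (C + D) * exp ((a + b) * norm x)" by (simp add: algebra_simps)
  qed (use f g in auto)
qed

lemma expb_mult [intro]:
  fixes f g :: "'a::euclidean_space \<Rightarrow> real"
  assumes "expb f" "expb g"
  shows "expb (\<lambda>x. f x * g x)"
proof -
  obtain C a D b where f: "C \<ge> 0" "a \<ge> 0" "\<And>x. norm (f x) \<le> C * exp (a * norm x)"
    and g: "D \<ge> 0" "b \<ge> 0" "\<And>x. norm (g x) \<le> D * exp (b * norm x)"
    using assms unfolding expb_def by metis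
  show ?thesis
  proof (rule expbI[of "C * D" "a + b"])
    fix x
    have "norm (f x * g x) \<le> (C * exp (a * norm x)) * (D * exp (b * norm x))"
      unfolding norm_mult using f g by (intro mult_mono) auto
    then show "norm (f x * g x) \<le> (C * D) * exp ((a + b) * norm x)"
      by (simp add: algebra_simps exp_add)
  qed (use f g in auto)
qed

lemma expb_power [intro]:
  fixes f :: "'a::euclidean_space \<Rightarrow> real"
  shows "expb f \<Longrightarrow> expb (\<lambda>x. f x ^ k)"
  by (induction k) auto

lemma expb_linear_growth:
  assumes "\<And>x. norm (f x) \<le> A + B * norm x"
  shows "expb f"
proof (rule expb_dominated)
  show "expb (\<lambda>x::'a. A + B * norm x)" by (intro expb_add expb_mult expb_const expb_norm_id)
  show "norm (f x) \<le> norm (A + B * norm x)" for x using assms[of x] by simp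
qed

lemma nn_integral_exp_square_finite:
  assumes "c > 0"
  shows "(\<integral>\<^sup>+ x. ennreal (exp (- c * (norm (x::'a::euclidean_space))\<^sup>2)) \<partial>lborel) < \<infinity>"
proof -
  \<comment> \<open>The standard deviation for which the normal density is a multiple of
    \<open>exp (- c * t\<^sup>2)\<close>.\<close>
  define s where "s = 1 / sqrt (2 * c)"
  have s: "s > 0" "s\<^sup>2 = 1 / (2 * c)" using assms by (auto simp: s_def power_divide)
  have one: "(\<integral>\<^sup>+ t. ennreal (exp (- c * t\<^sup>2)) \<partial>lborel) < \<infinity>"
  proof -
    have "exp (- c * t\<^sup>2) = sqrt (2 * pi * s\<^sup>2) * normal_density 0 s t" for t
      using s assms by (simp add: normal_density_def field_simps)
    then have "integrable lborel (\<lambda>t. exp (- c * t\<^sup>2))"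
      using s(1) by (simp add: integrable_normal_density)
    then show ?thesis by (simp add: nn_integral_eq_integral)
  qed
  have "ennreal (exp (- c * (norm x)\<^sup>2)) = (\<Prod>b\<in>Basis. ennreal (exp (- c * (x \<bullet> b)\<^sup>2)))" for x :: 'a
    by (subst norm_eq_sqrt_inner, subst euclidean_inner)
       (simp add: prod_ennreal exp_sum[symmetric] sum_nonneg power2_eq_square sum_distrib_left sum_negf)
  then have "(\<integral>\<^sup>+ x. ennreal (exp (- c * (norm (x::'a))\<^sup>2)) \<partial>lborel)
      = (\<Prod>b\<in>(Basis::'a set). (\<integral>\<^sup>+ t. ennreal (exp (- c * t\<^sup>2)) \<partial>lborel))"
    by (simp only:) (subst nn_integral_lborel_prod, auto)
  also have "\<dots> < \<infinity>" using one by (simp add: power_less_top_ennreal)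
  finally show ?thesis .
qed

text \<open>Half of the quadratic term absorbs the linear one:
  \<open>a * r \<le> c / 2 * r\<^sup>2 + a\<^sup>2 / (2 * c)\<close>.\<close>

lemma nn_integral_exp_tail_finite:
  assumes "c > 0"
  shows "(\<integral>\<^sup>+ x. ennreal (C * exp (a * norm (x::'a::euclidean_space) - c * (norm x)\<^sup>2)) \<partial>lborel) < \<infinity>"
proof -
  have le: "C * exp (a * r - c * r\<^sup>2) \<le> (\<bar>C\<bar> * exp (a\<^sup>2 / (2 * c))) * exp (- (c / 2) * r\<^sup>2)" for r :: real
  proof -
    have "0 \<le> (c * r - a)\<^sup>2 / (2 * c)" using assms by simp
    also have "\<dots> = c / 2 * r\<^sup>2 - a * r + a\<^sup>2 / (2 * c)"
      using assms by (simp add: power2_diff field_simps power2_eq_square)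
    finally have "a * r - c * r\<^sup>2 \<le> a\<^sup>2 / (2 * c) + - (c / 2) * r\<^sup>2" by (simp add: algebra_simps)
    then have "exp (a * r - c * r\<^sup>2) \<le> exp (a\<^sup>2 / (2 * c)) * exp (- (c / 2) * r\<^sup>2)"
      by (simp add: exp_add[symmetric])
    then have "\<bar>C\<bar> * exp (a * r - c * r\<^sup>2) \<le> \<bar>C\<bar> * (exp (a\<^sup>2 / (2 * c)) * exp (- (c / 2) * r\<^sup>2))"
      by (intro mult_left_mono) auto
    moreover have "C * exp (a * r - c * r\<^sup>2) \<le> \<bar>C\<bar> * exp (a * r - c * r\<^sup>2)" by (intro mult_right_mono) auto
    ultimately have "C * exp (a * r - c * r\<^sup>2) \<le> \<bar>C\<bar> * (exp (a\<^sup>2 / (2 * c)) * exp (- (c / 2) * r\<^sup>2))"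
      by (rule order_trans[rotated])
    then show ?thesis by (simp only: mult.assoc)
  qed
  have "(\<integral>\<^sup>+ x. ennreal (C * exp (a * norm (x::'a) - c * (norm x)\<^sup>2)) \<partial>lborel)
    \<le> (\<integral>\<^sup>+ x. ennreal (\<bar>C\<bar> * exp (a\<^sup>2 / (2 * c))) * ennreal (exp (- (c / 2) * (norm (x::'a))\<^sup>2)) \<partial>lborel)"
    by (intro nn_integral_mono) (subst ennreal_mult[symmetric], simp, simp, rule ennreal_leI, rule le)
  also have "\<dots> < \<infinity>"
    using nn_integral_exp_square_finite[of "c / 2", where 'a='a] assms
    by (subst nn_integral_cmult) (auto simp: ennreal_mult_less_top)
  finally show ?thesis .
qed

lemma integrable_gaussian_tail:
  fixes f :: "'a::euclidean_space \<Rightarrow> real"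
  assumes "f \<in> borel_measurable borel" "c > 0"
    and "\<And>x. \<bar>f x\<bar> \<le> C * exp (a * norm x - c * (norm x)\<^sup>2)"
  shows "integrable lborel f"
proof (rule integrableI_bounded)
  have "(\<integral>\<^sup>+ x. ennreal (norm (f x)) \<partial>lborel)
      \<le> (\<integral>\<^sup>+ x. ennreal (C * exp (a * norm (x::'a) - c * (norm x)\<^sup>2)) \<partial>lborel)"
    by (intro nn_integral_mono ennreal_leI) (simp add: assms(3))
  also have "\<dots> < \<infinity>" by (rule nn_integral_exp_tail_finite[OF assms(2)])
  finally show "(\<integral>\<^sup>+ x. ennreal (norm (f x)) \<partial>lborel) < \<infinity>" .
qed (use assms(1) in simp)

section \<open>The standard Gaussian measure\<close>

text \<open>The product of the one-dimensional densities in closed form. It depends on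
  \<open>norm x\<close> alone, which gives the invariance under reflection and rotation.\<close>

definition gden :: "'a::euclidean_space \<Rightarrow> real" where
  "gden x = (1 / sqrt (2 * pi)) ^ DIM('a) * exp (- ((norm x)\<^sup>2 / 2))"

lemma gden_prod: "(\<Prod>b\<in>Basis. std_normal_density (x \<bullet> b)) = gden (x::'a::euclidean_space)"
proof -
  have "(\<Prod>b\<in>Basis. std_normal_density (x \<bullet> b))
      = (\<Prod>b\<in>(Basis::'a set). 1 / sqrt (2 * pi)) * exp (\<Sum>b\<in>Basis. - ((x \<bullet> b)\<^sup>2 / 2))"
    unfolding std_normal_density_def by (subst exp_sum) (simp_all only: prod.distrib[symmetric] finite_Basis, simp)
  also have "(\<Sum>b\<in>Basis. - ((x \<bullet> b)\<^sup>2 / 2)) = - ((norm x)\<^sup>2 / 2)"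
    by (subst norm_eq_sqrt_inner, subst euclidean_inner)
       (simp add: sum_nonneg power2_eq_square sum_negf sum_divide_distrib)
  finally show ?thesis by (simp add: gden_def)
qed

lemma std_gaussian_eq: "std_gaussian = density lborel (\<lambda>x. ennreal (gden x))"
  by (simp add: std_gaussian_def gden_prod)

lemma gden_pos: "gden x > 0" and gden_uminus [simp]: "gden (- x) = gden x"
  by (auto simp: gden_def)

lemma gden_measurable [measurable]: "gden \<in> borel_measurable borel"
  unfolding gden_def by measurable

lemma sets_std_gaussian [simp, measurable_cong]: "sets std_gaussian = sets borel"
  and space_std_gaussian [simp]: "space std_gaussian = UNIV"
  by (auto simp: std_gaussian_def)

lemma prob_space_std_gaussian: "prob_space (std_gaussian :: 'a::euclidean_space measure)"
proof
  have "emeasure (std_gaussian :: 'a measure) UNIV = (\<integral>\<^sup>+x. (\<Prod>b\<in>(Basis::'a set). ennreal (std_normal_density (x \<bullet> b))) \<partial>lborel)"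
    by (simp add: std_gaussian_def emeasure_density prod_ennreal)
  also have "\<dots> = (\<Prod>b\<in>(Basis::'a set). (\<integral>\<^sup>+x. ennreal (std_normal_density x) \<partial>lborel))"
    by (subst nn_integral_lborel_prod) auto
  also have "\<dots> = 1" by (simp add: nn_integral_eq_integral)
  finally show "emeasure (std_gaussian :: 'a measure) (space std_gaussian) = 1" by simp
qed

interpretation G: prob_space "std_gaussian :: 'a::euclidean_space measure"
  by (rule prob_space_std_gaussian)

text \<open>Stated for any density \<open>D\<close> with a Gaussian tail, since it is applied both
  to \<open>gden\<close> and to the normalized \<open>exp (- F x)\<close>.\<close>

lemma expb_integrable_real:
  fixes f D :: "'a::euclidean_space \<Rightarrow> real"
  assumes [measurable]: "f \<in> borel_measurable borel" "D \<in> borel_measurable borel"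
    and "expb f" "c > 0" and D: "\<And>x. 0 \<le> D x" "\<And>x. D x \<le> C * exp (a * norm x - c * (norm x)\<^sup>2)"
  shows "integrable (density lborel (\<lambda>x. ennreal (D x))) f"
proof -
  obtain C' a' where f: "C' \<ge> 0" "a' \<ge> 0" "\<And>x. norm (f x) \<le> C' * exp (a' * norm x)"
    using assms unfolding expb_def by metis
  have "\<bar>D x * f x\<bar> \<le> (C * C') * exp ((a + a') * norm x - c * (norm x)\<^sup>2)" for x
  proof -
    have "\<bar>D x * f x\<bar> \<le> (C * exp (a * norm x - c * (norm x)\<^sup>2)) * (C' * exp (a' * norm x))"
      unfolding abs_mult using f(3)[of x] D[of x] order_trans[OF D(1) D(2)] by (intro mult_mono) auto
    also have "\<dots> = (C * C') * (exp (a * norm x - c * (norm x)\<^sup>2) * exp (a' * norm x))" by simp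
    also have "exp (a * norm x - c * (norm x)\<^sup>2) * exp (a' * norm x) = exp ((a + a') * norm x - c * (norm x)\<^sup>2)"
      by (simp add: exp_add[symmetric] algebra_simps)
    finally show ?thesis .
  qed
  then have "integrable lborel (\<lambda>x. D x * f x)"
    by (intro integrable_gaussian_tail[OF _ \<open>c > 0\<close>, where C="C*C'" and a="a+a'"]) auto
  then show ?thesis using D by (subst integrable_density) auto
qed

lemma expb_integrable_gaussian_real:
  fixes f :: "'a::euclidean_space \<Rightarrow> real"
  assumes "f \<in> borel_measurable borel" "expb f"
  shows "integrable std_gaussian f"
  unfolding std_gaussian_eq
  by (rule expb_integrable_real[where c="1/2" and a=0 and C="(1 / sqrt (2 * pi)) ^ DIM('a)"])
     (use assms gden_pos less_imp_le in \<open>auto simp: gden_def\<close>)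

lemma expb_integrable_gaussian:
  fixes f :: "'a::euclidean_space \<Rightarrow> 'b::euclidean_space"
  assumes "f \<in> borel_measurable borel" "expb f"
  shows "integrable std_gaussian f"
proof -
  have "integrable std_gaussian (\<lambda>x. norm (f x))"
    using assms by (intro expb_integrable_gaussian_real) auto
  then show ?thesis using assms(1) by (subst (asm) integrable_norm_iff) auto
qed

section \<open>Symmetry and moments of the Gaussian\<close>

lemma lborel_distr_uminus_euclidean: "distr lborel borel uminus = (lborel :: 'a::euclidean_space measure)"
  using lborel_affine[of "-1" "0::'a"] by (simp add: density_1)

lemma std_gaussian_uminus: "distr std_gaussian borel uminus = (std_gaussian :: 'a::euclidean_space measure)"
proof -
  have "distr std_gaussian borel uminus = (density (distr lborel borel uminus) (\<lambda>x. ennreal (gden x)) :: 'a measure)"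
    unfolding std_gaussian_eq by (subst density_distr) auto
  then show ?thesis by (simp add: lborel_distr_uminus_euclidean std_gaussian_eq)
qed

lemma nn_integral_gaussian_uminus:
  fixes f :: "'a::euclidean_space \<Rightarrow> ennreal"
  assumes [measurable]: "f \<in> borel_measurable borel"
  shows "(\<integral>\<^sup>+ z. f (- z) \<partial>std_gaussian) = (\<integral>\<^sup>+ z. f z \<partial>std_gaussian)"
  by (subst (2) std_gaussian_uminus[symmetric], subst nn_integral_distr) auto

lemma integral_gaussian_uminus:
  fixes f :: "'a::euclidean_space \<Rightarrow> 'b::euclidean_space"
  assumes [measurable]: "f \<in> borel_measurable borel"
  shows "(\<integral> z. f (- z) \<partial>std_gaussian) = (\<integral> z. f z \<partial>std_gaussian)"
  by (subst (2) std_gaussian_uminus[symmetric], subst integral_distr) auto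

lemma minus_eq_self_imp_zero: "- (v::'a::real_vector) = v \<Longrightarrow> v = 0"
  by (metis ab_left_minus scaleR_2 scaleR_eq_0_iff zero_neq_numeral)

lemma gaussian_mean: "(\<integral>x. x \<partial>std_gaussian) = (0 :: 'a::euclidean_space)"
proof (rule minus_eq_self_imp_zero)
  have "(\<integral>x. - x \<partial>std_gaussian) = (\<integral>x. x \<partial>(std_gaussian :: 'a measure))"
    by (rule integral_gaussian_uminus) simp
  then show "- (\<integral>x. x \<partial>std_gaussian) = (\<integral>x. x \<partial>(std_gaussian :: 'a measure))" by simp
qed

lemma integral_gaussian_prod:
  fixes p :: "'a::euclidean_space \<Rightarrow> real \<Rightarrow> real"
  assumes [measurable]: "\<And>b. p b \<in> borel_measurable borel"
    and int: "\<And>b. b \<in> Basis \<Longrightarrow> integrable lborel (\<lambda>t. std_normal_density t * p b t)"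
  shows "(\<integral>x. (\<Prod>b\<in>Basis. p b (x \<bullet> b)) \<partial>(std_gaussian :: 'a measure))
    = (\<Prod>b\<in>Basis. \<integral>t. std_normal_density t * p b t \<partial>lborel)"
proof -
  interpret P: product_sigma_finite "\<lambda>b::'a. lborel :: real measure" ..
  have "(\<integral>x. (\<Prod>b\<in>Basis. p b (x \<bullet> b)) \<partial>(std_gaussian :: 'a measure))
      = (\<integral>x. (\<Prod>b\<in>Basis. std_normal_density (x \<bullet> b) * p b (x \<bullet> b)) \<partial>(lborel :: 'a measure))"
    unfolding std_gaussian_def by (subst integral_density) (auto simp: prod.distrib prod_nonneg)
  also have "\<dots> = (\<integral>f. (\<Prod>b\<in>Basis. std_normal_density (f b) * p b (f b)) \<partial>(\<Pi>\<^sub>M b\<in>(Basis::'a set). lborel))"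
    by (subst lborel_eq, subst integral_distr) (auto intro!: Bochner_Integration.integral_cong prod.cong)
  also have "\<dots> = (\<Prod>b\<in>Basis. \<integral>t. std_normal_density t * p b t \<partial>lborel)"
    by (rule P.product_integral_prod) (use int in auto)
  finally show ?thesis .
qed

lemma gaussian_covariance_basis:
  fixes b c :: "'a::euclidean_space"
  assumes "b \<in> Basis" "c \<in> Basis"
  shows "(\<integral>x. (x \<bullet> b) * (x \<bullet> c) \<partial>std_gaussian) = (if b = c then 1 else 0)"
proof -
  \<comment> \<open>The monomial is written as a product over all coordinates, with the constant
    factor \<open>1\<close> away from \<open>b\<close> and \<open>c\<close>, so that it factors into
    one-dimensional integrals.\<close>
  define p where "p = (\<lambda>a (t::real). (if a = b then t else 1) * (if a = c then t else 1))"
  have m: "(\<lambda>t. std_normal_density t * t) = (\<lambda>t. std_normal_density t * t ^ (2 * 0 + 1))"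
    "(\<lambda>t. std_normal_density t * (t * t)) = (\<lambda>t. std_normal_density t * t ^ (2 * 1))"
    by (auto simp: power2_eq_square)
  have i: "integrable lborel (\<lambda>t. std_normal_density t * t)" "(\<integral>t. std_normal_density t * t \<partial>lborel) = 0"
    "integrable lborel (\<lambda>t. std_normal_density t * (t * t))" "(\<integral>t. std_normal_density t * (t * t) \<partial>lborel) = 1"
    unfolding m using std_normal_moment_odd[of 0] std_normal_moment_even[of 1]
    by (auto simp: has_bochner_integral_iff fact_numeral)
  have "(\<integral>x. (x \<bullet> b) * (x \<bullet> c) \<partial>std_gaussian) = (\<integral>x. (\<Prod>a\<in>Basis. p a (x \<bullet> a)) \<partial>(std_gaussian :: 'a measure))"
    using assms by (simp add: p_def prod.distrib prod.delta)
  also have "\<dots> = (\<Prod>a\<in>Basis. \<integral>t. std_normal_density t * p a t \<partial>lborel)"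
  proof (rule integral_gaussian_prod)
    show "p a \<in> borel_measurable borel" for a unfolding p_def by measurable
    show "integrable lborel (\<lambda>t. std_normal_density t * p a t)" for a
      using i by (cases "a = b"; cases "a = c") (auto simp: p_def)
  qed
  also have "\<dots> = (if b = c then 1 else 0)"
  proof (cases "b = c")
    case True
    then have "(\<integral>t. std_normal_density t * p a t \<partial>lborel) = 1" for a
      using i by (cases "a = c") (auto simp: p_def)
    then show ?thesis using True by simp
  next
    case False
    have "(\<integral>t. std_normal_density t * p b t \<partial>lborel) = 0" using False i by (simp add: p_def)
    then show ?thesis using False assms by (auto intro!: prod_zero)
  qed
  finally show ?thesis .
qed

text \<open>Identity covariance in the form needed later: averaging a linear form against the
  proposal returns the vector of the form. This is how rejections produce the gradient
  drift.\<close>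

lemma gaussian_covariance: "(\<integral>z. (z \<bullet> v) *\<^sub>R z \<partial>std_gaussian) = (v::'a::euclidean_space)"
proof (rule euclidean_eqI)
  fix b :: 'a assume b: "b \<in> Basis"
  have i1: "integrable std_gaussian (\<lambda>z. (z \<bullet> v) *\<^sub>R z)"
  proof (rule expb_integrable_gaussian)
    show "expb (\<lambda>z. (z \<bullet> v) *\<^sub>R z)"
    proof (rule expb_dominated)
      show "expb (\<lambda>z::'a. norm z * norm v * norm z)" by (intro expb_mult) auto
      show "norm ((z \<bullet> v) *\<^sub>R z) \<le> norm (norm z * norm v * norm z)" for z
        by (simp add: mult_right_mono Cauchy_Schwarz_ineq2)
    qed
  qed measurable
  have i2: "integrable std_gaussian (\<lambda>z::'a. (z \<bullet> c) * (z \<bullet> b))" for c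
  proof (rule expb_integrable_gaussian)
    show "expb (\<lambda>z::'a. (z \<bullet> c) * (z \<bullet> b))"
      by (intro expb_mult expb_linear_growth[of _ 0 "norm c"] expb_linear_growth[of _ 0 "norm b"])
         (auto simp: Cauchy_Schwarz_ineq2 mult.commute[of "norm c"] mult.commute[of "norm b"] simp del: norm_Basis)
  qed measurable
  have "(\<integral>z. (z \<bullet> v) *\<^sub>R z \<partial>std_gaussian) \<bullet> b = (\<integral>z. (z \<bullet> v) * (z \<bullet> b) \<partial>std_gaussian)"
    using i1 by (simp add: integral_inner_left[symmetric])
  also have "\<dots> = (\<integral>z. (\<Sum>c\<in>Basis. (v \<bullet> c) * ((z \<bullet> c) * (z \<bullet> b))) \<partial>std_gaussian)"
    by (subst euclidean_inner) (simp add: sum_distrib_left sum_distrib_right mult_ac)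
  also have "\<dots> = (\<Sum>c\<in>Basis. (v \<bullet> c) * (if c = b then 1 else 0))"
    using i2 b by (subst Bochner_Integration.integral_sum) (auto simp: gaussian_covariance_basis intro!: sum.cong)
  also have "\<dots> = v \<bullet> b" using b by (simp add: if_distrib sum.delta cong: if_cong)
  finally show "(\<integral>z. (z \<bullet> v) *\<^sub>R z \<partial>std_gaussian) \<bullet> b = v \<bullet> b" .
qed

lemma gaussian_second_moment: "(\<integral>z. (norm z)\<^sup>2 \<partial>(std_gaussian :: 'a::euclidean_space measure)) = DIM('a)"
proof -
  have i2: "integrable std_gaussian (\<lambda>z::'a. (z \<bullet> b) * (z \<bullet> b))" for b
  proof (rule expb_integrable_gaussian)
    show "expb (\<lambda>z::'a. (z \<bullet> b) * (z \<bullet> b))"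
      by (intro expb_mult expb_linear_growth[of _ 0 "norm b"])
         (auto simp: Cauchy_Schwarz_ineq2 mult.commute[of "norm b"] simp del: norm_Basis)
  qed measurable
  have "(\<integral>z. (norm z)\<^sup>2 \<partial>(std_gaussian :: 'a measure)) = (\<integral>z. (\<Sum>b\<in>Basis. (z \<bullet> b) * (z \<bullet> b)) \<partial>(std_gaussian :: 'a measure))"
    by (simp add: power2_norm_eq_inner euclidean_inner[symmetric])
  also have "\<dots> = (\<Sum>b\<in>(Basis::'a set). 1)"
    using i2 by (subst Bochner_Integration.integral_sum) (auto simp: gaussian_covariance_basis intro!: sum.cong)
  finally show ?thesis by simp
qed

lemma integrable_gaussian_norm_power: "integrable (std_gaussian :: 'a::euclidean_space measure) (\<lambda>z. norm z ^ k)"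
  by (rule expb_integrable_gaussian) auto

lemma L2le_gaussian: "L2le std_gaussian (\<lambda>z::'a::euclidean_space. z) (sqrt DIM('a))"
  using integrable_gaussian_norm_power[of 2, where 'a='a]
  by (intro L2leI) (auto simp: gaussian_second_moment)

lemma nn_integral_lborel_translate:
  fixes k :: "'a::euclidean_space \<Rightarrow> ennreal"
  assumes [measurable]: "k \<in> borel_measurable borel"
  shows "(\<integral>\<^sup>+ x. k (x + c) \<partial>lborel) = (\<integral>\<^sup>+ x. k x \<partial>lborel)"
  by (subst (2) lborel_distr_plus[of c, symmetric], subst nn_integral_distr) (auto simp: add.commute)

text \<open>A rotation of the plane is a product of three shears, and shears preserve Lebesgue measure by
  translation invariance alone.\<close>

lemma gaussian_rotation:
  fixes f :: "'a::euclidean_space \<Rightarrow> ennreal" and a b :: real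
  assumes [measurable]: "f \<in> borel_measurable borel" and ab: "a\<^sup>2 + b\<^sup>2 = 1" "b \<noteq> 0"
  shows "(\<integral>\<^sup>+ z. f (b *\<^sub>R fst z + a *\<^sub>R snd z) \<partial>(std_gaussian \<Otimes>\<^sub>M std_gaussian)) = (\<integral>\<^sup>+ z. f z \<partial>std_gaussian)"
proof -
  let ?LL = "lborel \<Otimes>\<^sub>M lborel :: ('a \<times> 'a) measure"
  have shear1: "(\<integral>\<^sup>+ z. k (fst z + s *\<^sub>R snd z, snd z) \<partial>?LL) = (\<integral>\<^sup>+ z. k z \<partial>?LL)"
    if [measurable]: "k \<in> borel_measurable (borel \<Otimes>\<^sub>M borel)" for k :: "'a \<times> 'a \<Rightarrow> ennreal" and s
    by (subst (1 2) lborel_pair.nn_integral_snd[symmetric])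
       (auto intro!: nn_integral_cong[where M=lborel and ?'a='a, OF nn_integral_lborel_translate[of "\<lambda>x. k (x, y)" "s *\<^sub>R y" for y]])
  have shear2: "(\<integral>\<^sup>+ z. k (fst z, snd z + s *\<^sub>R fst z) \<partial>?LL) = (\<integral>\<^sup>+ z. k z \<partial>?LL)"
    if [measurable]: "k \<in> borel_measurable (borel \<Otimes>\<^sub>M borel)" for k :: "'a \<times> 'a \<Rightarrow> ennreal" and s
    by (subst (1 2) lborel.nn_integral_fst[symmetric])
       (auto intro!: nn_integral_cong[where M=lborel and ?'a='a, OF nn_integral_lborel_translate[of "\<lambda>y. k (x, y)" "s *\<^sub>R x" for x]])
  \<comment> \<open>With \<open>a\<close> and \<open>b\<close> as cosine and sine, \<open>t\<close>
    is the tangent of half the angle, and the shears with parameters \<open>- t\<close>,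
    \<open>b\<close>, \<open>- t\<close> compose to the rotation taking \<open>(x, y)\<close> to
    \<open>(a x - b y, b x + a y)\<close>.\<close>
  define t where "t = (1 - a) / b"
  have tb: "b * t = 1 - a" using ab by (simp add: t_def)
  have t2: "t * (1 + a) = b" using ab by (simp add: t_def field_simps power2_eq_square)
  define k where "k = (\<lambda>z::'a \<times> 'a. ennreal (gden (fst z)) * ennreal (gden (snd z)) * f (snd z))"
  have [measurable]: "k \<in> borel_measurable (borel \<Otimes>\<^sub>M borel)" unfolding k_def by measurable
  have pair: "std_gaussian \<Otimes>\<^sub>M std_gaussian
      = density ?LL (\<lambda>(x, y). ennreal (gden x) * ennreal (gden y))"
    unfolding std_gaussian_eq
    by (rule pair_measure_density)
       (auto simp: std_gaussian_eq[symmetric] lborel.sigma_finite_measure_axioms G.sigma_finite_measure_axioms)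
  have rot: "ennreal (gden x) * ennreal (gden y) * f (b *\<^sub>R x + a *\<^sub>R y)
      = k ((x + (-t) *\<^sub>R y) + (-t) *\<^sub>R (y + b *\<^sub>R (x + (-t) *\<^sub>R y)), y + b *\<^sub>R (x + (-t) *\<^sub>R y))" for x y
  proof -
    have y1: "y + b *\<^sub>R (x + (-t) *\<^sub>R y) = b *\<^sub>R x + a *\<^sub>R y"
    proof -
      have "y + b *\<^sub>R (x + (-t) *\<^sub>R y) = b *\<^sub>R x + (1 - b * t) *\<^sub>R y" by (simp add: algebra_simps)
      then show ?thesis by (simp add: tb)
    qed
    have x2: "(x + (-t) *\<^sub>R y) + (-t) *\<^sub>R (b *\<^sub>R x + a *\<^sub>R y) = a *\<^sub>R x - b *\<^sub>R y"
    proof -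
      have "(x + (-t) *\<^sub>R y) + (-t) *\<^sub>R (b *\<^sub>R x + a *\<^sub>R y) = (1 - b * t) *\<^sub>R x - (t * (1 + a)) *\<^sub>R y"
        by (simp add: algebra_simps)
      then show ?thesis by (simp add: tb t2)
    qed
    have "(norm (a *\<^sub>R x - b *\<^sub>R y))\<^sup>2 + (norm (b *\<^sub>R x + a *\<^sub>R y))\<^sup>2 = (a\<^sup>2 + b\<^sup>2) * (norm x)\<^sup>2 + (a\<^sup>2 + b\<^sup>2) * (norm y)\<^sup>2"
      unfolding power2_norm_eq_inner
      by (simp add: inner_add_left inner_add_right inner_diff_left inner_diff_right inner_commute
          power2_eq_square algebra_simps)
    then have "(norm x)\<^sup>2 + (norm y)\<^sup>2 = (norm (a *\<^sub>R x - b *\<^sub>R y))\<^sup>2 + (norm (b *\<^sub>R x + a *\<^sub>R y))\<^sup>2"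
      using ab by simp
    then have "gden x * gden y = gden (a *\<^sub>R x - b *\<^sub>R y) * gden (b *\<^sub>R x + a *\<^sub>R y)"
      by (simp add: gden_def exp_add[symmetric] add_divide_distrib[symmetric] minus_add_distrib[symmetric] del: minus_add_distrib)
    then have "ennreal (gden x) * ennreal (gden y) = ennreal (gden (a *\<^sub>R x - b *\<^sub>R y)) * ennreal (gden (b *\<^sub>R x + a *\<^sub>R y))"
      by (simp add: ennreal_mult[symmetric] less_imp_le[OF gden_pos])
    then show ?thesis unfolding y1 x2 by (simp add: k_def)
  qed
  have "(\<integral>\<^sup>+ z. f (b *\<^sub>R fst z + a *\<^sub>R snd z) \<partial>(std_gaussian \<Otimes>\<^sub>M std_gaussian))
      = (\<integral>\<^sup>+ z. ennreal (gden (fst z)) * ennreal (gden (snd z)) * f (b *\<^sub>R fst z + a *\<^sub>R snd z) \<partial>?LL)"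
    unfolding pair by (subst nn_integral_density) (auto simp: split_beta')
  also have "\<dots> = (\<integral>\<^sup>+ z. (\<lambda>z. (\<lambda>z. (\<lambda>z. k z) (fst z + (-t) *\<^sub>R snd z, snd z)) (fst z, snd z + b *\<^sub>R fst z)) (fst z + (-t) *\<^sub>R snd z, snd z) \<partial>?LL)"
    unfolding rot by simp
  also have "\<dots> = (\<integral>\<^sup>+ z. k z \<partial>?LL)"
    by (subst shear1, measurable, subst shear2, measurable, subst shear1, measurable)
  also have "\<dots> = (\<integral>\<^sup>+ y. \<integral>\<^sup>+ x. ennreal (gden (x::'a)) * (ennreal (gden y) * f y) \<partial>lborel \<partial>lborel)"
    by (subst lborel_pair.nn_integral_snd[symmetric]) (auto simp: k_def mult.assoc)
  also have "\<dots> = (\<integral>\<^sup>+ y. ennreal (gden y) * f y \<partial>lborel)"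
    using G.emeasure_space_1[where 'a='a]
    by (simp add: nn_integral_multc std_gaussian_eq emeasure_density)
  also have "\<dots> = (\<integral>\<^sup>+ z. f z \<partial>std_gaussian)"
    unfolding std_gaussian_eq by (subst nn_integral_density) auto
  finally show ?thesis .
qed


section \<open>The Gibbs measure of a strongly convex potential\<close>

locale convex_potential =
  fixes F :: "'a::euclidean_space \<Rightarrow> real" and L \<mu> :: real
  assumes cont_diff_F: "cont_diff F" and smooth_F: "smooth L F"
    and convex_F: "strongly_convex \<mu> F" and mu_pos: "\<mu> > 0"
begin

lemma mu_le_L: "\<mu> \<le> L"
  by (rule strong_convexity_le_smoothness[OF cont_diff_F smooth_F convex_F])

lemma L_pos: "L > 0"
  using mu_le_L mu_pos by linarith

lemma F_measurable [measurable]: "F \<in> borel_measurable borel"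
  and grad_measurable [measurable]: "grad F \<in> borel_measurable borel"
  using cont_diff_borel[OF cont_diff_F] by auto

lemma grad_lipschitz: "norm (grad F x - grad F y) \<le> L * norm (x - y)"
  using smooth_F by (auto simp: smooth_def)

lemma grad_growth: "norm (grad F x) \<le> norm (grad F 0) + L * norm x"
  using grad_lipschitz[of x 0] norm_triangle_ineq2[of "grad F x" "grad F 0"] by simp

lemma F_increment: "\<bar>F (x + v) - F x - grad F x \<bullet> v\<bar> \<le> L / 2 * (norm v)\<^sup>2"
  by (rule smooth_increment[OF cont_diff_F smooth_F convex_F mu_pos])

text \<open>Strong convexity around \<open>0\<close> gives the density a Gaussian tail, the source
  of integrability under \<open>gibbs F\<close>.\<close>

lemma exp_F_le: "exp (- F x) \<le> exp (- F 0) * exp (norm (grad F 0) * norm x - \<mu> / 2 * (norm x)\<^sup>2)"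
proof -
  have "F x \<ge> F 0 + grad F 0 \<bullet> x + \<mu> / 2 * (norm x)\<^sup>2"
    using smooth_lower[OF cont_diff_F convex_F, of 0 x] by simp
  moreover have "grad F 0 \<bullet> x \<ge> - (norm (grad F 0) * norm x)"
    using Cauchy_Schwarz_ineq2[of "grad F 0" x] by linarith
  ultimately show ?thesis by (simp add: exp_add[symmetric])
qed

definition mass :: real where "mass = (\<integral>x. exp (- F x) \<partial>lborel)"

lemma exp_F_integrable: "integrable lborel (\<lambda>x. exp (- F x))"
  by (rule integrable_gaussian_tail[where c="\<mu>/2" and C="exp (- F 0)" and a="norm (grad F 0)"])
     (use exp_F_le mu_pos in auto)

lemma nn_integral_exp_F: "(\<integral>\<^sup>+ y. ennreal (exp (- F y)) \<partial>lborel) = ennreal mass"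
  unfolding mass_def by (rule nn_integral_eq_integral[OF exp_F_integrable]) auto

lemma mass_pos: "mass > 0"
proof -
  have "mass \<noteq> 0"
  proof
    assume "mass = 0"
    then have "(\<integral>\<^sup>+ y. ennreal (exp (- F y)) \<partial>lborel) = 0" by (simp add: nn_integral_exp_F)
    then have "AE y in (lborel :: 'a measure). False" by (subst (asm) nn_integral_0_iff_AE) auto
    then have "emeasure (lborel :: 'a measure) UNIV = 0"
      using AE_iff_null[of lborel "\<lambda>_::'a. False"] by (auto simp: null_sets_def)
    then show False by simp
  qed
  moreover have "mass \<ge> 0" unfolding mass_def by simp
  ultimately show ?thesis by simp
qed

lemma gibbs_eq: "gibbs F = density lborel (\<lambda>x. ennreal (exp (- F x) / mass))"
  unfolding gibbs_def nn_integral_exp_F by (simp add: divide_ennreal mass_pos)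

lemma sets_gibbs [simp, measurable_cong]: "sets (gibbs F) = sets borel"
  and space_gibbs [simp]: "space (gibbs F) = UNIV"
  by (auto simp: gibbs_def)

lemma prob_space_gibbs: "prob_space (gibbs F)"
proof
  have "emeasure (gibbs F) UNIV = (\<integral>\<^sup>+ x. ennreal (exp (- F x)) / ennreal mass \<partial>lborel)"
    by (simp add: gibbs_eq emeasure_density divide_ennreal mass_pos)
  also have "\<dots> = ennreal mass / ennreal mass" by (simp add: nn_integral_divide nn_integral_exp_F)
  finally show "emeasure (gibbs F) (space (gibbs F)) = 1"
    using mass_pos by (simp add: divide_ennreal)
qed

lemma expb_integrable_gibbs:
  fixes f :: "'a \<Rightarrow> real"
  assumes "f \<in> borel_measurable borel" "expb f"
  shows "integrable (gibbs F) f"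
  unfolding gibbs_eq
proof (rule expb_integrable_real[where c="\<mu>/2" and C="exp (- F 0) / mass" and a="norm (grad F 0)"])
  show "exp (- F x) / mass \<le> exp (- F 0) / mass * exp (norm (grad F 0) * norm x - \<mu> / 2 * (norm x)\<^sup>2)" for x
    using divide_right_mono[OF exp_F_le[of x], of mass] mass_pos by simp
qed (use assms mu_pos mass_pos in auto)

lemma expb_grad: "expb (grad F)"
  by (rule expb_linear_growth[OF grad_growth])

lemma integrable_gibbs_grad_power: "integrable (gibbs F) (\<lambda>x. norm (grad F x) ^ k)"
  by (rule expb_integrable_gibbs) (auto intro!: expb_grad)

text \<open>Integration by parts under \<open>\<pi>\<close> for a merely Lipschitz gradient: translate
  \<open>\<integral> v exp (-F)\<close> by \<open>t b\<close>, where \<open>v = \<nabla>F \<bullet> b\<close>, divide by \<open>t\<close>, and let \<open>t\<close> tend to \<open>0\<close>.\<close>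

lemma gibbs_partial_second_moment:
  assumes b: "b \<in> Basis"
  shows "(\<integral>x. (grad F x \<bullet> b)\<^sup>2 * exp (- F x) \<partial>lborel) \<le> L * mass"
proof -
  define v where "v = (\<lambda>x. grad F x \<bullet> b)"
  define t where "t = (\<lambda>n::nat. 1 / (real n + 1))"
  have t: "0 < t n" "t n \<le> 1" for n by (auto simp: t_def)
  have tlim: "t \<longlonglongrightarrow> 0" unfolding t_def using LIMSEQ_inverse_real_of_nat by (simp add: inverse_eq_divide add.commute)
  have nb [simp]: "norm b = 1" using b by simp
  have [measurable]: "v \<in> borel_measurable borel" unfolding v_def by measurable
  \<comment> \<open>A quantity read in two ways: pointwise it tends to
    \<open>(v x)\<^sup>2 * exp (- F x)\<close>, while under the integral the difference quotient can
    be moved onto \<open>v\<close>, where the Lipschitz constant \<open>L\<close> bounds it.\<close>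
  define s where "s = (\<lambda>n x. v (x + t n *\<^sub>R b) * (exp (- F x) - exp (- F (x + t n *\<^sub>R b))) / t n)"
  have [measurable]: "s n \<in> borel_measurable borel" for n unfolding s_def by measurable
  define A where "A = norm (grad F 0) + L"
  \<comment> \<open>A dominating function for all shifts by at most \<open>1\<close> in direction
    \<open>b\<close>: such a shift costs the factor \<open>exp (norm (grad F 0))\<close> and the
    additional term \<open>\<mu> * norm x\<close> in the exponent.\<close>
  define W where "W = (\<lambda>x::'a. (A + L * norm x)\<^sup>2 * (2 * exp (- F 0 + norm (grad F 0)))
      * exp ((norm (grad F 0) + \<mu>) * norm x - \<mu> / 2 * (norm x)\<^sup>2))"
  have A: "A \<ge> 0" using L_pos by (simp add: A_def)
  have v_lip: "\<bar>v x - v y\<bar> \<le> L * norm (x - y)" for x y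
  proof -
    have "\<bar>v x - v y\<bar> = \<bar>(grad F x - grad F y) \<bullet> b\<bar>" by (simp add: v_def inner_diff_left)
    also have "\<dots> \<le> norm (grad F x - grad F y)" using Cauchy_Schwarz_ineq2[of _ b] by simp
    finally show ?thesis using grad_lipschitz[of x y] by linarith
  qed
  have v_le: "\<bar>v x\<bar> \<le> norm (grad F x)" for x using Cauchy_Schwarz_ineq2[of "grad F x" b] by (simp add: v_def)
  have exp_shift: "exp (- F (x + u *\<^sub>R b)) \<le> exp (- F 0 + norm (grad F 0)) * exp ((norm (grad F 0) + \<mu>) * norm x - \<mu> / 2 * (norm x)\<^sup>2)"
    if u: "0 \<le> u" "u \<le> 1" for x u
  proof -
    let ?y = "x + u *\<^sub>R b"
    have 1: "norm ?y \<le> norm x + 1" using norm_triangle_ineq[of x "u *\<^sub>R b"] u by simp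
    have 2: "norm x - 1 \<le> norm ?y" using norm_triangle_ineq2[of x "- (u *\<^sub>R b)"] u by simp
    have 3: "(norm x)\<^sup>2 - 2 * norm x \<le> (norm ?y)\<^sup>2"
    proof (cases "norm x \<ge> 1")
      case True
      then have "(norm x - 1)\<^sup>2 \<le> (norm ?y)\<^sup>2" using 2 by (intro power_mono) auto
      then show ?thesis by (simp add: power2_diff)
    next
      case False
      then have "(norm x) * (norm x) \<le> 2 * norm x" by (intro mult_right_mono) auto
      then show ?thesis using zero_le_power2[of "norm ?y"] unfolding power2_eq_square by linarith
    qed
    have "norm (grad F 0) * norm ?y - \<mu> / 2 * (norm ?y)\<^sup>2
        \<le> norm (grad F 0) * (norm x + 1) - \<mu> / 2 * ((norm x)\<^sup>2 - 2 * norm x)"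
      using 1 3 mu_pos by (intro diff_mono mult_left_mono) auto
    then have "exp (norm (grad F 0) * norm ?y - \<mu> / 2 * (norm ?y)\<^sup>2)
        \<le> exp (norm (grad F 0) * (norm x + 1) - \<mu> / 2 * ((norm x)\<^sup>2 - 2 * norm x))" by simp
    then have "exp (- F 0) * exp (norm (grad F 0) * norm ?y - \<mu> / 2 * (norm ?y)\<^sup>2)
        \<le> exp (- F 0) * exp (norm (grad F 0) * (norm x + 1) - \<mu> / 2 * ((norm x)\<^sup>2 - 2 * norm x))" by simp
    also have "\<dots> = exp (- F 0 + norm (grad F 0)) * exp ((norm (grad F 0) + \<mu>) * norm x - \<mu> / 2 * (norm x)\<^sup>2)"
      unfolding exp_add[symmetric] by (simp add: algebra_simps)
    finally show ?thesis using exp_F_le[of ?y] by linarith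
  qed
  have incr: "\<bar>F (x + u *\<^sub>R b) - F x\<bar> \<le> u * (A + L * norm x)" if u: "0 \<le> u" "u \<le> 1" for x u
  proof -
    have "\<bar>grad F x \<bullet> (u *\<^sub>R b)\<bar> \<le> u * norm (grad F x)"
      using Cauchy_Schwarz_ineq2[of "grad F x" "u *\<^sub>R b"] u by (simp add: mult.commute)
    also have "\<dots> \<le> u * (norm (grad F 0) + L * norm x)" using u grad_growth by (intro mult_left_mono) auto
    finally have "\<bar>grad F x \<bullet> (u *\<^sub>R b)\<bar> \<le> u * (norm (grad F 0) + L * norm x)" .
    then have "\<bar>F (x + u *\<^sub>R b) - F x\<bar> \<le> u * (norm (grad F 0) + L * norm x) + L / 2 * u\<^sup>2"
    proof -
      have "(norm (u *\<^sub>R b))\<^sup>2 = u\<^sup>2" by simp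
      moreover have "\<bar>p\<bar> \<le> B + C" if "\<bar>p - q\<bar> \<le> C" "\<bar>q\<bar> \<le> B" for p q B C :: real
        using that by linarith
      ultimately show ?thesis
        using F_increment[of x "u *\<^sub>R b"] \<open>\<bar>grad F x \<bullet> (u *\<^sub>R b)\<bar> \<le> u * (norm (grad F 0) + L * norm x)\<close> by metis
    qed
    also have "L / 2 * u\<^sup>2 \<le> L * u"
    proof -
      have "u * u \<le> 1 * u" using u by (intro mult_right_mono) auto
      then have "u\<^sup>2 \<le> 2 * u" using u by (simp add: power2_eq_square)
      then show ?thesis using L_pos by simp
    qed
    finally show ?thesis by (simp add: A_def algebra_simps)
  qed
  have exp_diff: "\<bar>exp p - exp q\<bar> \<le> \<bar>p - q\<bar> * (exp p + exp q)" for p q :: real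
  proof -
    have *: "exp q - exp p \<le> (q - p) * (exp p + exp q) \<and> exp q - exp p \<ge> 0" if "p \<le> q" for p q :: real
    proof
      have "exp q * (1 - (q - p)) \<le> exp q * exp (p - q)"
      proof (rule mult_left_mono)
        show "1 - (q - p) \<le> exp (p - q)" using exp_ge_add_one_self[of "p - q"] by linarith
      qed simp
      then have "exp q - exp p \<le> (q - p) * exp q" by (simp add: exp_add[symmetric] algebra_simps)
      also have "\<dots> \<le> (q - p) * (exp p + exp q)" using that by (intro mult_left_mono) auto
      finally show "exp q - exp p \<le> (q - p) * (exp p + exp q)" .
    qed (use that in simp)
    show ?thesis using *[of p q] *[of q p] by (cases "p \<le> q") (auto simp: abs_if add.commute)
  qed
  have dom: "\<bar>s n x\<bar> \<le> W x" for n x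
  proof -
    let ?y = "x + t n *\<^sub>R b" and ?K = "exp (- F 0 + norm (grad F 0)) * exp ((norm (grad F 0) + \<mu>) * norm x - \<mu> / 2 * (norm x)\<^sup>2)"
    have "\<bar>v ?y\<bar> \<le> norm (grad F ?y)" by (rule v_le)
    also have "\<dots> \<le> norm (grad F 0) + L * norm ?y" by (rule grad_growth)
    also have "\<dots> \<le> norm (grad F 0) + L * (norm x + 1)"
      using norm_triangle_ineq[of x "t n *\<^sub>R b"] t[of n] L_pos by (intro add_left_mono mult_left_mono) auto
    finally have v: "\<bar>v ?y\<bar> \<le> A + L * norm x" by (simp add: A_def algebra_simps)
    have "\<bar>exp (- F x) - exp (- F ?y)\<bar> \<le> \<bar>(- F x) - (- F ?y)\<bar> * (exp (- F x) + exp (- F ?y))" by (rule exp_diff)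
    also have "\<dots> \<le> (t n * (A + L * norm x)) * (?K + ?K)"
      using incr[of "t n" x] t[of n] exp_shift[of "t n" x] exp_shift[of 0 x]
      by (intro mult_mono add_mono) auto
    finally have e: "\<bar>exp (- F x) - exp (- F ?y)\<bar> / t n \<le> (A + L * norm x) * (2 * ?K)"
      using t[of n] by (simp add: field_simps)
    have "\<bar>s n x\<bar> = \<bar>v ?y\<bar> * (\<bar>exp (- F x) - exp (- F ?y)\<bar> / t n)"
      using t[of n] by (simp add: s_def abs_mult)
    also have "\<dots> \<le> (A + L * norm x) * ((A + L * norm x) * (2 * ?K))"
      using v e t[of n] A L_pos by (intro mult_mono) auto
    finally show ?thesis by (simp add: W_def power2_eq_square mult_ac)
  qed
  have W_int: "integrable lborel W"
  proof -
    have "expb (\<lambda>x::'a. (A + L * norm x)\<^sup>2 * (2 * exp (- F 0 + norm (grad F 0))))"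
      by (intro expb_mult expb_power expb_add expb_const expb_norm_id)
    then obtain C a where C: "\<And>x::'a. \<bar>(A + L * norm x)\<^sup>2 * (2 * exp (- F 0 + norm (grad F 0)))\<bar> \<le> C * exp (a * norm x)"
      unfolding expb_def by auto
    show ?thesis
    proof (rule integrable_gaussian_tail[where c="\<mu>/2" and C=C and a="a + (norm (grad F 0) + \<mu>)"])
      fix x :: 'a
      have "\<bar>W x\<bar> \<le> (C * exp (a * norm x)) * exp ((norm (grad F 0) + \<mu>) * norm x - \<mu> / 2 * (norm x)\<^sup>2)"
        unfolding W_def abs_mult[of _ "exp ((norm (grad F 0) + \<mu>) * norm x - \<mu> / 2 * (norm x)\<^sup>2)"]
        using C[of x] by simp
      also have "\<dots> = C * exp ((a + (norm (grad F 0) + \<mu>)) * norm x - \<mu> / 2 * (norm x)\<^sup>2)"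
        by (simp add: mult.assoc exp_add[symmetric] algebra_simps)
      finally show "\<bar>W x\<bar> \<le> C * exp ((a + (norm (grad F 0) + \<mu>)) * norm x - \<mu> / 2 * (norm x)\<^sup>2)" .
    qed (use mu_pos in \<open>auto simp: W_def\<close>)
  qed
  have pointwise: "(\<lambda>n. s n x) \<longlonglongrightarrow> (v x)\<^sup>2 * exp (- F x)" for x
  proof -
    have "((\<lambda>u. F (x + u *\<^sub>R b)) has_real_derivative (b \<bullet> grad F x)) (at 0)"
      using GDERIV_along[of F x b 0] cont_diff_GDERIV[OF cont_diff_F] by simp
    then have "((\<lambda>u. exp (- F (x + u *\<^sub>R b))) has_real_derivative (- v x * exp (- F x))) (at 0)"
      by (auto intro!: derivative_eq_intros simp: v_def inner_commute)
    then have d: "((\<lambda>u. (exp (- F (x + u *\<^sub>R b)) - exp (- F x)) / u) \<longlongrightarrow> - v x * exp (- F x)) (at 0)"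
      by (simp add: has_field_derivative_iff)
    have "filterlim t (at 0) sequentially"
      using tlim t by (auto simp: filterlim_at eventually_sequentially less_imp_neq[symmetric])
    from filterlim_compose[OF d this]
    have l1: "(\<lambda>n. (exp (- F (x + t n *\<^sub>R b)) - exp (- F x)) / t n) \<longlonglongrightarrow> - v x * exp (- F x)" .
    have "(\<lambda>n. v (x + t n *\<^sub>R b) - v x) \<longlonglongrightarrow> 0"
    proof (rule Lim_null_comparison)
      show "\<forall>\<^sub>F n in sequentially. norm (v (x + t n *\<^sub>R b) - v x) \<le> L * t n"
        using v_lip[of "x + t _ *\<^sub>R b" x] less_imp_le[OF t(1)] by (auto intro!: always_eventually)
      show "(\<lambda>n. L * t n) \<longlonglongrightarrow> 0" using tendsto_mult_right_zero[OF tlim] by simp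
    qed
    then have l2: "(\<lambda>n. v (x + t n *\<^sub>R b)) \<longlonglongrightarrow> v x" by (simp add: LIM_zero_iff)
    have "(\<lambda>n. - (v (x + t n *\<^sub>R b) * ((exp (- F (x + t n *\<^sub>R b)) - exp (- F x)) / t n))) \<longlonglongrightarrow> - (v x * (- v x * exp (- F x)))"
      by (intro tendsto_minus tendsto_mult l1 l2)
    also have "(\<lambda>n. - (v (x + t n *\<^sub>R b) * ((exp (- F (x + t n *\<^sub>R b)) - exp (- F x)) / t n))) = (\<lambda>n. s n x)"
      using t by (auto simp: s_def fun_eq_iff algebra_simps diff_divide_distrib)
    finally show ?thesis by (simp add: power2_eq_square mult.assoc)
  qed
  have conv: "(\<lambda>n. \<integral>x. s n x \<partial>lborel) \<longlonglongrightarrow> (\<integral>x. (v x)\<^sup>2 * exp (- F x) \<partial>lborel)"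
    by (rule integral_dominated_convergence[where w=W]) (use W_int dom pointwise in auto)
  have "(\<integral>x. s n x \<partial>lborel) \<le> L * mass" for n
  proof -
    let ?u = "\<lambda>x. v x * exp (- F x)" and ?d = "\<lambda>x. (v (x + t n *\<^sub>R b) - v x) / t n * exp (- F x)"
    have u_int: "integrable lborel ?u"
    proof -
      have "integrable (gibbs F) v"
        by (rule expb_integrable_gibbs) (auto intro!: expb_dominated[OF expb_grad] simp: v_le)
      then have "integrable lborel (\<lambda>x. exp (- F x) / mass * v x)"
        unfolding gibbs_eq using mass_pos by (subst (asm) integrable_density) auto
      then have "integrable lborel (\<lambda>x. mass * (exp (- F x) / mass * v x))" by (rule integrable_mult_right)
      then show ?thesis using mass_pos by (simp add: mult.commute)
    qed
    have us: "integrable lborel (\<lambda>x. ?u (x + t n *\<^sub>R b))" "(\<integral>x. ?u (x + t n *\<^sub>R b) \<partial>lborel) = (\<integral>x. ?u x \<partial>lborel)"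
    proof -
      have *: "lborel = distr lborel borel ((+) (t n *\<^sub>R b))" by (rule lborel_distr_plus[symmetric])
      show "(\<integral>x. ?u (x + t n *\<^sub>R b) \<partial>lborel) = (\<integral>x. ?u x \<partial>lborel)"
        by (subst (2) *, subst integral_distr) (auto simp: add.commute)
      show "integrable lborel (\<lambda>x. ?u (x + t n *\<^sub>R b))"
        using u_int by (subst (asm) *, subst (asm) integrable_distr_eq) (auto simp: add.commute)
    qed
    have d_le: "\<bar>?d x\<bar> \<le> L * exp (- F x)" for x
    proof -
      have "\<bar>v (x + t n *\<^sub>R b) - v x\<bar> \<le> L * t n"
        using v_lip[of "x + t n *\<^sub>R b" x] t[of n] by simp
      then have "\<bar>(v (x + t n *\<^sub>R b) - v x) / t n\<bar> \<le> L" using t[of n] by (simp add: field_simps)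
      then have "\<bar>(v (x + t n *\<^sub>R b) - v x) / t n\<bar> * exp (- F x) \<le> L * exp (- F x)"
        by (rule mult_right_mono) simp
      then show ?thesis by (simp only: abs_mult abs_exp_cancel)
    qed
    have d_int: "integrable lborel ?d"
    proof (rule Bochner_Integration.integrable_bound)
      show "integrable lborel (\<lambda>x. L * exp (- F x))" using exp_F_integrable by simp
      show "AE x in lborel. norm (?d x) \<le> norm (L * exp (- F x))"
        using d_le L_pos by (auto simp: abs_mult)
    qed auto
    \<comment> \<open>The discrete product rule. The second part is a difference of two translates
      of an integrable function and integrates to \<open>0\<close>.\<close>
    have "s n x = ?d x - (?u (x + t n *\<^sub>R b) - ?u x) / t n" for x
      using t[of n] by (simp add: s_def field_simps)
    then have "(\<integral>x. s n x \<partial>lborel) = (\<integral>x. ?d x \<partial>lborel)"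
      using us d_int u_int by simp
    also have "\<dots> \<le> (\<integral>x. L * exp (- F x) \<partial>lborel)"
    proof (rule integral_mono[OF d_int])
      show "integrable lborel (\<lambda>x. L * exp (- F x))" using exp_F_integrable by simp
    qed (rule abs_le_D1[OF d_le])
    also have "\<dots> = L * mass" by (simp add: mass_def)
    finally show ?thesis .
  qed
  then have "(\<integral>x. (v x)\<^sup>2 * exp (- F x) \<partial>lborel) \<le> L * mass"
    by (intro LIMSEQ_le_const2[OF conv]) auto
  then show ?thesis by (simp add: v_def)
qed

text \<open>Formally the second moment of the gradient is the mean of the Laplacian of
  \<open>F\<close>, at most \<open>L\<close> per coordinate; the coordinatewise estimate gives this
  bound without second derivatives.\<close>

lemma L2le_grad: "L2le (gibbs F) (grad F) (sqrt (L * DIM('a)))"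
proof (rule L2leI)
  show "integrable (gibbs F) (\<lambda>x. (norm (grad F x))\<^sup>2)" by (rule integrable_gibbs_grad_power)
  have ex: "expb (\<lambda>x. (grad F x \<bullet> b)\<^sup>2)" for b
    by (intro expb_power expb_dominated[OF expb_mult[OF expb_norm[OF expb_grad] expb_const[of "norm b"]]])
       (simp add: Cauchy_Schwarz_ineq2)
  have i: "integrable (gibbs F) (\<lambda>x. (grad F x \<bullet> b)\<^sup>2)" for b
    by (rule expb_integrable_gibbs[OF _ ex]) measurable
  have "(\<integral>x. (norm (grad F x))\<^sup>2 \<partial>gibbs F) = (\<integral>x. (\<Sum>b\<in>Basis. (grad F x \<bullet> b)\<^sup>2) \<partial>gibbs F)"
    by (subst power2_norm_eq_inner, subst euclidean_inner) (simp add: power2_eq_square)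
  also have "\<dots> = (\<Sum>b\<in>Basis. \<integral>x. (grad F x \<bullet> b)\<^sup>2 \<partial>gibbs F)"
    using i by (rule Bochner_Integration.integral_sum)
  also have "\<dots> \<le> (\<Sum>b\<in>(Basis::'a set). L)"
  proof (rule sum_mono)
    fix b :: 'a assume b: "b \<in> Basis"
    have "(\<integral>x. (grad F x \<bullet> b)\<^sup>2 \<partial>gibbs F) = (\<integral>x. exp (- F x) / mass * (grad F x \<bullet> b)\<^sup>2 \<partial>lborel)"
      unfolding gibbs_eq using mass_pos by (subst integral_density) auto
    also have "\<dots> = (\<integral>x. (grad F x \<bullet> b)\<^sup>2 * exp (- F x) \<partial>lborel) / mass"
      by (simp add: mult.commute)
    also have "\<dots> \<le> L"
      using gibbs_partial_second_moment[OF b] mass_pos by (simp add: field_simps)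
    finally show "(\<integral>x. (grad F x \<bullet> b)\<^sup>2 \<partial>gibbs F) \<le> L" .
  qed
  also have "\<dots> = (sqrt (L * DIM('a)))\<^sup>2" using L_pos by simp
  finally show "(\<integral>x. (norm (grad F x))\<^sup>2 \<partial>gibbs F) \<le> (sqrt (L * DIM('a)))\<^sup>2" .
qed (use L_pos in auto)

end

section \<open>One step of random-walk Metropolis\<close>

definition unit_uniform :: "real measure" where
  "unit_uniform = uniform_measure lborel {0..1}"

lemma prob_space_unit_uniform: "prob_space unit_uniform"
  unfolding unit_uniform_def by (rule prob_space_uniform_measure) auto

lemma sets_unit_uniform [simp, measurable_cong]: "sets unit_uniform = sets borel"
  and space_unit_uniform [simp]: "space unit_uniform = UNIV"
  by (auto simp: unit_uniform_def)

lemma emeasure_unit_uniform_le: "p \<ge> 0 \<Longrightarrow> emeasure unit_uniform {u. u \<le> p} = ennreal (min 1 p)"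
  and emeasure_unit_uniform_gt: "p \<ge> 0 \<Longrightarrow> emeasure unit_uniform {u. \<not> u \<le> p} = ennreal (1 - min 1 p)"
proof -
  assume p: "p \<ge> 0"
  have "{0..1} \<inter> {u. u \<le> p} = {0..min 1 p}" "{0..1} \<inter> {u. \<not> u \<le> p} = {min 1 p<..1}" using p by auto
  moreover have "{u. u \<le> p} \<in> sets borel" "{u. \<not> u \<le> p} \<in> sets borel" by measurable
  ultimately show "emeasure unit_uniform {u. u \<le> p} = ennreal (min 1 p)"
    "emeasure unit_uniform {u. \<not> u \<le> p} = ennreal (1 - min 1 p)"
    using p by (simp_all add: unit_uniform_def divide_ennreal_def)
qed

lemma nn_integral_accept:
  fixes A B :: ennreal
  assumes "p \<ge> 0"
  shows "(\<integral>\<^sup>+ u. (if u \<le> p then A else B) \<partial>unit_uniform) = ennreal (min 1 p) * A + ennreal (1 - min 1 p) * B"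
proof -
  have [measurable]: "{u. u \<le> p} \<in> sets borel" "{u. \<not> u \<le> p} \<in> sets borel" by measurable
  have "(\<integral>\<^sup>+ u. (if u \<le> p then A else B) \<partial>unit_uniform)
      = (\<integral>\<^sup>+ u. A * indicator {u. u \<le> p} u + B * indicator {u. \<not> u \<le> p} u \<partial>unit_uniform)"
    by (intro nn_integral_cong) auto
  also have "\<dots> = A * emeasure unit_uniform {u. u \<le> p} + B * emeasure unit_uniform {u. \<not> u \<le> p}"
    by (subst nn_integral_add) (auto simp: nn_integral_cmult_indicator)
  finally show ?thesis
    using assms by (simp only: emeasure_unit_uniform_le emeasure_unit_uniform_gt mult.commute)
qed

text \<open>A Gaussian proposal direction paired with the uniform variable that decides on
  acceptance.\<close>

definition step_noise :: "('a::euclidean_space \<times> real) measure" where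
  "step_noise = std_gaussian \<Otimes>\<^sub>M unit_uniform"

lemma sets_step_noise [simp, measurable_cong]: "sets step_noise = sets (borel \<Otimes>\<^sub>M borel)"
  and space_step_noise [simp]: "space step_noise = UNIV"
  by (auto simp: step_noise_def space_pair_measure intro!: sets_pair_measure_cong)

lemma fst_step_noise_measurable [measurable]: "fst \<in> borel_measurable step_noise"
  by (subst measurable_cong_sets[OF sets_step_noise refl]) measurable

lemma prob_space_step_noise: "prob_space step_noise"
proof -
  interpret U: prob_space unit_uniform by (rule prob_space_unit_uniform)
  interpret P: pair_prob_space "std_gaussian :: 'a measure" unit_uniform ..
  show ?thesis unfolding step_noise_def by (rule P.prob_space_axioms)
qed

lemma distr_step_noise_fst: "distr step_noise borel fst = std_gaussian"
proof -
  interpret U: prob_space unit_uniform by (rule prob_space_unit_uniform)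
  have "distr step_noise borel fst = distr (std_gaussian \<Otimes>\<^sub>M unit_uniform) std_gaussian fst"
    by (simp add: step_noise_def cong: distr_cong)
  then show ?thesis by (simp add: U.distr_pair_fst)
qed

lemma nn_integral_step_noise:
  assumes [measurable]: "f \<in> borel_measurable (borel \<Otimes>\<^sub>M borel)"
  shows "(\<integral>\<^sup>+ t. f t \<partial>step_noise) = (\<integral>\<^sup>+ x. \<integral>\<^sup>+ u. f (x, u) \<partial>unit_uniform \<partial>std_gaussian)"
proof -
  interpret U: prob_space unit_uniform by (rule prob_space_unit_uniform)
  show ?thesis unfolding step_noise_def by (subst U.nn_integral_fst[symmetric]) auto
qed

lemma integrable_step_noise_fst:
  fixes f :: "'a::euclidean_space \<Rightarrow> real"
  assumes "f \<in> borel_measurable borel" "expb f"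
  shows "integrable step_noise (\<lambda>t. f (fst t))"
  using expb_integrable_gaussian_real[OF assms] assms(1) unfolding distr_step_noise_fst[symmetric]
  by (subst (asm) integrable_distr_eq) auto

lemma integral_step_noise_fst:
  fixes f :: "'a::euclidean_space \<Rightarrow> 'b::euclidean_space"
  assumes "f \<in> borel_measurable borel"
  shows "(\<integral>t. f (fst t) \<partial>step_noise) = (\<integral>x. f x \<partial>std_gaussian)"
  using assms unfolding distr_step_noise_fst[symmetric] by (subst integral_distr) auto

lemma L2le_step_noise_fst: "L2le step_noise (\<lambda>t. fst t :: 'a::euclidean_space) (sqrt DIM('a))"
  using L2le_gaussian unfolding distr_step_noise_fst[symmetric] by (subst (asm) L2le_distr) auto

lemma integrable_step_noise: "integrable step_noise (\<lambda>t. fst t :: 'a::euclidean_space)"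
proof -
  interpret T: prob_space "step_noise :: ('a \<times> real) measure" by (rule prob_space_step_noise)
  show ?thesis by (rule T.L2le_imp_integrable[OF L2le_step_noise_fst])
qed

lemma step_noise_mean: "(\<integral>t. fst t \<partial>step_noise) = (0 :: 'a::euclidean_space)"
proof -
  show ?thesis using gaussian_mean integral_step_noise_fst[of "\<lambda>x::'a. x"] by simp
qed

text \<open>The probability of rejecting a proposal that raises the potential by
  \<open>s\<close>.\<close>

definition clip :: "real \<Rightarrow> real" where
  "clip s = 1 - min 1 (exp (- s))"

lemma clip_bounds: "0 \<le> clip s" "clip s \<le> 1" "clip s \<le> \<bar>s\<bar>"
proof -
  show "0 \<le> clip s" "clip s \<le> 1" by (auto simp: clip_def)
  show "clip s \<le> \<bar>s\<bar>"
    using exp_ge_add_one_self[of "- s"] by (auto simp: clip_def min_def)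
qed

text \<open>First-order expansion of the rejection probability. For \<open>s > 0\<close>,
  \<open>exp (- s)\<close> lies between \<open>1 - s\<close> and \<open>1 / (1 + s)\<close>, and the
  latter is at most \<open>1 - s + s\<^sup>2\<close> because
  \<open>(1 - s + s\<^sup>2) * (1 + s) = 1 + s ^ 3\<close>.\<close>

lemma clip_approx: "\<bar>clip s - max 0 s\<bar> \<le> s\<^sup>2"
proof (cases "s \<le> 0")
  case False
  then have s: "s > 0" by simp
  have "exp (- s) \<ge> 1 - s" using exp_ge_add_one_self[of "- s"] by simp
  moreover have "exp (- s) \<le> 1 - s + s\<^sup>2"
  proof -
    have "exp (- s) \<le> 1 / (1 + s)"
      using exp_ge_add_one_self[of s] s by (simp add: exp_minus inverse_eq_divide frac_le)
    also have "\<dots> \<le> 1 - s + s\<^sup>2"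
    proof -
      have "(1 - s + s\<^sup>2) * (1 + s) = 1 + s ^ 3" by (simp add: algebra_simps power2_eq_square power3_eq_cube)
      then show ?thesis using s by (simp add: divide_le_eq)
    qed
    finally show ?thesis .
  qed
  ultimately show ?thesis using s by (simp add: clip_def)
qed (simp add: clip_def)

section \<open>The Metropolis kernel and its deviation from an Euler step\<close>

context convex_potential
begin

text \<open>The uniform variable is compared with the uncapped ratio of densities; since it lies
  between \<open>0\<close> and \<open>1\<close> almost surely, the acceptance probability is the
  ratio capped at \<open>1\<close>.\<close>

definition rwm :: "real \<Rightarrow> 'a \<Rightarrow> 'a \<times> real \<Rightarrow> 'a" where
  "rwm c y t = (if snd t \<le> exp (F y - F (y + c *\<^sub>R fst t)) then y + c *\<^sub>R fst t else y)"

lemma rwm_measurable [measurable]: "(\<lambda>(y, t). rwm c y t) \<in> borel_measurable (borel \<Otimes>\<^sub>M (borel \<Otimes>\<^sub>M borel))"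
  unfolding rwm_def by measurable

lemma rwm_increment: "norm (rwm c y t - y) \<le> \<bar>c\<bar> * norm (fst t)"
  by (simp add: rwm_def)

text \<open>Detailed balance: \<open>exp (-F y)\<close> times the acceptance probability is
  \<open>min (exp (-F y)) (exp (-F y'))\<close>, symmetric in the present and the proposed state.\<close>

lemma rwm_stationary:
  "distr (gibbs F \<Otimes>\<^sub>M step_noise) borel (\<lambda>(y, t). rwm c y t) = gibbs F"
proof (rule measure_eqI)
  interpret T: prob_space "step_noise :: ('a \<times> real) measure" by (rule prob_space_step_noise)
  interpret U: prob_space unit_uniform by (rule prob_space_unit_uniform)
  interpret \<pi>: prob_space "gibbs F" by (rule prob_space_gibbs)
  interpret LG: pair_sigma_finite "lborel :: 'a measure" "std_gaussian :: 'a measure"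
    by (intro pair_sigma_finite.intro lborel.sigma_finite_measure_axioms G.sigma_finite_measure_axioms)
  fix A assume "A \<in> sets (distr (gibbs F \<Otimes>\<^sub>M step_noise) borel (\<lambda>(y, t). rwm c y t))"
  then have A [measurable]: "A \<in> sets borel" by simp
  define f :: "'a \<Rightarrow> ennreal" where "f = indicator A"
  have [measurable]: "f \<in> borel_measurable borel" unfolding f_def by measurable
  define p where "p = (\<lambda>y x. min 1 (exp (F y - F (y + c *\<^sub>R x))))"
  have [measurable]: "(\<lambda>z. p (fst z) (snd z)) \<in> borel_measurable (borel \<Otimes>\<^sub>M borel)"
    unfolding p_def by measurable
  have [measurable]: "p y \<in> borel_measurable borel" for y
    unfolding p_def by measurable
  define m where "m = (\<lambda>y y'. ennreal (min (exp (- F y)) (exp (- F y')) / mass))"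
  have [measurable]: "(\<lambda>z. m (fst z) (snd z)) \<in> borel_measurable (borel \<Otimes>\<^sub>M borel)"
    unfolding m_def by measurable
  have m_sym: "m y y' = m y' y" for y y' by (simp add: m_def min.commute)
  have pm: "ennreal (exp (- F y) / mass) * ennreal (p y x) = m y (y + c *\<^sub>R x)" for y x
  proof -
    have "exp (- F y) * p y x = min (exp (- F y)) (exp (- F (y + c *\<^sub>R x)))"
      unfolding p_def by (subst min_mult_distrib_left) (simp_all add: exp_add[symmetric])
    then have "exp (- F y) / mass * p y x = min (exp (- F y)) (exp (- F (y + c *\<^sub>R x))) / mass"
      by (simp add: field_simps)
    then show ?thesis unfolding m_def by (subst ennreal_mult[symmetric]) (use mass_pos in \<open>auto simp: p_def\<close>)
  qed
  \<comment> \<open>Fubini puts the Lebesgue integral over the present state inside, where it can be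
    translated by the proposal.\<close>
  have gibbs_nn: "(\<integral>\<^sup>+ y. \<integral>\<^sup>+ x. ennreal (p y x) * k y x \<partial>std_gaussian \<partial>gibbs F)
      = (\<integral>\<^sup>+ x. \<integral>\<^sup>+ y. m y (y + c *\<^sub>R x) * k y x \<partial>lborel \<partial>std_gaussian)"
    if [measurable]: "(\<lambda>z. k (fst z) (snd z)) \<in> borel_measurable (borel \<Otimes>\<^sub>M borel)" for k
  proof -
    have "(\<integral>\<^sup>+ y. \<integral>\<^sup>+ x. ennreal (p y x) * k y x \<partial>std_gaussian \<partial>gibbs F)
        = (\<integral>\<^sup>+ y. ennreal (exp (- F y) / mass) * (\<integral>\<^sup>+ x. ennreal (p y x) * k y x \<partial>std_gaussian) \<partial>lborel)"
      unfolding gibbs_eq by (subst nn_integral_density) auto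
    also have "\<dots> = (\<integral>\<^sup>+ y. \<integral>\<^sup>+ x. m y (y + c *\<^sub>R x) * k y x \<partial>std_gaussian \<partial>lborel)"
    proof (rule nn_integral_cong)
      fix y
      have "(\<lambda>x. (\<lambda>z. k (fst z) (snd z)) (y, x)) \<in> borel_measurable borel" by measurable
      then have [measurable]: "k y \<in> borel_measurable borel" by simp_all
      have "ennreal (exp (- F y) / mass) * (\<integral>\<^sup>+ x. ennreal (p y x) * k y x \<partial>std_gaussian)
          = (\<integral>\<^sup>+ x. ennreal (exp (- F y) / mass) * (ennreal (p y x) * k y x) \<partial>std_gaussian)"
        by (rule nn_integral_cmult[symmetric]) measurable
      then show "ennreal (exp (- F y) / mass) * (\<integral>\<^sup>+ x. ennreal (p y x) * k y x \<partial>std_gaussian)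
          = (\<integral>\<^sup>+ x. m y (y + c *\<^sub>R x) * k y x \<partial>std_gaussian)"
        by (simp add: mult.assoc[symmetric] pm)
    qed
    also have "\<dots> = (\<integral>\<^sup>+ x. \<integral>\<^sup>+ y. m y (y + c *\<^sub>R x) * k y x \<partial>lborel \<partial>std_gaussian)"
    proof (rule LG.Fubini'[symmetric])
      have "(\<lambda>z. k (fst z) (snd z)) \<in> borel_measurable (lborel \<Otimes>\<^sub>M std_gaussian)"
        using that by (subst measurable_cong_sets[OF sets_pair_measure_cong refl]) auto
      moreover have "(\<lambda>z. m (fst z) (fst z + c *\<^sub>R snd z)) \<in> borel_measurable (lborel \<Otimes>\<^sub>M std_gaussian)"
        unfolding m_def by measurable
      ultimately have "(\<lambda>z. m (fst z) (fst z + c *\<^sub>R snd z) * k (fst z) (snd z)) \<in> borel_measurable (lborel \<Otimes>\<^sub>M std_gaussian)"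
        by (intro borel_measurable_times_ennreal)
      then show "(\<lambda>(y, x). m y (y + c *\<^sub>R x) * k y x) \<in> borel_measurable (lborel \<Otimes>\<^sub>M std_gaussian)"
        by (simp add: split_beta')
    qed
    finally show ?thesis .
  qed
  \<comment> \<open>Substituting the proposed for the present state and then reflecting the proposal
    direction exchanges the two states; the symmetric weight \<open>m\<close> does not
    change.\<close>
  have balance: "(\<integral>\<^sup>+ y. \<integral>\<^sup>+ x. ennreal (p y x) * f (y + c *\<^sub>R x) \<partial>std_gaussian \<partial>gibbs F)
      = (\<integral>\<^sup>+ y. \<integral>\<^sup>+ x. ennreal (p y x) * f y \<partial>std_gaussian \<partial>gibbs F)"
  proof -
    have "(\<integral>\<^sup>+ y. \<integral>\<^sup>+ x. ennreal (p y x) * f (y + c *\<^sub>R x) \<partial>std_gaussian \<partial>gibbs F)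
        = (\<integral>\<^sup>+ x. \<integral>\<^sup>+ y. m (y + c *\<^sub>R x + c *\<^sub>R (- x)) (y + c *\<^sub>R x) * f (y + c *\<^sub>R x) \<partial>lborel \<partial>std_gaussian)"
      by (subst gibbs_nn) (auto simp: algebra_simps)
    also have "\<dots> = (\<integral>\<^sup>+ x. \<integral>\<^sup>+ y. m y (y + c *\<^sub>R (- x)) * f y \<partial>lborel \<partial>std_gaussian)"
    proof (rule nn_integral_cong)
      fix x
      have "(\<lambda>y. m y (y + c *\<^sub>R (- x)) * f y) \<in> borel_measurable borel" unfolding m_def by measurable
      from nn_integral_lborel_translate[OF this, of "c *\<^sub>R x"]
      show "(\<integral>\<^sup>+ y. m (y + c *\<^sub>R x + c *\<^sub>R (- x)) (y + c *\<^sub>R x) * f (y + c *\<^sub>R x) \<partial>lborel)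
          = (\<integral>\<^sup>+ y. m y (y + c *\<^sub>R (- x)) * f y \<partial>lborel)"
        by (subst m_sym)
    qed
    also have "\<dots> = (\<integral>\<^sup>+ x. \<integral>\<^sup>+ y. m y (y + c *\<^sub>R x) * f y \<partial>lborel \<partial>std_gaussian)"
      by (rule nn_integral_gaussian_uminus) (unfold m_def, measurable)
    also have "\<dots> = (\<integral>\<^sup>+ y. \<integral>\<^sup>+ x. ennreal (p y x) * f y \<partial>std_gaussian \<partial>gibbs F)"
      by (subst gibbs_nn) auto
    finally show ?thesis .
  qed
  have "emeasure (distr (gibbs F \<Otimes>\<^sub>M step_noise) borel (\<lambda>(y, t). rwm c y t)) A
      = (\<integral>\<^sup>+ z. f (rwm c (fst z) (snd z)) \<partial>(gibbs F \<Otimes>\<^sub>M step_noise))"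
    unfolding f_def
    by (subst nn_integral_indicator[symmetric], simp, subst nn_integral_distr) (auto simp: split_beta')
  also have "\<dots> = (\<integral>\<^sup>+ y. \<integral>\<^sup>+ t. f (rwm c y t) \<partial>step_noise \<partial>gibbs F)"
    by (subst T.nn_integral_fst[symmetric]) auto
  also have "\<dots> = (\<integral>\<^sup>+ y. \<integral>\<^sup>+ x. ennreal (p y x) * f (y + c *\<^sub>R x) + ennreal (1 - p y x) * f y \<partial>std_gaussian \<partial>gibbs F)"
  proof (rule nn_integral_cong)
    fix y
    have "(\<integral>\<^sup>+ t. f (rwm c y t) \<partial>step_noise) = (\<integral>\<^sup>+ x. \<integral>\<^sup>+ u. f (rwm c y (x, u)) \<partial>unit_uniform \<partial>std_gaussian)"
      by (rule nn_integral_step_noise) measurable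
    also have "\<dots> = (\<integral>\<^sup>+ x. \<integral>\<^sup>+ u. (if u \<le> exp (F y - F (y + c *\<^sub>R x)) then f (y + c *\<^sub>R x) else f y) \<partial>unit_uniform \<partial>std_gaussian)"
      by (intro nn_integral_cong) (simp add: rwm_def)
    also have "\<dots> = (\<integral>\<^sup>+ x. ennreal (p y x) * f (y + c *\<^sub>R x) + ennreal (1 - p y x) * f y \<partial>std_gaussian)"
      by (simp add: nn_integral_accept p_def)
    finally show "(\<integral>\<^sup>+ t. f (rwm c y t) \<partial>step_noise) = \<dots>" .
  qed
  also have "\<dots> = (\<integral>\<^sup>+ y. \<integral>\<^sup>+ x. ennreal (p y x) * f (y + c *\<^sub>R x) \<partial>std_gaussian \<partial>gibbs F)
      + (\<integral>\<^sup>+ y. \<integral>\<^sup>+ x. ennreal (1 - p y x) * f y \<partial>std_gaussian \<partial>gibbs F)"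
  proof -
    have "(\<integral>\<^sup>+ x. ennreal (p y x) * f (y + c *\<^sub>R x) + ennreal (1 - p y x) * f y \<partial>std_gaussian)
        = (\<integral>\<^sup>+ x. ennreal (p y x) * f (y + c *\<^sub>R x) \<partial>std_gaussian)
          + (\<integral>\<^sup>+ x. ennreal (1 - p y x) * f y \<partial>std_gaussian)" for y
      by (rule nn_integral_add) measurable
    then show ?thesis by (simp only:) (rule nn_integral_add; measurable)
  qed
  also have "\<dots> = (\<integral>\<^sup>+ y. \<integral>\<^sup>+ x. ennreal (p y x) * f y \<partial>std_gaussian \<partial>gibbs F)
      + (\<integral>\<^sup>+ y. \<integral>\<^sup>+ x. ennreal (1 - p y x) * f y \<partial>std_gaussian \<partial>gibbs F)"
    unfolding balance ..
  also have "\<dots> = (\<integral>\<^sup>+ y. \<integral>\<^sup>+ x. (ennreal (p y x) + ennreal (1 - p y x)) * f y \<partial>std_gaussian \<partial>gibbs F)"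
  proof -
    have "(\<integral>\<^sup>+ x. (ennreal (p y x) + ennreal (1 - p y x)) * f y \<partial>std_gaussian)
        = (\<integral>\<^sup>+ x. ennreal (p y x) * f y \<partial>std_gaussian)
          + (\<integral>\<^sup>+ x. ennreal (1 - p y x) * f y \<partial>std_gaussian)" for y
      unfolding distrib_right by (rule nn_integral_add) measurable
    then show ?thesis by (simp only:) (rule nn_integral_add[symmetric]; measurable)
  qed
  also have "\<dots> = (\<integral>\<^sup>+ y. \<integral>\<^sup>+ (x::'a). f y \<partial>std_gaussian \<partial>gibbs F)"
    by (intro nn_integral_cong) (simp add: ennreal_plus[symmetric] p_def del: ennreal_plus)
  also have "\<dots> = (\<integral>\<^sup>+ y. f y \<partial>gibbs F)" by (simp add: G.emeasure_space_1[simplified])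
  also have "\<dots> = emeasure (gibbs F) A" by (simp add: f_def)
  finally show "emeasure (distr (gibbs F \<Otimes>\<^sub>M step_noise) borel (\<lambda>(y, t). rwm c y t)) A = emeasure (gibbs F) A" .
qed simp

text \<open>What separates a Metropolis step from the Euler step of the Langevin diffusion with time
  step \<open>c\<^sup>2 / 2\<close> and the same Gaussian.\<close>

definition defect :: "real \<Rightarrow> 'a \<Rightarrow> 'a \<times> real \<Rightarrow> 'a" where
  "defect c y t = rwm c y t - y - c *\<^sub>R fst t + (c\<^sup>2 / 2) *\<^sub>R grad F y"

definition mean_defect :: "real \<Rightarrow> 'a \<Rightarrow> 'a" where
  "mean_defect c y = (\<integral>t. defect c y t \<partial>step_noise)"

definition moment :: "nat \<Rightarrow> real" where
  "moment k = (\<integral>x. norm x ^ k \<partial>(std_gaussian :: 'a measure))"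

lemma moment_nonneg: "moment k \<ge> 0"
  unfolding moment_def by simp

lemma defect_measurable [measurable]: "(\<lambda>(y, t). defect c y t) \<in> borel_measurable (borel \<Otimes>\<^sub>M (borel \<Otimes>\<^sub>M borel))"
  unfolding defect_def by measurable

lemma mean_defect_measurable [measurable]: "mean_defect c \<in> borel_measurable borel"
proof -
  interpret T: prob_space "step_noise :: ('a \<times> real) measure" by (rule prob_space_step_noise)
  show ?thesis unfolding mean_defect_def by (rule T.borel_measurable_lebesgue_integral) measurable
qed

lemma defect_eq:
  "defect c y (x, u) = (if u \<le> exp (F y - F (y + c *\<^sub>R x)) then 0 else - c *\<^sub>R x) + (c\<^sup>2 / 2) *\<^sub>R grad F y"
  by (simp add: defect_def rwm_def)

lemma defect_norm: "norm (defect c y t) \<le> \<bar>c\<bar> * norm (fst t) + c\<^sup>2 / 2 * norm (grad F y)"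
  by (cases t) (auto simp: defect_eq intro!: order_trans[OF norm_triangle_ineq4])

lemma defect_integrable: "integrable step_noise (defect c y)"
proof (rule Bochner_Integration.integrable_bound)
  show "integrable step_noise (\<lambda>t. \<bar>c\<bar> * norm (fst t :: 'a) + c\<^sup>2 / 2 * norm (grad F y))"
    by (rule integrable_step_noise_fst) (auto intro!: expb_add expb_mult expb_const expb_norm_id)
  show "AE t in step_noise. norm (defect c y t) \<le> norm (\<bar>c\<bar> * norm (fst t) + c\<^sup>2 / 2 * norm (grad F y))"
    using defect_norm by (auto intro!: AE_I2 order_trans[OF defect_norm])
qed measurable

text \<open>Integrating out the uniform variable turns the acceptance test into the rejection
  probability; a rejection takes back the proposal \<open>c *\<^sub>R x\<close>.\<close>

lemma mean_defect_eq:
  "mean_defect c y = (c\<^sup>2 / 2) *\<^sub>R grad F y - c *\<^sub>R (\<integral>x. clip (F (y + c *\<^sub>R x) - F y) *\<^sub>R x \<partial>std_gaussian)"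
proof -
  interpret U: prob_space unit_uniform by (rule prob_space_unit_uniform)
  interpret GU: pair_prob_space "std_gaussian :: 'a measure" unit_uniform ..
  have inner: "(\<integral>u. defect c y (x, u) \<partial>unit_uniform) = (c\<^sup>2 / 2) *\<^sub>R grad F y - c *\<^sub>R (clip (F (y + c *\<^sub>R x) - F y) *\<^sub>R x)" for x
  proof -
    let ?p = "exp (F y - F (y + c *\<^sub>R x))"
    have [measurable]: "{u. \<not> u \<le> ?p} \<in> sets borel" by measurable
    have m: "measure unit_uniform {u. \<not> u \<le> ?p} = clip (F (y + c *\<^sub>R x) - F y)"
      using emeasure_unit_uniform_gt[of ?p] by (simp add: measure_def clip_def)
    have "(\<integral>u. defect c y (x, u) \<partial>unit_uniform)
        = (\<integral>u. indicator {u. \<not> u \<le> ?p} u *\<^sub>R (- c *\<^sub>R x) + (c\<^sup>2 / 2) *\<^sub>R grad F y \<partial>unit_uniform)"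
      by (intro Bochner_Integration.integral_cong refl) (simp add: defect_eq)
    also have "\<dots> = measure unit_uniform {u. \<not> u \<le> ?p} *\<^sub>R (- c *\<^sub>R x) + (c\<^sup>2 / 2) *\<^sub>R grad F y"
    proof -
      have i: "integrable unit_uniform (indicator {u. \<not> u \<le> ?p} :: real \<Rightarrow> real)"
        by (rule integrable_real_indicator) (auto simp: U.emeasure_finite less_top[symmetric])
      then have "(\<integral>u. indicator {u. \<not> u \<le> ?p} u *\<^sub>R (- c *\<^sub>R x) \<partial>unit_uniform)
          = measure unit_uniform {u. \<not> u \<le> ?p} *\<^sub>R (- c *\<^sub>R x)"
        by (subst integral_scaleR_left) auto
      with i show ?thesis
        by (subst Bochner_Integration.integral_add) (auto simp: U.prob_space[simplified] simp del: scaleR_scaleR scaleR_minus_left)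
    qed
    finally show ?thesis unfolding m by simp
  qed
  have i: "integrable std_gaussian (\<lambda>x. clip (F (y + c *\<^sub>R x) - F y) *\<^sub>R x)"
  proof (rule expb_integrable_gaussian)
    show "expb (\<lambda>x. clip (F (y + c *\<^sub>R x) - F y) *\<^sub>R x)"
      by (rule expb_dominated[OF expb_norm_id])
         (auto simp: clip_bounds intro!: mult_left_le_one_le)
    show "(\<lambda>x. clip (F (y + c *\<^sub>R x) - F y) *\<^sub>R x) \<in> borel_measurable borel"
      unfolding clip_def by measurable
  qed
  have "mean_defect c y = (\<integral>x. \<integral>u. defect c y (x, u) \<partial>unit_uniform \<partial>std_gaussian)"
    unfolding mean_defect_def step_noise_def
    by (rule GU.integral_fst'[symmetric]) (use defect_integrable in \<open>simp add: step_noise_def\<close>)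
  also have "\<dots> = (c\<^sup>2 / 2) *\<^sub>R grad F y - c *\<^sub>R (\<integral>x. clip (F (y + c *\<^sub>R x) - F y) *\<^sub>R x \<partial>std_gaussian)"
    unfolding inner using i by (simp add: G.prob_space[simplified] del: scaleR_scaleR)
  finally show ?thesis .
qed

text \<open>By the symmetry of the Gaussian only the odd part \<open>a / 2\<close> of \<open>max 0 a\<close> contributes.\<close>

lemma gaussian_positive_part: "(\<integral>x. max 0 (x \<bullet> v) *\<^sub>R x \<partial>std_gaussian) = (1 / 2) *\<^sub>R (v::'a)"
proof -
  have i1: "integrable std_gaussian (\<lambda>x::'a. (x \<bullet> v) *\<^sub>R x)" and i2: "integrable std_gaussian (\<lambda>x::'a. \<bar>x \<bullet> v\<bar> *\<^sub>R x)"
    by (auto intro!: expb_integrable_gaussian expb_dominated[OF expb_mult[OF expb_mult[OF expb_norm_id expb_const[of "norm v"]] expb_norm_id]]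
         simp: Cauchy_Schwarz_ineq2 mult_right_mono)
  have "(\<integral>x. \<bar>(- x) \<bullet> v\<bar> *\<^sub>R (- x) \<partial>std_gaussian) = (\<integral>x. \<bar>x \<bullet> v\<bar> *\<^sub>R x \<partial>std_gaussian)"
    by (rule integral_gaussian_uminus) measurable
  then have 0: "(\<integral>x. \<bar>x \<bullet> v\<bar> *\<^sub>R x \<partial>std_gaussian) = 0"
    using i2 minus_eq_self_imp_zero by simp
  have "max 0 (x \<bullet> v) *\<^sub>R x = (1 / 2) *\<^sub>R ((x \<bullet> v) *\<^sub>R x) + (1 / 2) *\<^sub>R (\<bar>x \<bullet> v\<bar> *\<^sub>R x)" for x
    by (cases "x \<bullet> v \<ge> 0") (auto simp: scaleR_add_left[symmetric])
  then have "(\<integral>x. max 0 (x \<bullet> v) *\<^sub>R x \<partial>std_gaussian) = (1 / 2) *\<^sub>R (\<integral>x. (x \<bullet> v) *\<^sub>R x \<partial>std_gaussian)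
      + (1 / 2) *\<^sub>R (\<integral>x. \<bar>x \<bullet> v\<bar> *\<^sub>R x \<partial>std_gaussian)"
    using i1 i2 by (simp del: scaleR_scaleR)
  then show ?thesis by (simp add: 0 gaussian_covariance)
qed

text \<open>Only the finiteness of \<open>K1\<close>, \<open>K2\<close> and \<open>J\<close>
  matters, because they occur with powers of \<open>c\<close>, which becomes arbitrarily
  small.\<close>

definition K1 :: real where "K1 = 2 * moment 3 + L\<^sup>2 * moment 5 + L * moment 3"

lemma K1_nonneg: "K1 \<ge> 0"
  using moment_nonneg L_pos by (auto simp: K1_def)

text \<open>To first order the rejection probability is the positive part of \<open>a x\<close>, and
  by \<open>gaussian_positive_part\<close> its contribution cancels the drift term exactly. The
  second-order errors of \<open>clip\<close> and of the increment of \<open>F\<close> are of order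
  \<open>c\<^sup>2\<close>; the proposal itself supplies the third factor \<open>c\<close>.\<close>

lemma mean_defect_bound:
  assumes c: "0 < c" "c \<le> 1"
  shows "norm (mean_defect c y) \<le> c ^ 3 * K1 * (1 + (norm (grad F y))\<^sup>2)"
proof -
  let ?g = "grad F y"
  define s where "s = (\<lambda>x. F (y + c *\<^sub>R x) - F y)"
  define a where "a = (\<lambda>x. x \<bullet> (c *\<^sub>R ?g))"
  have [measurable]: "s \<in> borel_measurable borel" "a \<in> borel_measurable borel"
    unfolding s_def a_def by measurable
  have sa: "\<bar>s x - a x\<bar> \<le> L / 2 * c\<^sup>2 * (norm x)\<^sup>2" for x
    using F_increment[of y "c *\<^sub>R x"] by (simp add: s_def a_def power_mult_distrib inner_commute)
  have ab: "\<bar>a x\<bar> \<le> c * norm ?g * norm x" for x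
    using Cauchy_Schwarz_ineq2[of x "c *\<^sub>R ?g"] c by (simp add: a_def mult_ac)
  \<comment> \<open>A polynomial in \<open>norm x\<close> that dominates the integrand, so that only
    Gaussian moments of orders 3 and 5 enter.\<close>
  define w where "w = (\<lambda>r::real. 2 * c\<^sup>2 * (norm ?g)\<^sup>2 * r ^ 3 + L\<^sup>2 * c\<^sup>2 * r ^ 5 + L * c\<^sup>2 * r ^ 3)"
  have pw: "\<bar>clip (s x) - max 0 (a x)\<bar> * norm x \<le> w (norm x)" for x
  proof -
    have "\<bar>s x\<bar> \<le> c * norm ?g * norm x + L / 2 * c\<^sup>2 * (norm x)\<^sup>2"
      using sa[of x] ab[of x] by linarith
    then have "(s x)\<^sup>2 \<le> (c * norm ?g * norm x + L / 2 * c\<^sup>2 * (norm x)\<^sup>2)\<^sup>2"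
      by (metis abs_ge_zero power2_abs power_mono)
    also have "\<dots> \<le> 2 * (c * norm ?g * norm x)\<^sup>2 + 2 * (L / 2 * c\<^sup>2 * (norm x)\<^sup>2)\<^sup>2"
      using sum_squares_bound[of "c * norm ?g * norm x" "L / 2 * c\<^sup>2 * (norm x)\<^sup>2"]
      by (simp add: power2_sum)
    also have "\<dots> = 2 * c\<^sup>2 * (norm ?g)\<^sup>2 * (norm x)\<^sup>2 + L\<^sup>2 / 2 * (c\<^sup>2 * c\<^sup>2) * norm x ^ 4"
      by (simp add: power_mult_distrib power_divide power2_eq_square power4_eq_xxxx)
    also have "L\<^sup>2 / 2 * (c\<^sup>2 * c\<^sup>2) * norm x ^ 4 \<le> L\<^sup>2 * c\<^sup>2 * norm x ^ 4"
    proof -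
      have "c\<^sup>2 * c\<^sup>2 \<le> 1 * c\<^sup>2" using c by (intro mult_right_mono) (auto simp: power_le_one)
      then have "L\<^sup>2 * (c\<^sup>2 * c\<^sup>2) \<le> L\<^sup>2 * (1 * c\<^sup>2)" by (rule mult_left_mono) simp
      moreover have "0 \<le> L\<^sup>2 * (c\<^sup>2 * c\<^sup>2)" by simp
      ultimately have "L\<^sup>2 / 2 * (c\<^sup>2 * c\<^sup>2) \<le> L\<^sup>2 * c\<^sup>2" by linarith
      then show ?thesis by (intro mult_right_mono) auto
    qed
    finally have s2: "(s x)\<^sup>2 \<le> 2 * c\<^sup>2 * (norm ?g)\<^sup>2 * (norm x)\<^sup>2 + L\<^sup>2 * c\<^sup>2 * norm x ^ 4" by simp
    have "\<bar>clip (s x) - max 0 (a x)\<bar> \<le> \<bar>clip (s x) - max 0 (s x)\<bar> + \<bar>s x - a x\<bar>" by linarith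
    also have "\<dots> \<le> (s x)\<^sup>2 + L / 2 * c\<^sup>2 * (norm x)\<^sup>2" by (intro add_mono clip_approx sa)
    also have "\<dots> \<le> 2 * c\<^sup>2 * (norm ?g)\<^sup>2 * (norm x)\<^sup>2 + L\<^sup>2 * c\<^sup>2 * norm x ^ 4 + L * c\<^sup>2 * (norm x)\<^sup>2"
      using s2 L_pos by (intro add_mono mult_right_mono) auto
    finally have "\<bar>clip (s x) - max 0 (a x)\<bar> * norm x \<le> \<dots> * norm x" by (rule mult_right_mono) simp
    also have "\<dots> = w (norm x)" by (simp add: w_def algebra_simps eval_nat_numeral)
    finally show ?thesis .
  qed
  have i1: "integrable std_gaussian (\<lambda>x. clip (s x) *\<^sub>R x)"
  proof (rule expb_integrable_gaussian)
    show "expb (\<lambda>x. clip (s x) *\<^sub>R x)"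
      by (rule expb_dominated[OF expb_norm_id])
         (auto simp: clip_bounds intro!: mult_left_le_one_le)
    show "(\<lambda>x. clip (s x) *\<^sub>R x) \<in> borel_measurable borel"
      unfolding clip_def by measurable
  qed
  have i2: "integrable std_gaussian (\<lambda>x. max 0 (a x) *\<^sub>R x)"
  proof (rule expb_integrable_gaussian)
    show "expb (\<lambda>x. max 0 (a x) *\<^sub>R x)"
      by (rule expb_dominated[OF expb_mult[OF expb_mult[OF expb_const[of "c * norm ?g"] expb_norm_id] expb_norm_id]])
         (use ab c in \<open>auto simp: abs_mult max_def intro!: mult_right_mono abs_ge_self order_trans[OF _ abs_ge_self] order_trans[OF abs_ge_self ab]\<close>)
  qed measurable
  have mom: "integrable std_gaussian (\<lambda>x::'a. norm x ^ k)" for k by (rule integrable_gaussian_norm_power)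
  have "mean_defect c y = c *\<^sub>R ((\<integral>x. max 0 (a x) *\<^sub>R x \<partial>std_gaussian) - (\<integral>x. clip (s x) *\<^sub>R x \<partial>std_gaussian))"
    unfolding mean_defect_eq a_def s_def gaussian_positive_part
    by (simp add: scaleR_diff_right power2_eq_square)
  also have "\<dots> = c *\<^sub>R (\<integral>x. (max 0 (a x) - clip (s x)) *\<^sub>R x \<partial>std_gaussian)"
    using i1 i2 by (simp add: scaleR_diff_left)
  finally have "norm (mean_defect c y) = c * norm (\<integral>x. (max 0 (a x) - clip (s x)) *\<^sub>R x \<partial>std_gaussian)"
    using c by simp
  also have "\<dots> \<le> c * (\<integral>x. norm ((max 0 (a x) - clip (s x)) *\<^sub>R x) \<partial>std_gaussian)"
    using c by (intro mult_left_mono integral_norm_bound) auto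
  also have "\<dots> \<le> c * (\<integral>x. w (norm x) \<partial>(std_gaussian :: 'a measure))"
  proof (intro mult_left_mono integral_mono)
    show "integrable std_gaussian (\<lambda>x. norm ((max 0 (a x) - clip (s x)) *\<^sub>R x))"
      using i1 i2 by (intro integrable_norm) (simp add: scaleR_diff_left)
    show "integrable (std_gaussian :: 'a measure) (\<lambda>x. w (norm x))" unfolding w_def using mom by simp
    show "norm ((max 0 (a x) - clip (s x)) *\<^sub>R x) \<le> w (norm x)" for x
      using pw[of x] by (simp add: abs_minus_commute)
  qed (use c in auto)
  also have "(\<integral>x. w (norm x) \<partial>(std_gaussian :: 'a measure))
      = 2 * c\<^sup>2 * (norm ?g)\<^sup>2 * moment 3 + L\<^sup>2 * c\<^sup>2 * moment 5 + L * c\<^sup>2 * moment 3"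
    unfolding w_def moment_def using mom by simp
  also have "c * (2 * c\<^sup>2 * (norm ?g)\<^sup>2 * moment 3 + L\<^sup>2 * c\<^sup>2 * moment 5 + L * c\<^sup>2 * moment 3)
      = c ^ 3 * ((2 * moment 3) * (norm ?g)\<^sup>2 + (L\<^sup>2 * moment 5 + L * moment 3))"
    by (simp add: algebra_simps power2_eq_square power3_eq_cube)
  also have "\<dots> \<le> c ^ 3 * (K1 * (norm ?g)\<^sup>2 + K1)"
    using c moment_nonneg L_pos
    by (intro mult_left_mono add_mono mult_right_mono) (auto simp: K1_def)
  finally show ?thesis by (simp add: algebra_simps)
qed

definition K2 :: real where "K2 = 4 * moment 3 + L * moment 4 + 1"

lemma K2_nonneg: "K2 \<ge> 0"
  using moment_nonneg L_pos by (auto simp: K2_def)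

text \<open>A defect of size \<open>c\<close> occurs only on rejection, an event of probability of
  order \<open>c\<close>. This gives \<open>c ^ 3\<close>, just enough for about
  \<open>2 * h / c\<^sup>2\<close> steps to have vanishing total variance.\<close>

lemma defect_second_moment:
  assumes c: "0 < c" "c \<le> 1"
  shows "(\<integral>\<^sup>+ t. ennreal ((norm (defect c y t))\<^sup>2) \<partial>step_noise) \<le> ennreal (c ^ 3 * K2 * (1 + (norm (grad F y))\<^sup>2))"
proof -
  let ?g = "grad F y"
  have mom: "integrable std_gaussian (\<lambda>x::'a. norm x ^ k)" for k by (rule integrable_gaussian_norm_power)
  define w where "w = (\<lambda>r::real. 2 * c\<^sup>2 * r\<^sup>2 * (c * norm ?g * r + L / 2 * c\<^sup>2 * r\<^sup>2) + 2 * (c\<^sup>2 / 2)\<^sup>2 * (norm ?g)\<^sup>2)"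
  have step: "(\<integral>\<^sup>+ u. ennreal ((norm (defect c y (x, u)))\<^sup>2) \<partial>unit_uniform) \<le> ennreal (w (norm x))" for x
  proof -
    interpret U: prob_space unit_uniform by (rule prob_space_unit_uniform)
    let ?p = "exp (F y - F (y + c *\<^sub>R x))" and ?s = "F (y + c *\<^sub>R x) - F y"
    let ?B = "2 * (c\<^sup>2 / 2)\<^sup>2 * (norm ?g)\<^sup>2"
    have "(\<integral>\<^sup>+ u. ennreal ((norm (defect c y (x, u)))\<^sup>2) \<partial>unit_uniform)
        \<le> (\<integral>\<^sup>+ u. (if u \<le> ?p then ennreal ?B else ennreal (2 * c\<^sup>2 * (norm x)\<^sup>2 + ?B)) \<partial>unit_uniform)"
    proof (rule nn_integral_mono)
      fix u
      show "ennreal ((norm (defect c y (x, u)))\<^sup>2) \<le> (if u \<le> ?p then ennreal ?B else ennreal (2 * c\<^sup>2 * (norm x)\<^sup>2 + ?B))"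
      proof (cases "u \<le> ?p")
        case True
        have "(norm ((c\<^sup>2 / 2) *\<^sub>R ?g))\<^sup>2 = (c\<^sup>2 / 2)\<^sup>2 * (norm ?g)\<^sup>2" by (simp add: power_mult_distrib power_divide)
        also have "\<dots> \<le> ?B" by simp
        finally show ?thesis using True by (auto simp: defect_eq intro!: ennreal_leI)
      next
        case False
        have "(norm (- c *\<^sub>R x + (c\<^sup>2 / 2) *\<^sub>R ?g))\<^sup>2 \<le> 2 * (norm (- c *\<^sub>R x))\<^sup>2 + 2 * (norm ((c\<^sup>2 / 2) *\<^sub>R ?g))\<^sup>2"
          using norm_add_power2_weighted[of 1 "- c *\<^sub>R x" "(c\<^sup>2 / 2) *\<^sub>R ?g"] by simp
        also have "\<dots> = 2 * c\<^sup>2 * (norm x)\<^sup>2 + ?B" by (simp add: power_mult_distrib power_divide)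
        finally show ?thesis using False by (simp add: defect_eq ennreal_leI del: ennreal_plus)
      qed
    qed
    also have "\<dots> = ennreal (min 1 ?p) * ennreal ?B + ennreal (1 - min 1 ?p) * ennreal (2 * c\<^sup>2 * (norm x)\<^sup>2 + ?B)"
      by (rule nn_integral_accept) simp
    also have "\<dots> = ennreal (min 1 ?p * ?B + (1 - min 1 ?p) * (2 * c\<^sup>2 * (norm x)\<^sup>2 + ?B))"
      by (simp add: ennreal_mult[symmetric] ennreal_plus[symmetric] del: ennreal_plus)
    also have "min 1 ?p * ?B + (1 - min 1 ?p) * (2 * c\<^sup>2 * (norm x)\<^sup>2 + ?B) = 2 * c\<^sup>2 * (norm x)\<^sup>2 * clip ?s + ?B"
      by (simp add: clip_def algebra_simps)
    also have "\<dots> \<le> w (norm x)"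
    proof -
      have "clip ?s \<le> \<bar>?s\<bar>" by (rule clip_bounds)
      also have "\<bar>?s\<bar> \<le> c * norm ?g * norm x + L / 2 * c\<^sup>2 * (norm x)\<^sup>2"
      proof -
        have "\<bar>?g \<bullet> (c *\<^sub>R x)\<bar> \<le> c * norm ?g * norm x"
          using Cauchy_Schwarz_ineq2[of ?g "c *\<^sub>R x"] c by (simp add: mult_ac)
        moreover have "\<bar>?s - ?g \<bullet> (c *\<^sub>R x)\<bar> \<le> L / 2 * c\<^sup>2 * (norm x)\<^sup>2"
          using F_increment[of y "c *\<^sub>R x"] by (simp add: power_mult_distrib)
        ultimately show ?thesis by linarith
      qed
      finally show ?thesis unfolding w_def by (intro add_right_mono mult_left_mono) auto
    qed
    finally show ?thesis by (simp add: ennreal_leI)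
  qed
  have "(\<integral>\<^sup>+ t. ennreal ((norm (defect c y t))\<^sup>2) \<partial>step_noise)
      = (\<integral>\<^sup>+ x. \<integral>\<^sup>+ u. ennreal ((norm (defect c y (x, u)))\<^sup>2) \<partial>unit_uniform \<partial>std_gaussian)"
    by (rule nn_integral_step_noise) measurable
  also have "\<dots> \<le> (\<integral>\<^sup>+ x. ennreal (w (norm x)) \<partial>(std_gaussian :: 'a measure))"
    by (intro nn_integral_mono step)
  also have "\<dots> = ennreal (2 * c ^ 3 * norm ?g * moment 3 + L * c ^ 4 * moment 4 + 2 * (c\<^sup>2 / 2)\<^sup>2 * (norm ?g)\<^sup>2)"
  proof -
    have w: "w r = 2 * c ^ 3 * norm ?g * r ^ 3 + L * c ^ 4 * r ^ 4 + 2 * (c\<^sup>2 / 2)\<^sup>2 * (norm ?g)\<^sup>2" for r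
      by (simp add: w_def algebra_simps eval_nat_numeral)
    have nn: "0 \<le> w (norm x)" for x :: 'a unfolding w_def using c L_pos by auto
    have "(\<integral>\<^sup>+ x. ennreal (w (norm x)) \<partial>(std_gaussian :: 'a measure)) = ennreal (\<integral> x. w (norm x) \<partial>(std_gaussian :: 'a measure))"
      by (rule nn_integral_eq_integral) (use mom nn in \<open>auto simp: w\<close>)
    then show ?thesis unfolding w moment_def using mom by (simp add: G.prob_space[simplified])
  qed
  also have "\<dots> \<le> ennreal (c ^ 3 * K2 * (1 + (norm ?g)\<^sup>2))"
  proof (rule ennreal_leI)
    have g1: "norm ?g \<le> 1 + (norm ?g)\<^sup>2"
    proof -
      have "0 \<le> (norm ?g - 1/2)\<^sup>2" by simp
      then have "norm ?g \<le> (norm ?g)\<^sup>2 + (1/2)\<^sup>2" by (simp add: power2_diff)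
      then show ?thesis by (simp add: power2_eq_square)
    qed
    have c4: "c ^ 4 \<le> c ^ 3" using c by (intro power_decreasing) auto
    have "2 * c ^ 3 * norm ?g * moment 3 \<le> 2 * c ^ 3 * (1 + (norm ?g)\<^sup>2) * moment 3"
      using c g1 moment_nonneg by (intro mult_right_mono mult_left_mono) auto
    moreover have "L * c ^ 4 * moment 4 \<le> L * c ^ 3 * moment 4 * (1 + (norm ?g)\<^sup>2)"
    proof -
      have "L * c ^ 4 * moment 4 * 1 \<le> L * c ^ 3 * moment 4 * (1 + (norm ?g)\<^sup>2)"
        using c c4 L_pos moment_nonneg by (intro mult_mono) auto
      then show ?thesis by simp
    qed
    moreover have "2 * (c\<^sup>2 / 2)\<^sup>2 * (norm ?g)\<^sup>2 \<le> c ^ 3 * (1 + (norm ?g)\<^sup>2)"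
    proof -
      have "2 * (c\<^sup>2 / 2)\<^sup>2 = c ^ 4 / 2" by (simp add: power2_eq_square power4_eq_xxxx)
      also have "\<dots> \<le> c ^ 3" using c4 zero_le_power[of c 4] c by linarith
      finally show ?thesis using c by (intro mult_mono) auto
    qed
    moreover have "0 \<le> 2 * c ^ 3 * (1 + (norm ?g)\<^sup>2) * moment 3" using c moment_nonneg by auto
    ultimately show "2 * c ^ 3 * norm ?g * moment 3 + L * c ^ 4 * moment 4 + 2 * (c\<^sup>2 / 2)\<^sup>2 * (norm ?g)\<^sup>2
        \<le> c ^ 3 * K2 * (1 + (norm ?g)\<^sup>2)"
      by (simp add: K2_def algebra_simps)
  qed
  finally show ?thesis .
qed

definition J :: real where "J = (\<integral>y. (1 + (norm (grad F y))\<^sup>2)\<^sup>2 \<partial>gibbs F)"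

lemma J_nonneg: "J \<ge> 0" by (simp add: J_def)

lemma L2le_one_plus: "L2le (gibbs F) (\<lambda>y. 1 + (norm (grad F y))\<^sup>2) (sqrt J)"
proof (rule L2leI)
  have "integrable (gibbs F) (\<lambda>y. (1 + (norm (grad F y))\<^sup>2)\<^sup>2)"
    by (rule expb_integrable_gibbs) (auto intro!: expb_power expb_add expb_const expb_norm expb_grad)
  then show "integrable (gibbs F) (\<lambda>y. (norm (1 + (norm (grad F y))\<^sup>2))\<^sup>2)" by simp
qed (auto simp: J_def)

lemma L2le_mean_defect:
  assumes c: "0 < c" "c \<le> 1"
  shows "L2le (gibbs F) (mean_defect c) (c ^ 3 * K1 * sqrt J)"
proof (rule L2le_norm_bound)
  show "L2le (gibbs F) (\<lambda>y. (c ^ 3 * K1) *\<^sub>R (1 + (norm (grad F y))\<^sup>2)) (c ^ 3 * K1 * sqrt J)"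
    using L2le_scaleR[OF L2le_one_plus, of "c ^ 3 * K1"] c K1_nonneg by simp
qed (use mean_defect_bound[OF c] in auto)

lemma L2le_defect:
  assumes c: "0 < c" "c \<le> 1"
  shows "L2le (gibbs F \<Otimes>\<^sub>M step_noise) (\<lambda>(y, t). defect c y t) (sqrt (c ^ 3 * K2 * (1 + L * DIM('a))))"
proof -
  interpret T: prob_space "step_noise :: ('a \<times> real) measure" by (rule prob_space_step_noise)
  interpret \<pi>: prob_space "gibbs F" by (rule prob_space_gibbs)
  have g: "integrable (gibbs F) (\<lambda>y. (norm (grad F y))\<^sup>2)" "(\<integral>y. (norm (grad F y))\<^sup>2 \<partial>gibbs F) \<le> L * DIM('a)"
    using L2le_integrable[OF L2le_grad] L_pos by simp_all
  have "(\<integral>\<^sup>+ z. ennreal ((norm (defect c (fst z) (snd z)))\<^sup>2) \<partial>(gibbs F \<Otimes>\<^sub>M step_noise))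
      = (\<integral>\<^sup>+ y. \<integral>\<^sup>+ t. ennreal ((norm (defect c y t))\<^sup>2) \<partial>step_noise \<partial>gibbs F)"
    by (subst T.nn_integral_fst[symmetric]) auto
  also have "\<dots> \<le> (\<integral>\<^sup>+ y. ennreal (c ^ 3 * K2 * (1 + (norm (grad F y))\<^sup>2)) \<partial>gibbs F)"
    by (intro nn_integral_mono defect_second_moment c)
  also have "\<dots> = ennreal (\<integral> y. c ^ 3 * K2 * (1 + (norm (grad F y))\<^sup>2) \<partial>gibbs F)"
    using g c K2_nonneg by (intro nn_integral_eq_integral) auto
  also have "\<dots> \<le> ennreal (c ^ 3 * K2 * (1 + L * DIM('a)))"
    using g c K2_nonneg by (intro ennreal_leI) (auto simp: \<pi>.prob_space[simplified] intro!: mult_left_mono)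
  finally show ?thesis using c K2_nonneg L_pos unfolding L2le_def
    by (auto simp: split_beta')
qed

definition grad_drift :: "real \<Rightarrow> 'a \<Rightarrow> 'a" where
  "grad_drift c y = (\<integral>t. grad F (rwm c y t) - grad F y \<partial>step_noise)"

lemma grad_drift_integrable: "integrable step_noise (\<lambda>t. grad F (rwm c y t) - grad F y)"
proof (rule Bochner_Integration.integrable_bound)
  show "integrable step_noise (\<lambda>t. L * (\<bar>c\<bar> * norm (fst t :: 'a)))"
    by (rule integrable_step_noise_fst) (auto intro!: expb_mult expb_const expb_norm_id)
  have "norm (grad F (rwm c y t) - grad F y) \<le> L * (\<bar>c\<bar> * norm (fst t))" for t
    using order_trans[OF grad_lipschitz[of "rwm c y t" y] mult_left_mono[OF rwm_increment[of c y t], of L]] L_pos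
    by linarith
  then show "AE t in step_noise. norm (grad F (rwm c y t) - grad F y) \<le> norm (L * (\<bar>c\<bar> * norm (fst t)))"
    using L_pos by (auto simp: abs_mult)
qed measurable

lemma grad_drift_measurable [measurable]: "grad_drift c \<in> borel_measurable borel"
proof -
  interpret T: prob_space "step_noise :: ('a \<times> real) measure" by (rule prob_space_step_noise)
  show ?thesis unfolding grad_drift_def by (rule T.borel_measurable_lebesgue_integral) measurable
qed

text \<open>The first-order term is the Hessian applied to the mean displacement, in which the
  Gaussian proposal averages out; what is left of it is \<open>mean_defect\<close> and the drift.
  The Taylor remainder costs \<open>K * c\<^sup>2\<close> times the second Gaussian moment. The mean
  change is thus of order \<open>c\<^sup>2\<close>, although a single change is of order
  \<open>c\<close>.\<close>

lemma grad_drift_bound: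
  assumes c: "0 < c" and H: "twice_cont_diff F" "smooth_hessian K F" "K \<ge> 0"
  shows "norm (grad_drift c y) \<le> L * (norm (mean_defect c y) + c\<^sup>2 / 2 * norm (grad F y)) + K * c\<^sup>2 * DIM('a)"
proof -
  interpret T: prob_space "step_noise :: ('a \<times> real) measure" by (rule prob_space_step_noise)
  let ?H = "blinfun_apply (hessian F y)"
  define q where "q = (\<lambda>t. rwm c y t - y)"
  have fst_int: "integrable step_noise (\<lambda>t. fst t :: 'a)" "(\<integral>t. fst t \<partial>step_noise) = (0 :: 'a)"
    by (rule integrable_step_noise step_noise_mean)+
  have q_eq: "q t = defect c y t + c *\<^sub>R fst t - (c\<^sup>2 / 2) *\<^sub>R grad F y" for t
    by (simp add: q_def defect_def)
  have q_int: "integrable step_noise q" unfolding q_eq using fst_int defect_integrable by simp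
  have q_mean: "(\<integral>t. q t \<partial>step_noise) = mean_defect c y - (c\<^sup>2 / 2) *\<^sub>R grad F y"
    unfolding q_eq mean_defect_def using fst_int defect_integrable by (simp add: T.prob_space[simplified])
  define \<rho> where "\<rho> = (\<lambda>t. grad F (rwm c y t) - grad F y - ?H (q t))"
  have \<rho>_int: "integrable step_noise \<rho>"
    unfolding \<rho>_def
    by (rule Bochner_Integration.integrable_diff[OF grad_drift_integrable
        integrable_bounded_linear[OF blinfun.bounded_linear_right q_int]])
  have sq: "integrable step_noise (\<lambda>t. (norm (fst t :: 'a))\<^sup>2)" "(\<integral>t. (norm (fst t :: 'a))\<^sup>2 \<partial>step_noise) \<le> DIM('a)"
    using L2le_integrable[OF L2le_step_noise_fst] by simp_all
  have \<rho>_le: "norm (\<rho> t) \<le> K * c\<^sup>2 * (norm (fst t))\<^sup>2" for t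
  proof -
    have "norm (\<rho> t) \<le> K * (norm (q t))\<^sup>2"
      using grad_taylor[OF H, of y "q t"] by (simp add: \<rho>_def q_def)
    also have "\<dots> \<le> K * (\<bar>c\<bar> * norm (fst t))\<^sup>2"
      using H(3) rwm_increment[of c y t] by (intro mult_left_mono power_mono) (auto simp: q_def)
    finally show ?thesis by (simp add: power_mult_distrib mult.assoc)
  qed
  have "grad_drift c y = (\<integral>t. ?H (q t) + \<rho> t \<partial>step_noise)" by (simp add: grad_drift_def \<rho>_def)
  also have "\<dots> = ?H (\<integral>t. q t \<partial>step_noise) + (\<integral>t. \<rho> t \<partial>step_noise)"
    using q_int \<rho>_int integral_bounded_linear[OF blinfun.bounded_linear_right q_int, of "hessian F y"]
      integrable_bounded_linear[OF blinfun.bounded_linear_right q_int, of "hessian F y"]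
    by simp
  finally have "norm (grad_drift c y) \<le> norm (?H (\<integral>t. q t \<partial>step_noise)) + norm (\<integral>t. \<rho> t \<partial>step_noise)"
    by (simp add: norm_triangle_ineq)
  also have "norm (?H (\<integral>t. q t \<partial>step_noise)) \<le> L * (norm (mean_defect c y) + c\<^sup>2 / 2 * norm (grad F y))"
  proof -
    have "norm (?H (\<integral>t. q t \<partial>step_noise)) \<le> L * norm (\<integral>t. q t \<partial>step_noise)"
      by (rule hessian_bound[OF H smooth_F])
    also have "norm (\<integral>t. q t \<partial>step_noise) \<le> norm (mean_defect c y) + c\<^sup>2 / 2 * norm (grad F y)"
      unfolding q_mean using norm_triangle_ineq4[of "mean_defect c y" "(c\<^sup>2 / 2) *\<^sub>R grad F y"] by simp
    finally show ?thesis using L_pos by simp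
  qed
  also have "norm (\<integral>t. \<rho> t \<partial>step_noise) \<le> (\<integral>t. norm (\<rho> t) \<partial>step_noise)" by (rule integral_norm_bound)
  also have "\<dots> \<le> (\<integral>t. K * c\<^sup>2 * (norm (fst t :: 'a))\<^sup>2 \<partial>step_noise)"
    using \<rho>_int sq \<rho>_le by (intro integral_mono) auto
  also have "\<dots> \<le> K * c\<^sup>2 * DIM('a)" using sq H(3) by (simp add: mult_left_mono)
  finally show ?thesis by simp
qed

lemma L2le_grad_drift:
  assumes c: "0 < c" "c \<le> 1" and H: "twice_cont_diff F" "smooth_hessian K F" "K \<ge> 0"
  shows "L2le (gibbs F) (grad_drift c)
    (L * (c ^ 3 * K1 * sqrt J + c\<^sup>2 / 2 * sqrt (L * DIM('a))) + K * c\<^sup>2 * DIM('a))"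
proof -
  interpret \<pi>: prob_space "gibbs F" by (rule prob_space_gibbs)
  have const: "L2le (gibbs F) (\<lambda>y. K * c\<^sup>2 * DIM('a)) (K * c\<^sup>2 * DIM('a))"
    using H(3) by (intro L2leI) (auto simp: \<pi>.prob_space[simplified])
  have g: "L2le (gibbs F) (\<lambda>y. (c\<^sup>2 / 2) *\<^sub>R norm (grad F y)) (c\<^sup>2 / 2 * sqrt (L * DIM('a)))"
    using L2le_scaleR[OF L2le_norm[OF L2le_grad], of "c\<^sup>2 / 2"] by simp
  have "L2le (gibbs F) (\<lambda>y. L *\<^sub>R (norm (mean_defect c y) + (c\<^sup>2 / 2) *\<^sub>R norm (grad F y)) + K * c\<^sup>2 * DIM('a))
     (\<bar>L\<bar> * (c ^ 3 * K1 * sqrt J + c\<^sup>2 / 2 * sqrt (L * DIM('a))) + K * c\<^sup>2 * DIM('a))"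
    by (intro L2le_add L2le_scaleR const g L2le_norm L2le_mean_defect c)
  then show ?thesis
    using grad_drift_bound[OF c(1) H] L_pos by (intro L2le_norm_bound[where f="grad_drift c"]) auto
qed

end

section \<open>The Metropolis chain as a discrete Langevin flow\<close>

definition noise_seq :: "(nat \<Rightarrow> 'a::euclidean_space \<times> real) measure" where
  "noise_seq = PiM UNIV (\<lambda>_. step_noise)"

lemma prob_space_noise_seq: "prob_space noise_seq"
  unfolding noise_seq_def by (intro prob_space_PiM prob_space_step_noise)

lemma resampling_noise_seq: "resampling noise_seq step_noise (\<lambda>w t. w(i := t))"
  unfolding noise_seq_def by (rule resampling_PiM) (rule prob_space_step_noise)

lemma space_noise_seq [simp]: "space noise_seq = UNIV"
  by (simp add: noise_seq_def space_PiM PiE_UNIV_domain)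

lemma noise_seq_component [measurable]: "(\<lambda>w. w i) \<in> measurable noise_seq step_noise"
  unfolding noise_seq_def by measurable

lemma noise_seq_component_borel [measurable]: "(\<lambda>w. w i) \<in> measurable noise_seq (borel \<Otimes>\<^sub>M borel)"
  using noise_seq_component measurable_cong_sets[OF refl sets_step_noise] by blast

lemma distr_noise_seq_component: "distr noise_seq step_noise (\<lambda>w. w i) = step_noise"
  unfolding noise_seq_def by (rule distr_PiM_component) (auto intro: prob_space_step_noise)

lemma integrable_noise_seq_component: "integrable noise_seq (\<lambda>w. fst (w i) :: 'a::euclidean_space)"
proof -
  have "integrable (distr noise_seq step_noise (\<lambda>w. w i)) (\<lambda>t. fst t :: 'a)"
    unfolding distr_noise_seq_component by (rule integrable_step_noise)
  then show ?thesis by (subst (asm) integrable_distr_eq) auto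
qed

definition normalized_sum :: "nat \<Rightarrow> (nat \<Rightarrow> 'a::euclidean_space \<times> real) \<Rightarrow> 'a" where
  "normalized_sum k w = (1 / sqrt (real k)) *\<^sub>R (\<Sum>j<k. fst (w j))"

lemma normalized_sum_measurable [measurable]: "normalized_sum k \<in> borel_measurable noise_seq"
  unfolding normalized_sum_def by measurable

lemma normalized_sum_integrable: "integrable noise_seq (normalized_sum k :: _ \<Rightarrow> 'a::euclidean_space)"
  unfolding normalized_sum_def
  by (intro integrable_scaleR_right Bochner_Integration.integrable_sum integrable_noise_seq_component)

text \<open>Stability of the Gaussian by induction: the next normalized sum is \<open>b\<close>
  times the previous one plus \<open>a\<close> times an independent Gaussian with
  \<open>a\<^sup>2 + b\<^sup>2 = 1\<close>, and \<open>gaussian_rotation\<close> applies.\<close>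

lemma distr_normalized_sum:
  assumes "k > 0"
  shows "distr noise_seq borel (normalized_sum k) = (std_gaussian :: 'a::euclidean_space measure)"
  using assms
proof (induction k)
  case (Suc k)
  show ?case
  proof (cases "k = 0")
    case True
    have "normalized_sum (Suc k) = (\<lambda>w. fst (w 0 :: 'a \<times> real))"
      by (simp add: True normalized_sum_def fun_eq_iff)
    then have "distr noise_seq borel (normalized_sum (Suc k)) = distr (distr noise_seq step_noise (\<lambda>w. w 0)) borel (fst :: 'a \<times> real \<Rightarrow> 'a)"
      by (subst distr_distr) (auto simp: o_def)
    then show ?thesis by (simp add: distr_noise_seq_component distr_step_noise_fst)
  next
    case False
    define a b where "a = 1 / sqrt (real (Suc k))" and "b = sqrt (real k) / sqrt (real (Suc k))"
    have ab: "a\<^sup>2 + b\<^sup>2 = 1" "b \<noteq> 0"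
      using False by (simp_all add: a_def b_def power_divide add_divide_distrib[symmetric])
    have ns: "normalized_sum (Suc k) w = b *\<^sub>R normalized_sum k w + a *\<^sub>R fst (w k)" for w :: "nat \<Rightarrow> 'a \<times> real"
      using False by (simp add: normalized_sum_def a_def b_def scaleR_add_right)
    interpret T: prob_space "step_noise :: ('a \<times> real) measure" by (rule prob_space_step_noise)
    have joint: "distr noise_seq (borel \<Otimes>\<^sub>M step_noise) (\<lambda>w. (normalized_sum k w, w k))
        = (std_gaussian :: 'a measure) \<Otimes>\<^sub>M step_noise"
      using resampling_joint_law[OF resampling_noise_seq[of k], of "normalized_sum k :: _ \<Rightarrow> 'a" borel "\<lambda>w. w k"]
        Suc.IH False by (simp add: normalized_sum_def)
    show ?thesis
    proof (rule measure_eqI)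
      fix A assume "A \<in> sets (distr noise_seq borel (normalized_sum (Suc k) :: _ \<Rightarrow> 'a))"
      then have [measurable]: "A \<in> sets borel" by simp
      have "emeasure (distr noise_seq borel (normalized_sum (Suc k))) A
          = (\<integral>\<^sup>+ w. indicator A (b *\<^sub>R normalized_sum k w + a *\<^sub>R fst (w k)) \<partial>noise_seq)"
        by (subst nn_integral_indicator[symmetric], simp, subst nn_integral_distr) (auto simp: ns)
      also have "\<dots> = (\<integral>\<^sup>+ z. indicator A (b *\<^sub>R fst z + a *\<^sub>R fst (snd z))
          \<partial>distr noise_seq (borel \<Otimes>\<^sub>M step_noise) (\<lambda>w. (normalized_sum k w, w k)))"
        by (subst nn_integral_distr) auto
      also have "\<dots> = (\<integral>\<^sup>+ x. \<integral>\<^sup>+ t. indicator A (b *\<^sub>R x + a *\<^sub>R fst t) \<partial>step_noise \<partial>std_gaussian)"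
        unfolding joint by (subst T.nn_integral_fst[symmetric]) auto
      also have "\<dots> = (\<integral>\<^sup>+ x. \<integral>\<^sup>+ y. indicator A (b *\<^sub>R x + a *\<^sub>R y) \<partial>std_gaussian \<partial>std_gaussian)"
      proof (rule nn_integral_cong)
        fix x
        have "(\<integral>\<^sup>+ t. indicator A (b *\<^sub>R x + a *\<^sub>R fst t) \<partial>step_noise)
            = (\<integral>\<^sup>+ y. indicator A (b *\<^sub>R x + a *\<^sub>R y) \<partial>distr step_noise borel fst)"
          by (subst nn_integral_distr) auto
        then show "(\<integral>\<^sup>+ t. indicator A (b *\<^sub>R x + a *\<^sub>R fst t) \<partial>step_noise)
            = (\<integral>\<^sup>+ y. indicator A (b *\<^sub>R x + a *\<^sub>R y) \<partial>std_gaussian)"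
          unfolding distr_step_noise_fst .
      qed
      also have "\<dots> = (\<integral>\<^sup>+ z. indicator A (b *\<^sub>R fst z + a *\<^sub>R snd z) \<partial>(std_gaussian \<Otimes>\<^sub>M std_gaussian))"
        by (subst G.nn_integral_fst[symmetric]) auto
      also have "\<dots> = (\<integral>\<^sup>+ z. indicator A z \<partial>std_gaussian)"
        by (rule gaussian_rotation[OF _ ab]) measurable
      finally show "emeasure (distr noise_seq borel (normalized_sum (Suc k))) A = emeasure std_gaussian A" by simp
    qed simp
  qed
qed simp

context convex_potential
begin

primrec chain :: "real \<Rightarrow> nat \<Rightarrow> 'a \<Rightarrow> (nat \<Rightarrow> 'a \<times> real) \<Rightarrow> 'a" where
  "chain c 0 y w = y"
| "chain c (Suc i) y w = rwm c (chain c i y w) (w i)"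

text \<open>Adaptedness of the chain to its noises, in the form required by resampling.\<close>

lemma chain_upd: "i \<le> j \<Longrightarrow> chain c i y (w(j := t)) = chain c i y w"
  by (induction i) auto

lemma chain_measurable [measurable]: "(\<lambda>(y, w). chain c i y w) \<in> borel_measurable (borel \<Otimes>\<^sub>M noise_seq)"
proof (induction i)
  case (Suc i)
  note [measurable] = Suc.IH
  show ?case by simp measurable
qed simp

abbreviation "\<Omega> \<equiv> gibbs F \<Otimes>\<^sub>M (noise_seq :: (nat \<Rightarrow> 'a \<times> real) measure)"

lemma resampling_\<Omega>: "resampling \<Omega> step_noise (\<lambda>z t. (fst z, (snd z)(i := t)))"
  by (rule resampling_pair[OF resampling_noise_seq prob_space_gibbs])

lemma \<Omega>_chain_measurable [measurable]: "(\<lambda>z. chain c i (fst z) (snd z)) \<in> borel_measurable \<Omega>"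
  using chain_measurable[of c i] by (simp add: split_beta' cong: measurable_cong_sets)

lemma \<Omega>_component_measurable [measurable]: "(\<lambda>z. snd z i) \<in> measurable \<Omega> step_noise"
  by measurable

text \<open>The marginal law is a hypothesis because the lemma serves inside the induction that
  establishes it.\<close>

lemma chain_joint_law':
  assumes "distr \<Omega> borel (\<lambda>z. chain c i (fst z) (snd z)) = gibbs F"
  shows "distr \<Omega> (borel \<Otimes>\<^sub>M step_noise) (\<lambda>z. (chain c i (fst z) (snd z), snd z i)) = gibbs F \<Otimes>\<^sub>M step_noise"
  using resampling_joint_law[OF resampling_\<Omega>[of i], of "\<lambda>z. chain c i (fst z) (snd z)" borel "\<lambda>z. snd z i"] assms
  by (simp add: chain_upd)

lemma chain_law: "distr \<Omega> borel (\<lambda>z. chain c i (fst z) (snd z)) = gibbs F"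
proof (induction i)
  case 0
  interpret W: prob_space "noise_seq :: (nat \<Rightarrow> 'a \<times> real) measure" by (rule prob_space_noise_seq)
  have "distr \<Omega> borel fst = distr \<Omega> (gibbs F) fst" by (rule distr_cong) auto
  then show ?case by (simp add: W.distr_pair_fst)
next
  case (Suc i)
  have "distr \<Omega> borel (\<lambda>z. chain c (Suc i) (fst z) (snd z))
      = distr (distr \<Omega> (borel \<Otimes>\<^sub>M step_noise) (\<lambda>z. (chain c i (fst z) (snd z), snd z i))) borel (\<lambda>(y, t). rwm c y t)"
    by (subst distr_distr) (auto simp: o_def)
  also have "\<dots> = gibbs F" unfolding chain_joint_law'[OF Suc.IH] by (rule rwm_stationary)
  finally show ?case .
qed

lemmas chain_joint_law = chain_joint_law'[OF chain_law]

lemma L2le_chain: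
  assumes "L2le (gibbs F) f a"
  shows "L2le \<Omega> (\<lambda>z. f (chain c i (fst z) (snd z))) a"
  using assms by (subst (asm) chain_law[symmetric], subst (asm) L2le_distr) auto

lemma L2le_chain_noise:
  assumes "L2le (gibbs F \<Otimes>\<^sub>M step_noise) (\<lambda>(y, t). f y t) a"
  shows "L2le \<Omega> (\<lambda>z. f (chain c i (fst z) (snd z)) (snd z i)) a"
  using assms by (subst (asm) chain_joint_law[symmetric], subst (asm) L2le_distr) auto

text \<open>The martingale part of the defect: its conditional mean given the state before the step
  is subtracted.\<close>

definition fluctuation :: "real \<Rightarrow> nat \<Rightarrow> 'a \<times> (nat \<Rightarrow> 'a \<times> real) \<Rightarrow> 'a" where
  "fluctuation c i z = defect c (chain c i (fst z) (snd z)) (snd z i) - mean_defect c (chain c i (fst z) (snd z))"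

text \<open>Bounds for the conditional mean (\<open>r1\<close>) and the martingale part
  (\<open>r2\<close>) of one defect, of orders \<open>c ^ 3\<close> and \<open>c\<close> to the
  power 3/2. Over \<open>m = 2 * h / c\<^sup>2\<close> steps they accumulate to
  \<open>m * r1\<close> and \<open>sqrt m * r2\<close>, and both tend to \<open>0\<close> with
  \<open>c\<close>.\<close>

definition r1 :: "real \<Rightarrow> real" where "r1 c = c ^ 3 * K1 * sqrt J"
definition r2 :: "real \<Rightarrow> real" where "r2 c = sqrt (c ^ 3 * K2 * (1 + L * DIM('a))) + r1 c"

lemma r_nonneg: "0 \<le> c \<Longrightarrow> 0 \<le> r1 c" "0 \<le> c \<Longrightarrow> 0 \<le> r2 c"
  using K1_nonneg K2_nonneg J_nonneg L_pos by (auto simp: r1_def r2_def)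

lemma L2le_fluctuation:
  assumes "0 < c" "c \<le> 1"
  shows "L2le \<Omega> (fluctuation c i) (r2 c)"
  unfolding fluctuation_def r2_def r1_def
  by (intro L2le_diff L2le_chain_noise L2le_chain L2le_defect L2le_mean_defect assms)

lemma L2le_fluctuation_sum:
  assumes c: "0 < c" "c \<le> 1"
  shows "L2le \<Omega> (\<lambda>z. \<Sum>i<k. fluctuation c i z) (sqrt (real k) * r2 c)"
proof (rule L2le_orthogonal_sum)
  fix i
  interpret T: prob_space "step_noise :: ('a \<times> real) measure" by (rule prob_space_step_noise)
  show "(\<integral>z. (\<Sum>j<i. fluctuation c j z) \<bullet> fluctuation c i z \<partial>\<Omega>) = 0"
  proof (rule resampling_orthogonal[OF resampling_\<Omega>[of i] L2le_sum[OF L2le_fluctuation[OF c]] L2le_fluctuation[OF c]])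
    show "(\<Sum>j<i. fluctuation c j (fst z, (snd z)(i := t))) = (\<Sum>j<i. fluctuation c j z)" for z t
      by (intro sum.cong) (auto simp: fluctuation_def chain_upd)
    show "integrable step_noise (\<lambda>t. fluctuation c i (fst z, (snd z)(i := t)))" for z
      by (simp add: fluctuation_def chain_upd defect_integrable)
    show "(\<integral>t. fluctuation c i (fst z, (snd z)(i := t)) \<partial>step_noise) = 0" for z
      by (simp add: fluctuation_def chain_upd defect_integrable mean_defect_def T.prob_space[simplified])
  qed
qed (rule L2le_fluctuation[OF c])

lemma L2le_noise_sum: "L2le \<Omega> (\<lambda>z. \<Sum>i<k. fst (snd z i)) (sqrt (real k) * sqrt DIM('a))"
proof (rule L2le_orthogonal_sum)
  have n: "L2le \<Omega> (\<lambda>z. fst (snd z i)) (sqrt DIM('a))" for i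
    by (rule L2le_chain_noise[of "\<lambda>y t. fst t" _ 0 i, simplified])
       (use L2le_snd[OF prob_space_gibbs prob_space_step_noise L2le_step_noise_fst] in \<open>simp add: split_beta'\<close>)
  then show "L2le \<Omega> (\<lambda>z. fst (snd z i)) (sqrt DIM('a))" for i .
  fix i
  show "(\<integral>z. (\<Sum>j<i. fst (snd z j)) \<bullet> fst (snd z i) \<partial>\<Omega>) = 0"
    by (rule resampling_orthogonal[OF resampling_\<Omega>[of i] L2le_sum[OF n] n])
       (auto simp: integrable_step_noise step_noise_mean intro!: sum.cong)
qed

definition total_defect :: "real \<Rightarrow> nat \<Rightarrow> 'a \<times> (nat \<Rightarrow> 'a \<times> real) \<Rightarrow> 'a" where
  "total_defect c k z = (\<Sum>i<k. defect c (chain c i (fst z) (snd z)) (snd z i))"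

lemma L2le_total_defect:
  assumes c: "0 < c" "c \<le> 1" and k: "k \<le> m"
  shows "L2le \<Omega> (total_defect c k) (sqrt (real m) * r2 c + real m * r1 c)"
proof (rule L2le_mono)
  have "L2le \<Omega> (\<lambda>z. (\<Sum>i<k. fluctuation c i z) + (\<Sum>i<k. mean_defect c (chain c i (fst z) (snd z))))
      (sqrt (real k) * r2 c + (\<Sum>i<k. r1 c))"
    unfolding r1_def by (intro L2le_add L2le_fluctuation_sum L2le_sum L2le_chain L2le_mean_defect c)
  then show "L2le \<Omega> (total_defect c k) (sqrt (real k) * r2 c + (\<Sum>i<k. r1 c))"
    unfolding total_defect_def[abs_def] by (simp add: fluctuation_def sum_subtractf)
  show "sqrt (real k) * r2 c + (\<Sum>i<k. r1 c) \<le> sqrt (real m) * r2 c + real m * r1 c"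
    using k r_nonneg[of c] c by (auto intro!: add_mono mult_right_mono)
qed

lemma chain_decomposition:
  "chain c k (fst z) (snd z) = fst z + c *\<^sub>R (\<Sum>i<k. fst (snd z i))
     - (c\<^sup>2 / 2) *\<^sub>R (\<Sum>i<k. grad F (chain c i (fst z) (snd z))) + total_defect c k z"
proof (induction k)
  case (Suc k)
  have "chain c (Suc k) (fst z) (snd z) = chain c k (fst z) (snd z) + c *\<^sub>R fst (snd z k)
      - (c\<^sup>2 / 2) *\<^sub>R grad F (chain c k (fst z) (snd z)) + defect c (chain c k (fst z) (snd z)) (snd z k)"
    by (simp add: defect_def)
  then show ?case by (simp add: Suc.IH total_defect_def scaleR_add_right algebra_simps)
qed (simp add: total_defect_def)

lemma L2le_displacement:
  assumes c: "0 < c" "c \<le> 1" and k: "k \<le> m"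
  shows "L2le \<Omega> (\<lambda>z. chain c k (fst z) (snd z) - fst z)
    (c * sqrt (real m) * sqrt DIM('a) + c\<^sup>2 / 2 * real m * sqrt (L * DIM('a)) + (sqrt (real m) * r2 c + real m * r1 c))"
proof (rule L2le_mono)
  have "L2le \<Omega> (\<lambda>z. c *\<^sub>R (\<Sum>i<k. fst (snd z i)) - (c\<^sup>2 / 2) *\<^sub>R (\<Sum>i<k. grad F (chain c i (fst z) (snd z))) + total_defect c k z)
     (\<bar>c\<bar> * (sqrt (real k) * sqrt DIM('a)) + \<bar>c\<^sup>2 / 2\<bar> * (\<Sum>i<k. sqrt (L * DIM('a))) + (sqrt (real m) * r2 c + real m * r1 c))"
    by (intro L2le_add L2le_diff L2le_scaleR L2le_noise_sum L2le_sum L2le_chain L2le_grad L2le_total_defect c k)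
  then show "L2le \<Omega> (\<lambda>z. chain c k (fst z) (snd z) - fst z)
     (\<bar>c\<bar> * (sqrt (real k) * sqrt DIM('a)) + \<bar>c\<^sup>2 / 2\<bar> * (\<Sum>i<k. sqrt (L * DIM('a))) + (sqrt (real m) * r2 c + real m * r1 c))"
    by (rule L2le_cong) (subst chain_decomposition[of c k], simp)
  have "c * (sqrt (real k) * sqrt DIM('a)) \<le> c * sqrt (real m) * sqrt DIM('a)"
    using k c by (simp add: mult.assoc mult_right_mono)
  moreover have "c\<^sup>2 / 2 * (real k * sqrt (L * DIM('a))) \<le> c\<^sup>2 / 2 * real m * sqrt (L * DIM('a))"
    using k L_pos by (simp add: mult.assoc mult_left_mono mult_right_mono)
  ultimately have "c * (sqrt (real k) * sqrt DIM('a)) + c\<^sup>2 / 2 * (real k * sqrt (L * DIM('a))) + (sqrt (real m) * r2 c + real m * r1 c)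
      \<le> c * sqrt (real m) * sqrt DIM('a) + c\<^sup>2 / 2 * real m * sqrt (L * DIM('a)) + (sqrt (real m) * r2 c + real m * r1 c)"
    by linarith
  then show "\<bar>c\<bar> * (sqrt (real k) * sqrt DIM('a)) + \<bar>c\<^sup>2 / 2\<bar> * (\<Sum>i<k. sqrt (L * DIM('a))) + (sqrt (real m) * r2 c + real m * r1 c)
      \<le> c * sqrt (real m) * sqrt DIM('a) + c\<^sup>2 / 2 * real m * sqrt (L * DIM('a)) + (sqrt (real m) * r2 c + real m * r1 c)"
    using c by simp
qed

text \<open>A pathwise bound: it yields integrability at every fixed starting point, where the L2
  bounds speak only of the average over starting points.\<close>

lemma chain_displacement_bound: "norm (chain c k y w - y) \<le> \<bar>c\<bar> * (\<Sum>i<k. norm (fst (w i)))"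
proof (induction k)
  case (Suc k)
  have "chain c (Suc k) y w - y = (rwm c (chain c k y w) (w k) - chain c k y w) + (chain c k y w - y)" by simp
  then have "norm (chain c (Suc k) y w - y) \<le> \<bar>c\<bar> * norm (fst (w k)) + norm (chain c k y w - y)"
    using rwm_increment[of c "chain c k y w" "w k"] norm_triangle_ineq by (smt (verit))
  with Suc.IH show ?case by (simp add: algebra_simps)
qed simp

lemma chain_measurable_fixed [measurable]: "(\<lambda>w. chain c k y w) \<in> borel_measurable noise_seq"
  using measurable_compose[OF _ chain_measurable[of c k], of "\<lambda>w. (y, w)" noise_seq] by simp

lemma chain_displacement_integrable: "integrable noise_seq (\<lambda>w. chain c k y w - y)"
proof (rule Bochner_Integration.integrable_bound)
  show "integrable noise_seq (\<lambda>w. \<bar>c\<bar> * (\<Sum>i<k. norm (fst (w i) :: 'a)))"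
    by (intro integrable_mult_right Bochner_Integration.integrable_sum integrable_norm integrable_noise_seq_component)
  show "AE w in noise_seq. norm (chain c k y w - y) \<le> norm (\<bar>c\<bar> * (\<Sum>i<k. norm (fst (w i))))"
    using chain_displacement_bound by (auto simp: abs_mult sum_nonneg)
qed measurable

lemma chain_grad_increment_integrable: "integrable noise_seq (\<lambda>w. grad F (chain c k y w) - grad F y)"
proof (rule Bochner_Integration.integrable_bound)
  show "integrable noise_seq (\<lambda>w. L * norm (chain c k y w - y))"
    by (intro integrable_mult_right integrable_norm chain_displacement_integrable)
  show "AE w in noise_seq. norm (grad F (chain c k y w) - grad F y) \<le> norm (L * norm (chain c k y w - y))"
    using grad_lipschitz L_pos by (auto simp: abs_mult)
qed measurable

text \<open>The increment telescopes over the steps, and resampling the noise of step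
  \<open>i\<close> replaces each term by its conditional mean.\<close>

lemma chain_grad_increment_mean:
  "(\<integral>w. grad F (chain c k y w) - grad F y \<partial>noise_seq) = (\<Sum>i<k. \<integral>w. grad_drift c (chain c i y w) \<partial>noise_seq)"
proof -
  let ?g = "\<lambda>i w. grad F (chain c (Suc i) y w) - grad F (chain c i y w)"
  have int: "integrable noise_seq (?g i)" for i
    using Bochner_Integration.integrable_diff[OF chain_grad_increment_integrable[of c "Suc i" y] chain_grad_increment_integrable[of c i y]]
    by simp
  have "grad F (chain c k y w) - grad F y = (\<Sum>i<k. ?g i w)" for w
    using sum_lessThan_telescope[of "\<lambda>i. grad F (chain c i y w)" k] by simp
  then have "(\<integral>w. grad F (chain c k y w) - grad F y \<partial>noise_seq) = (\<Sum>i<k. \<integral>w. ?g i w \<partial>noise_seq)"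
    by (simp only: Bochner_Integration.integral_sum[OF int])
  also have "\<dots> = (\<Sum>i<k. \<integral>w. grad_drift c (chain c i y w) \<partial>noise_seq)"
  proof (rule sum.cong[OF refl])
    fix i
    have "(\<integral>w. ?g i w \<partial>noise_seq) = (\<integral>w. \<integral>t. ?g i (w(i := t)) \<partial>step_noise \<partial>noise_seq)"
      by (rule resampling_integral[OF resampling_noise_seq int])
    also have "\<dots> = (\<integral>w. grad_drift c (chain c i y w) \<partial>noise_seq)"
      by (simp add: chain_upd grad_drift_def)
    finally show "(\<integral>w. ?g i w \<partial>noise_seq) = (\<integral>w. grad_drift c (chain c i y w) \<partial>noise_seq)" .
  qed
  finally show ?thesis .
qed

text \<open>With \<open>c = sqrt (2 * h / m)\<close> the \<open>m\<close> steps cover the time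
  \<open>h\<close> exactly; the accumulated defect is then a sum of terms with positive powers of
  \<open>c\<close>.\<close>

lemma vanishing_step:
  assumes h: "h > 0" and e: "e > 0"
  obtains m :: nat and c where "m > 0" "0 < c" "c \<le> 1" "c * sqrt (real m) = sqrt (2 * h)" "c\<^sup>2 / 2 * real m = h"
    "sqrt (real m) * r2 c + real m * r1 c \<le> e"
proof -
  define s where "s = sqrt (2 * h)"
  define A B where "A = K2 * (1 + L * DIM('a))" and "B = K1 * sqrt J"
  define c where "c = (\<lambda>m::nat. sqrt (2 * h / real m))"
  have lim: "c \<longlonglongrightarrow> 0" unfolding c_def using tendsto_real_sqrt[OF lim_const_over_n[of "2 * h"]] by simp
  have "(\<lambda>m. s * (sqrt (c m * A) + c m * c m * B) + s\<^sup>2 * c m * B) \<longlonglongrightarrow> s * (sqrt (0 * A) + 0 * 0 * B) + s\<^sup>2 * 0 * B"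
    by (intro tendsto_intros tendsto_real_sqrt lim)
  then have "\<forall>\<^sub>F m in sequentially. s * (sqrt (c m * A) + c m * c m * B) + s\<^sup>2 * c m * B < e"
    using e by (simp add: order_tendstoD)
  moreover have "\<forall>\<^sub>F m in sequentially. c m < 1" using lim by (rule order_tendstoD) simp
  ultimately have "\<forall>\<^sub>F m in sequentially. m > 0 \<and> c m < 1 \<and> s * (sqrt (c m * A) + c m * c m * B) + s\<^sup>2 * c m * B < e"
    using eventually_gt_at_top[of "0::nat"] by eventually_elim auto
  then obtain m where m: "m > 0" "c m < 1" "s * (sqrt (c m * A) + c m * c m * B) + s\<^sup>2 * c m * B < e"
    by (auto simp: eventually_sequentially)
  have c: "c m > 0" using h m by (simp add: c_def)
  have cm: "c m * sqrt (real m) = s" using m h by (simp add: c_def s_def real_sqrt_mult[symmetric])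
  have c2: "(c m)\<^sup>2 * real m = s\<^sup>2" using arg_cong[OF cm, of "\<lambda>x. x\<^sup>2"] by (simp add: power_mult_distrib)
  have 1: "sqrt (real m) * sqrt (c m ^ 3 * A) = s * sqrt (c m * A)"
  proof -
    have "sqrt (real m) * sqrt (c m ^ 3 * A) = sqrt ((c m)\<^sup>2 * real m * (c m * A))"
      by (simp add: real_sqrt_mult[symmetric] power3_eq_cube power2_eq_square mult_ac)
    also have "\<dots> = sqrt (s\<^sup>2) * sqrt (c m * A)" unfolding c2 by (rule real_sqrt_mult)
    finally show ?thesis using h by (simp add: s_def)
  qed
  have 2: "sqrt (real m) * (c m ^ 3 * B) = s * (c m * c m * B)"
    unfolding cm[symmetric] by (simp add: power3_eq_cube mult_ac)
  have 3: "real m * (c m ^ 3 * B) = s\<^sup>2 * c m * B"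
    unfolding c2[symmetric] by (simp add: power3_eq_cube power2_eq_square mult_ac)
  have "sqrt (real m) * r2 (c m) + real m * r1 (c m) = s * (sqrt (c m * A) + c m * c m * B) + s\<^sup>2 * c m * B"
  proof -
    have "sqrt (real m) * r2 (c m) + real m * r1 (c m)
        = sqrt (real m) * sqrt (c m ^ 3 * A) + sqrt (real m) * (c m ^ 3 * B) + real m * (c m ^ 3 * B)"
      by (simp add: r1_def r2_def A_def B_def distrib_left mult.assoc)
    then show ?thesis unfolding 1 2 3 by (simp add: distrib_left)
  qed
  moreover have "(c m)\<^sup>2 / 2 * real m = h" using c2 h by (simp add: s_def)
  ultimately show ?thesis using that[of m "c m"] m c cm by (simp add: s_def)
qed

text \<open>The step \<open>y \<mapsto> y - h \<nabla>F y + \<surd>(2h) \<Xi> q + E y q\<close> of the next lemma preserves \<open>\<pi>\<close> exactly, so it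
  replaces the Langevin diffusion run for time \<open>h\<close>.\<close>

lemma stationary_coupling:
  assumes h: "h > 0" and e: "e > 0"
  obtains Q :: "(nat \<Rightarrow> 'a \<times> real) measure" and \<Xi> :: "(nat \<Rightarrow> 'a \<times> real) \<Rightarrow> 'a" and E :: "'a \<Rightarrow> (nat \<Rightarrow> 'a \<times> real) \<Rightarrow> 'a"
  where "prob_space Q" "\<Xi> \<in> borel_measurable Q" "distr Q borel \<Xi> = std_gaussian"
    "(\<lambda>(y, q). E y q) \<in> borel_measurable (borel \<Otimes>\<^sub>M Q)"
    "distr (gibbs F \<Otimes>\<^sub>M Q) borel (\<lambda>(y, q). y - h *\<^sub>R grad F y + sqrt (2 * h) *\<^sub>R \<Xi> q + E y q) = gibbs F"
    "L2le (gibbs F \<Otimes>\<^sub>M Q) (\<lambda>(y, q). E y q) (h * L * (sqrt (2 * h * DIM('a)) + h * sqrt (L * DIM('a))) + e)"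
    "\<And>y. integrable Q (E y)"
    "\<And>K. K > 0 \<Longrightarrow> twice_cont_diff F \<Longrightarrow> smooth_hessian K F \<Longrightarrow>
       L2le (gibbs F) (\<lambda>y. \<integral>q. E y q \<partial>Q) (h\<^sup>2 * (L * sqrt (L * DIM('a)) + 2 * K * DIM('a)) + e)"
proof -
  have hL: "1 + h * L > 0" using h L_pos by (simp add: add_pos_pos)
  \<comment> \<open>The defect bound enters twice, directly and multiplied by \<open>h * L\<close>
    through the displacement of the chain; dividing by \<open>1 + h * L\<close> keeps the total
    below \<open>e\<close>.\<close>
  obtain m c where m: "m > 0" and c: "0 < c" "c \<le> 1" and cm: "c * sqrt (real m) = sqrt (2 * h)" "c\<^sup>2 / 2 * real m = h"
    and small: "sqrt (real m) * r2 c + real m * r1 c \<le> e / (1 + h * L)"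
    using vanishing_step[OF h, of "e / (1 + h * L)"] e hL by auto
  define \<eta> where "\<eta> = sqrt (real m) * r2 c + real m * r1 c"
  have \<eta>: "\<eta> + h * L * \<eta> \<le> e"
  proof -
    have "\<eta> \<le> e / (1 + h * L)" using small by (simp only: \<eta>_def)
    then show ?thesis using hL by (simp add: pos_le_divide_eq algebra_simps)
  qed
  have \<eta>_nonneg: "0 \<le> \<eta>" "real m * r1 c \<le> \<eta>" using r_nonneg[of c] c by (auto simp: \<eta>_def)
  \<comment> \<open>The error is defined as whatever separates \<open>m\<close> Metropolis steps
    from one Euler step, so stationarity of the large step is stationarity of the chain.\<close>
  define E where "E = (\<lambda>y w. chain c m y w - y + h *\<^sub>R grad F y - sqrt (2 * h) *\<^sub>R normalized_sum m w)"
  interpret W: prob_space "noise_seq :: (nat \<Rightarrow> 'a \<times> real) measure" by (rule prob_space_noise_seq)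
  have E_meas: "(\<lambda>(y, q). E y q) \<in> borel_measurable (borel \<Otimes>\<^sub>M noise_seq)"
    unfolding E_def by measurable
  have ns: "sqrt (2 * h) *\<^sub>R normalized_sum m w = c *\<^sub>R (\<Sum>i<m. fst (w i))" for w :: "nat \<Rightarrow> 'a \<times> real"
    using m by (simp add: normalized_sum_def cm(1)[symmetric])
  \<comment> \<open>The two sources of error: the accumulated defects, and the gradient being frozen
    at the starting point.\<close>
  have E_eq: "E (fst z) (snd z) = total_defect c m z - (c\<^sup>2 / 2) *\<^sub>R (\<Sum>i<m. grad F (chain c i (fst z) (snd z)) - grad F (fst z))" for z
  proof -
    have "h *\<^sub>R grad F (fst z) = (c\<^sup>2 / 2) *\<^sub>R (\<Sum>i<m. grad F (fst z))"
      by (simp add: cm(2)[symmetric] sum_constant_scaleR del: sum_constant)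
    then show ?thesis unfolding E_def ns
      by (subst chain_decomposition[of c m]) (simp add: sum_subtractf scaleR_diff_right)
  qed
  have law: "distr \<Omega> borel (\<lambda>(y, q). y - h *\<^sub>R grad F y + sqrt (2 * h) *\<^sub>R normalized_sum m q + E y q) = gibbs F"
    using chain_law[of c m] by (simp add: E_def split_beta')
  define D where "D = sqrt (2 * h * DIM('a)) + h * sqrt (L * DIM('a)) + \<eta>"
  have disp: "L2le \<Omega> (\<lambda>z. chain c i (fst z) (snd z) - fst z) D" if "i < m" for i
    using L2le_displacement[OF c, of i m] that cm by (simp add: D_def \<eta>_def real_sqrt_mult[symmetric])
  have strong: "L2le \<Omega> (\<lambda>(y, q). E y q) (h * L * (sqrt (2 * h * DIM('a)) + h * sqrt (L * DIM('a))) + e)"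
  proof (rule L2le_mono)
    have g: "L2le \<Omega> (\<lambda>z. grad F (chain c i (fst z) (snd z)) - grad F (fst z)) (L * D)" if "i < m" for i
    proof (rule L2le_norm_bound)
      show "L2le \<Omega> (\<lambda>z. L *\<^sub>R norm (chain c i (fst z) (snd z) - fst z)) (L * D)"
        using L2le_scaleR[OF L2le_norm[OF disp[OF that]], of L] L_pos by simp
    qed (use grad_lipschitz in auto)
    have "L2le \<Omega> (\<lambda>z. total_defect c m z - (c\<^sup>2 / 2) *\<^sub>R (\<Sum>i<m. grad F (chain c i (fst z) (snd z)) - grad F (fst z)))
       (\<eta> + \<bar>c\<^sup>2 / 2\<bar> * (\<Sum>i<m. L * D))"
      unfolding \<eta>_def by (intro L2le_diff L2le_scaleR L2le_sum g L2le_total_defect c) auto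
    then show "L2le \<Omega> (\<lambda>(y, q). E y q) (\<eta> + \<bar>c\<^sup>2 / 2\<bar> * (\<Sum>i<m. L * D))"
      by (simp only: E_eq[symmetric] split_beta')
    have "\<bar>c\<^sup>2 / 2\<bar> * (\<Sum>i<m. L * D) = (c\<^sup>2 / 2 * real m) * (L * D)" by simp
    then show "\<eta> + \<bar>c\<^sup>2 / 2\<bar> * (\<Sum>i<m. L * D) \<le> h * L * (sqrt (2 * h * DIM('a)) + h * sqrt (L * DIM('a))) + e"
      using \<eta> unfolding cm(2) D_def by (simp add: algebra_simps)
  qed
  have E_int: "integrable noise_seq (E y)" for y
    unfolding E_def by (intro Bochner_Integration.integrable_diff Bochner_Integration.integrable_add
        chain_displacement_integrable integrable_scaleR_right normalized_sum_integrable) simp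
  have weak: "L2le (gibbs F) (\<lambda>y. \<integral>q. E y q \<partial>noise_seq) (h\<^sup>2 * (L * sqrt (L * DIM('a)) + 2 * K * DIM('a)) + e)"
    if K: "K > 0" and H: "twice_cont_diff F" "smooth_hessian K F" for K
  proof (rule L2le_mono)
    define k1 where "k1 = L * (r1 c + c\<^sup>2 / 2 * sqrt (L * DIM('a))) + K * c\<^sup>2 * DIM('a)"
    have k1_nonneg: "k1 \<ge> 0" using r_nonneg[of c] c K L_pos by (simp add: k1_def)
    have drift: "L2le (gibbs F) (grad_drift c) k1"
      unfolding k1_def r1_def using K by (intro L2le_grad_drift c H) auto
    have td_int: "integrable noise_seq (\<lambda>w. total_defect c m (y, w))" for y
    proof -
      have "total_defect c m (y, w) = E y w + (c\<^sup>2 / 2) *\<^sub>R (\<Sum>i<m. grad F (chain c i y w) - grad F y)" for w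
        using E_eq[of "(y, w)"] by simp
      then show ?thesis
        by (simp only:) (intro Bochner_Integration.integrable_add E_int integrable_scaleR_right
          Bochner_Integration.integrable_sum chain_grad_increment_integrable)
    qed
    \<comment> \<open>The expected gradient increment up to time \<open>i\<close> is a sum of
      \<open>i\<close> one-step drifts of order \<open>c\<^sup>2\<close>. The double sum has fewer
      than \<open>m\<^sup>2\<close> terms, which with the prefactor \<open>c\<^sup>2 / 2\<close>
      gives the order \<open>h\<^sup>2\<close>.\<close>
    have mean: "(\<integral>q. E y q \<partial>noise_seq) = (\<integral>w. total_defect c m (y, w) \<partial>noise_seq)
       - (c\<^sup>2 / 2) *\<^sub>R (\<Sum>i<m. \<Sum>j<i. \<integral>w. grad_drift c (chain c j y w) \<partial>noise_seq)" for y
    proof -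
      have "(\<integral>q. E y q \<partial>noise_seq) = (\<integral>w. total_defect c m (y, w) - (c\<^sup>2 / 2) *\<^sub>R (\<Sum>i<m. grad F (chain c i y w) - grad F y) \<partial>noise_seq)"
        using E_eq[of "(y, _)"] by simp
      also have "\<dots> = (\<integral>w. total_defect c m (y, w) \<partial>noise_seq) - (\<integral>w. (c\<^sup>2 / 2) *\<^sub>R (\<Sum>i<m. grad F (chain c i y w) - grad F y) \<partial>noise_seq)"
        by (intro Bochner_Integration.integral_diff td_int integrable_scaleR_right
          Bochner_Integration.integrable_sum chain_grad_increment_integrable)
      also have "(\<integral>w. (c\<^sup>2 / 2) *\<^sub>R (\<Sum>i<m. grad F (chain c i y w) - grad F y) \<partial>noise_seq)
          = (c\<^sup>2 / 2) *\<^sub>R (\<Sum>i<m. \<integral>w. grad F (chain c i y w) - grad F y \<partial>noise_seq)"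
        by (simp only: integral_scaleR_right Bochner_Integration.integral_sum[OF chain_grad_increment_integrable])
      finally show ?thesis by (simp only: chain_grad_increment_mean)
    qed
    have 1: "L2le (gibbs F) (\<lambda>y. \<integral>w. total_defect c m (y, w) \<partial>noise_seq) \<eta>"
      unfolding \<eta>_def by (intro L2le_partial_integral prob_space_gibbs prob_space_noise_seq L2le_total_defect c order_refl)
    have 2: "L2le (gibbs F) (\<lambda>y. \<integral>w. grad_drift c (chain c j y w) \<partial>noise_seq) k1" for j
      using L2le_partial_integral[OF prob_space_gibbs prob_space_noise_seq L2le_chain[OF drift, of c j]] by simp
    show "L2le (gibbs F) (\<lambda>y. \<integral>q. E y q \<partial>noise_seq) (\<eta> + \<bar>c\<^sup>2 / 2\<bar> * (\<Sum>i<m. \<Sum>j<i. k1))"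
      unfolding mean by (intro L2le_diff L2le_scaleR L2le_sum 1 2)
    have "(\<Sum>i<m. \<Sum>j<i. k1) \<le> (\<Sum>i<m. real m * k1)"
      using k1_nonneg by (intro sum_mono) (simp add: mult_right_mono)
    then have "c\<^sup>2 / 2 * (\<Sum>i<m. \<Sum>j<i. k1) \<le> c\<^sup>2 / 2 * (real m * (real m * k1))"
      by (intro mult_left_mono) auto
    also have "\<dots> = h * (real m * k1)" using cm(2) by (simp add: mult.assoc[symmetric])
    also have "real m * k1 = L * (real m * r1 c) + (c\<^sup>2 / 2 * real m) * (L * sqrt (L * DIM('a)) + 2 * K * DIM('a))"
      by (simp add: k1_def algebra_simps)
    also have "h * (L * (real m * r1 c) + (c\<^sup>2 / 2 * real m) * (L * sqrt (L * DIM('a)) + 2 * K * DIM('a)))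
        \<le> h * (L * \<eta> + (c\<^sup>2 / 2 * real m) * (L * sqrt (L * DIM('a)) + 2 * K * DIM('a)))"
      using h L_pos \<eta>_nonneg by (intro mult_left_mono add_right_mono) auto
    finally show "\<eta> + \<bar>c\<^sup>2 / 2\<bar> * (\<Sum>i<m. \<Sum>j<i. k1) \<le> h\<^sup>2 * (L * sqrt (L * DIM('a)) + 2 * K * DIM('a)) + e"
      using \<eta> unfolding cm(2) by (simp add: algebra_simps power2_eq_square)
  qed
  show ?thesis
    by (rule that[of noise_seq "normalized_sum m" E])
       (use prob_space_noise_seq distr_normalized_sum[OF m] E_meas law strong E_int weak in auto)
qed

end

section \<open>Blocks of a uniformly random permutation\<close>

text \<open>Uniform averages over finite sets keep the combinatorics free of measures. On the empty
  set the value is \<open>0\<close>.\<close>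

definition avg :: "'b set \<Rightarrow> ('b \<Rightarrow> real) \<Rightarrow> real" where
  "avg A f = (\<Sum>a\<in>A. f a) / real (card A)"

lemma avg_cong: "(\<And>a. a \<in> A \<Longrightarrow> f a = g a) \<Longrightarrow> avg A f = avg A g"
  unfolding avg_def by (metis sum.cong)

lemma avg_mono: "(\<And>a. a \<in> A \<Longrightarrow> f a \<le> g a) \<Longrightarrow> avg A f \<le> avg A g"
  unfolding avg_def by (intro divide_right_mono sum_mono) auto

lemma avg_nonneg: "(\<And>a. a \<in> A \<Longrightarrow> 0 \<le> f a) \<Longrightarrow> 0 \<le> avg A f"
  unfolding avg_def by (intro divide_nonneg_nonneg sum_nonneg) auto

lemma avg_add: "avg A (\<lambda>a. f a + g a) = avg A f + avg A g"
  unfolding avg_def by (simp add: sum.distrib add_divide_distrib)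

lemma avg_cmult: "avg A (\<lambda>a. c * f a) = c * avg A f"
  unfolding avg_def by (simp add: sum_distrib_left)

lemma avg_uminus: "avg A (\<lambda>a. - f a) = - avg A f"
  unfolding avg_def by (simp add: sum_negf)

lemma avg_sum: "avg A (\<lambda>a. \<Sum>i\<in>I. f i a) = (\<Sum>i\<in>I. avg A (f i))"
  unfolding avg_def by (subst sum.swap) (simp add: sum_divide_distrib)

abbreviation perms :: "nat \<Rightarrow> (nat \<Rightarrow> nat) set" where
  "perms N \<equiv> {p. p permutes {1..N}}"

lemma finite_perms [simp]: "finite (perms N)"
  by (rule finite_permutations) simp

lemma perms_nonempty: "perms N \<noteq> {}"
  using permutes_id by blast

lemma finite_batches [simp]: "finite (batches N n)"
proof (rule finite_subset)
  show "batches N n \<subseteq> {xs. set xs \<subseteq> {1..N} \<and> length xs = n}" by (auto simp: batches_def)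
qed (rule finite_lists_length_eq, simp)

lemma length_block [simp]: "length (block n p r) = n"
  by (simp add: block_def)

lemma nth_block: "i < n \<Longrightarrow> block n p r ! i = p (r * n + i + 1)"
  by (simp add: block_def del: upt_Suc)

lemma block_comp: "block n (q \<circ> p) r = map q (block n p r)"
  by (simp add: block_def)

lemma block_eqI: "(\<And>i. i < n \<Longrightarrow> p (r * n + i + 1) = q (s * n + i + 1)) \<Longrightarrow> block n p r = block n q s"
  by (rule nth_equalityI) (simp_all add: nth_block)

lemma block_index_bound: "r < R \<Longrightarrow> i < n \<Longrightarrow> r * n + i + 1 \<le> n * R" for r n R i :: nat
proof -
  assume "r < R" "i < n"
  then have "r * n + i + 1 \<le> Suc r * n" by simp
  also have "\<dots> \<le> R * n" using \<open>r < R\<close> by (intro mult_right_mono) auto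
  finally show ?thesis by (simp add: mult.commute)
qed

lemma block_in_batches:
  assumes p: "p permutes {1..n * R}" and r: "r < R"
  shows "block n p r \<in> batches (n * R) n"
proof -
  have "set [r * n + 1..<r * n + n + 1] \<subseteq> {1..n * R}"
  proof
    fix i assume "i \<in> set [r * n + 1..<r * n + n + 1]"
    then obtain j where "j < n" "i = r * n + j + 1" by (auto simp: le_iff_add)
    then show "i \<in> {1..n * R}" using block_index_bound[OF r, of j n] by auto
  qed
  then show ?thesis
    using permutes_in_image[OF p] permutes_inj_on[OF p]
    by (auto simp: batches_def block_def distinct_map simp del: upt_Suc)
qed

text \<open>A permutation of positions exchanging two blocks and keeping the order inside each;
  positions start at \<open>1\<close>, hence the shifts.\<close>

definition swap_blocks :: "nat \<Rightarrow> nat \<Rightarrow> nat \<Rightarrow> nat \<Rightarrow> nat \<Rightarrow> nat" where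
  "swap_blocks n R r s i =
     (if i \<in> {1..n * R} then Transposition.transpose r s ((i - 1) div n) * n + (i - 1) mod n + 1 else i)"

lemma swap_blocks_index:
  assumes "k < R" "i < n"
  shows "swap_blocks n R r s (k * n + i + 1) = Transposition.transpose r s k * n + i + 1"
  using block_index_bound[OF assms] assms by (simp add: swap_blocks_def)

lemma block_index_cases:
  fixes n R i :: nat
  assumes "i \<in> {1..n * R}"
  obtains k j where "k < R" "j < n" "i = k * n + j + 1"
proof -
  have n: "n > 0" using assms by (cases n) auto
  show ?thesis
  proof (rule that[of "(i - 1) div n" "(i - 1) mod n"])
    show "(i - 1) div n < R" using assms by (auto simp: div_less_iff_less_mult[OF n] mult.commute)
    show "i = (i - 1) div n * n + (i - 1) mod n + 1" using assms by simp
  qed (use n in simp)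
qed

lemma swap_blocks_permutes:
  assumes "r < R" "s < R"
  shows "swap_blocks n R r s permutes {1..n * R}"
proof (rule bij_imp_permutes)
  let ?t = "swap_blocks n R r s"
  have tr: "Transposition.transpose r s k < R" if "k < R" for k using assms that by (auto simp: Transposition.transpose_def)
  show "bij_betw ?t {1..n * R} {1..n * R}"
  proof (rule bij_betw_byWitness[where f'="?t"])
    show "\<forall>a\<in>{1..n * R}. ?t (?t a) = a"
    proof
      fix a assume "a \<in> {1..n * R}"
      then obtain k j where "k < R" "j < n" "a = k * n + j + 1" by (rule block_index_cases)
      then show "?t (?t a) = a" by (simp only: swap_blocks_index tr transpose_involutory)
    qed
    then show "\<forall>a\<in>{1..n * R}. ?t (?t a) = a" .
    show "?t ` {1..n * R} \<subseteq> {1..n * R}"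
    proof
      fix b assume "b \<in> ?t ` {1..n * R}"
      then obtain a where a: "a \<in> {1..n * R}" "b = ?t a" by blast
      from a(1) obtain k j where kj: "k < R" "j < n" "b = ?t (k * n + j + 1)"
        unfolding a(2) by (rule block_index_cases) blast
      then show "b \<in> {1..n * R}"
        using block_index_bound[OF tr[OF kj(1)] kj(2)] by (simp only: swap_blocks_index) auto
    qed
    then show "?t ` {1..n * R} \<subseteq> {1..n * R}" .
  qed
qed (simp only: swap_blocks_def if_False)

lemma block_swap_blocks:
  assumes "k < R"
  shows "block n (p \<circ> swap_blocks n R r s) k = block n p (Transposition.transpose r s k)"
  using assms by (intro block_eqI) (simp only: o_def swap_blocks_index)

text \<open>Exchangeability of the blocks: composing on the right with a fixed permutation of
  positions is a bijection of \<open>perms (n * R)\<close>.\<close>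

lemma avg_perms_swap:
  assumes "r < R" "s < R"
  shows "avg (perms (n * R)) f = avg (perms (n * R)) (\<lambda>p. f (p \<circ> swap_blocks n R r s))"
  unfolding avg_def by (subst sum_permutations_compose_right[OF swap_blocks_permutes[OF assms]]) simp

text \<open>Matching the entries position by position gives a bijection of the two entry sets, and
  it extends because their complements are equally large.\<close>

lemma ex_perm_of_batches:
  assumes w: "w \<in> batches N n" "w' \<in> batches N n"
  obtains q where "q permutes {1..N}" "map q w = w'"
proof -
  have len: "length w = n" "length w' = n" "distinct w" "distinct w'" "set w \<subseteq> {1..N}" "set w' \<subseteq> {1..N}"
    using w by (auto simp: batches_def)
  define f where "f = (\<lambda>x. w' ! the_inv_into {..<n} ((!) w) x)"
  have bw: "bij_betw ((!) w) {..<n} (set w)" "bij_betw ((!) w') {..<n} (set w')"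
    using len by (auto intro: bij_betw_nth)
  have f_nth: "f (w ! i) = w' ! i" if "i < n" for i
    using that bw(1) by (simp add: f_def the_inv_into_f_f[OF bij_betw_imp_inj_on])
  have bf: "bij_betw f (set w) (set w')"
    unfolding f_def using bij_betw_trans[OF bij_betw_the_inv_into[OF bw(1)] bw(2)] by (simp add: o_def)
  have "card ({1..N} - set w) = card ({1..N} - set w')"
    using len by (simp add: card_Diff_subset distinct_card)
  then obtain g where bg: "bij_betw g ({1..N} - set w) ({1..N} - set w')"
    by (metis finite_same_card_bij finite_Diff finite_atLeastAtMost)
  define q where "q = (\<lambda>x. if x \<in> set w then f x else if x \<in> {1..N} then g x else x)"
  have "bij_betw q (set w \<union> ({1..N} - set w)) (set w' \<union> ({1..N} - set w'))"
  proof (rule bij_betw_combine)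
    show "bij_betw q (set w) (set w')"
      using bf by (subst bij_betw_cong[of _ _ f]) (auto simp: q_def)
    show "bij_betw q ({1..N} - set w) ({1..N} - set w')"
      using bg by (subst bij_betw_cong[of _ _ g]) (auto simp: q_def)
  qed auto
  moreover have "set w \<union> ({1..N} - set w) = {1..N}" "set w' \<union> ({1..N} - set w') = {1..N}" using len by auto
  ultimately have "q permutes {1..N}"
    using len by (intro bij_imp_permutes) (auto simp: q_def)
  moreover have "map q w = w'"
    using len f_nth by (intro nth_equalityI) (auto simp: q_def)
  ultimately show ?thesis by (rule that)
qed

text \<open>All fibres of the map from permutations to their \<open>r\<close>-th block have the same
  size: composing on the left with a permutation that maps \<open>w\<close> to \<open>w'\<close>
  injects one fibre into the other.\<close>

lemma avg_block:
  assumes r: "r < R"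
  shows "avg (perms (n * R)) (\<lambda>p. f (block n p r)) = avg (batches (n * R) n) f"
proof -
  let ?P = "perms (n * R)" and ?B = "batches (n * R) n"
  define fib where "fib = (\<lambda>w. {p \<in> ?P. block n p r = w})"
  have sub: "(\<lambda>p. block n p r) ` ?P \<subseteq> ?B" using block_in_batches[OF _ r] by auto
  have le: "card (fib w) \<le> card (fib w')" if "w \<in> ?B" "w' \<in> ?B" for w w'
  proof -
    obtain q where q: "q permutes {1..n * R}" "map q w = w'"
      by (rule ex_perm_of_batches[OF \<open>w \<in> ?B\<close> \<open>w' \<in> ?B\<close>])
    show ?thesis
    proof (rule card_inj_on_le[where f="\<lambda>p. q \<circ> p"])
      show "inj_on ((\<circ>) q) (fib w)"
        using permutes_inj[OF q(1)] by (auto simp: inj_on_def fun.inj_map_strong fun_eq_iff dest: injD)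
      show "(\<circ>) q ` fib w \<subseteq> fib w'"
        using q by (auto simp: fib_def block_comp intro: permutes_compose)
      show "finite (fib w')" unfolding fib_def by (rule finite_subset[OF Collect_restrict finite_perms])
    qed
  qed
  obtain p0 where "p0 \<in> ?P" using perms_nonempty by blast
  then obtain w0 where w0: "w0 \<in> ?B" "w0 = block n p0 r" using sub by blast
  have eq: "card (fib w) = card (fib w0)" if "w \<in> ?B" for w
    using le[OF that w0(1)] le[OF w0(1) that] by simp
  have fin: "finite (fib w0)" unfolding fib_def by (rule finite_subset[OF Collect_restrict finite_perms])
  moreover have "p0 \<in> fib w0" using \<open>p0 \<in> ?P\<close> w0(2) by (simp add: fib_def)
  ultimately have pos: "card (fib w0) > 0" by (auto simp: card_gt_0_iff)
  have sums: "(\<Sum>p\<in>?P. k (block n p r)) = real (card (fib w0)) * (\<Sum>w\<in>?B. k w)" for k :: "nat list \<Rightarrow> real"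
  proof -
    have "(\<Sum>p\<in>?P. k (block n p r)) = (\<Sum>w\<in>?B. \<Sum>p\<in>fib w. k (block n p r))"
      unfolding fib_def by (rule sum.group[symmetric, OF finite_perms finite_batches sub])
    also have "\<dots> = (\<Sum>w\<in>?B. real (card (fib w0)) * k w)"
    proof (rule sum.cong[OF refl])
      fix w assume w: "w \<in> ?B"
      have "(\<Sum>p\<in>fib w. k (block n p r)) = (\<Sum>p\<in>fib w. k w)"
        by (rule sum.cong) (auto simp: fib_def)
      also have "\<dots> = real (card (fib w)) * k w" by simp
      finally show "(\<Sum>p\<in>fib w. k (block n p r)) = real (card (fib w0)) * k w" using eq[OF w] by simp
    qed
    finally show ?thesis by (simp add: sum_distrib_left)
  qed
  \<comment> \<open>The normalizing constants are compared by the same identity for the constant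
    function \<open>1\<close>.\<close>
  have "real (card ?P) = real (card (fib w0)) * real (card ?B)" using sums[of "\<lambda>_. 1"] by simp
  then show ?thesis using pos sums[of f] by (simp add: avg_def)
qed

text \<open>\<open>\<Phi> i\<close> is evaluated at the \<open>i\<close>-th block; the functions may differ from block to block because the
  trajectory moves within an epoch.\<close>

context
  fixes n R :: nat and \<Phi> :: "nat \<Rightarrow> nat list \<Rightarrow> 'a::euclidean_space"
  assumes zero_sum: "\<And>i p. i < R \<Longrightarrow> p permutes {1..n * R} \<Longrightarrow> (\<Sum>r<R. \<Phi> i (block n p r)) = 0"
    and R2: "R \<ge> 2"
begin

text \<open>By exchangeability the sum is the same whichever block is inserted into
  \<open>\<Phi> i\<close>, and adding up over all blocks gives \<open>0\<close>.\<close>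

lemma block_mean_zero:
  assumes i: "i < R"
  shows "(\<Sum>p\<in>perms (n * R). \<Phi> i (block n p i)) = 0"
proof -
  have "(\<Sum>p\<in>perms (n * R). \<Phi> i (block n p r)) = (\<Sum>p\<in>perms (n * R). \<Phi> i (block n p i))" if "r < R" for r
    by (subst sum_permutations_compose_right[OF swap_blocks_permutes[OF i that]])
       (simp add: block_swap_blocks[OF that])
  then have "(\<Sum>r<R. \<Sum>p\<in>perms (n * R). \<Phi> i (block n p r)) = real R *\<^sub>R (\<Sum>p\<in>perms (n * R). \<Phi> i (block n p i))"
    by (simp add: sum_constant_scaleR del: sum_constant)
  moreover have "(\<Sum>r<R. \<Sum>p\<in>perms (n * R). \<Phi> i (block n p r)) = 0"
    by (subst sum.swap) (simp add: zero_sum[OF i])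
  ultimately show ?thesis using R2 by simp
qed

text \<open>The negative correlation of sampling without replacement. By exchangeability every block
  other than \<open>i\<close> gives the same mean product. The products over all blocks, including
  block \<open>i\<close> itself, sum to \<open>0\<close>, so the diagonal one is shared with
  opposite sign among \<open>R - 1\<close> others.\<close>

lemma block_covariance:
  assumes ij: "i < R" "j < R" "i \<noteq> j"
  shows "avg (perms (n * R)) (\<lambda>p. \<Phi> i (block n p i) \<bullet> \<Phi> j (block n p j))
    = - (1 / (real R - 1)) * avg (batches (n * R) n) (\<lambda>w. \<Phi> i w \<bullet> \<Phi> j w)"
proof -
  let ?c = "\<lambda>r. avg (perms (n * R)) (\<lambda>p. \<Phi> i (block n p i) \<bullet> \<Phi> j (block n p r))"
  have same: "?c r = ?c j" if "r < R" "r \<noteq> i" for r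
    by (subst avg_perms_swap[OF ij(2) that(1)])
       (use that ij in \<open>simp add: block_swap_blocks transpose_apply_other\<close>)
  have "?c i + (\<Sum>r\<in>{..<R} - {i}. ?c r) = (\<Sum>r<R. ?c r)" using ij by (simp add: sum.remove)
  also have "\<dots> = avg (perms (n * R)) (\<lambda>p. \<Phi> i (block n p i) \<bullet> (\<Sum>r<R. \<Phi> j (block n p r)))"
    by (simp add: avg_sum[symmetric] inner_sum_right)
  also have "\<dots> = avg (perms (n * R)) (\<lambda>p. 0)" by (rule avg_cong) (simp add: zero_sum[OF ij(2)])
  also have "\<dots> = 0" by (simp add: avg_def)
  finally have "?c i + (\<Sum>r\<in>{..<R} - {i}. ?c r) = 0" .
  moreover have "(\<Sum>r\<in>{..<R} - {i}. ?c r) = (\<Sum>r\<in>{..<R} - {i}. ?c j)"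
    by (intro sum.cong refl same) auto
  moreover have "(\<Sum>r\<in>{..<R} - {i}. ?c j) = (real R - 1) * ?c j"
    using ij by (simp add: of_nat_diff)
  ultimately have "?c i + (real R - 1) * ?c j = 0" by (simp only:)
  moreover have "?c i = avg (batches (n * R) n) (\<lambda>w. \<Phi> i w \<bullet> \<Phi> j w)"
    by (rule avg_block[OF ij(1), of n "\<lambda>w. \<Phi> i w \<bullet> \<Phi> j w"])
  moreover have R1: "real R - 1 > 0" using R2 by simp
  moreover have solve: "y = - (1 / a) * x" if "x + a * y = 0" "a > 0" for x y a :: real
    using that by (simp add: field_simps)
  ultimately show ?thesis using solve[of "?c i" "real R - 1" "?c j"] by (simp only:)
qed

lemma block_second_moment:
  assumes "i < R"
  shows "avg (perms (n * R)) (\<lambda>p. \<Phi> i (block n p i) \<bullet> \<Phi> i (block n p i))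
    = avg (batches (n * R) n) (\<lambda>w. (norm (\<Phi> i w))\<^sup>2)"
  using avg_block[OF assms, of n "\<lambda>w. (norm (\<Phi> i w))\<^sup>2"] by (simp add: power2_norm_eq_inner)

lemma block_sum_second_moment:
  assumes k: "k \<le> R"
  shows "avg (perms (n * R)) (\<lambda>p. (norm (\<Sum>i<k. \<Phi> i (block n p i)))\<^sup>2)
    = (\<Sum>i<k. avg (batches (n * R) n) (\<lambda>w. (norm (\<Phi> i w))\<^sup>2))
      - (1 / (real R - 1)) * (\<Sum>i<k. \<Sum>j\<in>{..<k} - {i}. avg (batches (n * R) n) (\<lambda>w. \<Phi> i w \<bullet> \<Phi> j w))"
proof -
  let ?P = "perms (n * R)" and ?B = "batches (n * R) n"
  have "avg ?P (\<lambda>p. (norm (\<Sum>i<k. \<Phi> i (block n p i)))\<^sup>2)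
      = (\<Sum>i<k. \<Sum>j<k. avg ?P (\<lambda>p. \<Phi> i (block n p i) \<bullet> \<Phi> j (block n p j)))"
    by (simp add: power2_norm_eq_inner inner_sum_left inner_sum_right avg_sum) (rule sum.swap)
  also have "\<dots> = (\<Sum>i<k. avg ?B (\<lambda>w. (norm (\<Phi> i w))\<^sup>2)
      + (\<Sum>j\<in>{..<k} - {i}. - (1 / (real R - 1)) * avg ?B (\<lambda>w. \<Phi> i w \<bullet> \<Phi> j w)))"
  proof (rule sum.cong[OF refl])
    fix i assume i: "i \<in> {..<k}"
    then have "(\<Sum>j<k. avg ?P (\<lambda>p. \<Phi> i (block n p i) \<bullet> \<Phi> j (block n p j)))
        = avg ?P (\<lambda>p. \<Phi> i (block n p i) \<bullet> \<Phi> i (block n p i))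
          + (\<Sum>j\<in>{..<k} - {i}. avg ?P (\<lambda>p. \<Phi> i (block n p i) \<bullet> \<Phi> j (block n p j)))"
      by (simp add: sum.remove)
    also have "\<dots> = avg ?B (\<lambda>w. (norm (\<Phi> i w))\<^sup>2)
      + (\<Sum>j\<in>{..<k} - {i}. - (1 / (real R - 1)) * avg ?B (\<lambda>w. \<Phi> i w \<bullet> \<Phi> j w))"
      using i k by (intro arg_cong2[where f="(+)"] sum.cong refl block_second_moment block_covariance) auto
    finally show "(\<Sum>j<k. avg ?P (\<lambda>p. \<Phi> i (block n p i) \<bullet> \<Phi> j (block n p j))) = \<dots>" .
  qed
  finally show ?thesis by (simp add: sum.distrib sum_subtractf sum_distrib_left sum_negf)
qed

text \<open>For differing \<open>\<Phi> i\<close> and \<open>\<Phi> j\<close> the mixed terms have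
  no sign. Estimated by squares they contribute at most \<open>(k - 1) / (R - 1)\<close> times the
  diagonal, hence the factor \<open>2\<close>.\<close>

lemma block_sum_bound:
  assumes k: "k \<le> R"
  shows "avg (perms (n * R)) (\<lambda>p. (norm (\<Sum>i<k. \<Phi> i (block n p i)))\<^sup>2)
    \<le> 2 * (\<Sum>i<k. avg (batches (n * R) n) (\<lambda>w. (norm (\<Phi> i w))\<^sup>2))"
proof -
  let ?B = "batches (n * R) n"
  define v where "v = (\<lambda>i. avg ?B (\<lambda>w. (norm (\<Phi> i w))\<^sup>2))"
  have v0: "v i \<ge> 0" for i unfolding v_def by (rule avg_nonneg) simp
  have off: "- avg ?B (\<lambda>w. \<Phi> i w \<bullet> \<Phi> j w) \<le> (v i + v j) / 2" for i j
  proof -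
    have "- (x \<bullet> y) \<le> 1 / 2 * ((norm x)\<^sup>2 + (norm y)\<^sup>2)" for x y :: 'a
    proof -
      have "0 \<le> (norm (x + y))\<^sup>2" by simp
      then show ?thesis by (simp add: power2_norm_eq_inner inner_add_left inner_add_right inner_commute)
    qed
    then have "avg ?B (\<lambda>w. - (\<Phi> i w \<bullet> \<Phi> j w)) \<le> avg ?B (\<lambda>w. 1 / 2 * ((norm (\<Phi> i w))\<^sup>2 + (norm (\<Phi> j w))\<^sup>2))"
      by (rule avg_mono)
    then show ?thesis unfolding avg_cmult avg_add avg_uminus v_def by simp
  qed
  have "(\<Sum>i<k. \<Sum>j\<in>{..<k} - {i}. - avg ?B (\<lambda>w. \<Phi> i w \<bullet> \<Phi> j w)) \<le> (\<Sum>i<k. \<Sum>j\<in>{..<k} - {i}. (v i + v j) / 2)"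
    by (intro sum_mono off)
  also have "\<dots> = (real k - 1) * (\<Sum>i<k. v i)"
  proof -
    have "(\<Sum>j\<in>{..<k} - {i}. (v i + v j) / 2) = (real k - 2) / 2 * v i + (\<Sum>j<k. v j) / 2" if "i < k" for i
    proof -
      have "(\<Sum>j\<in>{..<k} - {i}. (v i + v j) / 2) = (\<Sum>j<k. (v i + v j) / 2) - v i"
        using that by (simp add: sum_diff1)
      also have "(\<Sum>j<k. (v i + v j) / 2) = real k * v i / 2 + (\<Sum>j<k. v j) / 2"
        by (simp add: sum_divide_distrib[symmetric] sum.distrib add_divide_distrib)
      finally show ?thesis by (simp add: field_simps)
    qed
    then have "(\<Sum>i<k. \<Sum>j\<in>{..<k} - {i}. (v i + v j) / 2) = (\<Sum>i<k. (real k - 2) / 2 * v i + (\<Sum>j<k. v j) / 2)"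
      by (intro sum.cong) auto
    also have "\<dots> = (real k - 2) / 2 * (\<Sum>i<k. v i) + real k * ((\<Sum>j<k. v j) / 2)"
      by (simp add: sum.distrib sum_distrib_left)
    finally show ?thesis by (simp add: field_simps)
  qed
  finally have "- (\<Sum>i<k. \<Sum>j\<in>{..<k} - {i}. avg ?B (\<lambda>w. \<Phi> i w \<bullet> \<Phi> j w)) \<le> (real k - 1) * (\<Sum>i<k. v i)"
    by (simp add: sum_negf)
  also have "\<dots> \<le> (real R - 1) * (\<Sum>i<k. v i)"
    using k v0 by (intro mult_right_mono sum_nonneg) auto
  finally have "(1 / (real R - 1)) * (- (\<Sum>i<k. \<Sum>j\<in>{..<k} - {i}. avg ?B (\<lambda>w. \<Phi> i w \<bullet> \<Phi> j w)))
      \<le> (1 / (real R - 1)) * ((real R - 1) * (\<Sum>i<k. v i))"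
    using R2 by (intro mult_left_mono) auto
  also have "\<dots> = (\<Sum>i<k. v i)" using R2 by simp
  finally show ?thesis unfolding block_sum_second_moment[OF k] v_def by simp
qed

text \<open>Polarization: with all \<open>R\<close> blocks present, the weight
  \<open>1 / (R - 1)\<close> of the covariances is exactly the one for which diagonal and mixed
  terms combine to squared differences.\<close>

lemma block_full_sum:
  "avg (perms (n * R)) (\<lambda>p. (norm (\<Sum>i<R. \<Phi> i (block n p i)))\<^sup>2)
    = (1 / (2 * (real R - 1))) * (\<Sum>i<R. \<Sum>j<R. avg (batches (n * R) n) (\<lambda>w. (norm (\<Phi> i w - \<Phi> j w))\<^sup>2))"
proof -
  let ?B = "batches (n * R) n"
  define v where "v = (\<lambda>i. avg ?B (\<lambda>w. (norm (\<Phi> i w))\<^sup>2))"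
  define u where "u = (\<lambda>i j. avg ?B (\<lambda>w. \<Phi> i w \<bullet> \<Phi> j w))"
  have uv: "u i i = v i" for i by (simp add: u_def v_def power2_norm_eq_inner)
  have "avg ?B (\<lambda>w. (norm (\<Phi> i w - \<Phi> j w))\<^sup>2) = v i + v j - 2 * u i j" for i j
  proof -
    have "(norm (\<Phi> i w - \<Phi> j w))\<^sup>2 = ((norm (\<Phi> i w))\<^sup>2 + (norm (\<Phi> j w))\<^sup>2) + (-2) * (\<Phi> i w \<bullet> \<Phi> j w)" for w
      by (simp add: power2_norm_eq_inner inner_diff_left inner_diff_right inner_commute)
    then show ?thesis unfolding v_def u_def by (simp only: avg_add avg_cmult)
  qed
  then have "(\<Sum>i<R. \<Sum>j<R. avg ?B (\<lambda>w. (norm (\<Phi> i w - \<Phi> j w))\<^sup>2))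
      = (\<Sum>i<R. real R * v i + (\<Sum>j<R. v j) - 2 * (\<Sum>j<R. u i j))"
    by (simp add: sum.distrib sum_subtractf sum_distrib_left)
  also have "\<dots> = 2 * real R * (\<Sum>i<R. v i) - 2 * (\<Sum>i<R. \<Sum>j<R. u i j)"
    by (simp add: sum.distrib sum_subtractf sum_distrib_left[symmetric])
  also have "(\<Sum>i<R. \<Sum>j<R. u i j) = (\<Sum>i<R. v i) + (\<Sum>i<R. \<Sum>j\<in>{..<R} - {i}. u i j)"
    unfolding sum.distrib[symmetric] by (intro sum.cong refl) (simp add: uv[symmetric] sum.remove)
  finally have *: "(\<Sum>i<R. \<Sum>j<R. avg ?B (\<lambda>w. (norm (\<Phi> i w - \<Phi> j w))\<^sup>2))
      = 2 * ((real R - 1) * (\<Sum>i<R. v i) - (\<Sum>i<R. \<Sum>j\<in>{..<R} - {i}. u i j))"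
    by (simp add: algebra_simps)
  have "avg (perms (n * R)) (\<lambda>p. (norm (\<Sum>i<R. \<Phi> i (block n p i)))\<^sup>2)
      = (\<Sum>i<R. v i) - (1 / (real R - 1)) * (\<Sum>i<R. \<Sum>j\<in>{..<R} - {i}. u i j)"
    using block_sum_second_moment[OF order_refl] by (simp add: u_def v_def)
  then show ?thesis unfolding * using R2 by (simp add: field_simps)
qed

end

lemma nn_integral_uniform_count_measure:
  assumes "finite A" "\<And>a. a \<in> A \<Longrightarrow> 0 \<le> f a"
  shows "(\<integral>\<^sup>+ a. ennreal (f a) \<partial>uniform_count_measure A) = ennreal (avg A f)"
proof -
  have "(\<integral>\<^sup>+ a. ennreal (f a) \<partial>uniform_count_measure A) = (\<Sum>a\<in>A. ennreal (1 / card A) * ennreal (f a))"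
    unfolding uniform_count_measure_def using assms(1)
    by (subst nn_integral_point_measure_finite) (auto simp: mult.commute)
  also have "\<dots> = ennreal (\<Sum>a\<in>A. 1 / card A * f a)"
    using assms by (simp add: ennreal_mult[symmetric] sum_ennreal)
  finally show ?thesis by (simp add: avg_def sum_divide_distrib)
qed

section \<open>The coupled SGLD iteration\<close>

text \<open>The condition \<open>2 \<le> R\<close> expresses \<open>n < N\<close>, and the factor
  \<open>1 / (R - 1)\<close> of the block covariances relies on it.\<close>

locale rr_problem = convex_potential F L \<mu>
  for F :: "'a::euclidean_space \<Rightarrow> real" and L \<mu> +
  fixes g :: "nat \<Rightarrow> 'a \<Rightarrow> real" and n R :: nat and h \<sigma> :: real
  assumes F_eq: "F = objective g (n * R)" and n_pos: "0 < n" and R_ge_2: "2 \<le> R"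
    and batch: "\<And>w. w \<in> batches (n * R) n \<Longrightarrow>
      cont_diff (batch_fun g w) \<and> smooth L (batch_fun g w) \<and> strongly_convex \<mu> (batch_fun g w)"
    and variance: "batch_grad_variance g (n * R) n (gibbs F) \<le> ennreal (\<sigma>\<^sup>2)"
    and sigma_nonneg: "0 \<le> \<sigma>" and h_pos: "0 < h" and hL: "h * L < 1"
begin

abbreviation "\<rho> \<equiv> 1 - h * \<mu>"

lemma h_mu: "0 < h * \<mu>" "h * \<mu> < 1"
  using h_pos mu_pos hL mult_left_mono[OF mu_le_L, of h] by (simp, linarith)

definition \<phi> :: "nat list \<Rightarrow> 'a \<Rightarrow> 'a" where
  "\<phi> w y = grad (batch_fun g w) y - grad F y"

lemma batch_grad_measurable: "w \<in> batches (n * R) n \<Longrightarrow> grad (batch_fun g w) \<in> borel_measurable borel"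
  using batch cont_diff_borel by blast

lemma phi_measurable: "w \<in> batches (n * R) n \<Longrightarrow> \<phi> w \<in> borel_measurable borel"
  unfolding \<phi>_def using batch_grad_measurable by measurable

lemma batch_grad_lipschitz:
  "w \<in> batches (n * R) n \<Longrightarrow> norm (grad (batch_fun g w) x - grad (batch_fun g w) y) \<le> L * norm (x - y)"
  using batch by (auto simp: smooth_def)

lemma phi_lipschitz:
  assumes "w \<in> batches (n * R) n"
  shows "norm (\<phi> w x - \<phi> w y) \<le> 2 * L * norm (x - y)"
proof -
  have "\<phi> w x - \<phi> w y = (grad (batch_fun g w) x - grad (batch_fun g w) y) - (grad F x - grad F y)"
    by (simp add: \<phi>_def)
  then show ?thesis
    using norm_triangle_ineq4[of "grad (batch_fun g w) x - grad (batch_fun g w) y" "grad F x - grad F y"]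
      batch_grad_lipschitz[OF assms, of x y] grad_lipschitz[of x y] by simp
qed

lemma sum_over_blocks: "(\<Sum>r<R. \<Sum>j<n. k (r * n + j + 1)) = (\<Sum>i = 1..n * R. k i)" for k :: "nat \<Rightarrow> 'b::comm_monoid_add"
proof -
  have "(\<Sum>j<n. k (r * n + j + 1)) = (\<Sum>i\<in>{r * n..<r * n + n}. k (i + 1))" for r
    by (rule sum.reindex_bij_witness[of _ "\<lambda>i. i - r * n" "\<lambda>j. r * n + j"]) auto
  then have "(\<Sum>r<R. \<Sum>j<n. k (r * n + j + 1)) = (\<Sum>i<R * n. k (i + 1))"
    by (simp add: sum.nat_group)
  also have "\<dots> = (\<Sum>i = 1..n * R. k i)"
    by (rule sum.reindex_bij_witness[of _ "\<lambda>i. i - 1" "\<lambda>i. i + 1"]) (auto simp: mult.commute)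
  finally show ?thesis .
qed

text \<open>The blocks of a permutation partition the indices, so the batch functions add up to
  \<open>R\<close> times \<open>F\<close>. The sum is differentiated as a whole, because
  differentiability is assumed of the batch functions and not of the single
  \<open>g i\<close>.\<close>

lemma phi_zero_sum:
  assumes p: "p permutes {1..n * R}"
  shows "(\<Sum>r<R. \<phi> (block n p r) y) = 0"
proof -
  have "(\<Sum>r<R. batch_fun g (block n p r) x) = real R * F x" for x
  proof -
    have "batch_fun g (block n p r) x = (\<Sum>j<n. g (p (r * n + j + 1)) x) / real n" for r
      unfolding batch_fun_def by (simp add: nth_block)
    then have "(\<Sum>r<R. batch_fun g (block n p r) x) = (\<Sum>r<R. \<Sum>j<n. g (p (r * n + j + 1)) x) / real n"
      by (simp add: sum_divide_distrib)
    also have "(\<Sum>r<R. \<Sum>j<n. g (p (r * n + j + 1)) x) = (\<Sum>i = 1..n * R. g (p i) x)"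
      by (rule sum_over_blocks)
    also have "\<dots> = (\<Sum>i = 1..n * R. g i x)" using sum.permute[OF p, of "\<lambda>i. g i x"] by (simp add: o_def)
    finally show ?thesis using n_pos R_ge_2 by (simp add: F_eq objective_def)
  qed
  then have eq: "(\<lambda>x. \<Sum>r<R. batch_fun g (block n p r) x) = (\<lambda>x. real R * F x)" by blast
  have d1: "GDERIV (\<lambda>x. \<Sum>r<R. batch_fun g (block n p r) x) y :> (\<Sum>r<R. grad (batch_fun g (block n p r)) y)"
    unfolding gderiv_def inner_sum_right
    by (intro has_derivative_sum) (use batch[OF block_in_batches[OF p]] cont_diff_GDERIV in \<open>auto simp: gderiv_def\<close>)
  have d2: "GDERIV (\<lambda>x. real R * F x) y :> real R *\<^sub>R grad F y"
    using cont_diff_GDERIV[OF cont_diff_F, of y] unfolding gderiv_def inner_scaleR_right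
    by (rule has_derivative_mult_right)
  have "(\<Sum>r<R. grad (batch_fun g (block n p r)) y) = real R *\<^sub>R grad F y"
    using grad_eqI[OF d1] grad_eqI[OF d2] by (simp add: eq)
  then show ?thesis by (simp add: \<phi>_def sum_subtractf sum_constant_scaleR)
qed

definition V :: "'a \<Rightarrow> real" where
  "V y = avg (batches (n * R) n) (\<lambda>w. (norm (\<phi> w y))\<^sup>2)"

lemma V_nonneg: "V y \<ge> 0"
  unfolding V_def by (rule avg_nonneg) simp

lemma V_measurable [measurable]: "V \<in> borel_measurable borel"
proof -
  have "(\<lambda>y. (norm (\<phi> w y))\<^sup>2) \<in> borel_measurable borel" if "w \<in> batches (n * R) n" for w
  proof -
    have [measurable]: "\<phi> w \<in> borel_measurable borel" by (rule phi_measurable[OF that])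
    show ?thesis by measurable
  qed
  then show ?thesis
    unfolding V_def avg_def by (intro borel_measurable_divide borel_measurable_sum borel_measurable_const)
qed

lemma V_integral: "(\<integral>\<^sup>+ y. ennreal (V y) \<partial>gibbs F) \<le> ennreal (\<sigma>\<^sup>2)"
proof -
  let ?B = "uniform_count_measure (batches (n * R) n)"
  have fin: "finite_measure ?B"
    by (rule finite_measureI) (simp add: space_uniform_count_measure emeasure_uniform_count_measure)
  interpret B: finite_measure ?B by (rule fin)
  have m: "(\<lambda>z. ennreal ((norm (\<phi> (snd z) (fst z)))\<^sup>2)) \<in> borel_measurable (gibbs F \<Otimes>\<^sub>M ?B)"
  proof (rule measurable_compose_countable'[where f="\<lambda>w z. ennreal ((norm (\<phi> w (fst z)))\<^sup>2)" and I="batches (n * R) n"])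
    fix w assume w: "w \<in> batches (n * R) n"
    have [measurable]: "\<phi> w \<in> borel_measurable borel" by (rule phi_measurable[OF w])
    show "(\<lambda>z. ennreal ((norm (\<phi> w (fst z)))\<^sup>2)) \<in> borel_measurable (gibbs F \<Otimes>\<^sub>M ?B)" by measurable
  next
    show "snd \<in> measurable (gibbs F \<Otimes>\<^sub>M ?B) (count_space (batches (n * R) n))"
      using measurable_snd[of "gibbs F" ?B]
      by (simp add: measurable_cong_sets[OF refl sets_uniform_count_measure_count_space])
  qed (simp add: countable_finite)
  have "(\<integral>\<^sup>+ y. ennreal (V y) \<partial>gibbs F) = (\<integral>\<^sup>+ y. \<integral>\<^sup>+ w. ennreal ((norm (\<phi> w y))\<^sup>2) \<partial>?B \<partial>gibbs F)"
    by (intro nn_integral_cong) (simp add: V_def nn_integral_uniform_count_measure)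
  also have "\<dots> = (\<integral>\<^sup>+ z. ennreal ((norm (\<phi> (snd z) (fst z)))\<^sup>2) \<partial>(gibbs F \<Otimes>\<^sub>M ?B))"
    using B.nn_integral_fst[OF m] by simp
  also have "\<dots> = batch_grad_variance g (n * R) n (gibbs F)"
    by (simp add: batch_grad_variance_def \<phi>_def F_eq[symmetric] split_beta')
  finally show ?thesis using variance by simp
qed

lemma batch_step_contraction:
  assumes "w \<in> batches (n * R) n"
  shows "norm ((x - h *\<^sub>R grad (batch_fun g w) x) - (y - h *\<^sub>R grad (batch_fun g w) y)) \<le> \<rho> * norm (x - y)"
  using batch[OF assms] gradient_step_contraction h_pos hL by blast

end

text \<open>All that enters from the Metropolis construction is a driving Gaussian
  \<open>\<Xi>\<close>, stationarity, and an error \<open>E\<close> with bound \<open>es\<close>.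
  The measure \<open>\<gamma>\<close> couples the initial law with \<open>gibbs F\<close> at cost
  \<open>v0\<close>.\<close>

locale rr_coupling = rr_problem F L \<mu> g n R h \<sigma>
  for F :: "'a::euclidean_space \<Rightarrow> real" and L \<mu> g n R h \<sigma> +
  fixes \<gamma> :: "('a \<times> 'a) measure" and Q :: "'q measure" and \<Xi> :: "'q \<Rightarrow> 'a" and E :: "'a \<Rightarrow> 'q \<Rightarrow> 'a"
    and es v0 :: real
  assumes prob_gamma: "prob_space \<gamma>" and sets_gamma [measurable_cong]: "sets \<gamma> = sets (borel \<Otimes>\<^sub>M borel)"
    and gamma_snd: "distr \<gamma> borel snd = gibbs F"
    and gamma_cost: "L2le \<gamma> (\<lambda>z. fst z - snd z) v0"
    and prob_Q: "prob_space Q" and Xi_measurable [measurable]: "\<Xi> \<in> borel_measurable Q"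
    and Xi_law: "distr Q borel \<Xi> = std_gaussian"
    and E_measurable [measurable]: "(\<lambda>(y, q). E y q) \<in> borel_measurable (borel \<Otimes>\<^sub>M Q)"
    and E_stationary: "distr (gibbs F \<Otimes>\<^sub>M Q) borel (\<lambda>(y, q). y - h *\<^sub>R grad F y + sqrt (2 * h) *\<^sub>R \<Xi> q + E y q) = gibbs F"
    and E_L2: "L2le (gibbs F \<Otimes>\<^sub>M Q) (\<lambda>(y, q). E y q) es"
    and E_integrable: "\<And>y. integrable Q (E y)"
begin

abbreviation "\<P> \<equiv> uniform_count_measure (perms (n * R))"

text \<open>Every source draws a sample of the full space \<open>S\<close> but uses one component of it only: an initial
  pair, the noise of a step, or the permutation of an epoch.\<close>

definition S :: "((('a \<times> 'a) \<times> 'q) \<times> (nat \<Rightarrow> nat)) measure" where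
  "S = (\<gamma> \<Otimes>\<^sub>M Q) \<Otimes>\<^sub>M \<P>"

definition \<Omega>' :: "(source \<Rightarrow> (('a \<times> 'a) \<times> 'q) \<times> (nat \<Rightarrow> nat)) measure" where
  "\<Omega>' = PiM UNIV (\<lambda>_. S)"

lemma prob_Pi: "prob_space \<P>"
  by (rule prob_space_uniform_count_measure[OF finite_perms perms_nonempty])

lemma prob_gamma_Q: "prob_space (\<gamma> \<Otimes>\<^sub>M Q)"
proof -
  interpret \<gamma>: prob_space \<gamma> by (rule prob_gamma)
  interpret Q: prob_space Q by (rule prob_Q)
  interpret pair_prob_space \<gamma> Q ..
  show ?thesis by (rule prob_space_axioms)
qed

lemma prob_S: "prob_space S"
proof -
  interpret a: prob_space "\<gamma> \<Otimes>\<^sub>M Q" by (rule prob_gamma_Q)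
  interpret b: prob_space \<P> by (rule prob_Pi)
  interpret pair_prob_space "\<gamma> \<Otimes>\<^sub>M Q" \<P> ..
  show ?thesis unfolding S_def by (rule prob_space_axioms)
qed

lemma S_measurable [measurable]:
  "(\<lambda>t. fst (fst t)) \<in> measurable S \<gamma>" "(\<lambda>t. snd (fst t)) \<in> measurable S Q" "snd \<in> measurable S \<P>"
  unfolding S_def by measurable

lemma distr_S:
  "distr S \<gamma> (\<lambda>t. fst (fst t)) = \<gamma>" "distr S Q (\<lambda>t. snd (fst t)) = Q" "distr S \<P> snd = \<P>"
proof -
  interpret \<gamma>: prob_space \<gamma> by (rule prob_gamma)
  interpret Q: prob_space Q by (rule prob_Q)
  interpret a: prob_space "\<gamma> \<Otimes>\<^sub>M Q" by (rule prob_gamma_Q)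
  interpret b: prob_space \<P> by (rule prob_Pi)
  interpret ab: pair_prob_space "\<gamma> \<Otimes>\<^sub>M Q" \<P> ..
  interpret c: pair_prob_space \<gamma> Q ..
  have fst_S: "distr S (\<gamma> \<Otimes>\<^sub>M Q) fst = \<gamma> \<Otimes>\<^sub>M Q" unfolding S_def by (rule b.distr_pair_fst)
  have snd_pair: "distr (A \<Otimes>\<^sub>M B) B snd = B" if "prob_space A" "prob_space B"
    for A :: "'x measure" and B :: "'y measure"
  proof -
    interpret A: prob_space A by fact
    interpret B: prob_space B by fact
    interpret P: pair_prob_space A B ..
    show ?thesis
    proof (rule measure_eqI)
      fix X assume "X \<in> sets (distr (A \<Otimes>\<^sub>M B) B snd)"
      then have X: "X \<in> sets B" by simp
      have "snd -` X \<inter> space (A \<Otimes>\<^sub>M B) = space A \<times> X"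
        using sets.sets_into_space[OF X] by (auto simp: space_pair_measure)
      then show "emeasure (distr (A \<Otimes>\<^sub>M B) B snd) X = emeasure B X"
        using X by (simp add: emeasure_distr B.emeasure_pair_measure_Times A.emeasure_space_1)
    qed simp
  qed
  have "distr S \<gamma> (\<lambda>t. fst (fst t)) = distr (distr S (\<gamma> \<Otimes>\<^sub>M Q) fst) \<gamma> fst"
    by (subst distr_distr) (auto simp: o_def S_def)
  then show "distr S \<gamma> (\<lambda>t. fst (fst t)) = \<gamma>" by (simp add: fst_S Q.distr_pair_fst)
  have "distr S Q (\<lambda>t. snd (fst t)) = distr (distr S (\<gamma> \<Otimes>\<^sub>M Q) fst) Q snd"
    by (subst distr_distr) (auto simp: o_def S_def)
  then show "distr S Q (\<lambda>t. snd (fst t)) = Q" by (simp add: fst_S snd_pair prob_gamma prob_Q)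
  show "distr S \<P> snd = \<P>" unfolding S_def by (rule snd_pair[OF prob_gamma_Q prob_Pi])
qed

lemma prob_\<Omega>': "prob_space \<Omega>'"
  unfolding \<Omega>'_def by (intro prob_space_PiM prob_S)

lemma resampling_\<Omega>': "resampling \<Omega>' S (\<lambda>w t. w(i := t))"
  unfolding \<Omega>'_def by (rule resampling_PiM) (rule prob_S)

lemma \<Omega>'_component [measurable]: "(\<lambda>w. w i) \<in> measurable \<Omega>' S"
  unfolding \<Omega>'_def by measurable

lemma distr_\<Omega>'_component: "distr \<Omega>' S (\<lambda>w. w i) = S"
  unfolding \<Omega>'_def by (rule distr_PiM_component) (auto intro: prob_S)

section \<open>The coupled processes on the product space\<close>

definition qn :: "nat \<Rightarrow> (source \<Rightarrow> (('a \<times> 'a) \<times> 'q) \<times> (nat \<Rightarrow> nat)) \<Rightarrow> 'q" where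
  "qn k w = snd (fst (w (Noise k)))"

definition pm :: "nat \<Rightarrow> (source \<Rightarrow> (('a \<times> 'a) \<times> 'q) \<times> (nat \<Rightarrow> nat)) \<Rightarrow> nat \<Rightarrow> nat" where
  "pm l w = snd (w (Shuffle l))"

definition bk :: "nat \<Rightarrow> (source \<Rightarrow> (('a \<times> 'a) \<times> 'q) \<times> (nat \<Rightarrow> nat)) \<Rightarrow> nat list" where
  "bk k w = block n (pm (k div R) w) (k mod R)"

lemma qn_measurable [measurable]: "qn k \<in> measurable \<Omega>' Q"
  unfolding qn_def by measurable

lemma pm_measurable [measurable]: "pm l \<in> measurable \<Omega>' \<P>"
  unfolding pm_def by measurable

lemma pm_permutes: "w \<in> space \<Omega>' \<Longrightarrow> pm l w permutes {1..n * R}"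
  using measurable_space[OF pm_measurable] by (auto simp: space_uniform_count_measure)

lemma mod_R: "k mod R < R"
  using R_ge_2 by simp

lemma bk_batches: "w \<in> space \<Omega>' \<Longrightarrow> bk k w \<in> batches (n * R) n"
  unfolding bk_def by (intro block_in_batches pm_permutes mod_R)

lemma bk_measurable: "bk k \<in> measurable \<Omega>' (count_space (batches (n * R) n))"
proof -
  have "(\<lambda>p. block n p (k mod R)) \<in> measurable \<P> (count_space (batches (n * R) n))"
    using block_in_batches[OF _ mod_R]
    by (subst measurable_cong_sets[OF sets_uniform_count_measure_count_space refl]) auto
  from measurable_compose[OF pm_measurable[of "k div R"] this] show ?thesis by (simp add: bk_def[abs_def])
qed

text \<open>A batch takes finitely many values, so it suffices to treat each batch
  separately.\<close>

lemma measurable_bk_compose: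
  assumes "\<And>b. b \<in> batches (n * R) n \<Longrightarrow> f b \<in> borel_measurable borel"
    and "X \<in> borel_measurable \<Omega>'"
  shows "(\<lambda>w. f (bk k w) (X w)) \<in> borel_measurable \<Omega>'"
  by (rule measurable_compose_countable'[where f="\<lambda>b w. f b (X w)", OF _ bk_measurable])
     (use assms measurable_compose[OF assms(2) assms(1)] in \<open>auto simp: countable_finite\<close>)

text \<open>The synchronous coupling: \<open>Y\<close> and \<open>X\<close> are driven by the same
  Gaussian, which cancels in their difference.\<close>

primrec Y where
  "Y 0 w = snd (fst (fst (w Initial)))"
| "Y (Suc k) w = Y k w - h *\<^sub>R grad F (Y k w) + sqrt (2 * h) *\<^sub>R \<Xi> (qn k w) + E (Y k w) (qn k w)"

primrec X where
  "X 0 w = fst (fst (fst (w Initial)))"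
| "X (Suc k) w = X k w - h *\<^sub>R grad (batch_fun g (bk k w)) (X k w) + sqrt (2 * h) *\<^sub>R \<Xi> (qn k w)"

text \<open>\<open>C\<close> accumulates the gradient noise of the current epoch.  At the end of an epoch it is not reset
  to zero but damped by \<open>\<theta>\<close>: what remains has mean zero given the past and stays bounded over
  many epochs, and the part removed is small enough to be absorbed by the contraction.\<close>

definition \<theta> :: real where "\<theta> = max 0 (1 - L * R * h)"

primrec C where
  "C 0 w = 0"
| "C (Suc k) w = (if R dvd Suc k then \<theta> else 1) *\<^sub>R (C k w + h *\<^sub>R \<phi> (bk k w) (Y k w))"

lemma theta_bounds: "0 \<le> \<theta>" "\<theta> < 1"
  using L_pos h_pos R_ge_2 by (auto simp: \<theta>_def)

lemma Y_measurable [measurable]: "Y k \<in> borel_measurable \<Omega>'"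
proof (induction k)
  case 0
  have "(\<lambda>w. fst (fst (w Initial))) \<in> measurable \<Omega>' (borel \<Otimes>\<^sub>M borel)"
    using measurable_compose[OF \<Omega>'_component S_measurable(1)] by (simp add: measurable_cong_sets[OF refl sets_gamma])
  from measurable_compose[OF this measurable_snd] show ?case by simp
next
  case (Suc k)
  note [measurable] = Suc.IH
  show ?case by simp measurable
qed

lemma X_measurable [measurable]: "X k \<in> borel_measurable \<Omega>'"
proof (induction k)
  case 0
  have "(\<lambda>w. fst (fst (w Initial))) \<in> measurable \<Omega>' (borel \<Otimes>\<^sub>M borel)"
    using measurable_compose[OF \<Omega>'_component S_measurable(1)] by (simp add: measurable_cong_sets[OF refl sets_gamma])
  from measurable_compose[OF this measurable_fst] show ?case by simp
next
  case (Suc k)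
  note [measurable] = Suc.IH measurable_bk_compose[OF batch_grad_measurable Suc.IH]
  show ?case by simp measurable
qed

lemma phi_bk_measurable [measurable]: "(\<lambda>w. \<phi> (bk k w) (Y k w)) \<in> borel_measurable \<Omega>'"
  by (rule measurable_bk_compose[OF phi_measurable Y_measurable])

lemma C_measurable [measurable]: "C k \<in> borel_measurable \<Omega>'"
proof (induction k)
  case (Suc k)
  note [measurable] = Suc.IH
  show ?case by simp measurable
qed simp

lemma Y_noise_upd: "k \<le> j \<Longrightarrow> Y k (w(Noise j := t)) = Y k w"
  by (induction k) (auto simp: qn_def)

text \<open>The stationary chain never sees the batches. It is therefore independent of all
  permutations, and averages over a permutation may be taken with its trajectory held fixed.\<close>

lemma Y_shuffle_upd: "Y k (w(Shuffle l := t)) = Y k w"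
  by (induction k) (auto simp: qn_def)

lemma bk_noise_upd: "bk k (w(Noise j := t)) = bk k w"
  by (simp add: bk_def pm_def)

lemma X_noise_upd: "k \<le> j \<Longrightarrow> X k (w(Noise j := t)) = X k w"
  by (induction k) (auto simp: qn_def bk_noise_upd)

text \<open>The index reaches one further than for \<open>X\<close> and \<open>Y\<close>, because
  \<open>C (Suc j)\<close> involves \<open>Y\<close> only up to time \<open>j\<close>, before the
  noise \<open>j\<close> acts.\<close>

lemma C_noise_upd: "k \<le> Suc j \<Longrightarrow> C k (w(Noise j := t)) = C k w"
  by (induction k) (auto simp: Y_noise_upd bk_noise_upd)

lemma bk_shuffle_upd: "k < l * R \<Longrightarrow> bk k (w(Shuffle l := t)) = bk k w"
  using R_ge_2 by (auto simp: bk_def pm_def div_less_iff_less_mult less_imp_neq)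

lemma C_shuffle_upd: "k \<le> l * R \<Longrightarrow> C k (w(Shuffle l := t)) = C k w"
  by (induction k) (auto simp: Y_shuffle_upd bk_shuffle_upd)

lemma noise_joint_law:
  assumes A: "A \<in> borel_measurable \<Omega>'" and ind: "\<And>w t. A (w(Noise k := t)) = A w"
  shows "distr \<Omega>' (borel \<Otimes>\<^sub>M Q) (\<lambda>w. (A w, qn k w)) = distr \<Omega>' borel A \<Otimes>\<^sub>M Q"
proof -
  interpret \<Omega>': prob_space \<Omega>' by (rule prob_\<Omega>')
  interpret S: prob_space S by (rule prob_S)
  interpret Q: prob_space Q by (rule prob_Q)
  interpret A: prob_space "distr \<Omega>' borel A" by (rule \<Omega>'.prob_space_distr[OF A])
  note [measurable] = A
  have j: "distr \<Omega>' (borel \<Otimes>\<^sub>M S) (\<lambda>w. (A w, w (Noise k))) = distr \<Omega>' borel A \<Otimes>\<^sub>M S"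
    by (rule resampling_joint_law[OF resampling_\<Omega>'[of "Noise k"] A]) (auto simp: ind)
  have "distr \<Omega>' (borel \<Otimes>\<^sub>M Q) (\<lambda>w. (A w, qn k w))
      = distr (distr \<Omega>' (borel \<Otimes>\<^sub>M S) (\<lambda>w. (A w, w (Noise k)))) (borel \<Otimes>\<^sub>M Q) (\<lambda>(a, t). (id a, snd (fst t)))"
    by (subst distr_distr) (auto simp: o_def qn_def split_beta')
  also have "\<dots> = distr (distr \<Omega>' borel A \<Otimes>\<^sub>M S) (borel \<Otimes>\<^sub>M Q) (\<lambda>(a, t). (id a, snd (fst t)))"
    unfolding j ..
  also have "\<dots> = distr (distr \<Omega>' borel A) borel id \<Otimes>\<^sub>M distr S Q (\<lambda>t. snd (fst t))"
    by (rule pair_measure_distr[symmetric])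
       (auto simp: distr_S intro: Q.sigma_finite_measure_axioms)
  also have "distr (distr \<Omega>' borel A) borel id = distr \<Omega>' borel A"
    unfolding id_def by (rule distr_id2) simp
  finally show ?thesis by (simp only: distr_S)
qed

lemma Y_law: "distr \<Omega>' borel (Y k) = gibbs F"
proof (induction k)
  case 0
  have "Y 0 = (\<lambda>w. snd (fst (fst (w Initial))))" by (simp add: fun_eq_iff)
  then have "distr \<Omega>' borel (Y 0) = distr (distr (distr \<Omega>' S (\<lambda>w. w Initial)) \<gamma> (\<lambda>t. fst (fst t))) borel snd"
    by (subst distr_distr, simp, simp, subst distr_distr)
       (auto simp: o_def measurable_cong_sets[OF sets_gamma refl])
  then show ?case by (simp only: distr_\<Omega>'_component distr_S gamma_snd)
next
  case (Suc k)
  have "Y (Suc k) = (\<lambda>w. Y k w - h *\<^sub>R grad F (Y k w) + sqrt (2 * h) *\<^sub>R \<Xi> (qn k w) + E (Y k w) (qn k w))"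
    by (simp add: fun_eq_iff)
  then have "distr \<Omega>' borel (Y (Suc k)) = distr (distr \<Omega>' (borel \<Otimes>\<^sub>M Q) (\<lambda>w. (Y k w, qn k w))) borel
      (\<lambda>(y, q). y - h *\<^sub>R grad F y + sqrt (2 * h) *\<^sub>R \<Xi> q + E y q)"
    by (subst distr_distr) (auto simp: o_def)
  also have "\<dots> = gibbs F"
    by (subst noise_joint_law) (auto simp: Y_noise_upd Suc.IH E_stationary)
  finally show ?case .
qed

lemma L2le_Y: "L2le (gibbs F) f a \<Longrightarrow> L2le \<Omega>' (\<lambda>w. f (Y k w)) a"
  by (subst (asm) Y_law[of k, symmetric], subst (asm) L2le_distr) auto

lemma Y_noise_law: "distr \<Omega>' (borel \<Otimes>\<^sub>M Q) (\<lambda>w. (Y k w, qn k w)) = gibbs F \<Otimes>\<^sub>M Q"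
  by (subst noise_joint_law) (auto simp: Y_noise_upd Y_law)

lemma L2le_E: "L2le \<Omega>' (\<lambda>w. E (Y k w) (qn k w)) es"
  using E_L2 by (subst (asm) Y_noise_law[of k, symmetric], subst (asm) L2le_distr) auto

lemma es_nonneg: "es \<ge> 0"
  using E_L2 by (rule L2le_nonneg)

lemma Xi_integrable: "integrable Q \<Xi>" and Xi_mean: "(\<integral>q. \<Xi> q \<partial>Q) = 0" and Xi_L2: "L2le Q \<Xi> (sqrt DIM('a))"
proof -
  interpret Q: prob_space Q by (rule prob_Q)
  show L2: "L2le Q \<Xi> (sqrt DIM('a))"
    using L2le_gaussian[where 'a='a] unfolding Xi_law[symmetric] by (subst (asm) L2le_distr) auto
  show "integrable Q \<Xi>" by (rule Q.L2le_imp_integrable[OF L2])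
  show "(\<integral>q. \<Xi> q \<partial>Q) = 0"
    using gaussian_mean[where 'a='a] unfolding Xi_law[symmetric] by (subst (asm) integral_distr) auto
qed

lemma integral_S_noise:
  fixes f :: "'q \<Rightarrow> 'a"
  assumes "integrable Q f"
  shows "integrable S (\<lambda>t. f (snd (fst t)))" "(\<integral>t. f (snd (fst t)) \<partial>S) = (\<integral>q. f q \<partial>Q)"
proof -
  have [measurable]: "f \<in> borel_measurable Q" using assms by auto
  show "integrable S (\<lambda>t. f (snd (fst t)))"
    using assms by (subst (asm) distr_S(2)[symmetric], subst (asm) integrable_distr_eq) auto
  show "(\<integral>t. f (snd (fst t)) \<partial>S) = (\<integral>q. f q \<partial>Q)"
    by (subst (2) distr_S(2)[symmetric], subst integral_distr) auto
qed

lemma L2le_Xi_sum: "L2le \<Omega>' (\<lambda>w. \<Sum>j<i. \<Xi> (qn (a + j) w)) (sqrt (real i) * sqrt DIM('a))"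
proof (rule L2le_orthogonal_sum)
  have x: "L2le \<Omega>' (\<lambda>w. \<Xi> (qn k w)) (sqrt DIM('a))" for k
  proof -
    have "L2le (gibbs F \<Otimes>\<^sub>M Q) (\<lambda>z. \<Xi> (snd z)) (sqrt DIM('a))"
      by (rule L2le_snd[OF prob_space_gibbs prob_Q Xi_L2])
    then show ?thesis by (subst (asm) Y_noise_law[of k, symmetric], subst (asm) L2le_distr) auto
  qed
  then show "L2le \<Omega>' (\<lambda>w. \<Xi> (qn (a + i) w)) (sqrt DIM('a))" for i .
  fix i
  show "(\<integral>w. (\<Sum>j<i. \<Xi> (qn (a + j) w)) \<bullet> \<Xi> (qn (a + i) w) \<partial>\<Omega>') = 0"
    by (rule resampling_orthogonal[OF resampling_\<Omega>'[of "Noise (a + i)"] L2le_sum[OF x] x])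
       (auto simp: qn_def integral_S_noise[OF Xi_integrable] Xi_mean intro!: sum.cong)
qed

section \<open>Size of the accumulated gradient noise\<close>

definition W :: real where
  "W = real R * h * sqrt (L * DIM('a)) + sqrt (2 * h * R * DIM('a)) + real R * es"

lemma W_nonneg: "W \<ge> 0"
  using h_pos L_pos es_nonneg by (simp add: W_def)

lemma Y_displacement:
  assumes "i \<le> R"
  shows "L2le \<Omega>' (\<lambda>w. Y (a + i) w - Y a w) W"
proof (rule L2le_mono)
  have "Y (a + i) w - Y a w = (\<Sum>j<i. (- h) *\<^sub>R grad F (Y (a + j) w)) + sqrt (2 * h) *\<^sub>R (\<Sum>j<i. \<Xi> (qn (a + j) w))
      + (\<Sum>j<i. E (Y (a + j) w) (qn (a + j) w))" for w
    by (induction i) (auto simp: scaleR_add_right)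
  moreover have "L2le \<Omega>' (\<lambda>w. (\<Sum>j<i. (- h) *\<^sub>R grad F (Y (a + j) w)) + sqrt (2 * h) *\<^sub>R (\<Sum>j<i. \<Xi> (qn (a + j) w))
      + (\<Sum>j<i. E (Y (a + j) w) (qn (a + j) w)))
      ((\<Sum>j<i. \<bar>- h\<bar> * sqrt (L * DIM('a))) + \<bar>sqrt (2 * h)\<bar> * (sqrt (real i) * sqrt DIM('a)) + (\<Sum>j<i. es))"
    by (intro L2le_add L2le_scaleR L2le_sum L2le_Xi_sum L2le_E L2le_Y L2le_grad)
  ultimately show "L2le \<Omega>' (\<lambda>w. Y (a + i) w - Y a w)
      ((\<Sum>j<i. \<bar>- h\<bar> * sqrt (L * DIM('a))) + \<bar>sqrt (2 * h)\<bar> * (sqrt (real i) * sqrt DIM('a)) + (\<Sum>j<i. es))"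
    by simp
  have "real i * (h * sqrt (L * DIM('a))) \<le> real R * (h * sqrt (L * DIM('a)))"
    using assms h_pos L_pos by (intro mult_right_mono) auto
  moreover have "sqrt (2 * h) * (sqrt (real i) * sqrt DIM('a)) \<le> sqrt (2 * h * R * DIM('a))"
    using assms h_pos by (simp add: real_sqrt_mult[symmetric] mult_left_mono mult_right_mono)
  moreover have "real i * es \<le> real R * es" using assms es_nonneg by (intro mult_right_mono) auto
  ultimately have "real i * (h * sqrt (L * DIM('a))) + sqrt (2 * h) * (sqrt (real i) * sqrt DIM('a)) + real i * es
      \<le> real R * (h * sqrt (L * DIM('a))) + sqrt (2 * h * R * DIM('a)) + real R * es" by linarith
  then show "(\<Sum>j<i. \<bar>- h\<bar> * sqrt (L * DIM('a))) + \<bar>sqrt (2 * h)\<bar> * (sqrt (real i) * sqrt DIM('a)) + (\<Sum>j<i. es) \<le> W"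
    using h_pos by (simp add: W_def mult.assoc)
qed

text \<open>The gradient noise of the first \<open>k\<close> batches of epoch \<open>l\<close>,
  along the trajectory of \<open>Y\<close>.\<close>

definition partial_sum where
  "partial_sum l k w = (\<Sum>i<k. \<phi> (block n (pm l w) i) (Y (l * R + i) w))"

lemma bk_index: "i < R \<Longrightarrow> bk (l * R + i) w = block n (pm l w) i"
  by (simp add: bk_def)

lemma partial_sum_measurable: "k \<le> R \<Longrightarrow> partial_sum l k \<in> borel_measurable \<Omega>'"
  unfolding partial_sum_def
  by (intro borel_measurable_sum) (simp add: bk_index[symmetric] phi_bk_measurable)

text \<open>Resampling the permutation of the epoch leaves \<open>Y\<close> fixed, so the
  combinatorial estimates apply to each trajectory separately.\<close>

lemma shuffle_resample:
  assumes k: "k \<le> R"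
  shows "(\<integral>\<^sup>+ w. ennreal ((norm (partial_sum l k w))\<^sup>2) \<partial>\<Omega>')
    = (\<integral>\<^sup>+ w. ennreal (avg (perms (n * R)) (\<lambda>p. (norm (\<Sum>i<k. \<phi> (block n p i) (Y (l * R + i) w)))\<^sup>2)) \<partial>\<Omega>')"
proof -
  have [measurable]: "partial_sum l k \<in> borel_measurable \<Omega>'" by (rule partial_sum_measurable[OF k])
  have "(\<integral>\<^sup>+ w. ennreal ((norm (partial_sum l k w))\<^sup>2) \<partial>\<Omega>')
      = (\<integral>\<^sup>+ w. \<integral>\<^sup>+ t. ennreal ((norm (partial_sum l k (w(Shuffle l := t))))\<^sup>2) \<partial>S \<partial>\<Omega>')"
    by (rule resampling_nn_integral[OF resampling_\<Omega>'[of "Shuffle l"]]) measurable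
  also have "\<dots> = (\<integral>\<^sup>+ w. ennreal (avg (perms (n * R)) (\<lambda>p. (norm (\<Sum>i<k. \<phi> (block n p i) (Y (l * R + i) w)))\<^sup>2)) \<partial>\<Omega>')"
  proof (rule nn_integral_cong)
    fix w
    let ?f = "\<lambda>p. (norm (\<Sum>i<k. \<phi> (block n p i) (Y (l * R + i) w)))\<^sup>2"
    have m: "(\<lambda>p. ennreal (?f p)) \<in> borel_measurable \<P>"
      by (subst measurable_cong_sets[OF sets_uniform_count_measure_count_space refl]) simp
    have "(\<integral>\<^sup>+ t. ennreal ((norm (partial_sum l k (w(Shuffle l := t))))\<^sup>2) \<partial>S) = (\<integral>\<^sup>+ t. ennreal (?f (snd t)) \<partial>S)"
      by (simp add: partial_sum_def pm_def Y_shuffle_upd)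
    also have "\<dots> = (\<integral>\<^sup>+ p. ennreal (?f p) \<partial>distr S \<P> snd)"
      using m by (intro nn_integral_distr[OF S_measurable(3), symmetric]) (simp only: measurable_distr_eq1)
    also have "\<dots> = ennreal (avg (perms (n * R)) ?f)"
      unfolding distr_S by (rule nn_integral_uniform_count_measure[OF finite_perms]) simp
    finally show "(\<integral>\<^sup>+ t. ennreal ((norm (partial_sum l k (w(Shuffle l := t))))\<^sup>2) \<partial>S) = ennreal (avg (perms (n * R)) ?f)" .
  qed
  finally show ?thesis .
qed

lemma zero_sum_Y: "p permutes {1..n * R} \<Longrightarrow> (\<Sum>r<R. \<phi> (block n p r) (Y (l * R + i) w)) = 0"
  by (rule phi_zero_sum)

text \<open>After \<open>block_sum_bound\<close>, stationarity of \<open>Y\<close> bounds the mean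
  of each \<open>V\<close> by the variance under \<open>gibbs F\<close>.\<close>

lemma L2le_partial_sum:
  assumes k: "k \<le> R"
  shows "L2le \<Omega>' (partial_sum l k) (sqrt (2 * real R) * \<sigma>)"
proof -
  have "(\<integral>\<^sup>+ w. ennreal ((norm (partial_sum l k w))\<^sup>2) \<partial>\<Omega>') \<le> (\<integral>\<^sup>+ w. (\<Sum>i<k. 2 * ennreal (V (Y (l * R + i) w))) \<partial>\<Omega>')"
    unfolding shuffle_resample[OF k]
  proof (rule nn_integral_mono)
    fix w
    have "avg (perms (n * R)) (\<lambda>p. (norm (\<Sum>i<k. \<phi> (block n p i) (Y (l * R + i) w)))\<^sup>2) \<le> 2 * (\<Sum>i<k. V (Y (l * R + i) w))"
      unfolding V_def by (rule block_sum_bound[OF _ R_ge_2 k]) (rule zero_sum_Y)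
    then have "ennreal (avg (perms (n * R)) (\<lambda>p. (norm (\<Sum>i<k. \<phi> (block n p i) (Y (l * R + i) w)))\<^sup>2))
        \<le> ennreal (2 * (\<Sum>i<k. V (Y (l * R + i) w)))" by (rule ennreal_leI)
    also have "\<dots> = (\<Sum>i<k. 2 * ennreal (V (Y (l * R + i) w)))"
      using V_nonneg by (simp add: sum_distrib_left[symmetric] ennreal_mult sum_nonneg)
    finally show "ennreal (avg (perms (n * R)) (\<lambda>p. (norm (\<Sum>i<k. \<phi> (block n p i) (Y (l * R + i) w)))\<^sup>2)) \<le> \<dots>" .
  qed
  also have "\<dots> = (\<Sum>i<k. 2 * (\<integral>\<^sup>+ w. ennreal (V (Y (l * R + i) w)) \<partial>\<Omega>'))"
    by (simp add: nn_integral_sum nn_integral_cmult)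
  also have "\<dots> \<le> (\<Sum>i<k. 2 * ennreal (\<sigma>\<^sup>2))"
  proof (intro sum_mono mult_left_mono)
    fix i
    have "(\<integral>\<^sup>+ w. ennreal (V (Y (l * R + i) w)) \<partial>\<Omega>') = (\<integral>\<^sup>+ y. ennreal (V y) \<partial>distr \<Omega>' borel (Y (l * R + i)))"
      by (subst nn_integral_distr) auto
    then show "(\<integral>\<^sup>+ w. ennreal (V (Y (l * R + i) w)) \<partial>\<Omega>') \<le> ennreal (\<sigma>\<^sup>2)" using V_integral by (simp add: Y_law)
  qed simp
  also have "\<dots> = ennreal (2 * real k * \<sigma>\<^sup>2)"
    by (simp add: ennreal_mult ennreal_of_nat_eq_real_of_nat mult_ac)
  also have "\<dots> \<le> ennreal ((sqrt (2 * real R) * \<sigma>)\<^sup>2)"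
    using k by (intro ennreal_leI) (simp add: power_mult_distrib mult_right_mono)
  finally show ?thesis using partial_sum_measurable[OF k] sigma_nonneg by (simp add: L2le_def)
qed

text \<open>In \<open>block_full_sum\<close> the same batch is compared at two times of the epoch;
  Lipschitz continuity with constant \<open>2 * L\<close> reduces this to the displacement
  \<open>W\<close> of the stationary chain, and \<open>\<sigma>\<close> does not enter.\<close>

lemma L2le_full_sum: "L2le \<Omega>' (partial_sum l R) (sqrt (2 * real R) * L * W)"
proof -
  let ?D = "\<lambda>i j w. (norm (Y (l * R + i) w - Y (l * R + j) w))\<^sup>2"
  define K where "K = (1 / (2 * (real R - 1))) * (4 * L\<^sup>2)"
  have K: "K \<ge> 0" using R_ge_2 by (simp add: K_def)
  have D: "(\<integral>\<^sup>+ w. ennreal (?D i j w) \<partial>\<Omega>') \<le> ennreal (W\<^sup>2)" if "i < R" "j < R" for i j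
  proof -
    have *: "(\<integral>\<^sup>+ w. ennreal (?D i j w) \<partial>\<Omega>') \<le> ennreal (W\<^sup>2)" if ij: "j \<le> i" "i < R" for i j
    proof -
      have "L2le \<Omega>' (\<lambda>w. Y (l * R + i) w - Y (l * R + j) w) W"
        using Y_displacement[of "i - j" "l * R + j"] ij by simp
      then show ?thesis by (simp add: L2le_def)
    qed
    show ?thesis using *[of j i] *[of i j] that by (cases "j \<le> i") (auto simp: norm_minus_commute)
  qed
  have "(\<integral>\<^sup>+ w. ennreal ((norm (partial_sum l R w))\<^sup>2) \<partial>\<Omega>')
      \<le> (\<integral>\<^sup>+ w. (\<Sum>i<R. \<Sum>j\<in>{..<R} - {i}. ennreal K * ennreal (?D i j w)) \<partial>\<Omega>')"
    unfolding shuffle_resample[OF order_refl]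
  proof (rule nn_integral_mono)
    fix w
    have "avg (perms (n * R)) (\<lambda>p. (norm (\<Sum>i<R. \<phi> (block n p i) (Y (l * R + i) w)))\<^sup>2)
        = (1 / (2 * (real R - 1))) * (\<Sum>i<R. \<Sum>j<R. avg (batches (n * R) n)
            (\<lambda>b. (norm (\<phi> b (Y (l * R + i) w) - \<phi> b (Y (l * R + j) w)))\<^sup>2))"
      by (rule block_full_sum[OF _ R_ge_2]) (rule zero_sum_Y)
    also have "\<dots> \<le> (1 / (2 * (real R - 1))) * (\<Sum>i<R. \<Sum>j<R. 4 * L\<^sup>2 * ?D i j w)"
    proof (intro mult_left_mono sum_mono)
      fix i j
      have "avg (batches (n * R) n) (\<lambda>b. (norm (\<phi> b (Y (l * R + i) w) - \<phi> b (Y (l * R + j) w)))\<^sup>2)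
          \<le> avg (batches (n * R) n) (\<lambda>b. 4 * L\<^sup>2 * ?D i j w)"
      proof (rule avg_mono)
        fix b assume "b \<in> batches (n * R) n"
        then have "(norm (\<phi> b (Y (l * R + i) w) - \<phi> b (Y (l * R + j) w)))\<^sup>2 \<le> (2 * L * norm (Y (l * R + i) w - Y (l * R + j) w))\<^sup>2"
          by (intro power_mono phi_lipschitz) auto
        then show "(norm (\<phi> b (Y (l * R + i) w) - \<phi> b (Y (l * R + j) w)))\<^sup>2 \<le> 4 * L\<^sup>2 * ?D i j w"
          by (simp add: power_mult_distrib)
      qed
      also have "\<dots> \<le> 4 * L\<^sup>2 * ?D i j w" by (cases "batches (n * R) n = {}") (auto simp: avg_def)
      finally show "avg (batches (n * R) n) (\<lambda>b. (norm (\<phi> b (Y (l * R + i) w) - \<phi> b (Y (l * R + j) w)))\<^sup>2)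
          \<le> 4 * L\<^sup>2 * ?D i j w" .
    qed (use R_ge_2 in simp)
    \<comment> \<open>The diagonal terms vanish. The \<open>R * (R - 1)\<close> remaining pairs
      cancel the denominator \<open>R - 1\<close> in \<open>K\<close>, leaving
      \<open>2 * R * L\<^sup>2 * W\<^sup>2\<close>.\<close>
    also have "\<dots> = (\<Sum>i<R. \<Sum>j\<in>{..<R} - {i}. K * ?D i j w)"
    proof -
      have rm: "(\<Sum>j<R. 4 * L\<^sup>2 * ?D i j w) = (\<Sum>j\<in>{..<R} - {i}. 4 * L\<^sup>2 * ?D i j w)" if "i < R" for i
        using that by (subst sum.remove[of _ i]) auto
      have "(\<Sum>i<R. \<Sum>j<R. 4 * L\<^sup>2 * ?D i j w) = (\<Sum>i<R. \<Sum>j\<in>{..<R} - {i}. 4 * L\<^sup>2 * ?D i j w)"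
        by (rule sum.cong[OF refl], rule rm) (simp only: lessThan_iff)
      then show ?thesis by (simp add: K_def sum_distrib_left mult.assoc)
    qed
    finally have "ennreal (avg (perms (n * R)) (\<lambda>p. (norm (\<Sum>i<R. \<phi> (block n p i) (Y (l * R + i) w)))\<^sup>2))
        \<le> ennreal (\<Sum>i<R. \<Sum>j\<in>{..<R} - {i}. K * ?D i j w)" by (rule ennreal_leI)
    also have "\<dots> = (\<Sum>i<R. \<Sum>j\<in>{..<R} - {i}. ennreal K * ennreal (?D i j w))"
      using K by (simp add: sum_ennreal[symmetric] ennreal_mult sum_nonneg)
    finally show "ennreal (avg (perms (n * R)) (\<lambda>p. (norm (\<Sum>i<R. \<phi> (block n p i) (Y (l * R + i) w)))\<^sup>2)) \<le> \<dots>" .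
  qed
  also have "\<dots> = (\<Sum>i<R. \<Sum>j\<in>{..<R} - {i}. ennreal K * (\<integral>\<^sup>+ w. ennreal (?D i j w) \<partial>\<Omega>'))"
    by (simp add: nn_integral_sum nn_integral_cmult)
  also have "\<dots> \<le> (\<Sum>i<R. \<Sum>j\<in>{..<R} - {i}. ennreal K * ennreal (W\<^sup>2))"
    by (intro sum_mono mult_left_mono D) auto
  also have "\<dots> = ennreal (real R * (real (R - 1) * (K * W\<^sup>2)))"
    using K R_ge_2 by (simp add: ennreal_mult ennreal_of_nat_eq_real_of_nat of_nat_diff)
  also have "real R * (real (R - 1) * (K * W\<^sup>2)) = (sqrt (2 * real R) * L * W)\<^sup>2"
    using R_ge_2 by (simp add: K_def power_mult_distrib of_nat_diff field_simps)
  finally show ?thesis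
    using partial_sum_measurable[OF order_refl] W_nonneg L_pos by (simp add: L2le_def)
qed

lemma C_epoch: "j < R \<Longrightarrow> C (l * R + j) w = C (l * R) w + h *\<^sub>R partial_sum l j w"
proof (induction j)
  case (Suc j)
  have "\<not> R dvd Suc (l * R + j)"
  proof
    assume "R dvd Suc (l * R + j)"
    then have "R dvd Suc j" by (metis add_Suc_right dvd_add_right_iff dvd_triv_right)
    then show False using Suc.prems by (auto dest: dvd_imp_le)
  qed
  with Suc show ?case by (simp add: bk_index partial_sum_def scaleR_add_right)
qed (simp add: partial_sum_def)

lemma C_epoch_undamped:
  assumes "j < R"
  shows "C (l * R + j) w + h *\<^sub>R \<phi> (bk (l * R + j) w) (Y (l * R + j) w) = C (l * R) w + h *\<^sub>R partial_sum l (Suc j) w"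
  using C_epoch[OF assms] assms by (simp add: bk_index partial_sum_def scaleR_add_right)

lemma C_epoch_end: "C (Suc l * R) w = \<theta> *\<^sub>R (C (l * R) w + h *\<^sub>R partial_sum l R w)"
proof -
  have R: "Suc (l * R + (R - 1)) = Suc l * R" "R - 1 < R" "Suc (R - 1) = R" using R_ge_2 by auto
  have "C (Suc (l * R + (R - 1))) w = \<theta> *\<^sub>R (C (l * R + (R - 1)) w + h *\<^sub>R \<phi> (bk (l * R + (R - 1)) w) (Y (l * R + (R - 1)) w))"
  proof -
    have "R dvd Suc (l * R + (R - 1))" unfolding R(1) by simp
    then show ?thesis by (simp only: C.simps(2) if_True)
  qed
  then show ?thesis unfolding C_epoch_undamped[OF R(2)] unfolding R(1,3) .
qed

text \<open>The size at which damping balances the new noise. An epoch adds an orthogonal increment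
  of size \<open>B = h * sqrt (2 * R) * L * W\<close> and damps by \<open>1 - a\<close> with
  \<open>a = L * R * h\<close>; the formula solves
  \<open>B\<^sup>2 = a * \<eta>\<^sup>2\<close>.\<close>

definition \<eta> :: real where "\<eta> = sqrt (2 * L * h) * W"

lemma eta_nonneg: "\<eta> \<ge> 0"
  using W_nonneg L_pos h_pos by (simp add: \<eta>_def)

text \<open>At its start, an epoch has a value of \<open>C\<close> independent of its permutation,
  and given \<open>Y\<close> the sum over the whole epoch has mean zero over permutations. The bound
  \<open>a\<close> only records square integrability.\<close>

lemma partial_sum_orthogonal:
  assumes "L2le \<Omega>' (C (l * R)) a"
  shows "(\<integral>w. C (l * R) w \<bullet> (h *\<^sub>R partial_sum l R w) \<partial>\<Omega>') = 0"
proof (rule resampling_orthogonal[OF resampling_\<Omega>'[of "Shuffle l"] assms L2le_scaleR[OF L2le_full_sum]])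
  interpret P: prob_space \<P> by (rule prob_Pi)
  show "C (l * R) (w(Shuffle l := t)) = C (l * R) w" for w t by (rule C_shuffle_upd) simp
  fix w
  let ?f = "\<lambda>p. h *\<^sub>R (\<Sum>i<R. \<phi> (block n p i) (Y (l * R + i) w))"
  have eq: "h *\<^sub>R partial_sum l R (w(Shuffle l := t)) = ?f (snd t)" for t
    by (simp add: partial_sum_def pm_def Y_shuffle_upd)
  have m: "?f \<in> borel_measurable \<P>"
    by (subst measurable_cong_sets[OF sets_uniform_count_measure_count_space refl]) simp
  have i: "integrable \<P> ?f"
    unfolding uniform_count_measure_def by (rule integrable_point_measure_finite) (rule finite_perms)
  show "integrable S (\<lambda>t. h *\<^sub>R partial_sum l R (w(Shuffle l := t)))"
    unfolding eq using i m by (subst (asm) distr_S(3)[symmetric]) (subst (asm) integrable_distr_eq[OF S_measurable(3)], auto)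
  have "(\<integral>t. h *\<^sub>R partial_sum l R (w(Shuffle l := t)) \<partial>S) = (\<integral>p. ?f p \<partial>distr S \<P> snd)"
    unfolding eq by (rule integral_distr[OF S_measurable(3) m, symmetric])
  also have "\<dots> = (\<Sum>p\<in>perms (n * R). (1 / card (perms (n * R))) *\<^sub>R ?f p)"
    unfolding distr_S(3) unfolding uniform_count_measure_def
    by (rule lebesgue_integral_point_measure_finite) (rule finite_perms, simp)
  also have "\<dots> = (1 / card (perms (n * R))) *\<^sub>R h *\<^sub>R (\<Sum>i<R. \<Sum>p\<in>perms (n * R). \<phi> (block n p i) (Y (l * R + i) w))"
    by (simp add: scaleR_sum_right) (rule sum.swap)
  also have "(\<Sum>i<R. \<Sum>p\<in>perms (n * R). \<phi> (block n p i) (Y (l * R + i) w)) = 0"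
  proof (rule sum.neutral, rule ballI)
    fix i assume "i \<in> {..<R}"
    then show "(\<Sum>p\<in>perms (n * R). \<phi> (block n p i) (Y (l * R + i) w)) = 0"
      by (intro block_mean_zero[where \<Phi>="\<lambda>i b. \<phi> b (Y (l * R + i) w)" and R=R, OF zero_sum_Y R_ge_2]) auto
  qed
  finally show "(\<integral>t. h *\<^sub>R partial_sum l R (w(Shuffle l := t)) \<partial>S) = 0"
    by (simp only: scaleR_zero_right)
qed

text \<open>Orthogonality makes the squares add up, so damping of order \<open>a\<close> per epoch
  keeps the sum bounded although its increments do not shrink.\<close>

lemma L2le_C_start: "L2le \<Omega>' (C (l * R)) \<eta>"
proof (induction l)
  case 0
  have "C 0 = (\<lambda>w. 0)" by (simp add: fun_eq_iff)
  then show ?case using L2le_mono[OF L2le_zero eta_nonneg] by simp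
next
  case (Suc l)
  define B where "B = h * (sqrt (2 * real R) * L * W)"
  have "L2le \<Omega>' (\<lambda>w. C (l * R) w + h *\<^sub>R partial_sum l R w) (sqrt (\<eta>\<^sup>2 + B\<^sup>2))"
    using L2le_orthogonal[OF Suc.IH L2le_scaleR[OF L2le_full_sum] partial_sum_orthogonal[OF Suc.IH]] h_pos
    by (simp add: B_def)
  then have step: "L2le \<Omega>' (C (Suc l * R)) (\<theta> * sqrt (\<eta>\<^sup>2 + B\<^sup>2))"
    using L2le_scaleR[of \<Omega>' "\<lambda>w. C (l * R) w + h *\<^sub>R partial_sum l R w" "sqrt (\<eta>\<^sup>2 + B\<^sup>2)" \<theta>] theta_bounds
    unfolding C_epoch_end by simp
  have "\<theta> * sqrt (\<eta>\<^sup>2 + B\<^sup>2) \<le> \<eta>"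
  proof (cases "\<theta> = 0")
    case False
    define a where "a = L * R * h"
    have a: "a > 0" "a < 1" "\<theta> = 1 - a" using False L_pos h_pos R_ge_2 by (auto simp: \<theta>_def a_def)
    have "B\<^sup>2 = a * \<eta>\<^sup>2" using L_pos h_pos by (simp add: B_def \<eta>_def a_def power_mult_distrib power2_eq_square)
    \<comment> \<open>Here \<open>(1 - a)\<^sup>2 * (1 + a)\<close> is regrouped into two factors
      between \<open>0\<close> and \<open>1\<close>.\<close>
    then have "\<theta>\<^sup>2 * (\<eta>\<^sup>2 + B\<^sup>2) = ((1 - a) * (1 - a\<^sup>2)) * \<eta>\<^sup>2"
      by (simp add: a(3) power2_eq_square algebra_simps)
    also have "\<dots> \<le> 1 * \<eta>\<^sup>2"
      using a by (intro mult_right_mono mult_le_one) (auto simp: power_le_one)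
    finally have "sqrt (\<theta>\<^sup>2 * (\<eta>\<^sup>2 + B\<^sup>2)) \<le> sqrt (\<eta>\<^sup>2)" by (simp only: mult_1 real_sqrt_le_iff)
    then show ?thesis using theta_bounds eta_nonneg by (simp add: real_sqrt_mult)
  qed (simp add: eta_nonneg)
  with step show ?case by (rule L2le_mono)
qed

text \<open>The part carried over from earlier epochs plus the partial sum of the current
  one.\<close>

definition cs :: real where "cs = \<eta> + h * (sqrt (2 * real R) * \<sigma>)"

lemma cs_nonneg: "cs \<ge> 0"
  using eta_nonneg h_pos sigma_nonneg by (simp add: cs_def)

lemma L2le_C_partial:
  assumes "j \<le> R"
  shows "L2le \<Omega>' (\<lambda>w. C (l * R) w + h *\<^sub>R partial_sum l j w) cs"
  using L2le_add[OF L2le_C_start L2le_scaleR[OF L2le_partial_sum[OF assms], of h]] h_pos by (simp add: cs_def)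

lemma L2le_C: "L2le \<Omega>' (C k) cs"
  and L2le_C_undamped: "L2le \<Omega>' (\<lambda>w. C k w + h *\<^sub>R \<phi> (bk k w) (Y k w)) cs"
proof -
  have k: "k = (k div R) * R + k mod R" by simp
  have "C k w = C (k div R * R) w + h *\<^sub>R partial_sum (k div R) (k mod R) w" for w
    using C_epoch[OF mod_R, of "k div R" k w] k by metis
  then have "C k = (\<lambda>w. C (k div R * R) w + h *\<^sub>R partial_sum (k div R) (k mod R) w)" by blast
  then show "L2le \<Omega>' (C k) cs"
    using L2le_C_partial[of "k mod R" "k div R"] mod_R[of k] by simp
  have "C k w + h *\<^sub>R \<phi> (bk k w) (Y k w) = C (k div R * R) w + h *\<^sub>R partial_sum (k div R) (Suc (k mod R)) w" for w
    using C_epoch_undamped[OF mod_R, of "k div R" k w] k by metis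
  then show "L2le \<Omega>' (\<lambda>w. C k w + h *\<^sub>R \<phi> (bk k w) (Y k w)) cs"
    using L2le_C_partial[of "Suc (k mod R)" "k div R"] mod_R[of k] by simp
qed

text \<open>\<open>D\<close> compares the iterate with \<open>Y - C\<close>, which follows the same stochastic gradients.\<close>

definition D where "D k w = X k w - Y k w + C k w"

text \<open>The next value of \<open>D\<close> without one-step error and damping. It does not
  involve the noise of step \<open>k\<close>, which makes the martingale part of \<open>E\<close>
  orthogonal to it.\<close>

definition U where
  "U k w = (X k w - h *\<^sub>R grad (batch_fun g (bk k w)) (X k w))
     - (Y k w - h *\<^sub>R grad (batch_fun g (bk k w)) (Y k w)) + C k w"

text \<open>The increment of \<open>C\<close> replaces the full gradient at \<open>Y\<close> by the
  batch gradient, so both processes take a step along the same function.\<close>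

lemma D_Suc:
  "D (Suc k) w = (U k w - E (Y k w) (qn k w))
     - (1 - (if R dvd Suc k then \<theta> else 1)) *\<^sub>R (C k w + h *\<^sub>R \<phi> (bk k w) (Y k w))"
  by (simp add: D_def U_def \<phi>_def algebra_simps)

lemma U_measurable [measurable]: "U k \<in> borel_measurable \<Omega>'"
proof -
  note [measurable] = measurable_bk_compose[OF batch_grad_measurable X_measurable]
    measurable_bk_compose[OF batch_grad_measurable Y_measurable]
  show ?thesis unfolding U_def by measurable
qed

text \<open>The contraction is applied to \<open>X\<close> and \<open>Y - C\<close>, which differ by
  \<open>D\<close>; evaluating the batch gradient at \<open>Y\<close> instead of
  \<open>Y - C\<close> costs \<open>h * L * norm (C k w)\<close>.\<close>

lemma U_bound:
  assumes w: "w \<in> space \<Omega>'"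
  shows "norm (U k w) \<le> \<rho> * norm (D k w) + h * L * norm (C k w)"
proof -
  let ?G = "\<lambda>y. y - h *\<^sub>R grad (batch_fun g (bk k w)) y" and ?Z = "Y k w - C k w"
  note b = bk_batches[OF w, of k]
  have "U k w = (?G (X k w) - ?G ?Z) + h *\<^sub>R (grad (batch_fun g (bk k w)) (Y k w) - grad (batch_fun g (bk k w)) ?Z)"
    by (simp add: U_def algebra_simps)
  moreover have "norm (?G (X k w) - ?G ?Z) \<le> \<rho> * norm (D k w)"
  proof -
    have "X k w - ?Z = D k w" by (simp add: D_def)
    then show ?thesis using batch_step_contraction[OF b, of "X k w" ?Z] by (simp only:)
  qed
  moreover have "norm (h *\<^sub>R (grad (batch_fun g (bk k w)) (Y k w) - grad (batch_fun g (bk k w)) ?Z)) \<le> h * L * norm (C k w)"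
    using batch_grad_lipschitz[OF b, of "Y k w" ?Z] h_pos by simp
  ultimately show ?thesis by (simp only: norm_triangle_mono)
qed

lemma L2le_U:
  assumes "L2le \<Omega>' (D k) v"
  shows "L2le \<Omega>' (U k) (\<rho> * v + h * L * cs)"
proof (rule L2le_norm_bound)
  have "L2le \<Omega>' (\<lambda>w. \<rho> *\<^sub>R norm (D k w) + (h * L) *\<^sub>R norm (C k w)) (\<bar>\<rho>\<bar> * v + \<bar>h * L\<bar> * cs)"
    by (intro L2le_add L2le_scaleR L2le_norm L2le_C assms)
  then show "L2le \<Omega>' (\<lambda>w. \<rho> * norm (D k w) + h * L * norm (C k w)) (\<rho> * v + h * L * cs)"
    using h_mu h_pos L_pos by (simp add: abs_mult)
qed (auto intro: U_bound)

lemma L2le_D_0: "L2le \<Omega>' (D 0) v0"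
proof -
  have "D 0 = (\<lambda>w. fst (fst (fst (w Initial))) - snd (fst (fst (w Initial))))" by (simp add: D_def fun_eq_iff)
  moreover have "L2le (distr (distr \<Omega>' S (\<lambda>w. w Initial)) \<gamma> (\<lambda>t. fst (fst t))) (\<lambda>z. fst z - snd z) v0"
    using gamma_cost by (simp add: distr_\<Omega>'_component distr_S)
  then have "L2le \<Omega>' (\<lambda>w. fst (fst (fst (w Initial))) - snd (fst (fst (w Initial)))) v0"
    by (subst (asm) L2le_distr, simp, subst (asm) L2le_distr) auto
  ultimately show ?thesis by simp
qed

text \<open>The fixed point of the epoch map that contracts by \<open>\<rho> ^ R\<close> and then
  adds the damping loss \<open>(1 - \<theta>) * cs\<close>.\<close>

definition \<beta> :: real where "\<beta> = (1 - \<theta>) * cs / (1 - \<rho> ^ R)"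

lemma rho_power: "\<rho> ^ R < 1"
proof -
  have "\<rho> ^ Suc (R - 1) < 1" by (rule power_Suc_less_one) (use h_mu in auto)
  then show ?thesis using R_ge_2 by simp
qed

lemma beta_eq: "\<beta> = \<rho> ^ R * \<beta> + (1 - \<theta>) * cs"
  using rho_power by (simp add: \<beta>_def field_simps)

lemma beta_nonneg: "\<beta> \<ge> 0"
  unfolding \<beta>_def using rho_power theta_bounds cs_nonneg by (intro divide_nonneg_nonneg mult_nonneg_nonneg) auto

text \<open>In the recursion \<open>v \<mapsto> sqrt ((\<rho> v + b)\<^sup>2 + m\<^sup>2) + a\<close> the martingale part \<open>m\<close> contributes only
  \<open>s = m / sqrt (1 - \<rho>\<^sup>2)\<close> in total.\<close>

lemma L2le_D:
  assumes err: "\<And>k u. L2le \<Omega>' (U k) u \<Longrightarrow> L2le \<Omega>' (\<lambda>w. U k w - E (Y k w) (qn k w)) (sqrt (u\<^sup>2 + m\<^sup>2) + a)"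
    and ma: "0 \<le> m" "0 \<le> a" and s: "m\<^sup>2 \<le> (1 - \<rho>\<^sup>2) * s\<^sup>2" "0 \<le> s"
  shows "L2le \<Omega>' (D k) (\<rho> ^ k * v0 + (h * L * cs + a) / (1 - \<rho>) + s + \<rho> ^ (k mod R) * \<beta>)"
proof (induction k)
  case 0
  have "0 \<le> (h * L * cs + a) / (1 - \<rho>) + s + \<beta>"
    using ma s h_mu h_pos L_pos cs_nonneg beta_nonneg by (intro add_nonneg_nonneg divide_nonneg_nonneg mult_nonneg_nonneg) auto
  then show ?case using L2le_mono[OF L2le_D_0] by simp
next
  case (Suc k)
  define b where "b = h * L * cs + a"
  define T where "T = \<rho> ^ k * v0 + b / (1 - \<rho>) + \<rho> ^ (k mod R) * \<beta>"
  have v0: "v0 \<ge> 0" using gamma_cost by (rule L2le_nonneg)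
  have hLc: "h * L * cs \<ge> 0" using h_pos L_pos cs_nonneg by simp
  have b: "b \<ge> 0" unfolding b_def using hLc ma by simp
  have T: "T \<ge> 0" unfolding T_def using v0 h_mu b beta_nonneg
    by (intro add_nonneg_nonneg divide_nonneg_nonneg mult_nonneg_nonneg) auto
  have "L2le \<Omega>' (D k) (T + s)" using Suc.IH by (simp add: T_def b_def add_ac)
  from err[OF L2le_U[OF this]]
  have step: "L2le \<Omega>' (\<lambda>w. U k w - E (Y k w) (qn k w)) (sqrt ((\<rho> * (T + s) + h * L * cs)\<^sup>2 + m\<^sup>2) + a)" .
  \<comment> \<open>The hypothesis on \<open>s\<close> makes it reproduce itself: adding
    \<open>(1 - \<rho>\<^sup>2) * s\<^sup>2\<close> to \<open>(p + \<rho> * s)\<^sup>2\<close> gives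
    at most \<open>(p + s)\<^sup>2\<close>, so \<open>s\<close> is paid once and not at every
    step.\<close>
  have le: "sqrt ((\<rho> * (T + s) + h * L * cs)\<^sup>2 + m\<^sup>2) + a \<le> \<rho> * T + b + s"
  proof -
    define p where "p = \<rho> * T + h * L * cs"
    have p: "p \<ge> 0" unfolding p_def using T h_mu by (intro add_nonneg_nonneg[OF mult_nonneg_nonneg hLc]) auto
    have expand: "(p + r * s)\<^sup>2 + (1 - r\<^sup>2) * s\<^sup>2 = p\<^sup>2 + 2 * r * (p * s) + s\<^sup>2" for r
      by (simp add: power2_sum power_mult_distrib algebra_simps)
    have "(p + \<rho> * s)\<^sup>2 + m\<^sup>2 \<le> (p + \<rho> * s)\<^sup>2 + (1 - \<rho>\<^sup>2) * s\<^sup>2" using s by simp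
    also have "\<dots> = p\<^sup>2 + 2 * \<rho> * (p * s) + s\<^sup>2" by (rule expand)
    also have "\<dots> \<le> p\<^sup>2 + 2 * 1 * (p * s) + s\<^sup>2"
      using p s h_mu by (intro add_mono mult_right_mono mult_left_mono order_refl) auto
    also have "\<dots> = (p + s)\<^sup>2" by (simp add: power2_sum)
    finally have "sqrt ((p + \<rho> * s)\<^sup>2 + m\<^sup>2) \<le> p + s" using p s by (intro real_le_lsqrt) auto
    moreover have "\<rho> * (T + s) + h * L * cs = p + \<rho> * s" by (simp add: p_def algebra_simps)
    moreover have "p + s + a = \<rho> * T + b + s" by (simp add: p_def b_def)
    ultimately show ?thesis by (metis add_right_mono)
  qed
  have geo: "\<rho> * (b / (1 - \<rho>)) + b = b / (1 - \<rho>)"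
  proof -
    have "(1 - x) * (b / x) + b = b / x" if "x > 0" for x using that by (simp add: field_simps)
    from this[of "h * \<mu>"] show ?thesis using h_mu by simp
  qed
  have rT: "\<rho> * T + b = \<rho> ^ Suc k * v0 + b / (1 - \<rho>) + \<rho> ^ Suc (k mod R) * \<beta>"
    using geo by (simp add: T_def distrib_left mult.assoc)
  define c where "c = (1 - (if R dvd Suc k then \<theta> else 1))"
  have c: "c \<ge> 0" using theta_bounds by (simp add: c_def)
  have "L2le \<Omega>' (\<lambda>w. (U k w - E (Y k w) (qn k w)) - c *\<^sub>R (C k w + h *\<^sub>R \<phi> (bk k w) (Y k w))) (\<rho> * T + b + s + \<bar>c\<bar> * cs)"
    by (intro L2le_diff L2le_scaleR L2le_C_undamped L2le_mono[OF step le])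
  then have main: "L2le \<Omega>' (D (Suc k)) (\<rho> * T + b + s + c * cs)"
    using c unfolding D_Suc c_def[symmetric] by simp
  \<comment> \<open>At the end of an epoch the exponent reaches \<open>R\<close>, and
    \<open>beta_eq\<close> restores the full \<open>\<beta>\<close>; at other times there is no
    damping and \<open>c\<close> is \<open>0\<close>.\<close>
  have "\<rho> ^ Suc (k mod R) * \<beta> + c * cs = \<rho> ^ (Suc k mod R) * \<beta>"
  proof (cases "R dvd Suc k")
    case True
    then have "Suc (k mod R) = R" by (metis dvd_imp_mod_0 mod_Suc nat.distinct(1))
    then show ?thesis using True beta_eq by (simp add: c_def del: power_Suc)
  next
    case False
    then have "Suc k mod R = Suc (k mod R)" by (metis mod_Suc dvd_eq_mod_eq_0)
    then show ?thesis using False by (simp add: c_def)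
  qed
  then have "\<rho> * T + b + s + c * cs = \<rho> ^ Suc k * v0 + b / (1 - \<rho>) + s + \<rho> ^ (Suc k mod R) * \<beta>"
    unfolding rT by linarith
  with main show ?case by (simp only: b_def)
qed

lemma L2le_X_Y:
  assumes "\<And>k u. L2le \<Omega>' (U k) u \<Longrightarrow> L2le \<Omega>' (\<lambda>w. U k w - E (Y k w) (qn k w)) (sqrt (u\<^sup>2 + m\<^sup>2) + a)"
    and "0 \<le> m" "0 \<le> a" and "m\<^sup>2 \<le> (1 - \<rho>\<^sup>2) * s\<^sup>2" "0 \<le> s"
  shows "L2le \<Omega>' (\<lambda>w. X k w - Y k w) (\<rho> ^ k * v0 + (h * L * cs + a) / (1 - \<rho>) + s + \<beta> + cs)"
proof (rule L2le_mono)
  have "L2le \<Omega>' (\<lambda>w. D k w - C k w) ((\<rho> ^ k * v0 + (h * L * cs + a) / (1 - \<rho>) + s + \<rho> ^ (k mod R) * \<beta>) + cs)"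
    by (intro L2le_diff L2le_D[OF assms] L2le_C)
  then show "L2le \<Omega>' (\<lambda>w. X k w - Y k w) ((\<rho> ^ k * v0 + (h * L * cs + a) / (1 - \<rho>) + s + \<rho> ^ (k mod R) * \<beta>) + cs)"
    by (simp add: D_def)
  have "\<rho> ^ (k mod R) * \<beta> \<le> 1 * \<beta>"
    using h_mu beta_nonneg by (intro mult_right_mono power_le_one) auto
  then show "(\<rho> ^ k * v0 + (h * L * cs + a) / (1 - \<rho>) + s + \<rho> ^ (k mod R) * \<beta>) + cs
      \<le> \<rho> ^ k * v0 + (h * L * cs + a) / (1 - \<rho>) + s + \<beta> + cs" by simp
qed

text \<open>Without further regularity the one-step error \<open>E\<close> is added by the triangle inequality; if its
  conditional mean is of smaller order, the rest is a martingale increment.\<close>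

lemma strong_error:
  "L2le \<Omega>' (U k) u \<Longrightarrow> L2le \<Omega>' (\<lambda>w. U k w - E (Y k w) (qn k w)) (sqrt (u\<^sup>2 + 0\<^sup>2) + es)"
  using L2le_diff[OF _ L2le_E] L2le_nonneg by fastforce

lemma U_noise_upd: "U k (w(Noise k := t)) = U k w"
  by (simp add: U_def X_noise_upd Y_noise_upd C_noise_upd bk_noise_upd)

lemma weak_error:
  assumes ew: "L2le (gibbs F) (\<lambda>y. \<integral>q. E y q \<partial>Q) ew" and U: "L2le \<Omega>' (U k) u"
  shows "L2le \<Omega>' (\<lambda>w. U k w - E (Y k w) (qn k w)) (sqrt (u\<^sup>2 + (es + ew)\<^sup>2) + ew)"
proof -
  interpret S: prob_space S by (rule prob_S)
  define A where "A = (\<lambda>y. \<integral>q. E y q \<partial>Q)"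
  have A: "L2le \<Omega>' (\<lambda>w. A (Y k w)) ew" unfolding A_def by (rule L2le_Y[OF ew])
  define M where "M = (\<lambda>w. A (Y k w) - E (Y k w) (qn k w))"
  have M: "L2le \<Omega>' M (ew + es)" unfolding M_def by (intro L2le_diff A L2le_E)
  have "(\<integral>w. U k w \<bullet> M w \<partial>\<Omega>') = 0"
  proof (rule resampling_orthogonal[OF resampling_\<Omega>'[of "Noise k"] U M])
    show "U k (w(Noise k := t)) = U k w" for w t by (rule U_noise_upd)
    show "integrable S (\<lambda>t. M (w(Noise k := t)))" for w
      using integral_S_noise[OF E_integrable] by (simp add: M_def Y_noise_upd qn_def)
    show "(\<integral>t. M (w(Noise k := t)) \<partial>S) = 0" for w
      using integral_S_noise[OF E_integrable] by (simp add: M_def Y_noise_upd qn_def A_def S.prob_space[simplified])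
  qed
  from L2le_diff[OF L2le_orthogonal[OF U M this] A]
  show ?thesis by (simp add: M_def add.commute)
qed

end

section \<open>The law of the iterates\<close>

definition rr_step :: "(nat \<Rightarrow> 'a::euclidean_space \<Rightarrow> real) \<Rightarrow> nat \<Rightarrow> nat \<Rightarrow> real \<Rightarrow> nat \<Rightarrow> 'a \<Rightarrow> (nat \<Rightarrow> nat) \<Rightarrow> 'a \<Rightarrow> 'a" where
  "rr_step g n R h k x p v = x - h *\<^sub>R grad (batch_fun g (block n p (k mod R))) x + sqrt (2 * h) *\<^sub>R v"

text \<open>Within an epoch the iterate alone is not Markov, but together with the permutation in
  use it is. At a multiple of \<open>R\<close> the old permutation is forgotten and a fresh
  independent one adjoined.\<close>

primrec rr_law :: "(nat \<Rightarrow> 'a::euclidean_space \<Rightarrow> real) \<Rightarrow> nat \<Rightarrow> nat \<Rightarrow> real \<Rightarrow> 'a measure \<Rightarrow> nat \<Rightarrow> ('a \<times> (nat \<Rightarrow> nat)) measure" where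
  "rr_law g n R h \<nu> 0 = \<nu> \<Otimes>\<^sub>M uniform_count_measure (perms (n * R))"
| "rr_law g n R h \<nu> (Suc k) =
     (let T = distr (rr_law g n R h \<nu> k \<Otimes>\<^sub>M std_gaussian) (borel \<Otimes>\<^sub>M count_space (perms (n * R)))
         (\<lambda>z. (rr_step g n R h k (fst (fst z)) (snd (fst z)) (snd z), snd (fst z)))
      in if R dvd Suc k then distr T borel fst \<Otimes>\<^sub>M uniform_count_measure (perms (n * R)) else T)"

lemma rr_step_measurable:
  assumes R: "R > 0" and batch: "\<And>w. w \<in> batches (n * R) n \<Longrightarrow> grad (batch_fun g w) \<in> borel_measurable borel"
    and X: "X \<in> borel_measurable N" and p: "p \<in> measurable N (count_space (perms (n * R)))" and v: "v \<in> borel_measurable N"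
  shows "(\<lambda>s. rr_step g n R h k (X s) (p s) (v s)) \<in> borel_measurable N"
proof -
  note [measurable] = X v
  have b: "(\<lambda>s. block n (p s) (k mod R)) \<in> measurable N (count_space (batches (n * R) n))"
  proof (rule measurable_compose[OF p])
    show "(\<lambda>p. block n p (k mod R)) \<in> measurable (count_space (perms (n * R))) (count_space (batches (n * R) n))"
      using block_in_batches[of _ n R "k mod R"] R by auto
  qed
  have "(\<lambda>s. grad (batch_fun g (block n (p s) (k mod R))) (X s)) \<in> borel_measurable N"
    by (rule measurable_compose_countable'[where f="\<lambda>w s. grad (batch_fun g w) (X s)", OF _ b])
       (auto intro: measurable_compose[OF X batch] simp: countable_finite)
  then show ?thesis unfolding rr_step_def by measurable
qed

context sgld_rr
begin

definition source_events :: "source \<Rightarrow> 's set set" where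
  "source_events s = (case s of
          Initial \<Rightarrow> {x 0 -` A \<inter> space M | A. A \<in> sets borel}
        | Noise k \<Rightarrow> {\<xi> k -` A \<inter> space M | A. A \<in> sets borel}
        | Shuffle l \<Rightarrow> {P l -` A \<inter> space M | A. A \<in> sets (count_space {p. p permutes {1..N}})})"

definition source_algebra :: "source set \<Rightarrow> 's measure" where
  "source_algebra A = sigma (space M) (\<Union>i\<in>A. source_events i)"

lemma source_events_subset: "source_events s \<subseteq> Pow (space M)"
  by (auto simp: source_events_def split: source.splits)

lemma source_events_events: "source_events s \<subseteq> events"
  using measurable_sets[OF x0_measurable] measurable_sets[OF noise_measurable] measurable_sets[OF perm_measurable]
  by (auto simp: source_events_def split: source.splits)

lemma space_source_algebra [simp]: "space (source_algebra A) = space M"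
  unfolding source_algebra_def by (rule space_measure_of) (use source_events_subset in blast)

lemma sets_source_algebra: "sets (source_algebra A) = sigma_sets (space M) (\<Union>i\<in>A. source_events i)"
  unfolding source_algebra_def by (rule sets_measure_of) (use source_events_subset in blast)

lemma source_algebra_events: "sets (source_algebra A) \<subseteq> events"
  unfolding sets_source_algebra by (rule sets.sigma_sets_subset) (use source_events_events in blast)

lemma Int_stable_preimages:
  fixes X :: "'s \<Rightarrow> 'c"
  shows "Int_stable {X -` A \<inter> space M | A. A \<in> sets B}"
proof (rule Int_stableI, clarsimp)
  fix A A' assume "A \<in> sets B" "A' \<in> sets B"
  then show "\<exists>C. X -` A \<inter> space M \<inter> (X -` A' \<inter> space M) = X -` C \<inter> space M \<and> C \<in> sets B"
    by (intro exI[of _ "A \<inter> A'"]) auto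
qed

lemma Int_stable_source_events: "Int_stable (source_events s)"
  unfolding source_events_def by (cases s) (simp_all only: source.case Int_stable_preimages)

lemma source_algebra_mono: "A \<subseteq> B \<Longrightarrow> X \<in> measurable (source_algebra A) N' \<Longrightarrow> X \<in> measurable (source_algebra B) N'"
proof -
  assume "A \<subseteq> B"
  then have "sets (source_algebra A) \<subseteq> sets (source_algebra B)"
    unfolding sets_source_algebra by (intro sigma_sets_mono') blast
  then show "X \<in> measurable (source_algebra A) N' \<Longrightarrow> X \<in> measurable (source_algebra B) N'"
    by (auto simp: measurable_def)
qed

lemma source_algebra_measurable_M: "X \<in> measurable (source_algebra A) N' \<Longrightarrow> X \<in> measurable M N'"
  using source_algebra_events[of A] by (auto simp: measurable_def)

text \<open>The generating events of each source are stable under intersection, so independence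
  passes to the sigma-algebras generated by disjoint groups of sources.\<close>

lemma disjoint_sources_law:
  assumes AB: "A \<inter> B = {}" and X: "X \<in> measurable (source_algebra A) S" and Y: "Y \<in> measurable (source_algebra B) T"
  shows "distr M (S \<Otimes>\<^sub>M T) (\<lambda>s. (X s, Y s)) = distr M S X \<Otimes>\<^sub>M distr M T Y"
proof -
  have XM: "X \<in> measurable M S" "Y \<in> measurable M T" using X Y by (auto intro: source_algebra_measurable_M)
  have ind0: "indep_sets source_events UNIV"
    using independent unfolding source_events_def[abs_def] .
  have "indep_sets (\<lambda>j. sigma_sets (space M) (\<Union>i\<in>case_bool A B j. source_events i)) UNIV"
  proof (rule indep_sets_collect_sigma)
    show "indep_sets source_events (\<Union>j\<in>UNIV. case_bool A B j)"
      by (rule indep_sets_mono_index[OF _ ind0]) simp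
    show "disjoint_family_on (case_bool A B) UNIV"
      using AB by (auto simp: disjoint_family_on_def split: bool.splits)
  qed (rule Int_stable_source_events)
  then have ind: "indep_set (sets (source_algebra A)) (sets (source_algebra B))"
    unfolding indep_set_def sets_source_algebra
    by (rule indep_sets_mono_sets) (auto split: bool.splits)
  interpret dX: prob_space "distr M S X" by (rule prob_space_distr[OF XM(1)])
  interpret dY: prob_space "distr M T Y" by (rule prob_space_distr[OF XM(2)])
  note [measurable] = XM
  show ?thesis
  proof (rule pair_measure_eqI[symmetric])
    fix a b assume ab: "a \<in> sets (distr M S X)" "b \<in> sets (distr M T Y)"
    have "(\<lambda>s. (X s, Y s)) -` (a \<times> b) \<inter> space M = (X -` a \<inter> space M) \<inter> (Y -` b \<inter> space M)" by auto
    moreover have "X -` a \<inter> space M \<in> sets (source_algebra A)" "Y -` b \<inter> space M \<in> sets (source_algebra B)"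
      using measurable_sets[OF X, of a] measurable_sets[OF Y, of b] ab by simp_all
    ultimately show "emeasure (distr M S X) a * emeasure (distr M T Y) b = emeasure (distr M (S \<Otimes>\<^sub>M T) (\<lambda>s. (X s, Y s))) (a \<times> b)"
      using ab indep_setD[OF ind]
      by (simp add: emeasure_distr emeasure_eq_measure ennreal_mult[symmetric])
  qed (auto intro: dX.sigma_finite_measure_axioms dY.sigma_finite_measure_axioms)
qed

text \<open>The sources that determine \<open>x k\<close>. Permutation \<open>l\<close> acts first
  in the step from time \<open>l * R\<close>, hence the strict inequality: \<open>x (l * R)\<close>
  is still independent of it.\<close>

definition past :: "nat \<Rightarrow> source set" where
  "past k = {Initial} \<union> {Noise j | j. j < k} \<union> {Shuffle l | l. l * R < k}"

lemma preimage_source_measurable: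
  assumes "X \<in> space M \<rightarrow> space B" "{X -` C \<inter> space M | C. C \<in> sets B} \<subseteq> source_events i" "i \<in> A"
  shows "X \<in> measurable (source_algebra A) B"
  using assms by (intro measurableI) (auto simp: sets_source_algebra intro!: sigma_sets.Basic)

lemma x0_source: "x 0 \<in> borel_measurable (source_algebra (past k))"
  by (rule preimage_source_measurable[where i=Initial]) (auto simp: source_events_def past_def)

lemma noise_source: "\<xi> k \<in> borel_measurable (source_algebra {Noise k})"
  by (rule preimage_source_measurable[where i="Noise k"]) (auto simp: source_events_def)

lemma perm_source: "P l \<in> measurable (source_algebra {Shuffle l}) (count_space (perms N))"
  using measurable_space[OF perm_measurable]
  by (intro preimage_source_measurable[where i="Shuffle l"]) (auto simp: source_events_def)

context
  assumes N_eq: "N = n * R" and R_pos: "R > 0"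
    and batch_measurable: "\<And>w. w \<in> batches N n \<Longrightarrow> grad (batch_fun g w) \<in> borel_measurable borel"
begin

lemma perm_source': "P l \<in> measurable (source_algebra {Shuffle l}) (count_space (perms (n * R)))"
  by (fold N_eq) (rule perm_source)

lemma x_source: "x k \<in> borel_measurable (source_algebra (past k))"
proof (induction k)
  case (Suc k)
  have "(\<lambda>s. rr_step g n R h k (x k s) (P (k div R) s) (\<xi> k s)) \<in> borel_measurable (source_algebra (past (Suc k)))"
  proof (rule rr_step_measurable[OF R_pos batch_measurable[unfolded N_eq]])
    show "x k \<in> borel_measurable (source_algebra (past (Suc k)))"
      by (rule source_algebra_mono[OF _ Suc.IH]) (auto simp: past_def)
    show "\<xi> k \<in> borel_measurable (source_algebra (past (Suc k)))"
      by (rule source_algebra_mono[OF _ noise_source]) (auto simp: past_def)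
    have "k div R * R < Suc k" by (simp add: less_Suc_eq_le)
    then show "P (k div R) \<in> measurable (source_algebra (past (Suc k))) (count_space (perms (n * R)))"
      by (intro source_algebra_mono[OF _ perm_source']) (auto simp: past_def)
  qed
  then show ?case
    by (subst measurable_cong[where g="\<lambda>s. rr_step g n R h k (x k s) (P (k div R) s) (\<xi> k s)"])
       (simp_all add: step rr_step_def)
qed (rule x0_source)

lemma joint_law: "distr M (borel \<Otimes>\<^sub>M count_space (perms (n * R))) (\<lambda>s. (x k s, P (k div R) s)) = rr_law g n R h (distr M borel (x 0)) k"
proof (induction k)
  case 0
  have "distr M (borel \<Otimes>\<^sub>M count_space (perms (n * R))) (\<lambda>s. (x 0 s, P 0 s))
      = distr M borel (x 0) \<Otimes>\<^sub>M distr M (count_space (perms (n * R))) (P 0)"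
    by (rule disjoint_sources_law[OF _ x0_source[of 0] perm_source']) (use R_pos in \<open>auto simp: past_def\<close>)
  then show ?case using perm_law[of 0] by (simp add: N_eq)
next
  case (Suc k)
  let ?p = "perms (n * R)"
  let ?J = "rr_law g n R h (distr M borel (x 0)) k"
  let ?f = "\<lambda>z. (rr_step g n R h k (fst (fst z)) (snd (fst z)) (snd z), snd (fst z))"
  have setsJ: "sets ?J = sets (borel \<Otimes>\<^sub>M count_space ?p)" unfolding Suc.IH[symmetric] by (rule sets_distr)
  \<comment> \<open>The set \<open>past (Suc k)\<close> without \<open>Noise k\<close> is used
    instead of \<open>past k\<close>, which lacks the permutation of an epoch beginning at time
    \<open>k\<close>.\<close>
  have past: "x k \<in> borel_measurable (source_algebra (past (Suc k) - {Noise k}))"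
    by (rule source_algebra_mono[OF _ x_source]) (auto simp: past_def)
  have kR: "k div R * R < Suc k" by (simp add: less_Suc_eq_le)
  have pP: "P (k div R) \<in> measurable (source_algebra (past (Suc k) - {Noise k})) (count_space ?p)"
    by (rule source_algebra_mono[OF _ perm_source']) (use kR in \<open>auto simp: past_def\<close>)
  have joint: "distr M ((borel \<Otimes>\<^sub>M count_space ?p) \<Otimes>\<^sub>M borel) (\<lambda>s. ((x k s, P (k div R) s), \<xi> k s)) = ?J \<Otimes>\<^sub>M std_gaussian"
    using disjoint_sources_law[of "past (Suc k) - {Noise k}" "{Noise k}", OF _ measurable_Pair[OF past pP] noise_source]
    by (simp only: Suc.IH noise_law) simp
  have f: "?f \<in> measurable (?J \<Otimes>\<^sub>M std_gaussian) (borel \<Otimes>\<^sub>M count_space ?p)"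
  proof (rule measurable_Pair)
    have [measurable_cong]: "sets ?J = sets (borel \<Otimes>\<^sub>M count_space ?p)" by (rule setsJ)
    show "(\<lambda>z. rr_step g n R h k (fst (fst z)) (snd (fst z)) (snd z)) \<in> borel_measurable (?J \<Otimes>\<^sub>M std_gaussian)"
      by (rule rr_step_measurable[OF R_pos batch_measurable[unfolded N_eq]]) measurable
    show "(\<lambda>z. snd (fst z)) \<in> measurable (?J \<Otimes>\<^sub>M std_gaussian) (count_space ?p)" by measurable
  qed
  have xk: "(\<lambda>s. ((x k s, P (k div R) s), \<xi> k s)) \<in> measurable M ((borel \<Otimes>\<^sub>M count_space ?p) \<Otimes>\<^sub>M borel)"
    using source_algebra_measurable_M[OF past] source_algebra_measurable_M[OF pP] source_algebra_measurable_M[OF noise_source[of k]]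
    by (intro measurable_Pair) auto
  have T: "distr M (borel \<Otimes>\<^sub>M count_space ?p) (\<lambda>s. (x (Suc k) s, P (k div R) s)) = distr (?J \<Otimes>\<^sub>M std_gaussian) (borel \<Otimes>\<^sub>M count_space ?p) ?f" (is "?L = ?T")
  proof -
    have "distr (?J \<Otimes>\<^sub>M std_gaussian) (borel \<Otimes>\<^sub>M count_space ?p) ?f
        = distr M (borel \<Otimes>\<^sub>M count_space ?p) (?f \<circ> (\<lambda>s. ((x k s, P (k div R) s), \<xi> k s)))"
      unfolding joint[symmetric]
      by (rule distr_distr[OF _ xk]) (use f in \<open>simp add: joint[symmetric]\<close>)
    also have "\<dots> = ?L" by (intro distr_cong refl) (simp add: step rr_step_def)
    finally show ?thesis by simp
  qed
  show ?case
  proof (cases "R dvd Suc k")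
    case False
    then have "Suc k div R = k div R" by (simp add: div_Suc dvd_eq_mod_eq_0)
    then show ?thesis using False T by (simp add: Let_def)
  next
    case True
    \<comment> \<open>The iterate at the end of an epoch involves only permutations of epochs before
      \<open>l\<close>, so the one adjoined here is independent of it.\<close>
    define l where "l = Suc k div R"
    have l: "l * R = Suc k" using True by (simp add: l_def)
    have "distr M (borel \<Otimes>\<^sub>M count_space ?p) (\<lambda>s. (x (Suc k) s, P l s))
        = distr M borel (x (Suc k)) \<Otimes>\<^sub>M distr M (count_space ?p) (P l)"
      by (rule disjoint_sources_law[OF _ x_source perm_source']) (use l in \<open>auto simp: past_def\<close>)
    also have "distr M (count_space ?p) (P l) = uniform_count_measure ?p" using perm_law[of l] by (simp add: N_eq)
    also have "distr M borel (x (Suc k)) = distr ?T borel fst"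
      unfolding T[symmetric]
      by (subst distr_distr) (use source_algebra_measurable_M[OF x_source[of "Suc k"]] perm_measurable[of "k div R"] in \<open>auto simp: o_def N_eq\<close>)
    finally show ?thesis using True by (simp add: Let_def l_def)
  qed
qed

lemma iterate_law: "distr M borel (x k) = distr (rr_law g n R h (distr M borel (x 0)) k) borel fst"
  unfolding joint_law[symmetric]
  by (subst distr_distr) (use source_algebra_measurable_M[OF x_source[of k]] perm_measurable[of "k div R"] in \<open>auto simp: o_def N_eq\<close>)

end

end

section \<open>The Wasserstein distance\<close>

lemma ennreal_sqrt_le:
  assumes "c \<le> ennreal (a\<^sup>2)" "0 \<le> a"
  shows "ennreal_sqrt c \<le> ennreal a"
proof -
  have "c < \<infinity>" using assms(1) by (auto intro: le_less_trans)
  then obtain r where r: "c = ennreal r" "r \<ge> 0" by (cases c) auto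
  then have "r \<le> a\<^sup>2" using assms by simp
  then have "sqrt r \<le> a" using assms(2) by (intro real_le_lsqrt) (auto simp: r)
  then show ?thesis using r by (simp add: ennreal_sqrt_def ennreal_leI)
qed

lemma W2_le_coupling:
  fixes X Y :: "'s \<Rightarrow> 'a::euclidean_space"
  assumes [measurable]: "X \<in> borel_measurable M" "Y \<in> borel_measurable M" and a: "L2le M (\<lambda>w. X w - Y w) a"
  shows "W2 (distr M borel X) (distr M borel Y) \<le> ennreal a"
  unfolding W2_def
proof (rule ennreal_sqrt_le)
  let ?g = "distr M (borel \<Otimes>\<^sub>M borel) (\<lambda>w. (X w, Y w))"
  have "?g \<in> couplings (distr M borel X) (distr M borel Y)"
    unfolding couplings_def by (auto simp: distr_distr o_def)
  then have "(INF \<gamma>\<in>couplings (distr M borel X) (distr M borel Y). \<integral>\<^sup>+ (x, y). ennreal ((dist x y)\<^sup>2) \<partial>\<gamma>)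
      \<le> (\<integral>\<^sup>+ (x, y). ennreal ((dist x y)\<^sup>2) \<partial>?g)" by (rule INF_lower)
  also have "\<dots> = (\<integral>\<^sup>+ w. ennreal ((norm (X w - Y w))\<^sup>2) \<partial>M)"
    by (subst nn_integral_distr) (auto simp: split_beta' dist_norm)
  also have "\<dots> \<le> ennreal (a\<^sup>2)" using a by (simp add: L2le_def)
  finally show "(INF \<gamma>\<in>couplings (distr M borel X) (distr M borel Y). \<integral>\<^sup>+ (x, y). ennreal ((dist x y)\<^sup>2) \<partial>\<gamma>) \<le> ennreal (a\<^sup>2)" .
qed (rule L2le_nonneg[OF a])

text \<open>A coupling within \<open>e\<close> of the infimum replaces an optimal one, so that no
  existence theorem for optimal couplings enters.\<close>

lemma W2_near_optimal:
  assumes W: "W2 \<alpha> \<beta> = ennreal w" "w \<ge> 0" and e: "e > 0"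
  obtains \<gamma> where "\<gamma> \<in> couplings \<alpha> \<beta>" "L2le \<gamma> (\<lambda>z. fst z - snd z) (w + e)"
proof -
  define c where "c = (INF \<gamma>\<in>couplings \<alpha> \<beta>. \<integral>\<^sup>+ (x, y). ennreal ((dist x y)\<^sup>2) \<partial>\<gamma>)"
  have c: "ennreal_sqrt c = ennreal w" using W by (simp add: W2_def c_def)
  then have "c \<noteq> \<infinity>" by (auto simp: ennreal_sqrt_def split: if_splits)
  then obtain r where r: "c = ennreal r" "r \<ge> 0" by (cases c) auto
  then have "sqrt r = w" using c W by (simp add: ennreal_sqrt_def)
  then have "r = w\<^sup>2" using r by auto
  then have "c < ennreal ((w + e)\<^sup>2)" using r W e by (simp add: ennreal_less_iff power_strict_mono)
  then obtain \<gamma> where \<gamma>: "\<gamma> \<in> couplings \<alpha> \<beta>" "(\<integral>\<^sup>+ (x, y). ennreal ((dist x y)\<^sup>2) \<partial>\<gamma>) < ennreal ((w + e)\<^sup>2)"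
    unfolding c_def by (auto simp: INF_less_iff)
  have "sets \<gamma> = sets (borel \<Otimes>\<^sub>M borel)" using \<gamma>(1) by (simp add: couplings_def)
  then have "(\<lambda>z. fst z - snd z) \<in> borel_measurable \<gamma>" by (subst measurable_cong_sets[OF _ refl]) auto
  then have "L2le \<gamma> (\<lambda>z. fst z - snd z) (w + e)"
    using \<gamma>(2) W e by (simp add: L2le_def split_beta' dist_norm)
  with \<gamma>(1) show ?thesis by (rule that)
qed

context rr_coupling
begin

lemma X0_law: "distr \<Omega>' borel (X 0) = distr \<gamma> borel fst"
proof -
  have "X 0 = (\<lambda>w. fst (fst (fst (w Initial))))" by (simp add: fun_eq_iff)
  then have "distr \<Omega>' borel (X 0) = distr (distr (distr \<Omega>' S (\<lambda>w. w Initial)) \<gamma> (\<lambda>t. fst (fst t))) borel fst"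
    by (subst distr_distr, simp, simp, subst distr_distr)
       (auto simp: o_def measurable_cong_sets[OF sets_gamma refl])
  then show ?thesis by (simp only: distr_\<Omega>'_component distr_S)
qed

lemma coordinate_independence:
  "prob_space.indep_sets \<Omega>' (\<lambda>i. {(\<lambda>w. w i) -` A \<inter> space \<Omega>' | A. A \<in> sets S}) UNIV"
proof -
  interpret \<Omega>': prob_space \<Omega>' by (rule prob_\<Omega>')
  have "\<Omega>'.indep_vars (\<lambda>_. S) (\<lambda>i w. w i) UNIV"
  proof (subst \<Omega>'.indep_vars_iff_distr_eq_PiM')
    have "distr \<Omega>' (PiM UNIV (\<lambda>_. S)) (\<lambda>w. \<lambda>i\<in>UNIV. w i) = distr \<Omega>' \<Omega>' (\<lambda>w. w)"
      by (simp add: \<Omega>'_def restrict_UNIV)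
    then show "distr \<Omega>' (PiM UNIV (\<lambda>_. S)) (\<lambda>w. \<lambda>i\<in>UNIV. w i) = PiM UNIV (\<lambda>i. distr \<Omega>' S (\<lambda>w. w i))"
      by (simp add: distr_\<Omega>'_component) (simp add: \<Omega>'_def)
  qed auto
  then show ?thesis unfolding \<Omega>'.indep_vars_def2 by simp
qed

text \<open>As an instance of the same locale, the coupled iteration is subject to the same
  recursion of laws as the given process.\<close>

lemma is_sgld_rr: "sgld_rr \<Omega>' g (n * R) n R h X (\<lambda>k w. \<Xi> (qn k w)) pm"
proof (rule sgld_rr.intro[OF prob_\<Omega>' sgld_rr_axioms.intro])
  interpret \<Omega>': prob_space \<Omega>' by (rule prob_\<Omega>')
  show "X 0 \<in> borel_measurable \<Omega>'" by (rule X_measurable)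
  show "(\<lambda>w. \<Xi> (qn k w)) \<in> borel_measurable \<Omega>'" for k by measurable
  show "distr \<Omega>' borel (\<lambda>w. \<Xi> (qn k w)) = std_gaussian" for k
  proof -
    have "distr \<Omega>' Q (qn k) = distr (distr \<Omega>' S (\<lambda>w. w (Noise k))) Q (\<lambda>t. snd (fst t))"
      by (subst distr_distr) (auto simp: o_def qn_def[abs_def])
    then have "distr \<Omega>' Q (qn k) = Q" by (simp only: distr_\<Omega>'_component distr_S)
    moreover have "distr \<Omega>' borel (\<lambda>w. \<Xi> (qn k w)) = distr (distr \<Omega>' Q (qn k)) borel \<Xi>"
      by (subst distr_distr) (auto simp: o_def)
    ultimately show ?thesis by (simp only: Xi_law)
  qed
  show pm: "pm l \<in> measurable \<Omega>' (count_space (perms (n * R)))" for l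
    using pm_measurable[of l] by (simp only: measurable_cong_sets[OF refl sets_uniform_count_measure_count_space])
  show "distr \<Omega>' (count_space (perms (n * R))) (pm l) = \<P>" for l
  proof -
    have "distr \<Omega>' (count_space (perms (n * R))) (pm l) = distr \<Omega>' \<P> (pm l)"
      by (intro distr_cong refl sets_uniform_count_measure_count_space[symmetric])
    also have "\<dots> = distr (distr \<Omega>' S (\<lambda>w. w (Shuffle l))) \<P> snd"
      by (subst distr_distr[OF S_measurable(3)]) (auto simp: o_def pm_def[abs_def])
    also have "\<dots> = \<P>" by (simp only: distr_\<Omega>'_component distr_S)
    finally show ?thesis .
  qed
  show "X (Suc k) w = X k w - h *\<^sub>R grad (batch_fun g (block n (pm (k div R) w) (k mod R))) (X k w) + sqrt (2 * h) *\<^sub>R \<Xi> (qn k w)" for k w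
    by (simp add: bk_def)
  \<comment> \<open>Every input is a measurable function of a single coordinate, so it inherits the
    independence of the coordinates.\<close>
  have pre: "{(\<lambda>w. f (w i)) -` A \<inter> space \<Omega>' | A. A \<in> sets B} \<subseteq> {(\<lambda>w. w i) -` A \<inter> space \<Omega>' | A. A \<in> sets S}"
    if f: "f \<in> measurable S B" for f :: "(('a \<times> 'a) \<times> 'q) \<times> (nat \<Rightarrow> nat) \<Rightarrow> 'z" and B i
  proof safe
    fix A assume A: "A \<in> sets B"
    have "(\<lambda>w. f (w i)) -` A \<inter> space \<Omega>' = (\<lambda>w. w i) -` (f -` A \<inter> space S) \<inter> space \<Omega>'"
      using measurable_space[OF \<Omega>'_component[of i]] by auto
    then show "\<exists>C. (\<lambda>w. f (w i)) -` A \<inter> space \<Omega>' = (\<lambda>w. w i) -` C \<inter> space \<Omega>' \<and> C \<in> sets S"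
      using measurable_sets[OF f A] by blast
  qed
  show "\<Omega>'.indep_sets (\<lambda>s. case s of
          Initial \<Rightarrow> {X 0 -` A \<inter> space \<Omega>' | A. A \<in> sets borel}
        | Noise k \<Rightarrow> {(\<lambda>w. \<Xi> (qn k w)) -` A \<inter> space \<Omega>' | A. A \<in> sets borel}
        | Shuffle l \<Rightarrow> {pm l -` A \<inter> space \<Omega>' | A. A \<in> sets (count_space (perms (n * R)))}) UNIV"
  proof (rule \<Omega>'.indep_sets_mono_sets[OF coordinate_independence])
    fix s :: source
    have X0: "X 0 = (\<lambda>w. (\<lambda>t. fst (fst (fst t))) (w Initial))" by (simp add: fun_eq_iff)
    have m: "(\<lambda>t. fst (fst (fst t))) \<in> borel_measurable S"
      using measurable_compose[OF S_measurable(1), of fst borel] by (simp add: measurable_cong_sets[OF sets_gamma refl])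
    have p: "pm l = (\<lambda>w. snd (w (Shuffle l)))" for l by (simp add: fun_eq_iff pm_def)
    have mp: "snd \<in> measurable S (count_space (perms (n * R)))"
      using S_measurable(3) by (simp only: measurable_cong_sets[OF refl sets_uniform_count_measure_count_space])
    have mn: "(\<lambda>t. \<Xi> (snd (fst t))) \<in> borel_measurable S" by measurable
    show "(case s of
          Initial \<Rightarrow> {X 0 -` A \<inter> space \<Omega>' | A. A \<in> sets borel}
        | Noise k \<Rightarrow> {(\<lambda>w. \<Xi> (qn k w)) -` A \<inter> space \<Omega>' | A. A \<in> sets borel}
        | Shuffle l \<Rightarrow> {pm l -` A \<inter> space \<Omega>' | A. A \<in> sets (count_space (perms (n * R)))})
        \<subseteq> {(\<lambda>w. w s) -` A \<inter> space \<Omega>' | A. A \<in> sets S}"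
    proof (cases s)
      case Initial
      show ?thesis unfolding Initial source.case X0 by (rule pre[OF m])
    next
      case (Noise k)
      show ?thesis unfolding Noise source.case qn_def by (rule pre[OF mn])
    next
      case (Shuffle l)
      show ?thesis unfolding Shuffle source.case p by (rule pre[OF mp])
    qed
  qed
qed

lemma X_law:
  assumes "sgld_rr M g (n * R) n R h x \<xi> P" and "distr M borel (x 0) = distr \<gamma> borel fst"
  shows "distr \<Omega>' borel (X k) = distr M borel (x k)"
proof -
  interpret A: sgld_rr M g "n * R" n R h x \<xi> P by fact
  interpret B: sgld_rr \<Omega>' g "n * R" n R h X "\<lambda>k w. \<Xi> (qn k w)" pm by (rule is_sgld_rr)
  have R: "R > 0" using R_ge_2 by simp
  have a: "distr M borel (x k) = distr (rr_law g n R h (distr M borel (x 0)) k) borel fst"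
    by (rule A.iterate_law[OF refl R batch_grad_measurable])
  have b: "distr \<Omega>' borel (X k) = distr (rr_law g n R h (distr \<Omega>' borel (X 0)) k) borel fst"
    by (rule B.iterate_law[OF refl R batch_grad_measurable])
  show ?thesis by (simp only: a b X0_law assms(2))
qed

end

section \<open>The final bound\<close>

text \<open>Naming the square roots turns everything into polynomial inequalities, and
  \<open>h * L < 1\<close> becomes \<open>p * q \<le> 1\<close>, which trades surplus powers of
  \<open>h\<close> and \<open>L\<close> for constants.\<close>

lemma error_sizes:
  fixes L h d e es R W :: real
  assumes pos: "L > 0" "h > 0" "h * L < 1" "d \<ge> 0" "R \<ge> 0" "e \<ge> 0"
    and es: "es = h * L * (sqrt (2 * h * d) + h * sqrt (L * d)) + e"
    and W: "W = R * h * sqrt (L * d) + sqrt (2 * h * R * d) + R * es"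
  shows "es \<le> 3 * (h * L * sqrt (h * d)) + e"
    and "sqrt (2 * L * h) * W \<le> h * (6 * (L * R * sqrt (h * d)) + 2 * sqrt (L * R * d)) + 2 * R * e"
proof -
  define p q r s t where "p = sqrt L" and "q = sqrt h" and "r = sqrt d" and "s = sqrt R" and "t = sqrt (2::real)"
  have nn: "p \<ge> 0" "q \<ge> 0" "r \<ge> 0" "s \<ge> 0" "t \<ge> 0" using pos by (auto simp: p_def q_def r_def s_def t_def)
  have sq: "L = p * p" "h = q * q" "t * t = 2" "R = s * s" using pos by (auto simp: p_def q_def t_def s_def)
  have t: "t \<le> 3 / 2" unfolding t_def by (rule real_le_lsqrt) (auto simp: power2_eq_square)
  have pq: "p * q \<le> 1"
  proof -
    have "(p * q) * (p * q) < 1" using pos(3) sq by (simp add: mult_ac)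
    then show ?thesis using nn by (metis mult_nonneg_nonneg not_le order.asym one_less_mult mult.right_neutral less_1_mult)
  qed
  have roots: "sqrt (2 * h * d) = t * q * r" "sqrt (L * d) = p * r" "sqrt (h * d) = q * r"
    "sqrt (2 * h * R * d) = t * q * s * r" "sqrt (L * R * d) = p * s * r" "sqrt (2 * L * h) = t * p * q"
    unfolding p_def q_def r_def s_def t_def by (simp_all add: real_sqrt_mult)
  have tpq: "t + p * q \<le> 3" using t pq by linarith
  have e1: "es = (h * L * (q * r)) * (t + p * q) + e"
    unfolding es roots using sq by (simp add: algebra_simps)
  have nn1: "0 \<le> h * L * (q * r)" using pos nn by simp
  have "(h * L * (q * r)) * (t + p * q) \<le> (h * L * (q * r)) * 3" by (rule mult_left_mono[OF tpq nn1])
  then show "es \<le> 3 * (h * L * sqrt (h * d)) + e" unfolding e1 roots by linarith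
  have "es = (h * (p * r)) * ((p * q) * (t + p * q)) + e"
    unfolding e1 using sq by (simp add: mult_ac)
  moreover have "(p * q) * (t + p * q) \<le> 1 * 3" using pq tpq nn by (intro mult_mono) auto
  then have "(h * (p * r)) * ((p * q) * (t + p * q)) \<le> (h * (p * r)) * 3"
    using pos nn by (intro mult_left_mono) auto
  ultimately have es2: "es \<le> 3 * (h * (p * r)) + e" by linarith
  have "W \<le> R * h * (p * r) + t * q * s * r + R * (3 * (h * (p * r)) + e)"
    unfolding W roots using es2 pos by (intro add_left_mono mult_left_mono) auto
  then have W2: "W \<le> 4 * (R * h * (p * r)) + t * q * s * r + R * e" by (simp add: algebra_simps)
  have "sqrt (2 * L * h) * W \<le> t * p * q * (4 * (R * h * (p * r)) + t * q * s * r + R * e)"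
    unfolding roots using W2 nn by (intro mult_left_mono) auto
  also have "\<dots> = 4 * t * (h * (L * R * (q * r))) + (t * t) * (h * (p * s * r)) + (t * (p * q)) * (R * e)"
    using sq(1,2) by (simp add: algebra_simps)
  \<comment> \<open>The constants come from \<open>t \<le> 3 / 2\<close> for the root of 2, from
    \<open>t * t = 2\<close> and from \<open>p * q \<le> 1\<close>.\<close>
  also have "\<dots> \<le> 6 * (h * (L * R * (q * r))) + 2 * (h * (p * s * r)) + 2 * (R * e)"
  proof (intro add_mono mult_right_mono)
    have "t * (p * q) \<le> (3 / 2) * 1" using t pq nn by (intro mult_mono) auto
    then show "t * (p * q) \<le> 2" by simp
  qed (use t sq pos nn in auto)
  finally show "sqrt (2 * L * h) * W \<le> h * (6 * (L * R * sqrt (h * d)) + 2 * sqrt (L * R * d)) + 2 * R * e"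
    unfolding roots by (simp add: algebra_simps)
qed

lemma le_ennreal_limit:
  assumes "\<And>e. e > 0 \<Longrightarrow> w \<le> ennreal (B + \<kappa> * e)" "B \<ge> 0" "\<kappa> \<ge> 0"
  shows "w \<le> ennreal B"
proof -
  have "w < \<infinity>" using assms(1)[of 1] by (auto intro: le_less_trans)
  then obtain r where r: "w = ennreal r" "r \<ge> 0" by (cases w) auto
  have "r \<le> B"
  proof (rule field_le_epsilon)
    fix e :: real assume e: "e > 0"
    have pos: "e / (\<kappa> + 1) > 0" "0 \<le> B + \<kappa> * (e / (\<kappa> + 1))" using e assms(2,3) by auto
    have "r \<le> B + \<kappa> * (e / (\<kappa> + 1))"
      using assms(1)[OF pos(1)] unfolding r(1) by (simp only: ennreal_le_iff[OF pos(2)])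
    also have "\<kappa> * (e / (\<kappa> + 1)) \<le> e" using e assms(3) by (simp add: field_simps)
    finally show "r \<le> B + e" by simp
  qed
  then show ?thesis using r by (simp add: ennreal_leI)
qed

context rr_coupling
begin

text \<open>The damping loss is at most \<open>min 1 (L * R * h)\<close>, while an epoch contracts
  by an amount of order \<open>min 1 y\<close> with \<open>y = R * h * \<mu>\<close>. Their ratio is
  of order \<open>L / \<mu>\<close>, independently of \<open>R\<close>.\<close>

lemma beta_le: "\<beta> \<le> 2 * (L / \<mu>) * cs"
proof -
  define y where "y = R * (h * \<mu>)"
  have y: "y > 0" using h_mu R_ge_2 by (simp add: y_def)
  have "1 + y \<le> (1 + h * \<mu>) ^ R" unfolding y_def using h_mu by (intro Bernoulli_inequality) auto
  then have "\<rho> ^ R * (1 + y) \<le> \<rho> ^ R * (1 + h * \<mu>) ^ R" using h_mu by (intro mult_left_mono) auto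
  also have "\<dots> = (\<rho> * (1 + h * \<mu>)) ^ R" by (rule power_mult_distrib[symmetric])
  also have "\<dots> \<le> 1"
  proof (rule power_le_one)
    have "\<rho> * (1 + h * \<mu>) = 1 - (h * \<mu>)\<^sup>2" by (simp add: algebra_simps power2_eq_square)
    then show "\<rho> * (1 + h * \<mu>) \<le> 1" by simp
    show "0 \<le> \<rho> * (1 + h * \<mu>)" using h_mu by (intro mult_nonneg_nonneg) auto
  qed
  finally have "\<rho> ^ R \<le> 1 / (1 + y)" using y by (simp add: pos_le_divide_eq)
  moreover have "1 - 1 / (1 + y) = y / (1 + y)" using y by (simp add: field_simps)
  ultimately have low: "y / (1 + y) \<le> 1 - \<rho> ^ R" by linarith
  have ratio: "L / \<mu> \<ge> 1" using mu_le_L mu_pos by simp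
  \<comment> \<open>For \<open>y \<le> 1\<close> the fraction \<open>y / (1 + y)\<close> is at least
    \<open>y / 2\<close>, otherwise at least \<open>1 / 2\<close>; this accounts for the factor
    \<open>2\<close>.\<close>
  have "1 - \<theta> \<le> 2 * (L / \<mu>) * (y / (1 + y))"
  proof (cases "y \<le> 1")
    case True
    have "1 - \<theta> \<le> (L / \<mu>) * y" using mu_pos by (simp add: \<theta>_def y_def)
    also have "\<dots> \<le> (L / \<mu>) * (2 * (y / (1 + y)))"
      using True y ratio by (intro mult_left_mono) (auto simp: field_simps)
    finally show ?thesis by (simp only: mult.left_commute mult.commute mult.assoc)
  next
    case False
    then have "1 / 2 \<le> y / (1 + y)" by (simp add: field_simps)
    then have "1 * (1 / 2) \<le> (L / \<mu>) * (y / (1 + y))" using ratio by (intro mult_mono) auto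
    moreover have "1 - \<theta> \<le> 1" using theta_bounds by simp
    ultimately have "1 - \<theta> \<le> 2 * ((L / \<mu>) * (y / (1 + y)))" by linarith
    then show ?thesis by (simp only: mult.assoc)
  qed
  also have "\<dots> \<le> 2 * (L / \<mu>) * (1 - \<rho> ^ R)" using low ratio by (intro mult_left_mono) auto
  finally have "(1 - \<theta>) * cs \<le> (2 * (L / \<mu>) * (1 - \<rho> ^ R)) * cs" using cs_nonneg by (rule mult_right_mono)
  moreover have "1 - \<rho> ^ R > 0" using rho_power by simp
  ultimately show ?thesis unfolding \<beta>_def by (simp only: pos_divide_le_eq mult_ac)
qed

text \<open>The four copies of \<open>(L / \<mu>) * cs\<close>: one from the gradient evaluated at a
  shifted point, two from \<open>\<beta>\<close>, one from removing \<open>C\<close> at the end. The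
  martingale part costs \<open>m / sqrt (h * \<mu>)\<close> because
  \<open>1 - \<rho>\<^sup>2 \<ge> h * \<mu>\<close>.\<close>

lemma L2le_final:
  assumes err: "\<And>k u. L2le \<Omega>' (U k) u \<Longrightarrow> L2le \<Omega>' (\<lambda>w. U k w - E (Y k w) (qn k w)) (sqrt (u\<^sup>2 + m\<^sup>2) + a)"
    and ma: "0 \<le> m" "0 \<le> a"
  shows "L2le \<Omega>' (\<lambda>w. X k w - Y k w) (\<rho> ^ k * v0 + 4 * (L / \<mu>) * cs + a / (h * \<mu>) + m / sqrt (h * \<mu>))"
proof (rule L2le_mono[OF L2le_X_Y[OF err ma]])
  define y where "y = h * \<mu>"
  have y: "0 < y" "y < 1" using h_mu by (auto simp: y_def)
  show "m\<^sup>2 \<le> (1 - \<rho>\<^sup>2) * (m / sqrt (h * \<mu>))\<^sup>2"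
  proof -
    have "(1 - (1 - y)\<^sup>2) * (m / sqrt y)\<^sup>2 = (2 - y) * m\<^sup>2"
      using y by (simp add: power_divide power2_eq_square field_simps)
    moreover have "1 * m\<^sup>2 \<le> (2 - y) * m\<^sup>2" using y by (intro mult_right_mono) auto
    ultimately show ?thesis by (simp add: y_def)
  qed
  show "0 \<le> m / sqrt (h * \<mu>)" using ma y by (simp add: y_def)
  have "1 * cs \<le> (L / \<mu>) * cs" using mu_le_L mu_pos cs_nonneg by (intro mult_right_mono) auto
  moreover have "(h * L * cs + a) / (1 - \<rho>) = (L / \<mu>) * cs + a / (h * \<mu>)"
    using h_pos mu_pos by (simp add: field_simps)
  ultimately show "\<rho> ^ k * v0 + (h * L * cs + a) / (1 - \<rho>) + m / sqrt (h * \<mu>) + \<beta> + cs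
      \<le> \<rho> ^ k * v0 + 4 * (L / \<mu>) * cs + a / (h * \<mu>) + m / sqrt (h * \<mu>)"
    using beta_le by linarith
qed

context
  fixes e :: real
  assumes e: "e > 0" and es_eq: "es = h * L * (sqrt (2 * h * DIM('a)) + h * sqrt (L * DIM('a))) + e"
begin

lemma es_le: "es \<le> 3 * (h * L * sqrt (h * DIM('a))) + e"
  and eta_le: "\<eta> \<le> h * (6 * (L * R * sqrt (h * DIM('a))) + 2 * sqrt (L * R * DIM('a))) + 2 * R * e"
  using error_sizes[OF L_pos h_pos hL _ _ _ es_eq W_def] e by (auto simp: \<eta>_def)

lemma cs_le: "4 * (L / \<mu>) * cs \<le> (L / \<mu>) * (8 * (h * sqrt R * \<sigma>) + 24 * (h * (L * R * sqrt (h * DIM('a))))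
    + 8 * (h * sqrt (L * R * DIM('a)))) + 8 * (L / \<mu>) * R * e"
proof -
  have "sqrt (2 * real R) \<le> 2 * sqrt R" by (rule real_le_lsqrt) (auto simp: power_mult_distrib)
  then have "h * (sqrt (2 * real R) * \<sigma>) \<le> 2 * (h * sqrt R * \<sigma>)"
  proof -
    assume "sqrt (2 * real R) \<le> 2 * sqrt R"
    then have "sqrt (2 * real R) * \<sigma> \<le> 2 * sqrt R * \<sigma>" using sigma_nonneg by (rule mult_right_mono)
    then have "h * (sqrt (2 * real R) * \<sigma>) \<le> h * (2 * sqrt R * \<sigma>)" using h_pos by (intro mult_left_mono) auto
    then show ?thesis by (simp only: mult_ac)
  qed
  then have "cs \<le> 2 * (h * sqrt R * \<sigma>) + 6 * (h * (L * R * sqrt (h * DIM('a)))) + 2 * (h * sqrt (L * R * DIM('a))) + 2 * R * e"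
    using eta_le unfolding cs_def by (simp add: algebra_simps)
  then have "4 * (L / \<mu>) * cs \<le> 4 * (L / \<mu>) * (2 * (h * sqrt R * \<sigma>) + 6 * (h * (L * R * sqrt (h * DIM('a))))
      + 2 * (h * sqrt (L * R * DIM('a))) + 2 * R * e)"
    using L_pos mu_pos by (intro mult_left_mono) auto
  then show ?thesis by (simp add: algebra_simps)
qed

text \<open>The one-step error is summed against the contraction: \<open>es / (h * \<mu>)\<close>
  with \<open>es\<close> of size \<open>h * L * sqrt (h * d)\<close> produces the term of order
  \<open>sqrt h\<close>.\<close>

lemma final_strong:
  "L2le \<Omega>' (\<lambda>w. X k w - Y k w) (\<rho> ^ k * v0
     + 240 * (L / \<mu>) * (h * sqrt R * \<sigma> + h * (L * R * sqrt (h * DIM('a)) + sqrt (L * R * DIM('a))) + sqrt (h * DIM('a)))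
     + (8 * (L / \<mu>) * R + 3 / (h * \<mu>)) * e)"
proof (rule L2le_mono[OF L2le_final[of 0 es, OF strong_error order_refl es_nonneg]])
  define g where "g = L / \<mu>"
  have g: "g > 0" using L_pos mu_pos by (simp add: g_def)
  define A1 A2 A3 A4 where "A1 = h * sqrt R * \<sigma>" and "A2 = h * (L * R * sqrt (h * DIM('a)))"
    and "A3 = h * sqrt (L * R * DIM('a))" and "A4 = sqrt (h * DIM('a))"
  have nn: "A1 \<ge> 0" "A2 \<ge> 0" "A3 \<ge> 0" "A4 \<ge> 0"
    using h_pos L_pos sigma_nonneg by (auto simp: A1_def A2_def A3_def A4_def)
  have "es / (h * \<mu>) \<le> (3 * (h * L * A4) + e) / (h * \<mu>)"
    using es_le h_mu unfolding A4_def by (intro divide_right_mono) auto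
  also have "\<dots> = 3 * (g * A4) + e / (h * \<mu>)" using h_pos mu_pos by (simp add: g_def add_divide_distrib)
  finally have 1: "es / (h * \<mu>) \<le> 3 * (g * A4) + e / (h * \<mu>)" .
  have 2: "4 * g * cs \<le> g * (8 * A1 + 24 * A2 + 8 * A3) + 8 * g * R * e"
    using cs_le by (simp add: g_def A1_def A2_def A3_def)
  have 3: "g * (8 * A1 + 24 * A2 + 8 * A3) + 3 * (g * A4) \<le> 240 * g * (A1 + (A2 + A3) + A4)"
  proof -
    have "g * (8 * A1 + 24 * A2 + 8 * A3 + 3 * A4) \<le> g * (240 * (A1 + (A2 + A3) + A4))"
      using g nn by (intro mult_left_mono) auto
    then show ?thesis by (simp add: algebra_simps)
  qed
  have 4: "e / (h * \<mu>) \<le> 3 / (h * \<mu>) * e" using e h_mu by (simp add: field_simps)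
  have "\<rho> ^ k * v0 + 4 * g * cs + es / (h * \<mu>) + 0 / sqrt (h * \<mu>)
      \<le> \<rho> ^ k * v0 + 240 * g * (A1 + (A2 + A3) + A4) + (8 * g * R * e + 3 / (h * \<mu>) * e)"
    using 1 2 3 4 by simp
  then show "\<rho> ^ k * v0 + 4 * (L / \<mu>) * cs + es / (h * \<mu>) + 0 / sqrt (h * \<mu>)
      \<le> \<rho> ^ k * v0 + 240 * (L / \<mu>) * (h * sqrt R * \<sigma> + h * (L * R * sqrt (h * DIM('a)) + sqrt (L * R * DIM('a))) + sqrt (h * DIM('a)))
     + (8 * (L / \<mu>) * R + 3 / (h * \<mu>)) * e"
    by (simp add: g_def A1_def A2_def A3_def A4_def algebra_simps)
qed

text \<open>The conditional mean \<open>e2\<close> is divided by \<open>h * \<mu>\<close>, but the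
  much larger martingale part only by the root of \<open>h * \<mu>\<close>; both end up of order
  \<open>h\<close>. Using \<open>\<mu> \<le> L\<close>, the latter becomes
  \<open>(L / \<mu>) * h * sqrt (L * d)\<close>.\<close>

lemma final_weak:
  fixes K :: real
  assumes K: "K > 0" and ew: "L2le (gibbs F) (\<lambda>y. \<integral>q. E y q \<partial>Q) (h\<^sup>2 * (L * sqrt (L * DIM('a)) + 2 * K * DIM('a)) + e)"
  shows "L2le \<Omega>' (\<lambda>w. X k w - Y k w) (\<rho> ^ k * v0
     + 240 * h * (L / \<mu>) * (sqrt R * \<sigma> + (L * R * sqrt (h * DIM('a)) + sqrt (L * R * DIM('a))) + (sqrt (L * DIM('a)) + K / L * DIM('a)))
     + (8 * (L / \<mu>) * R + 3 / (h * \<mu>)) * e)"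
proof -
  define e2 where "e2 = h\<^sup>2 * (L * sqrt (L * DIM('a)) + 2 * K * DIM('a)) + e"
  have e2: "e2 \<ge> 0" using h_pos L_pos K e by (simp add: e2_def)
  define g where "g = L / \<mu>"
  have g: "g > 0" using L_pos mu_pos by (simp add: g_def)
  define A1 A2 A3 A5 A6 where "A1 = h * (sqrt R * \<sigma>)" and "A2 = h * (L * R * sqrt (h * DIM('a)))"
    and "A3 = h * sqrt (L * R * DIM('a))" and "A5 = h * sqrt (L * DIM('a))" and "A6 = h * (K / L * DIM('a))"
  have nn: "A1 \<ge> 0" "A2 \<ge> 0" "A3 \<ge> 0" "A5 \<ge> 0" "A6 \<ge> 0"
    using h_pos L_pos sigma_nonneg K by (auto simp: A1_def A2_def A3_def A5_def A6_def)
  have sy: "h * \<mu> \<le> sqrt (h * \<mu>)"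
    using h_mu by (intro real_le_rsqrt) (simp add: power2_eq_square mult_left_le)
  have sy0: "sqrt (h * \<mu>) > 0" using h_mu by simp
  have e2_div: "e2 / (h * \<mu>) = g * (A5 + 2 * A6) + e / (h * \<mu>)"
    using h_pos mu_pos L_pos by (simp add: e2_def g_def A5_def A6_def field_simps power2_eq_square)
  have 1: "e2 / sqrt (h * \<mu>) \<le> e2 / (h * \<mu>)" using sy h_mu e2 by (intro divide_left_mono) auto
  have 2: "e / sqrt (h * \<mu>) \<le> e / (h * \<mu>)" using sy h_mu e by (intro divide_left_mono) auto
  have 3: "h * L * sqrt (h * DIM('a)) / sqrt (h * \<mu>) \<le> g * A5"
  proof -
    have "h * L * sqrt (h * DIM('a)) / sqrt (h * \<mu>) = h * sqrt DIM('a) * (L / sqrt \<mu>)"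
      using h_pos by (simp add: real_sqrt_mult)
    also have "L / sqrt \<mu> \<le> L / \<mu> * sqrt L"
    proof -
      have "L / sqrt \<mu> = L / \<mu> * sqrt \<mu>" using mu_pos by (simp add: field_simps)
      also have "\<dots> \<le> L / \<mu> * sqrt L" using mu_le_L L_pos mu_pos by (intro mult_left_mono) auto
      finally show ?thesis .
    qed
    then have "h * sqrt DIM('a) * (L / sqrt \<mu>) \<le> h * sqrt DIM('a) * (L / \<mu> * sqrt L)"
      using h_pos by (intro mult_left_mono) auto
    finally show ?thesis by (simp add: g_def A5_def real_sqrt_mult mult_ac)
  qed
  have "es / sqrt (h * \<mu>) \<le> (3 * (h * L * sqrt (h * DIM('a))) + e) / sqrt (h * \<mu>)"
    using es_le sy0 by (intro divide_right_mono) auto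
  also have "\<dots> = 3 * (h * L * sqrt (h * DIM('a)) / sqrt (h * \<mu>)) + e / sqrt (h * \<mu>)"
    by (simp add: add_divide_distrib)
  finally have 4: "es / sqrt (h * \<mu>) \<le> 3 * (g * A5) + e / (h * \<mu>)" using 2 3 by linarith
  have 5: "4 * g * cs \<le> g * (8 * A1 + 24 * A2 + 8 * A3) + 8 * g * R * e"
    using cs_le by (simp add: g_def A1_def A2_def A3_def mult.assoc)
  have 6: "g * (8 * A1 + 24 * A2 + 8 * A3) + 2 * (g * (A5 + 2 * A6)) + 3 * (g * A5) \<le> 240 * g * (A1 + (A2 + A3) + (A5 + A6))"
  proof -
    have "g * (8 * A1 + 24 * A2 + 8 * A3 + 5 * A5 + 4 * A6) \<le> g * (240 * (A1 + (A2 + A3) + (A5 + A6)))"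
      using g nn by (intro mult_left_mono) auto
    then show ?thesis by (simp add: algebra_simps)
  qed
  have "4 * g * cs + e2 / (h * \<mu>) + (es + e2) / sqrt (h * \<mu>)
      \<le> 240 * g * (A1 + (A2 + A3) + (A5 + A6)) + 8 * g * R * e + 3 * (e / (h * \<mu>))"
  proof -
    have gen: "c + x + y \<le> t + u + 3 * v"
      if "y = y1 + y2" "y2 \<le> x" "y1 \<le> 3 * a + v" "c \<le> q + u" "q + 2 * b + 3 * a \<le> t" "x = b + v"
      for c x y t u v y1 y2 a q b :: real
      using that by linarith
    from gen[OF add_divide_distrib 1 4 5 6 e2_div] show ?thesis .
  qed
  then have tot: "\<rho> ^ k * v0 + 4 * (L / \<mu>) * cs + e2 / (h * \<mu>) + (es + e2) / sqrt (h * \<mu>)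
      \<le> \<rho> ^ k * v0 + 240 * h * (L / \<mu>) * (sqrt R * \<sigma> + (L * R * sqrt (h * DIM('a)) + sqrt (L * R * DIM('a))) + (sqrt (L * DIM('a)) + K / L * DIM('a)))
     + (8 * (L / \<mu>) * R + 3 / (h * \<mu>)) * e"
    by (simp add: g_def A1_def A2_def A3_def A5_def A6_def algebra_simps)
  show ?thesis
    by (rule L2le_mono[OF L2le_final[of "es + e2" e2, OF weak_error[OF ew, folded e2_def] add_nonneg_nonneg[OF es_nonneg e2] e2] tot])
qed

end

end

context rr_problem
begin

text \<open>A near-optimal initial coupling and the stationary step together instantiate
  \<open>rr_coupling\<close>; one \<open>e\<close> serves both.\<close>

lemma W2_bounds:
  fixes M :: "'s measure" and x \<xi> :: "nat \<Rightarrow> 's \<Rightarrow> 'a" and P :: "nat \<Rightarrow> 's \<Rightarrow> nat \<Rightarrow> nat"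
  assumes sgld: "sgld_rr M g (n * R) n R h x \<xi> P" and w0: "W2 (distr M borel (x 0)) (gibbs F) = ennreal w0" "w0 \<ge> 0"
    and e: "e > 0"
  shows "W2 (distr M borel (x k)) (gibbs F) \<le> ennreal (\<rho> ^ k * (w0 + e)
       + 240 * (L / \<mu>) * (h * sqrt R * \<sigma> + h * (L * R * sqrt (h * DIM('a)) + sqrt (L * R * DIM('a))) + sqrt (h * DIM('a)))
       + (8 * (L / \<mu>) * R + 3 / (h * \<mu>)) * e)" (is ?strong)
    and "K > 0 \<Longrightarrow> twice_cont_diff F \<Longrightarrow> smooth_hessian K F \<Longrightarrow>
      W2 (distr M borel (x k)) (gibbs F) \<le> ennreal (\<rho> ^ k * (w0 + e)
       + 240 * h * (L / \<mu>) * (sqrt R * \<sigma> + (L * R * sqrt (h * DIM('a)) + sqrt (L * R * DIM('a))) + (sqrt (L * DIM('a)) + K / L * DIM('a)))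
       + (8 * (L / \<mu>) * R + 3 / (h * \<mu>)) * e)" (is "_ \<Longrightarrow> _ \<Longrightarrow> _ \<Longrightarrow> ?weak")
proof -
  obtain \<gamma> where \<gamma>: "\<gamma> \<in> couplings (distr M borel (x 0)) (gibbs F)" "L2le \<gamma> (\<lambda>z. fst z - snd z) (w0 + e)"
    by (rule W2_near_optimal[OF w0 e])
  have sets: "sets \<gamma> = sets (borel \<Otimes>\<^sub>M borel)" and marg: "distr \<gamma> borel fst = distr M borel (x 0)" "distr \<gamma> borel snd = gibbs F"
    using \<gamma>(1) by (auto simp: couplings_def)
  have "snd \<in> borel_measurable \<gamma>" by (subst measurable_cong_sets[OF sets refl]) simp
  then have prob: "prob_space \<gamma>" using prob_space_gibbs marg(2) by (metis prob_space_distrD)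
  obtain Q :: "(nat \<Rightarrow> 'a \<times> real) measure" and \<Xi> E where Q: "prob_space Q" "\<Xi> \<in> borel_measurable Q" "distr Q borel \<Xi> = std_gaussian"
    "(\<lambda>(y, q). E y q) \<in> borel_measurable (borel \<Otimes>\<^sub>M Q)"
    "distr (gibbs F \<Otimes>\<^sub>M Q) borel (\<lambda>(y, q). y - h *\<^sub>R grad F y + sqrt (2 * h) *\<^sub>R \<Xi> q + E y q) = gibbs F"
    "L2le (gibbs F \<Otimes>\<^sub>M Q) (\<lambda>(y, q). E y q) (h * L * (sqrt (2 * h * DIM('a)) + h * sqrt (L * DIM('a))) + e)"
    "\<And>y. integrable Q (E y)"
    and weak: "\<And>K. K > 0 \<Longrightarrow> twice_cont_diff F \<Longrightarrow> smooth_hessian K F \<Longrightarrow>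
       L2le (gibbs F) (\<lambda>y. \<integral>q. E y q \<partial>Q) (h\<^sup>2 * (L * sqrt (L * DIM('a)) + 2 * K * DIM('a)) + e)"
    by (rule stationary_coupling[OF h_pos e]) blast
  interpret C: rr_coupling F L \<mu> g n R h \<sigma> \<gamma> Q \<Xi> E "h * L * (sqrt (2 * h * DIM('a)) + h * sqrt (L * DIM('a))) + e" "w0 + e"
    by (rule rr_coupling.intro[OF rr_problem_axioms rr_coupling_axioms.intro[OF prob sets marg(2) \<gamma>(2) Q]])
  have W2: "W2 (distr M borel (x k)) (gibbs F) \<le> ennreal b" if "L2le C.\<Omega>' (\<lambda>w. C.X k w - C.Y k w) b" for b
    using W2_le_coupling[OF C.X_measurable C.Y_measurable that] C.X_law[OF sgld marg(1)[symmetric], of k] C.Y_law[of k]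
    by simp
  show ?strong by (rule W2[OF C.final_strong[OF e refl]])
  show ?weak if "K > 0" "twice_cont_diff F" "smooth_hessian K F"
    by (rule W2[OF C.final_weak[OF e refl that(1) weak[OF that]]])
qed

end

theorem theorem3p9:
  fixes g :: "nat \<Rightarrow> 'a::euclidean_space \<Rightarrow> real"
    and F :: "'a \<Rightarrow> real"
    and N n R :: nat
    and \<mu> L h \<sigma> d :: real
    and \<pi> :: "'a measure"
    and M :: "'s measure"
    and x \<xi> :: "nat \<Rightarrow> 's \<Rightarrow> 'a"
    and P :: "nat \<Rightarrow> 's \<Rightarrow> nat \<Rightarrow> nat"
    and \<pi>' :: "nat \<Rightarrow> 'a measure"
  assumes "0 < n" and "n < N" and "n dvd N" and "R = N div n"
    and "F = objective g N" and "\<pi> = gibbs F" and "d = real DIM('a)"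
    and "\<mu> > 0" and "L > 0"
    and "cont_diff F" and "smooth L F" and "strongly_convex \<mu> F"
    and "\<And>\<omega>. \<omega> \<in> batches N n \<Longrightarrow>
      cont_diff (batch_fun g \<omega>) \<and> smooth L (batch_fun g \<omega>) \<and> strongly_convex \<mu> (batch_fun g \<omega>)"
    and "0 < batch_grad_variance g N n \<pi>" and "batch_grad_variance g N n \<pi> < \<infinity>"
    and "\<sigma> = sqrt (enn2real (batch_grad_variance g N n \<pi>))"
    and "0 < h" and "h < 1 / L"
    and "sgld_rr M g N n R h x \<xi> P"
    and "\<And>k. \<pi>' k = distr M borel (x k)"
  shows "(\<forall>K. W2 (\<pi>' K) \<pi> \<le> ennreal ((1 - h * \<mu>) ^ K) * W2 (\<pi>' 0) \<pi>
            + ennreal (240 * (L / \<mu>) * (h * sqrt R * \<sigma>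
                + h * (L * R * sqrt (h * d) + sqrt (L * R * d)) + sqrt (h * d))))
       \<and> (\<forall>L\<^sub>1>0. twice_cont_diff F \<longrightarrow> smooth_hessian L\<^sub>1 F \<longrightarrow>
          (\<forall>K. W2 (\<pi>' K) \<pi> \<le> ennreal ((1 - h * \<mu>) ^ K) * W2 (\<pi>' 0) \<pi>
            + ennreal (240 * h * (L / \<mu>) * (sqrt R * \<sigma>
                + (L * R * sqrt (h * d) + sqrt (L * R * d))
                + (sqrt (L * d) + L\<^sub>1 / L * d)))))"
proof -
  have N: "N = n * R" using assms(3,4) by simp
  have R: "2 \<le> R"
  proof (rule ccontr)
    assume "\<not> 2 \<le> R"
    then have "R = 0 \<or> R = 1" by auto
    then show False using assms(1,2) N by auto
  qed
  have sigma: "0 \<le> \<sigma>" "batch_grad_variance g (n * R) n (gibbs F) \<le> ennreal (\<sigma>\<^sup>2)"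
    using assms(6,15,16) by (auto simp: N[symmetric] less_top)
  have hL: "h * L < 1" using assms(9,18) by (simp add: pos_less_divide_eq)
  interpret rr_problem F L \<mu> g n R h \<sigma>
    by unfold_locales (use assms(1,5,8,10-13,17) N R sigma hL in auto)
  note sgld = assms(19)[unfolded N]
  have d: "d = real DIM('a)" by (rule assms(7))
  \<comment> \<open>The passage to \<open>e = 0\<close> is the same for both bounds and is done once
    for a generic \<open>B\<close>.\<close>
  have combine: "W2 (\<pi>' k) \<pi> \<le> ennreal (\<rho> ^ k) * W2 (\<pi>' 0) \<pi> + ennreal B"
    if B: "B \<ge> 0" and bound: "\<And>w0 e. W2 (distr M borel (x 0)) (gibbs F) = ennreal w0 \<Longrightarrow> w0 \<ge> 0 \<Longrightarrow> e > 0 \<Longrightarrow>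
       W2 (distr M borel (x k)) (gibbs F) \<le> ennreal (\<rho> ^ k * (w0 + e) + B + \<kappa> * e)" and \<kappa>: "\<kappa> \<ge> 0" for B \<kappa> k
  proof (cases "W2 (\<pi>' 0) \<pi>")
    case (real w0)
    have rk: "\<rho> ^ k \<ge> 0" using h_mu by simp
    have "W2 (\<pi>' k) \<pi> \<le> ennreal (\<rho> ^ k * w0 + B)"
    proof (rule le_ennreal_limit)
      fix e :: real assume "e > 0"
      then show "W2 (\<pi>' k) \<pi> \<le> ennreal ((\<rho> ^ k * w0 + B) + (\<rho> ^ k + \<kappa>) * e)"
        using bound[of w0 e] real by (simp add: assms(6,20) algebra_simps)
    qed (use rk real B \<kappa> in auto)
    also have "\<dots> = ennreal (\<rho> ^ k) * W2 (\<pi>' 0) \<pi> + ennreal B"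
      using real rk B by (simp add: ennreal_mult)
    finally show ?thesis .
  next
    \<comment> \<open>An infinite initial distance makes the right-hand side infinite, because
      \<open>\<rho> ^ k\<close> is positive.\<close>
    case top
    define r where "r = \<rho> ^ k"
    have "r > 0" using h_mu by (simp add: r_def)
    then have "ennreal r * \<top> = \<top>" by (simp add: ennreal_mult_top)
    then show ?thesis using top unfolding r_def by (simp add: r_def)
  qed
  have \<kappa>: "8 * (L / \<mu>) * R + 3 / (h * \<mu>) \<ge> 0" using h_mu L_pos mu_pos by simp
  show ?thesis
  proof (intro conjI allI impI)
    fix k
    show "W2 (\<pi>' k) \<pi> \<le> ennreal (\<rho> ^ k) * W2 (\<pi>' 0) \<pi>
            + ennreal (240 * (L / \<mu>) * (h * sqrt R * \<sigma> + h * (L * R * sqrt (h * d) + sqrt (L * R * d)) + sqrt (h * d)))"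
      unfolding d by (rule combine[OF _ W2_bounds(1)[OF sgld] \<kappa>]) (use h_pos L_pos mu_pos sigma in auto)
  next
    fix L\<^sub>1 :: real and k
    assume L1: "L\<^sub>1 > 0" "twice_cont_diff F" "smooth_hessian L\<^sub>1 F"
    show "W2 (\<pi>' k) \<pi> \<le> ennreal (\<rho> ^ k) * W2 (\<pi>' 0) \<pi>
            + ennreal (240 * h * (L / \<mu>) * (sqrt R * \<sigma> + (L * R * sqrt (h * d) + sqrt (L * R * d)) + (sqrt (L * d) + L\<^sub>1 / L * d)))"
      unfolding d by (rule combine[OF _ W2_bounds(2)[OF sgld _ _ _ L1] \<kappa>]) (use h_pos L_pos mu_pos sigma L1 in auto)
  qed
qed

end
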